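(* Let $T>0$ and let $(\Omega,\mathcal F,(\mathcal F_t)_{0\le t\le T},\mathbb P)$ be a filtered probability space satisfying the usual conditions. Let $S=(S_t)_{0\le t\le T}$ be a locally bounded, real-valued, càdlàg, adapted process. Then the following are equivalent: (1) $S$ admits no free lunch with vanishing risk and little investment, i.e. for every sequence $(H^n)_{n\ge 1}$ of simple integrands with $\lim_{n\to\infty}\|(H^n\cdot S)^-\|_\infty=\lim_{n\to\infty}\|H^n\|_\infty=0$ we have $\lim_{n\to\infty}(H^n\cdot S)_T^+=0$ in probability. (2) $S$ is a semi-martingale, i.e. $S$ may be decomposed as $S=M+A$, where $M=(M_t)_{0\le t\le T}$ is a local martingale and $A=(A_t)_{0\le t\le T}$ is an adapted process of finite variation.
   Context: A simple integrand is a process $H=(H_t)_{0\le t\le T}$ of the form $H_t=\sum_{j=1}^n f_j\,\mathbf 1_{]\tau_{j-1},\tau_j]}(t)$, $0\le t\le T$, where $n$ is a finite number, $0=\tau_0\le\tau_1\le\dots\le\tau_n=T$ are stopping times, and $f_j\in L^\infty(\Omega,\mathcal F_{\tau_{j-1}},\mathbb P)$. For such $H$ one sets $(H\cdot S)_t=\sum_{j=1}^n f_j\,(S_{\tau_j\wedge t}-S_{\tau_{j-1}\wedge t})$ for $0\le t\le T$. For a bounded measurable $G:\Omega\times[0,T]\to\mathbb R$, $\|G\|_\infty=\sup_{0\le t\le T}\|G_t\|_{L^\infty(\mathbb P)}$ (with value $+\infty$ allowed for unbounded $G$); $x^+=\max(x,0)$ and $x^-=\max(-x,0)$, so $\|(H\cdot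 S)^-\|_\infty=\sup_{0\le t\le T}\|(H\cdot S)_t^-\|_{L^\infty(\mathbb P)}$. Local martingales are taken càdlàg; a finite variation process is a càdlàg adapted process with a.s. paths of finite total variation on $[0,T]$. $S$ is locally bounded if there are an increasing sequence of $[0,T]\cup\{\infty\}$-valued stopping times $\sigma_k$ with $\mathbb P[\sigma_k=\infty]\to1$ such that each stopped process $S^{\sigma_k}$ is uniformly bounded. *)

theory Defs
  imports "HOL-Probability.Probability"
begin

text \<open>
  A process on \<open>[0,T]\<close> is a function of type \<open>real \<Rightarrow> 'a \<Rightarrow> real\<close> of which only the values at
  times in \<open>{0..T}\<close> and points of \<open>space M\<close> are ever used.

  The library locale \<open>filtration\<close> indexes by the whole type \<open>real\<close>. A filtration on \<open>[0,T]\<close>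
  extends to \<open>real\<close> by \<open>F t = F 0\<close> for \<open>t < 0\<close> and \<open>F t = F T\<close> for \<open>t > T\<close>, and the
  \<open>\<sigma>\<close>-algebras \<open>F t\<close> with \<open>t \<notin> {0..T}\<close> are otherwise immaterial: for a \<open>[0,T]\<close>-valued \<open>\<tau>\<close>, the
  conditions of \<open>stopping_time F \<tau>\<close> and of membership in \<open>pre_sigma \<tau>\<close> at such \<open>t\<close> are implied
  by those at \<open>t \<in> {0..T}\<close>.
\<close>

locale usual_filtered_prob_space =
  prob_space M + complete_measure M + filtration "space M" F
  for M :: "'a measure" and F :: "real \<Rightarrow> 'a measure" +
  fixes T :: real
  assumes T_pos: "0 < T"
    and F_sub: "\<And>t. t \<in> {0..T} \<Longrightarrow> sets (F t) \<subseteq> sets M"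
    and F_null: "null_sets M \<subseteq> sets (F 0)"
    and F_right_cont: "\<And>t. t \<in> {0..<T} \<Longrightarrow> sets (F t) = (\<Inter>s\<in>{t<..T}. sets (F s))"

definition adapted :: "(real \<Rightarrow> 'a measure) \<Rightarrow> real \<Rightarrow> (real \<Rightarrow> 'a \<Rightarrow> real) \<Rightarrow> bool" where
  "adapted F T X \<longleftrightarrow> (\<forall>t\<in>{0..T}. X t \<in> borel_measurable (F t))"

definition cadlag :: "'a measure \<Rightarrow> real \<Rightarrow> (real \<Rightarrow> 'a \<Rightarrow> real) \<Rightarrow> bool" where
  "cadlag M T X \<longleftrightarrow> (\<forall>\<omega>\<in>space M.
     (\<forall>t\<in>{0..<T}. ((\<lambda>s. X s \<omega>) \<longlongrightarrow> X t \<omega>) (at_right t)) \<and>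
     (\<forall>t\<in>{0<..T}. \<exists>l. ((\<lambda>s. X s \<omega>) \<longlongrightarrow> l) (at_left t)))"

subsection \<open>Stopping times with values in \<open>[0,T] \<union> {\<infinity>}\<close> and localization\<close>

definition ext_stopping_time ::
  "'a measure \<Rightarrow> (real \<Rightarrow> 'a measure) \<Rightarrow> real \<Rightarrow> ('a \<Rightarrow> ereal) \<Rightarrow> bool" where
  "ext_stopping_time M F T \<sigma> \<longleftrightarrow>
     (\<forall>\<omega>\<in>space M. \<sigma> \<omega> \<in> ereal ` {0..T} \<union> {\<infinity>}) \<and>
     (\<forall>t\<in>{0..T}. {\<omega>\<in>space M. \<sigma> \<omega> \<le> ereal t} \<in> sets (F t))"

definition stopped :: "(real \<Rightarrow> 'a \<Rightarrow> real) \<Rightarrow> ('a \<Rightarrow> ereal) \<Rightarrow> real \<Rightarrow> 'a \<Rightarrow> real" where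
  "stopped X \<sigma> t \<omega> = X (real_of_ereal (min (ereal t) (\<sigma> \<omega>))) \<omega>"

definition localizing_seq ::
  "'a measure \<Rightarrow> (real \<Rightarrow> 'a measure) \<Rightarrow> real \<Rightarrow> (nat \<Rightarrow> 'a \<Rightarrow> ereal) \<Rightarrow> bool" where
  "localizing_seq M F T \<sigma> \<longleftrightarrow>
     (\<forall>k. ext_stopping_time M F T (\<sigma> k)) \<and>
     (\<forall>k. \<forall>\<omega>\<in>space M. \<sigma> k \<omega> \<le> \<sigma> (Suc k) \<omega>) \<and>
     (\<lambda>k. measure M {\<omega>\<in>space M. \<sigma> k \<omega> = \<infinity>}) \<longlonglongrightarrow> 1"

text \<open>Boundedness of the stopped process is required outside a null set.\<close>

definition locally_bounded ::
  "'a measure \<Rightarrow> (real \<Rightarrow> 'a measure) \<Rightarrow> real \<Rightarrow> (real \<Rightarrow> 'a \<Rightarrow> real) \<Rightarrow> bool" where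
  "locally_bounded M F T X \<longleftrightarrow> (\<exists>\<sigma>. localizing_seq M F T \<sigma> \<and>
     (\<forall>k. \<exists>C. AE \<omega> in M. \<forall>t\<in>{0..T}. \<bar>stopped X (\<sigma> k) t \<omega>\<bar> \<le> C))"

subsection \<open>Semi-martingales\<close>

definition martingale ::
  "'a measure \<Rightarrow> (real \<Rightarrow> 'a measure) \<Rightarrow> real \<Rightarrow> (real \<Rightarrow> 'a \<Rightarrow> real) \<Rightarrow> bool" where
  "martingale M F T X \<longleftrightarrow> adapted F T X \<and> (\<forall>t\<in>{0..T}. integrable M (X t)) \<and>
     (\<forall>s\<in>{0..T}. \<forall>t\<in>{s..T}. AE \<omega> in M. real_cond_exp M (F s) (X t) \<omega> = X s \<omega>)"

text \<open>
  In this convention the initial value of a local martingale is integrable. The class of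
  semi-martingales is the same if only the stopped increments \<open>X t - X 0\<close> are required to be
  martingales, as \<open>X 0\<close> may be moved into the finite variation part.
\<close>

definition local_martingale ::
  "'a measure \<Rightarrow> (real \<Rightarrow> 'a measure) \<Rightarrow> real \<Rightarrow> (real \<Rightarrow> 'a \<Rightarrow> real) \<Rightarrow> bool" where
  "local_martingale M F T X \<longleftrightarrow> cadlag M T X \<and> adapted F T X \<and>
     (\<exists>\<sigma>. localizing_seq M F T \<sigma> \<and> (\<forall>k. martingale M F T (stopped X (\<sigma> k))))"

definition finite_total_variation :: "real \<Rightarrow> (real \<Rightarrow> real) \<Rightarrow> bool" where
  "finite_total_variation T x \<longleftrightarrow> (\<exists>C. \<forall>n p.
     p 0 = 0 \<and> p n = T \<and> (\<forall>i<n. p i \<le> p (Suc i)) \<longrightarrow>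
     (\<Sum>i<n. \<bar>x (p (Suc i)) - x (p i)\<bar>) \<le> C)"

definition finite_variation_process ::
  "'a measure \<Rightarrow> (real \<Rightarrow> 'a measure) \<Rightarrow> real \<Rightarrow> (real \<Rightarrow> 'a \<Rightarrow> real) \<Rightarrow> bool" where
  "finite_variation_process M F T A \<longleftrightarrow> cadlag M T A \<and> adapted F T A \<and>
     (AE \<omega> in M. finite_total_variation T (\<lambda>t. A t \<omega>))"

definition semimartingale ::
  "'a measure \<Rightarrow> (real \<Rightarrow> 'a measure) \<Rightarrow> real \<Rightarrow> (real \<Rightarrow> 'a \<Rightarrow> real) \<Rightarrow> bool" where
  "semimartingale M F T S \<longleftrightarrow> (\<exists>N A. local_martingale M F T N \<and>
     finite_variation_process M F T A \<and>
     (\<forall>t\<in>{0..T}. \<forall>\<omega>\<in>space M. S t \<omega> = N t \<omega> + A t \<omega>))"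

subsection \<open>Simple integrands\<close>

text \<open>
  A simple integrand is given by the data \<open>n\<close>, \<open>\<tau>\<^sub>0, \<dots>, \<tau>\<^sub>n\<close>, \<open>f\<^sub>1, \<dots>, f\<^sub>n\<close> of a representation;
  \<open>times H j\<close> for \<open>j > n\<close> and \<open>coeff H j\<close> for \<open>j \<notin> {1..n}\<close> are unused. The stochastic integral
  depends on the represented process only.
\<close>

record 'a simple_data =
  steps :: nat
  times :: "nat \<Rightarrow> 'a \<Rightarrow> real"
  coeff :: "nat \<Rightarrow> 'a \<Rightarrow> real"

definition simple_integrand ::
  "'a measure \<Rightarrow> (real \<Rightarrow> 'a measure) \<Rightarrow> real \<Rightarrow> 'a simple_data \<Rightarrow> bool" where
  "simple_integrand M F T H \<longleftrightarrow>
     (\<forall>j\<le>steps H. stopping_time F (times H j)) \<and>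
     (\<forall>\<omega>\<in>space M. times H 0 \<omega> = 0 \<and> times H (steps H) \<omega> = T \<and>
        (\<forall>j<steps H. times H j \<omega> \<le> times H (Suc j) \<omega>)) \<and>
     (\<forall>j\<in>{1..steps H}.
        coeff H j \<in> borel_measurable (filtration.pre_sigma (space M) F (times H (j - 1))) \<and>
        (\<exists>C. AE \<omega> in M. \<bar>coeff H j \<omega>\<bar> \<le> C))"

definition simple_process :: "'a simple_data \<Rightarrow> real \<Rightarrow> 'a \<Rightarrow> real" where
  "simple_process H t \<omega> =
     (\<Sum>j=1..steps H. coeff H j \<omega> * indicator {times H (j - 1) \<omega><..times H j \<omega>} t)"

definition simple_integral ::
  "'a simple_data \<Rightarrow> (real \<Rightarrow> 'a \<Rightarrow> real) \<Rightarrow> real \<Rightarrow> 'a \<Rightarrow> real" where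
  "simple_integral H S t \<omega> =
     (\<Sum>j=1..steps H. coeff H j \<omega> *
        (S (min (times H j \<omega>) t) \<omega> - S (min (times H (j - 1) \<omega>) t) \<omega>))"

subsection \<open>No free lunch with vanishing risk and little investment\<close>

definition sup_norm :: "'a measure \<Rightarrow> real \<Rightarrow> (real \<Rightarrow> 'a \<Rightarrow> real) \<Rightarrow> ereal" where
  "sup_norm M T G = (SUP t\<in>{0..T}. esssup M (\<lambda>\<omega>. ereal \<bar>G t \<omega>\<bar>))"

definition tendsto_in_prob :: "'a measure \<Rightarrow> (nat \<Rightarrow> 'a \<Rightarrow> real) \<Rightarrow> ('a \<Rightarrow> real) \<Rightarrow> bool" where
  "tendsto_in_prob M X Y \<longleftrightarrow>
     (\<forall>\<epsilon>>0. (\<lambda>n. measure M {\<omega>\<in>space M. \<bar>X n \<omega> - Y \<omega>\<bar> > \<epsilon>}) \<longlonglongrightarrow> 0)"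

definition no_free_lunch_vrli ::
  "'a measure \<Rightarrow> (real \<Rightarrow> 'a measure) \<Rightarrow> real \<Rightarrow> (real \<Rightarrow> 'a \<Rightarrow> real) \<Rightarrow> bool" where
  "no_free_lunch_vrli M F T S \<longleftrightarrow> (\<forall>H :: nat \<Rightarrow> 'a simple_data.
     (\<forall>n. simple_integrand M F T (H n)) \<longrightarrow>
     (\<lambda>n. sup_norm M T (\<lambda>t \<omega>. max (- simple_integral (H n) S t \<omega>) 0)) \<longlonglongrightarrow> 0 \<longrightarrow>
     (\<lambda>n. sup_norm M T (simple_process (H n))) \<longlonglongrightarrow> 0 \<longrightarrow>
     tendsto_in_prob M (\<lambda>n \<omega>. max (simple_integral (H n) S T \<omega>) 0) (\<lambda>\<omega>. 0))"

end

theory Submission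
  imports Defs
begin

text \<open>
  If \<open>S = N + A\<close> is a semimartingale, \<open>N\<close> and \<open>A\<close> may be stopped so that \<open>A\<close> has bounded variation and \<open>N\<close>
  is a martingale. The gains \<open>(H \<cdot> N)\<close> then have expectation \<open>0\<close> by optional stopping and a negative part
  which is small in mean, hence they are small in probability.

  Conversely, after stopping and scaling, \<open>\<bar>S\<bar> \<le> 1\<close>. If \<open>S\<close> has conditional drifts \<open>d i\<close> along a dyadic grid,
  the gains of the strategy \<open>sgn (d i) - 2 S (t i)\<close> are, up to a martingale controlled in mean square,
  the total drift \<open>\<Sum>i. \<bar>d i\<bar>\<close> plus the quadratic variation, so absence of free lunches makes the total drifts
  tight. Convex combinations of the indicators that the drift is still below a level \<open>K\<close> converge almost
  surely, and their limit yields one stopping time of probability close to \<open>1\<close> at infinity before which all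
  dyadic drifts have bounded potential, hence are bounded in \<open>L\<^sup>2\<close>. Convex combinations of the discrete compensators
  then converge to a process of integrable variation on the dyadics whose difference with the stopped \<open>S\<close> is a
  martingale; since \<open>S\<close> is cadlag, right limits extend it to \<open>[0, T]\<close>. The decompositions obtained for a
  sequence of such stopping times are pasted together.
\<close>

section \<open>Almost sure convergence of convex combinations\<close>

text \<open>Tightness speaks about one grid at a time: it gives a separate time for every level, and
  nothing prevents the infimum of these times from being finite almost surely. Averaging survival
  indicators instead of times keeps the expectation at \<open>T\<close>, the monotonicity in time
  and every bound that is linear in the weight; the level \<open>1/2\<close> turns the averaged
  limit back into a time. Since averages of late levels are tested against the drift of an earlier
  level, survival on a fine grid has to control the drift on a coarse one.

  Compactness comes from minimising second moments over hulls of tails: near-minimisers are close by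
  the parallelogram identity. For the compensators the second-moment bound is essential, because
  almost sure convergence alone would not carry the martingale identity to the limit, whereas
  convergence in mean does.

  In the other direction the obstacle is the jump of \<open>N\<close> at the stopping time. The gain
  there is compared with the gain at the last trading time before it, which leaves an integrable
  error proportional to the size of the integrand.\<close>

inductive_set midhull :: "('b \<Rightarrow> real) set \<Rightarrow> ('b \<Rightarrow> real) set" for U where
  base: "f \<in> U \<Longrightarrow> f \<in> midhull U"
| mid: "f \<in> midhull U \<Longrightarrow> g \<in> midhull U \<Longrightarrow> (\<lambda>x. (f x + g x) / 2) \<in> midhull U"

lemma midhull_mono:
  assumes "U \<subseteq> V" shows "midhull U \<subseteq> midhull V"
proof
  fix f assume "f \<in> midhull U"
  then show "f \<in> midhull V" by induction (use assms in \<open>auto intro: midhull.intros\<close>)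
qed

lemma integrable_square_mean:
  fixes f g :: "'a \<Rightarrow> real"
  assumes [measurable]: "f \<in> borel_measurable N" "g \<in> borel_measurable N"
    and "integrable N (\<lambda>x. (f x)\<^sup>2)" "integrable N (\<lambda>x. (g x)\<^sup>2)"
  shows "integrable N (\<lambda>x. ((f x + g x) / 2)\<^sup>2)" "integrable N (\<lambda>x. (f x - g x)\<^sup>2)"
proof -
  have 1: "integrable N (\<lambda>x. 2 * (f x)\<^sup>2 + 2 * (g x)\<^sup>2)" using assms by auto
  have 2: "((f x + g x) / 2)\<^sup>2 \<le> 2 * (f x)\<^sup>2 + 2 * (g x)\<^sup>2" for x
  proof -
    have "2 * (f x)\<^sup>2 + 2 * (g x)\<^sup>2 - ((f x + g x) / 2)\<^sup>2 = (f x)\<^sup>2 + (g x)\<^sup>2 + ((f x - g x)/2)\<^sup>2 + ((f x)\<^sup>2 + (g x)\<^sup>2)/2"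
      by (simp add: power2_eq_square field_simps)
    also have "\<dots> \<ge> 0" by simp
    finally show ?thesis by simp
  qed
  have 3: "(f x - g x)\<^sup>2 \<le> 2 * (f x)\<^sup>2 + 2 * (g x)\<^sup>2" for x
  proof -
    have "2 * (f x)\<^sup>2 + 2 * (g x)\<^sup>2 - (f x - g x)\<^sup>2 = (f x + g x)\<^sup>2"
      by (simp add: power2_eq_square field_simps)
    also have "\<dots> \<ge> 0" by simp
    finally show ?thesis by simp
  qed
  show "integrable N (\<lambda>x. ((f x + g x) / 2)\<^sup>2)"
    by (rule Bochner_Integration.integrable_bound[OF 1]) (use 2 in \<open>auto simp del: power_divide intro: order_trans[OF _ abs_ge_self]\<close>)
  show "integrable N (\<lambda>x. (f x - g x)\<^sup>2)"
    by (rule Bochner_Integration.integrable_bound[OF 1]) (use 3 in \<open>auto intro: order_trans[OF _ abs_ge_self]\<close>)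
qed

lemma midhull_square_integrable:
  assumes "f \<in> midhull U"
    and "\<And>u. u \<in> U \<Longrightarrow> u \<in> borel_measurable N"
    and "\<And>u. u \<in> U \<Longrightarrow> integrable N (\<lambda>x. (u x)\<^sup>2)"
  shows "f \<in> borel_measurable N \<and> integrable N (\<lambda>x. (f x)\<^sup>2)"
  using assms(1)
proof induction
  case (base f) then show ?case using assms by auto
next
  case (mid f g)
  then show ?case using integrable_square_mean[of f N g] by (auto simp del: power_divide)
qed

lemma parallelogram_integral:
  fixes f g :: "'a \<Rightarrow> real"
  assumes [measurable]: "f \<in> borel_measurable N" "g \<in> borel_measurable N"
    and I: "integrable N (\<lambda>x. (f x)\<^sup>2)" "integrable N (\<lambda>x. (g x)\<^sup>2)"
  shows "(\<integral>x. (f x - g x)\<^sup>2 \<partial>N) =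
    2 * (\<integral>x. (f x)\<^sup>2 \<partial>N) + 2 * (\<integral>x. (g x)\<^sup>2 \<partial>N) - 4 * (\<integral>x. ((f x + g x) / 2)\<^sup>2 \<partial>N)"
proof -
  note J = integrable_square_mean[OF assms]
  have "(\<integral>x. (f x - g x)\<^sup>2 \<partial>N) = (\<integral>x. 2 * (f x)\<^sup>2 + 2 * (g x)\<^sup>2 - 4 * ((f x + g x) / 2)\<^sup>2 \<partial>N)"
    by (rule Bochner_Integration.integral_cong) (auto simp: power2_eq_square field_simps)
  also have "\<dots> = 2 * (\<integral>x. (f x)\<^sup>2 \<partial>N) + 2 * (\<integral>x. (g x)\<^sup>2 \<partial>N) - 4 * (\<integral>x. ((f x + g x) / 2)\<^sup>2 \<partial>N)"
    using I J by (simp del: power_divide)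
  finally show ?thesis .
qed

text \<open>Summable mean increments make the telescoping series absolutely convergent almost
  everywhere. The sum \<open>D\<close> of absolute values is integrable, so
  \<open>\<bar>f 0 x\<bar> + D x\<close> dominates the whole sequence, and dominated convergence
  upgrades the pointwise limit to convergence in mean.\<close>

lemma (in prob_space) AE_L1_limit:
  fixes f :: "nat \<Rightarrow> 'a \<Rightarrow> real"
  assumes f: "\<And>n. integrable M (f n)"
    and s: "summable (\<lambda>n. \<integral>x. \<bar>f (Suc n) x - f n x\<bar> \<partial>M)"
  shows "\<exists>g. integrable M g \<and> (AE x in M. (\<lambda>n. f n x) \<longlonglongrightarrow> g x) \<and> (\<lambda>n. \<integral>x. \<bar>f n x - g x\<bar> \<partial>M) \<longlonglongrightarrow> 0"
proof -
  have [measurable]: "f n \<in> borel_measurable M" for n using f by auto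
  define d where "d n x = f (Suc n) x - f n x" for n x
  have d[measurable]: "d n \<in> borel_measurable M" "integrable M (d n)" for n
    unfolding d_def using f by (auto intro!: Bochner_Integration.integrable_diff)
  have s': "summable (\<lambda>n. \<integral>x. norm (d n x) \<partial>M)" using s by (simp add: d_def)
  have "(\<integral>\<^sup>+x. (\<Sum>n. ennreal (norm (d n x))) \<partial>M) = (\<Sum>n. \<integral>\<^sup>+x. ennreal (norm (d n x)) \<partial>M)"
    by (rule nn_integral_suminf) auto
  also have "\<dots> = (\<Sum>n. ennreal (\<integral>x. norm (d n x) \<partial>M))"
    using d by (intro suminf_cong nn_integral_eq_integral) auto
  also have "\<dots> = ennreal (\<Sum>n. \<integral>x. norm (d n x) \<partial>M)"
    using s' by (intro suminf_ennreal2) auto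
  finally have "(\<integral>\<^sup>+x. (\<Sum>n. ennreal (norm (d n x))) \<partial>M) \<noteq> \<infinity>" by simp
  then have "AE x in M. (\<Sum>n. ennreal (norm (d n x))) \<noteq> \<infinity>"
    by (intro nn_integral_noteq_infinite) auto
  then have S: "AE x in M. summable (\<lambda>n. norm (d n x))"
    by eventually_elim (auto intro!: summable_suminf_not_top)
  define D where "D x = (\<Sum>n. norm (d n x))" for x
  have D: "integrable M D"
    unfolding D_def by (rule integrable_suminf) (use d S s' in auto)
  define g where "g x = lim (\<lambda>n. f n x)" for x
  have [measurable]: "g \<in> borel_measurable M" unfolding g_def by measurable
  have tele: "f n x - f 0 x = (\<Sum>i<n. d i x)" for n x
    unfolding d_def by (rule sum_lessThan_telescope[of "\<lambda>i. f i x" n, symmetric])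
  have conv: "AE x in M. (\<lambda>n. f n x) \<longlonglongrightarrow> g x"
    using S
  proof eventually_elim
    fix x assume "summable (\<lambda>n. norm (d n x))"
    then have "summable (\<lambda>n. d n x)" by (rule summable_norm_cancel)
    then have "convergent (\<lambda>n. \<Sum>i<n. d i x)" by (simp add: summable_iff_convergent)
    then have "convergent (\<lambda>n. f 0 x + (\<Sum>i<n. d i x))"
      by (intro convergent_add convergent_const)
    moreover have "f 0 x + (\<Sum>i<n. d i x) = f n x" for n using tele[of n x] by simp
    ultimately show "(\<lambda>n. f n x) \<longlonglongrightarrow> g x" unfolding g_def by (simp add: convergent_LIMSEQ_iff)
  qed
  have bd: "AE x in M. norm (f n x) \<le> \<bar>f 0 x\<bar> + D x" for n
    using S
  proof eventually_elim
    fix x assume "summable (\<lambda>n. norm (d n x))"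
    then have "(\<Sum>i<n. norm (d i x)) \<le> D x" unfolding D_def by (intro sum_le_suminf) auto
    moreover have "norm (\<Sum>i<n. d i x) \<le> (\<Sum>i<n. norm (d i x))" by (rule norm_sum)
    ultimately show "norm (f n x) \<le> \<bar>f 0 x\<bar> + D x" using tele[of n x] unfolding real_norm_def by linarith
  qed
  have w: "integrable M (\<lambda>x. \<bar>f 0 x\<bar> + D x)" using f D by auto
  have g: "integrable M g"
    by (rule integrable_dominated_convergence[OF _ _ w conv bd]) auto
  have "(\<lambda>n. \<integral>x. \<bar>f n x - g x\<bar> \<partial>M) \<longlonglongrightarrow> (\<integral>x. 0 \<partial>M)"
  proof (rule integral_dominated_convergence[where w="\<lambda>x. (\<bar>f 0 x\<bar> + D x) + \<bar>g x\<bar>"])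
    show "AE x in M. (\<lambda>n. \<bar>f n x - g x\<bar>) \<longlonglongrightarrow> 0"
      using conv by eventually_elim (metis LIM_zero tendsto_rabs_zero)
    show "AE x in M. norm \<bar>f n x - g x\<bar> \<le> \<bar>f 0 x\<bar> + D x + \<bar>g x\<bar>" for n
      using bd[of n] by eventually_elim auto
  qed (use w g in auto)
  then show ?thesis using g conv by auto
qed

text \<open>The infimum \<open>a m\<close> of the second moments over the hull of the tail from
  \<open>m\<close> increases to a finite limit \<open>L\<close>. Two near-minimisers from one hull
  have a midpoint in that hull, whose second moment cannot drop much below \<open>L\<close>; the
  parallelogram identity then forces them together. Midpoints are the only averages ever formed,
  which is why \<open>midhull\<close> closes under nothing else.\<close>

lemma (in prob_space) komlos_midhull:
  fixes u :: "nat \<Rightarrow> 'a \<Rightarrow> real"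
  assumes u: "\<And>n. u n \<in> borel_measurable M" "\<And>n. integrable M (\<lambda>x. (u n x)\<^sup>2)"
  and C: "\<And>n. (\<integral>x. (u n x)\<^sup>2 \<partial>M) \<le> C"
  shows "\<exists>f g. (\<forall>m. f m \<in> midhull (u ` {m..})) \<and> integrable M g \<and>
     (AE x in M. (\<lambda>n. f n x) \<longlonglongrightarrow> g x) \<and> (\<lambda>n. \<integral>x. \<bar>f n x - g x\<bar> \<partial>M) \<longlonglongrightarrow> 0"
proof -
  define H where "H m = midhull (u ` {m..})" for m
  define \<phi> where "\<phi> f = (\<integral>x. (f x)\<^sup>2 \<partial>M)" for f :: "'a \<Rightarrow> real"
  define a where "a m = Inf (\<phi> ` H m)" for m
  have uH: "u m \<in> H m" for m unfolding H_def by (auto intro: midhull.base)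
  have Hm: "f \<in> borel_measurable M" "integrable M (\<lambda>x. (f x)\<^sup>2)" if "f \<in> H m" for f m
    using midhull_square_integrable[of f "u ` {m..}" M] that u unfolding H_def by auto
  have \<phi>0: "0 \<le> \<phi> f" for f unfolding \<phi>_def by simp
  have bdd: "bdd_below (\<phi> ` H m)" for m by (rule bdd_belowI[of _ 0]) (use \<phi>0 in auto)
  have anti: "H m \<subseteq> H l" if "l \<le> m" for l m
    unfolding H_def using that by (intro midhull_mono image_mono) auto
  have a_le: "a m \<le> \<phi> f" if "f \<in> H m" for f m unfolding a_def using that bdd by (auto intro: cInf_lower)
  have a_mono: "a l \<le> a m" if "l \<le> m" for l m
    unfolding a_def using anti[OF that] uH bdd by (intro cInf_superset_mono) auto
  have aC: "a m \<le> C" for m using a_le[OF uH] C unfolding \<phi>_def by (meson order_trans)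
  have bA: "bdd_above (range a)" by (rule bdd_aboveI[of _ C]) (use aC in auto)
  define L where "L = (SUP m. a m)"
  have aL: "a m \<le> L" for m unfolding L_def using bA by (intro cSUP_upper) auto
  \<comment> \<open>The rate \<open>16^-i\<close> turns squared distances of order
    \<open>e i\<close> into mean distances of order \<open>4^-i\<close>, which are summable.\<close>
  define e where "e i = (1/16::real)^i" for i :: nat
  have e0: "e i > 0" for i unfolding e_def by simp
  have "\<exists>m\<ge>i. L - e i < a m" for i
  proof -
    have "L - e i < (SUP m. a m)" using e0[of i] unfolding L_def[symmetric] by simp
    then obtain m where "L - e i < a m" using less_cSUP_iff[of UNIV a "L - e i"] bA by auto
    then have "L - e i < a (max i m)" using a_mono[of m "max i m"] by simp
    then show ?thesis by (intro exI[of _ "max i m"]) auto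
  qed
  then obtain m where m: "\<And>i. i \<le> m i" "\<And>i. L - e i < a (m i)" by metis
  have "\<exists>f\<in>H (m i). \<phi> f < a (m i) + e i" for i
  proof -
    have "Inf (\<phi> ` H (m i)) < a (m i) + e i" unfolding a_def[symmetric] using e0[of i] by simp
    then show ?thesis using uH[of "m i"] by (subst (asm) cInf_less_iff) (use bdd in auto)
  qed
  then obtain f where f: "\<And>i. f i \<in> H (m i)" "\<And>i. \<phi> (f i) < a (m i) + e i" by metis
  note fM = Hm[OF f(1)]
  have fM'[measurable]: "f i \<in> borel_measurable M" for i by (rule fM)
  have dint: "integrable M (\<lambda>x. (f (Suc i) x - f i x)\<^sup>2)" for i
    by (rule integrable_square_mean(2)[OF fM(1) fM(1) fM(2) fM(2)])
  have d: "\<phi> (\<lambda>x. f (Suc i) x - f i x) \<le> 8 * e i" for i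
  proof -
    \<comment> \<open>The hull of the earlier of the two tails contains both near-minimisers and
      their midpoint, and its infimum still exceeds \<open>L - e i\<close>. The identity then gives
      at most \<open>2 (L + e i) + 2 (L + e i) - 4 (L - e i) = 8 e i\<close>.\<close>
    define k where "k = min (m i) (m (Suc i))"
    have ee: "e (Suc i) \<le> e i" unfolding e_def by simp
    have "f i \<in> H k" "f (Suc i) \<in> H k"
      using f(1)[of i] f(1)[of "Suc i"] anti[of k "m i"] anti[of k "m (Suc i)"] unfolding k_def by auto
    then have "(\<lambda>x. (f (Suc i) x + f i x) / 2) \<in> H k" unfolding H_def by (intro midhull.mid)
    from a_le[OF this] have "L - e i \<le> \<phi> (\<lambda>x. (f (Suc i) x + f i x) / 2)"
      using m(2)[of i] m(2)[of "Suc i"] ee unfolding k_def by (auto simp: min_def split: if_splits)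
    moreover have "\<phi> (\<lambda>x. f (Suc i) x - f i x) = 2 * \<phi> (f (Suc i)) + 2 * \<phi> (f i) - 4 * \<phi> (\<lambda>x. (f (Suc i) x + f i x) / 2)"
      unfolding \<phi>_def by (rule parallelogram_integral[OF fM(1) fM(1) fM(2) fM(2)])
    moreover have "\<phi> (f i) \<le> L + e i" "\<phi> (f (Suc i)) \<le> L + e i"
      using f(2)[of i] f(2)[of "Suc i"] aL[of "m i"] aL[of "m (Suc i)"] ee by auto
    ultimately show ?thesis by linarith
  qed
  have fint: "integrable M (f i)" for i
    by (rule square_integrable_imp_integrable[OF fM])
  have l1: "(\<integral>x. \<bar>f (Suc i) x - f i x\<bar> \<partial>M) \<le> 5 * (1/4)^i" for i
  proof -
    define c where "c = (1/4::real)^i"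
    have c0: "c > 0" unfolding c_def by simp
    have ec: "e i = c * c" unfolding e_def c_def by (simp add: power_mult_distrib[symmetric])
    \<comment> \<open>Young's inequality with weight \<open>c\<close>, the square root of
      \<open>e i\<close>, takes the place of Cauchy-Schwarz. The resulting constant is
      \<open>1/2 + 8/2 = 9/2\<close>, rounded up to \<open>5\<close>.\<close>
    have "(\<integral>x. \<bar>f (Suc i) x - f i x\<bar> \<partial>M) \<le> (\<integral>x. c/2 + (f (Suc i) x - f i x)\<^sup>2 / (2*c) \<partial>M)"
    proof (rule integral_mono)
      show "\<bar>f (Suc i) x - f i x\<bar> \<le> c/2 + (f (Suc i) x - f i x)\<^sup>2 / (2*c)" for x
      proof -
        let ?d = "\<bar>f (Suc i) x - f i x\<bar>"
        have "0 \<le> (?d - c)\<^sup>2" by simp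
        then have "2 * c * ?d \<le> c * c + ?d\<^sup>2" by (simp add: power2_eq_square algebra_simps)
        then show ?thesis using c0 by (simp add: field_simps power2_eq_square)
      qed
    qed (use fint dint in auto)
    also have "\<dots> = c/2 + \<phi> (\<lambda>x. f (Suc i) x - f i x) / (2*c)"
      unfolding \<phi>_def using dint[of i] by (simp add: prob_space)
    also have "\<dots> \<le> c/2 + 8 * (c*c) / (2*c)"
      using d[of i] c0 unfolding ec by (intro add_left_mono divide_right_mono) auto
    also have "\<dots> \<le> 5 * c" using c0 by (simp add: field_simps)
    finally show ?thesis unfolding c_def .
  qed
  have "summable (\<lambda>i. 5 * (1/4::real)^i)" by (intro summable_mult summable_geometric) auto
  then have "summable (\<lambda>i. \<integral>x. \<bar>f (Suc i) x - f i x\<bar> \<partial>M)"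
    by (rule summable_comparison_test[rotated]) (use l1 in auto)
  from AE_L1_limit[OF fint this] obtain g where g: "integrable M g"
    "AE x in M. (\<lambda>n. f n x) \<longlonglongrightarrow> g x" "(\<lambda>n. \<integral>x. \<bar>f n x - g x\<bar> \<partial>M) \<longlonglongrightarrow> 0" by blast
  have "f i \<in> midhull (u ` {i..})" for i using f(1)[of i] anti[OF m(1)[of i]] unfolding H_def by auto
  then show ?thesis using g by blast
qed

text \<open>The countably many limits are taken simultaneously by working on the product with a
  distribution of full support on the index set.\<close>

lemma (in prob_space) komlos_midhull_family:
  fixes u :: "nat \<Rightarrow> nat \<Rightarrow> 'a \<Rightarrow> real"
  assumes u[measurable]: "\<And>n k. u n k \<in> borel_measurable M" and ui: "\<And>n k. integrable M (\<lambda>x. (u n k x)\<^sup>2)"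
  and C: "\<And>n k. (\<integral>x. (u n k x)\<^sup>2 \<partial>M) \<le> C"
  shows "\<exists>f g. (\<forall>m. f m \<in> midhull ((\<lambda>n (k, x). u n k x) ` {m..})) \<and> (\<forall>k. integrable M (g k) \<and>
     (AE x in M. (\<lambda>n. f n (k, x)) \<longlonglongrightarrow> g k x) \<and> (\<lambda>n. \<integral>x. \<bar>f n (k, x) - g k x\<bar> \<partial>M) \<longlonglongrightarrow> 0)"
proof -
  define p where "p = measure_pmf (geometric_pmf (1/2))"
  have pk: "pmf (geometric_pmf (1/2)) k > 0" for k by (simp add: geometric_pmf.rep_eq)
  interpret p: prob_space p unfolding p_def by (rule prob_space_measure_pmf)
  interpret P: pair_prob_space p M ..
  have sp[measurable_cong]: "sets p = sets (count_space UNIV)" unfolding p_def by simp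
  define U where "U n = (\<lambda>(k, x). u n k x)" for n
  have Um[measurable]: "U n \<in> borel_measurable (p \<Otimes>\<^sub>M M)" for n
    unfolding U_def by measurable
  \<comment> \<open>Integrability and mean convergence on the product descend to the slice at
    \<open>k\<close> because the point \<open>k\<close> has positive mass; this mass reappears as
    the divisor \<open>K\<close> at the end.\<close>
  have int_p: "integrable M (h k)" "pmf (geometric_pmf (1/2)) k * (\<integral>x. \<bar>h k x\<bar> \<partial>M) \<le> (\<integral>y. \<bar>(\<lambda>(k,x). h k x) y\<bar> \<partial>(p \<Otimes>\<^sub>M M))"
    if h: "integrable (p \<Otimes>\<^sub>M M) (\<lambda>(k,x). h k x)" for h :: "nat \<Rightarrow> 'a \<Rightarrow> real" and k
  proof -
    have hm[measurable]: "(\<lambda>(k,x). h k x) \<in> borel_measurable (p \<Otimes>\<^sub>M M)" using h by auto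
    have hk[measurable]: "h k \<in> borel_measurable M" for k
      using measurable_Pair2[OF hm, of k] by (simp add: p_def)
    have "AE k in p. integrable M (\<lambda>x. (\<lambda>(k,x). h k x) (k, x))"
      by (rule P.AE_integrable_fst'[OF h])
    then show "integrable M (h k)" unfolding p_def AE_measure_pmf_iff
      using pk[of k] by (auto simp: set_pmf_iff)
    let ?K = "pmf (geometric_pmf (1/2)) k"
    have h': "integrable (p \<Otimes>\<^sub>M M) (\<lambda>y. \<bar>(\<lambda>(k,x). h k x) y\<bar>)" using h by (rule integrable_abs)
    have "(\<integral>y. \<bar>(\<lambda>(k,x). h k x) y\<bar> \<partial>(p \<Otimes>\<^sub>M M)) = (\<integral>k. \<integral>x. \<bar>h k x\<bar> \<partial>M \<partial>p)"
      using P.integral_fst'[OF h'] by simp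
    also have "\<dots> \<ge> (\<integral>j. indicator {k} j * (\<integral>x. \<bar>h k x\<bar> \<partial>M) \<partial>p)"
    proof (rule integral_mono)
      show "integrable p (\<lambda>j. indicator {k} j * (\<integral>x. \<bar>h k x\<bar> \<partial>M))"
        by (intro integrable_mult_left integrable_real_indicator) (auto simp: sp p.emeasure_finite less_top[symmetric])
      show "integrable p (\<lambda>j. \<integral>x. \<bar>h j x\<bar> \<partial>M)"
        using P.integrable_fst'[OF h'] by simp
    qed (auto simp: indicator_def)
    also have "(\<integral>j. indicator {k} j * (\<integral>x. \<bar>h k x\<bar> \<partial>M) \<partial>p) = ?K * (\<integral>x. \<bar>h k x\<bar> \<partial>M)"
      unfolding p_def by (simp add: measure_pmf_single)
    finally show "?K * (\<integral>x. \<bar>h k x\<bar> \<partial>M) \<le> (\<integral>y. \<bar>(\<lambda>(k,x). h k x) y\<bar> \<partial>(p \<Otimes>\<^sub>M M))" .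
  qed
  have int_p0: "integrable (p \<Otimes>\<^sub>M M) (\<lambda>y. (U n y)\<^sup>2) \<and> (\<integral>y. (U n y)\<^sup>2 \<partial>(p \<Otimes>\<^sub>M M)) \<le> C" for n
  proof -
    have "(\<integral>\<^sup>+y. ennreal ((U n y)\<^sup>2) \<partial>(p \<Otimes>\<^sub>M M)) = (\<integral>\<^sup>+k. \<integral>\<^sup>+x. ennreal ((u n k x)\<^sup>2) \<partial>M \<partial>p)"
      by (subst nn_integral_fst[symmetric]) (auto simp: U_def)
    also have "\<dots> = (\<integral>\<^sup>+k. ennreal (\<integral>x. (u n k x)\<^sup>2 \<partial>M) \<partial>p)"
      using ui by (intro nn_integral_cong nn_integral_eq_integral) auto
    also have "\<dots> \<le> (\<integral>\<^sup>+k. ennreal C \<partial>p)"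
      using C by (intro nn_integral_mono ennreal_leI) auto
    also have "\<dots> = ennreal C" by (simp add: p.emeasure_space_1)
    finally have *: "(\<integral>\<^sup>+y. ennreal ((U n y)\<^sup>2) \<partial>(p \<Otimes>\<^sub>M M)) \<le> ennreal C" .
    then have i: "integrable (p \<Otimes>\<^sub>M M) (\<lambda>y. (U n y)\<^sup>2)"
      by (intro integrableI_bounded) (auto simp: le_less_trans)
    have "0 \<le> (\<integral>x. (u 0 0 x)\<^sup>2 \<partial>M)" by simp
    then have C0: "0 \<le> C" using C[of 0 0] by linarith
    show ?thesis using i * nn_integral_eq_integral[OF i] C0 by (simp add: ennreal_le_iff)
  qed
  obtain f g where fg: "(\<forall>m. f m \<in> midhull (U ` {m..})) \<and> integrable (p \<Otimes>\<^sub>M M) g \<and>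
     (AE y in p \<Otimes>\<^sub>M M. (\<lambda>n. f n y) \<longlonglongrightarrow> g y) \<and> (\<lambda>n. \<integral>y. \<bar>f n y - g y\<bar> \<partial>(p \<Otimes>\<^sub>M M)) \<longlonglongrightarrow> 0"
    using P.komlos_midhull[of U, OF Um conjunct1[OF int_p0] conjunct2[OF int_p0]]
    by (elim exE) (rule that)
  note f = fg[THEN conjunct1, rule_format] and g = fg[THEN conjunct2, THEN conjunct1]
    fg[THEN conjunct2, THEN conjunct2, THEN conjunct1] fg[THEN conjunct2, THEN conjunct2, THEN conjunct2]
  have fi: "integrable (p \<Otimes>\<^sub>M M) (f n)" for n
  proof -
    have "f n \<in> borel_measurable (p \<Otimes>\<^sub>M M) \<and> integrable (p \<Otimes>\<^sub>M M) (\<lambda>x. (f n x)\<^sup>2)"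
    proof (rule midhull_square_integrable[OF f[of n]])
      fix v assume "v \<in> U ` {n..}"
      then obtain k where "v = U k" by auto
      then show "v \<in> borel_measurable (p \<Otimes>\<^sub>M M)" "integrable (p \<Otimes>\<^sub>M M) (\<lambda>x. (v x)\<^sup>2)"
        using Um[of k] int_p0[of k] by simp_all
    qed
    then show ?thesis using P.square_integrable_imp_integrable by blast
  qed
  have a: "AE k in p. AE x in M. (\<lambda>n. f n (k, x)) \<longlonglongrightarrow> g (k, x)"
    using P.AE_pair[OF g(2)] by simp
  show ?thesis
  proof (intro exI[of _ f] exI[of _ "\<lambda>k x. g (k,x)"] conjI allI)
    show "f m \<in> midhull ((\<lambda>n (k, x). u n k x) ` {m..})" for m
      using f[of m] unfolding U_def .
    fix k
    show "integrable M (\<lambda>x. g (k, x))" using int_p(1)[of "\<lambda>k x. g (k,x)" k] g(1) by simp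
    show "AE x in M. (\<lambda>n. f n (k, x)) \<longlonglongrightarrow> g (k, x)"
      using a pk[of k] unfolding p_def AE_measure_pmf_iff by (auto simp: set_pmf_iff)
    define K where "K = pmf (geometric_pmf (1/2)) k"
    have "K > 0" unfolding K_def by (rule pk)
    have le: "(\<integral>x. \<bar>f n (k,x) - g (k,x)\<bar> \<partial>M) \<le> (\<integral>y. \<bar>f n y - g y\<bar> \<partial>(p \<Otimes>\<^sub>M M)) / K" for n
    proof -
      have "integrable (p \<Otimes>\<^sub>M M) (\<lambda>y. f n y - g y)" using fi g(1) by auto
      then show ?thesis
        using int_p(2)[of "\<lambda>k x. f n (k,x) - g (k,x)" k] \<open>K > 0\<close> unfolding K_def
        by (simp add: field_simps case_prod_unfold)
    qed
    have lim: "(\<lambda>n. (\<integral>y. \<bar>f n y - g y\<bar> \<partial>(p \<Otimes>\<^sub>M M)) / K) \<longlonglongrightarrow> 0"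
      using tendsto_divide[OF g(3) tendsto_const, of K] \<open>K > 0\<close> by simp
    show "(\<lambda>n. \<integral>x. \<bar>f n (k,x) - g (k,x)\<bar> \<partial>M) \<longlonglongrightarrow> 0"
      by (rule tendsto_sandwich[OF _ _ tendsto_const lim]) (use le in auto)
  qed
qed

text \<open>Vitali's theorem by truncation. Clipping at \<open>a\<close> changes each
  \<open>Y m\<close> by at most its tail in mean, Fatou's lemma passes the same bound to
  \<open>Z\<close>, and between the clipped functions dominated convergence with the constant
  \<open>2 * a\<close> applies.\<close>

lemma (in prob_space) UI_limit:
  fixes Y :: "nat \<Rightarrow> 'a \<Rightarrow> real" and Z :: "'a \<Rightarrow> real"
  assumes Y: "\<And>m. integrable M (Y m)"
    and lim: "\<And>\<omega>. \<omega> \<in> space M \<Longrightarrow> (\<lambda>m. Y m \<omega>) \<longlonglongrightarrow> Z \<omega>"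
    and UI: "\<And>e. e > 0 \<Longrightarrow> \<exists>a>0. \<forall>m. (\<integral>\<omega>. \<bar>Y m \<omega>\<bar> * of_bool (\<bar>Y m \<omega>\<bar> > a) \<partial>M) \<le> e"
  shows "integrable M Z" "(\<lambda>m. \<integral>\<omega>. \<bar>Y m \<omega> - Z \<omega>\<bar> \<partial>M) \<longlonglongrightarrow> 0"
proof -
  have [measurable]: "Y m \<in> borel_measurable M" for m using Y by auto
  have [measurable]: "Z \<in> borel_measurable M" by (rule borel_measurable_LIMSEQ_metric[OF _ lim]) auto
  define tr where "tr a x = max (- a) (min a x)" for a x :: real
  have [measurable]: "tr a \<in> borel_measurable borel" for a unfolding tr_def by measurable
  have trb: "\<bar>tr a x\<bar> \<le> a" if "a > 0" for a x using that unfolding tr_def by auto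
  have trd: "\<bar>x - tr a x\<bar> \<le> \<bar>x\<bar> * of_bool (\<bar>x\<bar> > a)" if "a > 0" for a x using that unfolding tr_def by auto
  have itr: "integrable M (\<lambda>\<omega>. tr a (h \<omega>))" if "a > 0" and [measurable]: "h \<in> borel_measurable M" for h :: "'a \<Rightarrow> real" and a
    by (rule integrable_const_bound[of _ a]) (use trb[OF \<open>a>0\<close>] in auto)
  have iid: "integrable M (\<lambda>\<omega>. \<bar>Y m \<omega>\<bar> * of_bool (\<bar>Y m \<omega>\<bar> > a))" for m a
    by (rule Bochner_Integration.integrable_bound[OF Y[of m]]) auto
  have key: "integrable M Z \<and> (\<integral>\<omega>. \<bar>Z \<omega> - tr a (Z \<omega>)\<bar> \<partial>M) \<le> e \<and> (\<forall>m. (\<integral>\<omega>. \<bar>Y m \<omega> - tr a (Y m \<omega>)\<bar> \<partial>M) \<le> e)"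
    if "e > 0" "a > 0" and a: "\<forall>m. (\<integral>\<omega>. \<bar>Y m \<omega>\<bar> * of_bool (\<bar>Y m \<omega>\<bar> > a) \<partial>M) \<le> e" for e a
  proof -
    have 1: "(\<integral>\<omega>. \<bar>Y m \<omega> - tr a (Y m \<omega>)\<bar> \<partial>M) \<le> e" for m
    proof -
      have "(\<integral>\<omega>. \<bar>Y m \<omega> - tr a (Y m \<omega>)\<bar> \<partial>M) \<le> (\<integral>\<omega>. \<bar>Y m \<omega>\<bar> * of_bool (\<bar>Y m \<omega>\<bar> > a) \<partial>M)"
        by (rule integral_mono) (use trd[OF \<open>a>0\<close>] Y iid itr[OF \<open>a>0\<close>] in auto)
      then show ?thesis using a by (meson order_trans)
    qed
    have "(\<integral>\<^sup>+\<omega>. ennreal \<bar>Z \<omega> - tr a (Z \<omega>)\<bar> \<partial>M) = (\<integral>\<^sup>+\<omega>. liminf (\<lambda>m. ennreal \<bar>Y m \<omega> - tr a (Y m \<omega>)\<bar>) \<partial>M)"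
    proof (rule nn_integral_cong)
      fix \<omega> assume "\<omega> \<in> space M"
      have "(\<lambda>m. ennreal \<bar>Y m \<omega> - tr a (Y m \<omega>)\<bar>) \<longlonglongrightarrow> ennreal \<bar>Z \<omega> - tr a (Z \<omega>)\<bar>"
        unfolding tr_def using lim[OF \<open>\<omega> \<in> space M\<close>] by (intro tendsto_ennrealI tendsto_intros)
      then show "ennreal \<bar>Z \<omega> - tr a (Z \<omega>)\<bar> = liminf (\<lambda>m. ennreal \<bar>Y m \<omega> - tr a (Y m \<omega>)\<bar>)"
        by (rule lim_imp_Liminf[OF trivial_limit_sequentially, symmetric])
    qed
    also have "\<dots> \<le> liminf (\<lambda>m. \<integral>\<^sup>+\<omega>. ennreal \<bar>Y m \<omega> - tr a (Y m \<omega>)\<bar> \<partial>M)"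
      by (rule nn_integral_liminf) auto
    also have "\<dots> \<le> liminf (\<lambda>m. ennreal e)"
    proof (rule Liminf_mono, rule always_eventually, rule allI)
      fix m
      have "(\<integral>\<^sup>+\<omega>. ennreal \<bar>Y m \<omega> - tr a (Y m \<omega>)\<bar> \<partial>M) = ennreal (\<integral>\<omega>. \<bar>Y m \<omega> - tr a (Y m \<omega>)\<bar> \<partial>M)"
        using Y itr[OF \<open>a>0\<close>] by (intro nn_integral_eq_integral) auto
      then show "(\<integral>\<^sup>+\<omega>. ennreal \<bar>Y m \<omega> - tr a (Y m \<omega>)\<bar> \<partial>M) \<le> ennreal e" using 1 by (simp add: ennreal_leI)
    qed
    finally have 2: "(\<integral>\<^sup>+\<omega>. ennreal \<bar>Z \<omega> - tr a (Z \<omega>)\<bar> \<partial>M) \<le> ennreal e" by (simp add: Liminf_const)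
    then have "integrable M (\<lambda>\<omega>. Z \<omega> - tr a (Z \<omega>))"
      by (intro integrableI_bounded) (auto simp: le_less_trans)
    from Bochner_Integration.integrable_add[OF this itr[OF \<open>a>0\<close>, of Z]] have Z: "integrable M Z" by simp
    then have "(\<integral>\<^sup>+\<omega>. ennreal \<bar>Z \<omega> - tr a (Z \<omega>)\<bar> \<partial>M) = ennreal (\<integral>\<omega>. \<bar>Z \<omega> - tr a (Z \<omega>)\<bar> \<partial>M)"
        using Y itr[OF \<open>a>0\<close>] by (intro nn_integral_eq_integral) auto
    then show ?thesis using 1 2 Z \<open>e > 0\<close> by (simp add: ennreal_le_iff)
  qed
  obtain a where "a > 0" "\<forall>m. (\<integral>\<omega>. \<bar>Y m \<omega>\<bar> * of_bool (\<bar>Y m \<omega>\<bar> > a) \<partial>M) \<le> 1"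
    using UI[of 1] by auto
  then show Zi: "integrable M Z" using key[of 1 a] by auto
  show "(\<lambda>m. \<integral>\<omega>. \<bar>Y m \<omega> - Z \<omega>\<bar> \<partial>M) \<longlonglongrightarrow> 0"
  proof (rule LIMSEQ_I)
    fix r :: real assume "r > 0"
    obtain a where a: "a > 0" "\<forall>m. (\<integral>\<omega>. \<bar>Y m \<omega>\<bar> * of_bool (\<bar>Y m \<omega>\<bar> > a) \<partial>M) \<le> r/4"
      using UI[of "r/4"] \<open>r > 0\<close> by auto
    have K: "(\<integral>\<omega>. \<bar>Z \<omega> - tr a (Z \<omega>)\<bar> \<partial>M) \<le> r/4" "(\<integral>\<omega>. \<bar>Y m \<omega> - tr a (Y m \<omega>)\<bar> \<partial>M) \<le> r/4" for m
      using key[OF _ a] \<open>r > 0\<close> by auto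
    have "(\<lambda>m. \<integral>\<omega>. \<bar>tr a (Y m \<omega>) - tr a (Z \<omega>)\<bar> \<partial>M) \<longlonglongrightarrow> (\<integral>\<omega>. 0 \<partial>M)"
    proof (rule integral_dominated_convergence[where w="\<lambda>_. 2 * a"])
      show "AE x in M. (\<lambda>m. \<bar>tr a (Y m x) - tr a (Z x)\<bar>) \<longlonglongrightarrow> 0"
      proof (rule AE_I2)
        fix x assume "x \<in> space M"
        have "(\<lambda>m. \<bar>tr a (Y m x) - tr a (Z x)\<bar>) \<longlonglongrightarrow> \<bar>tr a (Z x) - tr a (Z x)\<bar>"
          unfolding tr_def using lim[OF \<open>x \<in> space M\<close>] by (intro tendsto_intros)
        then show "(\<lambda>m. \<bar>tr a (Y m x) - tr a (Z x)\<bar>) \<longlonglongrightarrow> 0" by simp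
      qed
      show "AE x in M. norm \<bar>tr a (Y m x) - tr a (Z x)\<bar> \<le> 2 * a" for m
      proof (rule AE_I2)
        fix x show "norm \<bar>tr a (Y m x) - tr a (Z x)\<bar> \<le> 2 * a"
          using trb[OF a(1), of "Y m x"] trb[OF a(1), of "Z x"] by auto
      qed
    qed auto
    then have "(\<lambda>m. \<integral>\<omega>. \<bar>tr a (Y m \<omega>) - tr a (Z \<omega>)\<bar> \<partial>M) \<longlonglongrightarrow> 0" by simp
    from LIMSEQ_D[OF this, of "r/4"] obtain n0 where
      n0: "\<And>m. m \<ge> n0 \<Longrightarrow> (\<integral>\<omega>. \<bar>tr a (Y m \<omega>) - tr a (Z \<omega>)\<bar> \<partial>M) < r/4" using \<open>r > 0\<close> by auto
    have "(\<integral>\<omega>. \<bar>Y m \<omega> - Z \<omega>\<bar> \<partial>M) < r" if "m \<ge> n0" for m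
    proof -
      have "(\<integral>\<omega>. \<bar>Y m \<omega> - Z \<omega>\<bar> \<partial>M) \<le> (\<integral>\<omega>. \<bar>Y m \<omega> - tr a (Y m \<omega>)\<bar> + \<bar>tr a (Y m \<omega>) - tr a (Z \<omega>)\<bar> + \<bar>Z \<omega> - tr a (Z \<omega>)\<bar> \<partial>M)"
        by (rule integral_mono) (use Y Zi itr[OF a(1)] in auto)
      also have "\<dots> = (\<integral>\<omega>. \<bar>Y m \<omega> - tr a (Y m \<omega>)\<bar> \<partial>M) + (\<integral>\<omega>. \<bar>tr a (Y m \<omega>) - tr a (Z \<omega>)\<bar> \<partial>M) + (\<integral>\<omega>. \<bar>Z \<omega> - tr a (Z \<omega>)\<bar> \<partial>M)"
        using Y Zi itr[OF a(1)] by simp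
      also have "\<dots> < r" using K(1) K(2)[of m] n0[OF that] \<open>r > 0\<close> by linarith
      finally show ?thesis .
    qed
    then show "\<exists>no. \<forall>n\<ge>no. norm ((\<integral>\<omega>. \<bar>Y n \<omega> - Z \<omega>\<bar> \<partial>M) - 0) < r"
      by (intro exI[of _ n0]) auto
  qed
qed

section \<open>Martingales and stopping times\<close>

text \<open>Rounding goes upwards so that right-continuity of the paths applies. The endpoint
  \<open>b\<close> is a parameter: grids of \<open>[0, t]\<close> keep a stopped value measurable at
  time \<open>t\<close>, and the grid of \<open>[0, T]\<close> serves optional stopping.\<close>

definition dyadic_ceil :: "real \<Rightarrow> nat \<Rightarrow> real \<Rightarrow> real" where
  "dyadic_ceil b m r = b * of_int \<lceil>r * 2 ^ m / b\<rceil> / 2 ^ m"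

lemma dyadic_ceil_bounds:
  assumes "0 < b"
  shows "r \<le> dyadic_ceil b m r" "dyadic_ceil b m r \<le> r + b / 2 ^ m"
proof -
  have "r * 2 ^ m / b \<le> of_int \<lceil>r * 2 ^ m / b\<rceil>" "of_int \<lceil>r * 2 ^ m / b\<rceil> \<le> r * 2 ^ m / b + 1" by linarith+
  then have "r * 2 ^ m \<le> b * of_int \<lceil>r * 2 ^ m / b\<rceil>"
    "b * of_int \<lceil>r * 2 ^ m / b\<rceil> \<le> b * (r * 2 ^ m / b + 1)"
    using assms by (simp_all only: pos_divide_le_eq mult.commute mult_left_mono less_imp_le)
  then show "r \<le> dyadic_ceil b m r" "dyadic_ceil b m r \<le> r + b / 2 ^ m"
    using assms unfolding dyadic_ceil_def by (simp_all add: pos_le_divide_eq pos_divide_le_eq algebra_simps)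
qed

lemma dyadic_ceil_le:
  assumes "0 < b" "r \<le> b" shows "dyadic_ceil b m r \<le> b"
proof -
  have "r * 2 ^ m / b \<le> of_int (2 ^ m)" using assms by (simp add: field_simps)
  then have "\<lceil>r * 2 ^ m / b\<rceil> \<le> 2 ^ m" by (simp add: ceiling_le_iff)
  then have "(of_int \<lceil>r * 2 ^ m / b\<rceil> :: real) \<le> of_int (2 ^ m)" by (simp only: of_int_le_iff)
  then show ?thesis using assms unfolding dyadic_ceil_def by (simp add: field_simps)
qed

lemma dyadic_ceil_cell:
  assumes "0 < b" "0 \<le> r" "r \<le> b"
  obtains i where "i \<le> 2 ^ m" "\<lceil>r * 2 ^ m / b\<rceil> = int i" "dyadic_ceil b m r = b * real i / 2 ^ m"
proof -
  have "r * 2 ^ m / b \<le> of_int (2 ^ m)" using assms by (simp add: field_simps)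
  then have 1: "\<lceil>r * 2 ^ m / b\<rceil> \<le> 2 ^ m" by (simp add: ceiling_le_iff)
  have 2: "0 \<le> \<lceil>r * 2 ^ m / b\<rceil>" using assms by (simp add: ceiling_le_iff less_le_trans[of "-1" 0])
  show ?thesis
    by (rule that[of "nat \<lceil>r * 2 ^ m / b\<rceil>"]) (use 1 2 in \<open>auto simp: dyadic_ceil_def nat_le_iff\<close>)
qed

lemma dyadic_ceil_tendsto:
  assumes "0 < b" shows "(\<lambda>m. dyadic_ceil b m r) \<longlonglongrightarrow> r"
proof -
  have "(\<lambda>m. r + b * (1/2)^m) \<longlonglongrightarrow> r + b * 0"
    by (intro tendsto_intros) auto
  then have l: "(\<lambda>m. r + b / 2 ^ m) \<longlonglongrightarrow> r" by (simp add: power_divide)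
  show ?thesis
    by (rule tendsto_sandwich[OF _ _ tendsto_const l]) (use dyadic_ceil_bounds[OF assms] in auto)
qed

lemma right_tendsto_sequentially:
  fixes f :: "real \<Rightarrow> real"
  assumes "(f \<longlongrightarrow> f t) (at_right t)" "s \<longlonglongrightarrow> t" "\<And>m. t \<le> s m"
  shows "(\<lambda>m. f (s m)) \<longlonglongrightarrow> f t"
proof -
  have "continuous (at_right t) f" using assms(1) by (simp add: continuous_within)
  then have "continuous (at t within {t..}) f"
    by (simp add: continuous_within at_within_Ici_at_right)
  then show ?thesis using assms(2,3) unfolding continuous_within_sequentially by (auto simp: o_def)
qed

lemma cadlag_right_limit:
  assumes "cadlag M T X" "\<omega> \<in> space M" "t \<in> {0..T}" "s \<longlonglongrightarrow> t" "\<And>m. s m \<in> {t..T}"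
  shows "(\<lambda>m. X (s m) \<omega>) \<longlonglongrightarrow> X t \<omega>"
proof (cases "t = T")
  case True
  then have "s m = t" for m using assms(5)[of m] by auto
  then show ?thesis by simp
next
  case False
  then have "((\<lambda>s. X s \<omega>) \<longlongrightarrow> X t \<omega>) (at_right t)" using assms(1,2,3) unfolding cadlag_def by auto
  then show ?thesis
    by (rule right_tendsto_sequentially[where f="\<lambda>s. X s \<omega>"]) (use assms(4,5) in auto)
qed

section \<open>Consequences of the usual conditions\<close>

context usual_filtered_prob_space
begin

lemmas [simp] = space_F

lemma borel_F_mono: "f \<in> borel_measurable (F s) \<Longrightarrow> s \<le> t \<Longrightarrow> f \<in> borel_measurable (F t)"
  using sets_F_mono[of s t] by (auto simp: measurable_def)

lemma borel_F_M: "f \<in> borel_measurable (F s) \<Longrightarrow> s \<in> {0..T} \<Longrightarrow> f \<in> borel_measurable M"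
  using F_sub[of s] by (auto simp: measurable_def)

lemma subalgebra_F: "t \<in> {0..T} \<Longrightarrow> subalgebra M (F t)"
  using F_sub by (auto simp: subalgebra_def)

lemma sigma_finite_F: "t \<in> {0..T} \<Longrightarrow> sigma_finite_subalgebra M (F t)"
  using subalgebra_F finite_measure_subalgebra_is_sigma_finite
  by (auto simp: finite_measure_subalgebra_def finite_measure_subalgebra_axioms_def intro: finite_measure_axioms)

lemma null_F: "N \<in> null_sets M \<Longrightarrow> 0 \<le> t \<Longrightarrow> N \<in> sets (F t)"
  using F_null sets_F_mono[of 0 t] by auto

lemma AE_null: "AE \<omega> in M. P \<omega> \<Longrightarrow> {\<omega>\<in>space M. \<not> P \<omega>} \<in> null_sets M"
proof -
  assume "AE \<omega> in M. P \<omega>"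
  then obtain N where "{\<omega>\<in>space M. \<not> P \<omega>} \<subseteq> N" "N \<in> null_sets M" by (auto elim!: AE_E simp: null_setsI)
  then show ?thesis by (rule complete2)
qed

text \<open>Completeness makes the exceptional set itself a null set, and all null sets belong to
  \<open>F 0\<close>. Thus processes may be redefined on an exceptional set without losing
  adaptedness.\<close>

lemma AE_set_F:
  assumes "AE \<omega> in M. P \<omega>" "0 \<le> t" shows "{\<omega>\<in>space M. P \<omega>} \<in> sets (F t)"
proof -
  have "space (F t) - {\<omega>\<in>space M. \<not> P \<omega>} \<in> sets (F t)"
    by (rule sets.compl_sets[OF null_F[OF AE_null[OF assms(1)] assms(2)]])
  also have "space (F t) - {\<omega>\<in>space M. \<not> P \<omega>} = {\<omega>\<in>space M. P \<omega>}" by auto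
  finally show ?thesis .
qed

text \<open>For each \<open>r\<close> after \<open>t\<close> the tail of the sequence is measurable
  at time \<open>r\<close>, hence so is the limit; right-continuity of the filtration intersects
  these sigma-algebras down to \<open>F t\<close>. At \<open>T\<close> there is no later time, but
  then all sampling times equal \<open>T\<close>.\<close>

lemma right_limit_measurable:
  assumes t: "t \<in> {0..T}" and h: "\<And>n. h n \<in> borel_measurable (F (s n))"
    and s: "\<And>n. s n \<in> {t..T}" "s \<longlonglongrightarrow> t"
    and lim: "\<And>\<omega>. \<omega> \<in> space M \<Longrightarrow> (\<lambda>n. h n \<omega>) \<longlonglongrightarrow> (f \<omega> :: real)"
  shows "f \<in> borel_measurable (F t)"
proof (cases "t = T")
  case True
  then have st: "s n = t" for n using s(1)[of n] by auto
  show ?thesis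
  proof (rule borel_measurable_LIMSEQ_metric)
    show "h n \<in> borel_measurable (F t)" for n using h[of n] st[of n] by simp
    show "(\<lambda>n. h n \<omega>) \<longlonglongrightarrow> f \<omega>" if "\<omega> \<in> space (F t)" for \<omega> using lim that by simp
  qed
next
  case False
  have *: "f \<in> borel_measurable (F r)" if r: "r \<in> {t<..T}" for r
  proof -
    obtain k where k: "\<And>n. n \<ge> k \<Longrightarrow> s n < r"
      using order_tendstoD(2)[OF s(2), of r] r by (auto simp: eventually_sequentially)
    show ?thesis
    proof (rule borel_measurable_LIMSEQ_metric[where f="\<lambda>n. h (n + k)"])
      show "h (n + k) \<in> borel_measurable (F r)" for n
        using h k[of "n + k"] by (intro borel_F_mono[OF h]) auto
      show "(\<lambda>n. h (n + k) \<omega>) \<longlonglongrightarrow> f \<omega>" if "\<omega> \<in> space (F r)" for \<omega>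
        using lim that by (intro LIMSEQ_ignore_initial_segment) auto
    qed
  qed
  show ?thesis
  proof (rule measurableI)
    fix B :: "real set" assume "B \<in> sets borel"
    then have "\<forall>r\<in>{t<..T}. f -` B \<inter> space M \<in> sets (F r)" using measurable_sets[OF *, of _ B] by auto
    then show "f -` B \<inter> space (F t) \<in> sets (F t)" using F_right_cont[of t] t False by auto
  qed simp
qed

lemma martingale_integral:
  assumes X: "martingale M F T X" and st: "s \<in> {0..T}" "t \<in> {s..T}"
    and g: "g \<in> borel_measurable (F s)" and c: "\<And>\<omega>. \<omega> \<in> space M \<Longrightarrow> \<bar>g \<omega>\<bar> \<le> c"
  shows "integrable M (\<lambda>\<omega>. g \<omega> * X t \<omega>)" "(\<integral>\<omega>. g \<omega> * X t \<omega> \<partial>M) = (\<integral>\<omega>. g \<omega> * X s \<omega> \<partial>M)"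
proof -
  interpret sigma_finite_subalgebra M "F s" using st by (intro sigma_finite_F) auto
  have [measurable]: "g \<in> borel_measurable M" using borel_F_M[OF g] st by auto
  have Xi: "integrable M (X t)" "integrable M (X s)" using X st unfolding martingale_def by auto
  have Xm[measurable]: "X t \<in> borel_measurable M" "X s \<in> borel_measurable M" using Xi by auto
  show i: "integrable M (\<lambda>\<omega>. g \<omega> * X t \<omega>)"
  proof (rule Bochner_Integration.integrable_bound[OF integrable_mult_right[OF Xi(1), of c]])
    show "AE \<omega> in M. norm (g \<omega> * X t \<omega>) \<le> norm (c * X t \<omega>)"
    proof (rule AE_I2)
      fix \<omega> assume "\<omega> \<in> space M"
      then have "\<bar>g \<omega>\<bar> \<le> \<bar>c\<bar>" using c[of \<omega>] by linarith
      then show "norm (g \<omega> * X t \<omega>) \<le> norm (c * X t \<omega>)" by (simp add: abs_mult mult_right_mono)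
    qed
  qed auto
  have "AE \<omega> in M. real_cond_exp M (F s) (X t) \<omega> = X s \<omega>" using X st unfolding martingale_def by auto
  then have "(\<integral>\<omega>. g \<omega> * X s \<omega> \<partial>M) = (\<integral>\<omega>. g \<omega> * real_cond_exp M (F s) (X t) \<omega> \<partial>M)"
    by (intro integral_cong_AE) auto
  also have "\<dots> = (\<integral>\<omega>. g \<omega> * X t \<omega> \<partial>M)" by (rule real_cond_exp_intg(2)[OF i g]) auto
  finally show "(\<integral>\<omega>. g \<omega> * X t \<omega> \<partial>M) = (\<integral>\<omega>. g \<omega> * X s \<omega> \<partial>M)" by simp
qed

text \<open>Integrals over events known at time \<open>s\<close> characterise the conditional
  expectation. This form is preserved by limits, which is how all martingales below arise.\<close>

lemma martingaleI:
  assumes a: "adapted F T X" and i: "\<And>t. t \<in> {0..T} \<Longrightarrow> integrable M (X t)"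
    and e: "\<And>s t A. s \<in> {0..T} \<Longrightarrow> t \<in> {s..T} \<Longrightarrow> A \<in> sets (F s) \<Longrightarrow>
      (\<integral>\<omega>. indicator A \<omega> * X t \<omega> \<partial>M) = (\<integral>\<omega>. indicator A \<omega> * X s \<omega> \<partial>M)"
  shows "martingale M F T X"
  unfolding martingale_def
proof (intro conjI ballI a i)
  fix s t assume st: "s \<in> {0..T}" "t \<in> {s..T}"
  interpret sigma_finite_subalgebra M "F s" using st by (intro sigma_finite_F) auto
  show "AE \<omega> in M. real_cond_exp M (F s) (X t) \<omega> = X s \<omega>"
    by (rule real_cond_exp_charact)
      (use e[OF st] i[of t] i[of s] st a in \<open>auto simp: set_lebesgue_integral_def adapted_def\<close>)
qed auto

lemma stopping_time_measurable:
  assumes "stopping_time F \<tau>" shows "(\<lambda>\<omega>. min (\<tau> \<omega>) t) \<in> borel_measurable (F t)"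
proof (rule borel_measurableI_le)
  fix c
  show "{\<omega> \<in> space (F t). min (\<tau> \<omega>) t \<le> c} \<in> sets (F t)"
  proof (cases "t \<le> c")
    case True
    then have "{\<omega> \<in> space (F t). min (\<tau> \<omega>) t \<le> c} = space (F t)" by auto
    then show ?thesis by (metis sets.top)
  next
    case False
    have "{\<omega> \<in> space (F c). \<tau> \<omega> \<le> c} \<in> sets (F c)"
      using stopping_timeD[OF assms, of c] by (simp add: pred_def)
    then have "{\<omega> \<in> space M. \<tau> \<omega> \<le> c} \<in> sets (F t)" using sets_F_mono[of c t] False by auto
    also have "{\<omega> \<in> space M. \<tau> \<omega> \<le> c} = {\<omega> \<in> space (F t). min (\<tau> \<omega>) t \<le> c}" using False by auto
    finally show ?thesis .
  qed
qed

lemma stopping_time_le_set: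
  assumes "stopping_time F \<tau>" "s \<le> t" shows "{\<omega>\<in>space M. \<tau> \<omega> \<le> s} \<in> sets (F t)"
  using stopping_time_le_const[OF assms] by (simp add: pred_def)

text \<open>Progressive measurability of right-continuous processes. The stopped time is rounded up
  within the grid of \<open>[0, t]\<close>, so all sampled values are known at time
  \<open>t\<close>; this grid degenerates for \<open>t = 0\<close>, which is treated
  separately.\<close>

lemma stopped_value_measurable:
  assumes X: "adapted F T X" "cadlag M T X" and \<tau>: "stopping_time F \<tau>" "\<And>\<omega>. \<omega> \<in> space M \<Longrightarrow> \<tau> \<omega> \<in> {0..T}"
    and t: "t \<in> {0..T}"
  shows "(\<lambda>\<omega>. X (min (\<tau> \<omega>) t) \<omega>) \<in> borel_measurable (F t)"
proof (cases "t = 0")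
  case True
  have "X 0 \<in> borel_measurable (F t)" using X(1) T_pos True unfolding adapted_def by auto
  then show ?thesis
  proof (rule measurable_cong[THEN iffD2, rotated])
    fix \<omega> assume "\<omega> \<in> space (F t)"
    then have "min (\<tau> \<omega>) t = 0" using \<tau>(2)[of \<omega>] True by auto
    then show "X (min (\<tau> \<omega>) t) \<omega> = X 0 \<omega>" by simp
  qed
next
  case False
  then have t0: "0 < t" using t by auto
  define \<sigma> where "\<sigma> \<omega> = min (\<tau> \<omega>) t" for \<omega>
  have [measurable]: "\<sigma> \<in> borel_measurable (F t)" unfolding \<sigma>_def by (rule stopping_time_measurable[OF \<tau>(1)])
  have \<sigma>: "0 \<le> \<sigma> \<omega>" "\<sigma> \<omega> \<le> t" if "\<omega> \<in> space M" for \<omega> using \<tau>(2)[OF that] t unfolding \<sigma>_def by auto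
  define h where "h m \<omega> = (\<Sum>i\<le>2^m. of_bool (\<lceil>\<sigma> \<omega> * 2 ^ m / t\<rceil> = int i) * X (t * real i / 2 ^ m) \<omega>)" for m :: nat and \<omega>
  have h: "h m \<omega> = X (dyadic_ceil t m (\<sigma> \<omega>)) \<omega>" if w: "\<omega> \<in> space M" for m \<omega>
  proof -
    obtain i where i: "i \<le> 2 ^ m" "\<lceil>\<sigma> \<omega> * 2 ^ m / t\<rceil> = int i" "dyadic_ceil t m (\<sigma> \<omega>) = t * real i / 2 ^ m"
      using dyadic_ceil_cell[OF t0 \<sigma>(1)[OF w] \<sigma>(2)[OF w]] by blast
    have "h m \<omega> = (\<Sum>j\<le>2^m. if j = i then X (t * real i / 2 ^ m) \<omega> else 0)"
      unfolding h_def i(2) by (rule sum.cong) auto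
    then show ?thesis using i by simp
  qed
  have hm: "h m \<in> borel_measurable (F t)" for m
    unfolding h_def
  proof (rule borel_measurable_sum)
    fix i :: nat assume i: "i \<in> {..2^m}"
    have "real i \<le> real (2 ^ m)" using i by (simp only: of_nat_le_iff) simp
    then have "t * real i / 2 ^ m \<le> t" using t0 by (simp add: field_simps)
    moreover have "0 \<le> t * real i / 2 ^ m" using t0 by simp
    ultimately have [measurable]: "X (t * real i / 2 ^ m) \<in> borel_measurable (F t)"
      using X(1) t unfolding adapted_def by (intro borel_F_mono[of _ "t * real i / 2 ^ m" t]) auto
    show "(\<lambda>x. of_bool (\<lceil>\<sigma> x * 2 ^ m / t\<rceil> = int i) * X (t * real i / 2 ^ m) x) \<in> borel_measurable (F t)"
      by measurable
  qed
  show ?thesis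
  proof (rule borel_measurable_LIMSEQ_metric[where f=h, OF hm])
    fix \<omega> assume w: "\<omega> \<in> space (F t)"
    then have w: "\<omega> \<in> space M" by simp
    have d: "dyadic_ceil t m (\<sigma> \<omega>) \<in> {\<sigma> \<omega>..T}" for m
      using dyadic_ceil_bounds(1)[OF t0, of "\<sigma> \<omega>" m] dyadic_ceil_le[OF t0 \<sigma>(2)[OF w], of m] t by auto
    show "(\<lambda>m. h m \<omega>) \<longlonglongrightarrow> X (min (\<tau> \<omega>) t) \<omega>"
      using cadlag_right_limit[OF X(2) w _ dyadic_ceil_tendsto[OF t0] d] \<sigma>[OF w] t
      unfolding h[OF w] by (auto simp: \<sigma>_def)
  qed
qed

lemma pre_sigma_restrict:
  assumes \<tau>: "stopping_time F \<tau>" and f: "f \<in> borel_measurable (pre_sigma \<tau>)"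
  shows "(\<lambda>\<omega>. if \<tau> \<omega> \<le> s then f \<omega> else (0::real)) \<in> borel_measurable (F s)"
proof (rule borel_measurableI_le)
  fix a
  have "{\<omega>\<in>space (pre_sigma \<tau>). f \<omega> \<le> a} \<in> sets (pre_sigma \<tau>)" using f by measurable
  then have 1: "{\<omega>\<in>space M. f \<omega> \<le> a \<and> \<tau> \<omega> \<le> s} \<in> sets (F s)"
    using sets_pre_sigmaD[OF \<tau>, of _ s] by (fastforce simp: space_pre_sigma)
  have 2: "space (F s) - {\<omega>\<in>space M. \<tau> \<omega> \<le> s} \<in> sets (F s)"
    by (rule sets.compl_sets[OF stopping_time_le_set[OF \<tau> order_refl]])
  have "{\<omega> \<in> space (F s). (if \<tau> \<omega> \<le> s then f \<omega> else 0) \<le> a} =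
    {\<omega>\<in>space M. f \<omega> \<le> a \<and> \<tau> \<omega> \<le> s} \<union> (if 0 \<le> a then space (F s) - {\<omega>\<in>space M. \<tau> \<omega> \<le> s} else {})"
    by auto
  then show "{\<omega> \<in> space (F s). (if \<tau> \<omega> \<le> s then f \<omega> else 0) \<le> a} \<in> sets (F s)"
    using 1 2 by auto
qed

text \<open>Where \<open>\<tau> < \<rho>\<close> the minimum is \<open>\<tau>\<close> itself, so
  what is known at \<open>\<tau>\<close> is known at the minimum. Cutting the function to zero
  elsewhere is what lets integrands be frozen at \<open>\<rho>\<close>.\<close>

lemma pre_sigma_min:
  assumes \<tau>: "stopping_time F \<tau>" and \<rho>: "stopping_time F \<rho>" and f: "f \<in> borel_measurable (pre_sigma \<tau>)"
  shows "(\<lambda>\<omega>. if \<tau> \<omega> < \<rho> \<omega> then f \<omega> else (0::real)) \<in> borel_measurable (pre_sigma (\<lambda>\<omega>. min (\<tau> \<omega>) (\<rho> \<omega>)))"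
proof (rule borel_measurableI_le)
  fix a
  have m: "stopping_time F (\<lambda>\<omega>. min (\<tau> \<omega>) (\<rho> \<omega>))" by (rule stopping_time_min[OF \<tau> \<rho>])
  have f': "{\<omega>\<in>space (pre_sigma \<tau>). f \<omega> \<le> a} \<in> sets (pre_sigma \<tau>)" using f by measurable
  have l': "{\<omega>\<in>space (pre_sigma \<tau>). \<tau> \<omega> < \<rho> \<omega>} \<in> sets (pre_sigma \<tau>)"
    using stopping_time_less[OF \<tau> \<rho>] by (simp add: pred_def)
  show "{\<omega> \<in> space (pre_sigma (\<lambda>\<omega>. min (\<tau> \<omega>) (\<rho> \<omega>))). (if \<tau> \<omega> < \<rho> \<omega> then f \<omega> else 0) \<le> a}
    \<in> sets (pre_sigma (\<lambda>\<omega>. min (\<tau> \<omega>) (\<rho> \<omega>)))"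
  proof (rule sets_pre_sigmaI[OF m])
    fix t
    let ?A = "{\<omega>\<in>{\<omega>\<in>space (pre_sigma \<tau>). f \<omega> \<le> a}. \<tau> \<omega> \<le> t}"
    let ?B = "{\<omega>\<in>{\<omega>\<in>space (pre_sigma \<tau>). \<tau> \<omega> < \<rho> \<omega>}. \<tau> \<omega> \<le> t}"
    let ?C = "{\<omega>\<in>space M. \<rho> \<omega> \<le> t}"
    have s: "?A \<in> sets (F t)" "?B \<in> sets (F t)" "?C \<in> sets (F t)"
      using sets_pre_sigmaD[OF \<tau> f', of t] sets_pre_sigmaD[OF \<tau> l', of t] stopping_time_le_set[OF \<rho> order_refl, of t] by auto
    have "{\<omega> \<in> {\<omega> \<in> space (pre_sigma (\<lambda>\<omega>. min (\<tau> \<omega>) (\<rho> \<omega>))). (if \<tau> \<omega> < \<rho> \<omega> then f \<omega> else 0) \<le> a}. min (\<tau> \<omega>) (\<rho> \<omega>) \<le> t}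
      = (?A \<inter> ?B) \<union> (if 0 \<le> a then ?C - ?B else {})"
      by (auto simp: space_pre_sigma min_def)
    then show "{\<omega> \<in> {\<omega> \<in> space (pre_sigma (\<lambda>\<omega>. min (\<tau> \<omega>) (\<rho> \<omega>))). (if \<tau> \<omega> < \<rho> \<omega> then f \<omega> else 0) \<le> a}. min (\<tau> \<omega>) (\<rho> \<omega>) \<le> t} \<in> sets (F t)"
      using s by auto
  qed
qed

lemma borel_pre_sigma_mono:
  assumes "stopping_time F \<tau>" "stopping_time F \<rho>" "\<And>\<omega>. \<omega> \<in> space M \<Longrightarrow> \<tau> \<omega> \<le> \<rho> \<omega>"
    and "f \<in> borel_measurable (pre_sigma \<tau>)"
  shows "f \<in> borel_measurable (pre_sigma \<rho>)"
  using mono_pre_sigma[OF assms(1-3)] assms(4) by (auto simp: measurable_def space_pre_sigma)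

lemma borel_pre_sigma_M:
  assumes "stopping_time F \<tau>" "\<And>\<omega>. \<omega> \<in> space M \<Longrightarrow> \<tau> \<omega> \<in> {0..T}" and f: "f \<in> borel_measurable (pre_sigma \<tau>)"
  shows "(f :: 'a \<Rightarrow> real) \<in> borel_measurable M"
proof -
  have "(\<lambda>\<omega>. if \<tau> \<omega> \<le> T then f \<omega> else (0::real)) \<in> borel_measurable M"
    using borel_F_M[OF pre_sigma_restrict[OF assms(1) f, of T]] T_pos by auto
  then show ?thesis by (rule measurable_cong[THEN iffD2, rotated]) (use assms(2) in auto)
qed


section \<open>Optional stopping for cadlag martingales\<close>

lemma dyadic_in: "i \<le> 2 ^ m \<Longrightarrow> T * real i / 2 ^ m \<in> {0..T}"
proof -
  assume "i \<le> 2 ^ m"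
  then have "real i \<le> real (2 ^ m)" by (simp only: of_nat_le_iff)
  then show ?thesis using T_pos by (simp add: field_simps)
qed

text \<open>The identity is exact for the rounded times, which take finitely many values. Passing to
  the limit needs uniform integrability of the sampled values, obtained by comparing their tails
  with those of \<open>X T\<close>. Testing against a bounded \<open>f\<close> known at
  \<open>\<tau>\<close> stands in for a conditional expectation given
  \<open>pre_sigma \<tau>\<close>.\<close>

theorem optional_stopping:
  assumes X: "martingale M F T X" "cadlag M T X"
    and \<tau>: "stopping_time F \<tau>" "\<And>\<omega>. \<omega> \<in> space M \<Longrightarrow> \<tau> \<omega> \<in> {0..T}"
    and f: "f \<in> borel_measurable (pre_sigma \<tau>)" "\<And>\<omega>. \<omega> \<in> space M \<Longrightarrow> \<bar>f \<omega>\<bar> \<le> c"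
  shows "integrable M (\<lambda>\<omega>. X (\<tau> \<omega>) \<omega>)"
    "(\<integral>\<omega>. f \<omega> * X (\<tau> \<omega>) \<omega> \<partial>M) = (\<integral>\<omega>. f \<omega> * X T \<omega> \<partial>M)"
proof -
  define t where "t m i = T * real i / 2 ^ m" for m i :: nat
  define cell where "cell m i \<omega> \<longleftrightarrow> \<lceil>\<tau> \<omega> * 2 ^ m / T\<rceil> = int i" for m i :: nat and \<omega>
  define \<tau>' where "\<tau>' m \<omega> = dyadic_ceil T m (\<tau> \<omega>)" for m \<omega>
  have t_in: "t m i \<in> {0..T}" if "i \<le> 2 ^ m" for m i unfolding t_def by (rule dyadic_in[OF that])
  have XT: "integrable M (X T)" using X(1) T_pos unfolding martingale_def by auto
  have Xt: "X (t m i) \<in> borel_measurable (F (t m i))" if "i \<le> 2 ^ m" for m i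
    using X(1) t_in[OF that] unfolding martingale_def adapted_def by auto
  have XtM: "integrable M (X (t m i))" if "i \<le> 2 ^ m" for m i
    using X(1) t_in[OF that] unfolding martingale_def by auto
  have pre: "(\<lambda>\<omega>. if cell m i \<omega> then g \<omega> else 0) \<in> borel_measurable (F (t m i))"
    if g: "g \<in> borel_measurable (pre_sigma \<tau>)" and "i \<le> 2 ^ m" for g :: "'a \<Rightarrow> real" and m i
  proof -
    have "cell m i \<omega> \<longleftrightarrow> \<tau> \<omega> \<le> t m i \<and> \<not> \<tau> \<omega> \<le> T * (real i - 1) / 2 ^ m" for \<omega>
    proof -
      have "cell m i \<omega> \<longleftrightarrow> real i - 1 < \<tau> \<omega> * 2 ^ m / T \<and> \<tau> \<omega> * 2 ^ m / T \<le> real i"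
        unfolding cell_def by (auto simp: ceiling_eq_iff)
      also have "\<dots> \<longleftrightarrow> \<tau> \<omega> \<le> t m i \<and> \<not> \<tau> \<omega> \<le> T * (real i - 1) / 2 ^ m"
        using T_pos unfolding t_def by (auto simp: field_simps)
      finally show ?thesis .
    qed
    then have eq: "(\<lambda>\<omega>. if cell m i \<omega> then g \<omega> else 0) =
       (\<lambda>\<omega>. if \<tau> \<omega> \<le> T * (real i - 1) / 2 ^ m then 0 else if \<tau> \<omega> \<le> t m i then g \<omega> else 0)" by auto
    have le: "T * (real i - 1) / 2 ^ m \<le> t m i" using T_pos unfolding t_def by (simp add: field_simps)
    show ?thesis unfolding eq
      by (intro measurable_If measurable_const pre_sigma_restrict[OF \<tau>(1) g])
        (use stopping_time_le_set[OF \<tau>(1) le] in auto)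
  qed
  have cells: "\<exists>i\<le>2^m. cell m i \<omega> \<and> \<tau>' m \<omega> = t m i \<and> (\<forall>j. cell m j \<omega> \<longleftrightarrow> j = i)" if w: "\<omega> \<in> space M" for \<omega> m
  proof -
    have b: "0 \<le> \<tau> \<omega>" "\<tau> \<omega> \<le> T" using \<tau>(2)[OF w] by auto
    obtain i where "i \<le> 2 ^ m" "\<lceil>\<tau> \<omega> * 2 ^ m / T\<rceil> = int i" "dyadic_ceil T m (\<tau> \<omega>) = T * real i / 2 ^ m"
      using dyadic_ceil_cell[OF T_pos b] by blast
    then show ?thesis unfolding cell_def \<tau>'_def t_def by auto
  qed
  have sumc: "(\<Sum>i\<le>2^m. (if cell m i \<omega> then g \<omega> else 0) * h (t m i)) = g \<omega> * h (\<tau>' m \<omega>)"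
    if w: "\<omega> \<in> space M" for \<omega> m and g :: "'a \<Rightarrow> real" and h :: "real \<Rightarrow> real"
  proof -
    obtain i where i: "i \<le> 2^m" "\<tau>' m \<omega> = t m i" "\<And>j. cell m j \<omega> \<longleftrightarrow> j = i" using cells[OF w, of m] by blast
    have "(\<Sum>j\<le>2^m. (if cell m j \<omega> then g \<omega> else 0) * h (t m j)) = (\<Sum>j\<le>2^m. if j = i then g \<omega> * h (t m i) else 0)"
      by (rule sum.cong) (auto simp: i(3))
    then show ?thesis using i(1,2) by simp
  qed
  \<comment> \<open>The weight only has to be measurable, cell by cell, at the right end of the
    cell. This is weaker than being known at \<open>\<tau>\<close> and admits weights built from the
    sampled value itself.\<close>
  have sums: "integrable M (\<lambda>\<omega>. g \<omega> * X (\<tau>' m \<omega>) \<omega>) \<and>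
     (\<integral>\<omega>. g \<omega> * X (\<tau>' m \<omega>) \<omega> \<partial>M) = (\<integral>\<omega>. g \<omega> * X T \<omega> \<partial>M)"
    if g: "\<And>i. i \<le> 2^m \<Longrightarrow> (\<lambda>\<omega>. if cell m i \<omega> then g \<omega> else 0) \<in> borel_measurable (F (t m i))"
      and c: "\<And>\<omega>. \<omega> \<in> space M \<Longrightarrow> \<bar>g \<omega>\<bar> \<le> c" for g c m
  proof -
    have c': "\<bar>if cell m i \<omega> then g \<omega> else 0\<bar> \<le> \<bar>c\<bar>" if "\<omega> \<in> space M" for \<omega> i using c[OF that] by auto
    have mi: "integrable M (\<lambda>\<omega>. (if cell m i \<omega> then g \<omega> else 0) * X (t m i) \<omega>)"
      "integrable M (\<lambda>\<omega>. (if cell m i \<omega> then g \<omega> else 0) * X T \<omega>)"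
      "(\<integral>\<omega>. (if cell m i \<omega> then g \<omega> else 0) * X T \<omega> \<partial>M) = (\<integral>\<omega>. (if cell m i \<omega> then g \<omega> else 0) * X (t m i) \<omega> \<partial>M)"
      if "i \<in> {..2^m}" for i
      using martingale_integral[OF X(1) t_in _ g c', of i "t m i"] martingale_integral[OF X(1) t_in _ g c', of i T]
        that t_in[of i m] by auto
    have "integrable M (\<lambda>\<omega>. \<Sum>i\<le>2^m. (if cell m i \<omega> then g \<omega> else 0) * X (t m i) \<omega>)"
      by (intro Bochner_Integration.integrable_sum mi)
    then have int: "integrable M (\<lambda>\<omega>. g \<omega> * X (\<tau>' m \<omega>) \<omega>)"
      by (rule Bochner_Integration.integrable_cong[OF refl, THEN iffD1, rotated]) (rule sumc)
    have "(\<integral>\<omega>. g \<omega> * X (\<tau>' m \<omega>) \<omega> \<partial>M) = (\<integral>\<omega>. (\<Sum>i\<le>2^m. (if cell m i \<omega> then g \<omega> else 0) * X (t m i) \<omega>) \<partial>M)"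
      by (intro Bochner_Integration.integral_cong refl sumc[symmetric])
    also have "\<dots> = (\<Sum>i\<le>2^m. \<integral>\<omega>. (if cell m i \<omega> then g \<omega> else 0) * X T \<omega> \<partial>M)"
      using mi by (subst Bochner_Integration.integral_sum) auto
    also have "\<dots> = (\<integral>\<omega>. (\<Sum>i\<le>2^m. (if cell m i \<omega> then g \<omega> else 0) * X T \<omega>) \<partial>M)"
      using mi by (subst Bochner_Integration.integral_sum) auto
    also have "\<dots> = (\<integral>\<omega>. g \<omega> * X T \<omega> \<partial>M)"
    proof (rule Bochner_Integration.integral_cong[OF refl])
      fix \<omega> assume "\<omega> \<in> space M"
      from sumc[OF this, of m g "\<lambda>_. X T \<omega>"]
      show "(\<Sum>i\<le>2^m. (if cell m i \<omega> then g \<omega> else 0) * X T \<omega>) = g \<omega> * X T \<omega>" .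
    qed
    finally show ?thesis using int by simp
  qed
  define Y where "Y m \<omega> = X (\<tau>' m \<omega>) \<omega>" for m \<omega>
  have one: "(\<lambda>\<omega>. if cell m i \<omega> then 1 else (0::real)) \<in> borel_measurable (F (t m i))" if "i \<le> 2^m" for m i
    using pre[of "\<lambda>_. 1" i m, OF _ that] by simp
  have Yi: "integrable M (Y m)" for m
    using sums[of m "\<lambda>_. 1" 1] one unfolding Y_def by auto
  have [measurable]: "Y m \<in> borel_measurable M" for m using Yi by auto
  have XTm[measurable]: "X T \<in> borel_measurable M" using XT by auto
  have Ylim: "(\<lambda>m. Y m \<omega>) \<longlonglongrightarrow> X (\<tau> \<omega>) \<omega>" if w: "\<omega> \<in> space M" for \<omega>
    unfolding Y_def \<tau>'_def
  proof (rule cadlag_right_limit[OF X(2) w \<tau>(2)[OF w] dyadic_ceil_tendsto[OF T_pos]])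
    show "dyadic_ceil T m (\<tau> \<omega>) \<in> {\<tau> \<omega>..T}" for m
      using dyadic_ceil_bounds(1)[OF T_pos, of "\<tau> \<omega>" m] dyadic_ceil_le[OF T_pos, of "\<tau> \<omega>" m] \<tau>(2)[OF w] by auto
  qed
  \<comment> \<open>Testing with the sign of \<open>Y m\<close> on its own tail event bounds that
    tail by the part of \<open>\<bar>X T \<omega>\<bar>\<close> on the same event.\<close>
  have tail: "(\<integral>\<omega>. \<bar>Y m \<omega>\<bar> * of_bool (\<bar>Y m \<omega>\<bar> > a) \<partial>M) \<le> (\<integral>\<omega>. \<bar>X T \<omega>\<bar> * of_bool (\<bar>Y m \<omega>\<bar> > a) \<partial>M)" for m a
  proof -
    define g where "g \<omega> = sgn (Y m \<omega>) * of_bool (\<bar>Y m \<omega>\<bar> > a)" for \<omega>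
    have gb: "\<bar>g \<omega>\<bar> \<le> 1" for \<omega> unfolding g_def by (auto simp: abs_mult abs_sgn_eq)
    have "(\<lambda>\<omega>. if cell m i \<omega> then g \<omega> else 0) \<in> borel_measurable (F (t m i))" if i: "i \<le> 2^m" for i
    proof -
      note [measurable] = one[OF i] Xt[OF i]
      have "(\<lambda>\<omega>. (if cell m i \<omega> then 1 else 0) * (sgn (X (t m i) \<omega>) * of_bool (\<bar>X (t m i) \<omega>\<bar> > a))) \<in> borel_measurable (F (t m i))"
        by measurable
      moreover have "(if cell m i \<omega> then g \<omega> else 0) = (if cell m i \<omega> then 1 else 0) * (sgn (X (t m i) \<omega>) * of_bool (\<bar>X (t m i) \<omega>\<bar> > a))"
        if "\<omega> \<in> space M" for \<omega>
        using cells[OF that, of m] unfolding g_def Y_def by auto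
      ultimately show ?thesis by (subst measurable_cong) auto
    qed
    from sums[OF this gb]
    have "(\<integral>\<omega>. g \<omega> * Y m \<omega> \<partial>M) = (\<integral>\<omega>. g \<omega> * X T \<omega> \<partial>M)" unfolding Y_def by blast
    also have "\<dots> \<le> (\<integral>\<omega>. \<bar>X T \<omega>\<bar> * of_bool (\<bar>Y m \<omega>\<bar> > a) \<partial>M)"
    proof (rule integral_mono)
      show "integrable M (\<lambda>\<omega>. g \<omega> * X T \<omega>)"
        by (rule Bochner_Integration.integrable_bound[OF XT]) (auto simp: g_def abs_mult abs_sgn_eq)
      show "integrable M (\<lambda>\<omega>. \<bar>X T \<omega>\<bar> * of_bool (\<bar>Y m \<omega>\<bar> > a))"
        by (rule Bochner_Integration.integrable_bound[OF XT]) auto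
      show "g \<omega> * X T \<omega> \<le> \<bar>X T \<omega>\<bar> * of_bool (\<bar>Y m \<omega>\<bar> > a)" for \<omega>
        unfolding g_def by (auto simp: sgn_if)
    qed
    also have "(\<integral>\<omega>. g \<omega> * Y m \<omega> \<partial>M) = (\<integral>\<omega>. \<bar>Y m \<omega>\<bar> * of_bool (\<bar>Y m \<omega>\<bar> > a) \<partial>M)"
      by (rule Bochner_Integration.integral_cong) (auto simp: g_def sgn_if)
    finally show ?thesis .
  qed
  have UI: "\<exists>a>0. \<forall>m. (\<integral>\<omega>. \<bar>Y m \<omega>\<bar> * of_bool (\<bar>Y m \<omega>\<bar> > a) \<partial>M) \<le> e" if e: "e > 0" for e
  proof -
    define I where "I = (\<integral>\<omega>. \<bar>X T \<omega>\<bar> \<partial>M)"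
    have I0: "I \<ge> 0" unfolding I_def by simp
    have "(\<lambda>b. \<integral>\<omega>. \<bar>X T \<omega>\<bar> * of_bool (\<bar>X T \<omega>\<bar> > real b) \<partial>M) \<longlonglongrightarrow> (\<integral>\<omega>. 0 \<partial>M)"
    proof (rule integral_dominated_convergence[where w="\<lambda>\<omega>. \<bar>X T \<omega>\<bar>"])
      show "AE x in M. (\<lambda>b. \<bar>X T x\<bar> * of_bool (\<bar>X T x\<bar> > real b)) \<longlonglongrightarrow> 0"
      proof (rule AE_I2)
        fix x
        obtain n where "\<bar>X T x\<bar> \<le> real n" using real_arch_simple by blast
        then have "\<forall>b\<ge>n. \<bar>X T x\<bar> * of_bool (\<bar>X T x\<bar> > real b) = 0" by auto
        then show "(\<lambda>b. \<bar>X T x\<bar> * of_bool (\<bar>X T x\<bar> > real b)) \<longlonglongrightarrow> 0"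
          by (intro tendsto_eventually) (auto simp: eventually_sequentially)
      qed
    qed (use XT in auto)
    then have "(\<lambda>b. \<integral>\<omega>. \<bar>X T \<omega>\<bar> * of_bool (\<bar>X T \<omega>\<bar> > real b) \<partial>M) \<longlonglongrightarrow> 0" by simp
    from order_tendstoD(2)[OF this, of "e/2"] obtain b :: nat where
      b: "(\<integral>\<omega>. \<bar>X T \<omega>\<bar> * of_bool (\<bar>X T \<omega>\<bar> > real b) \<partial>M) < e/2"
      using e by (auto simp: eventually_sequentially)
    \<comment> \<open>On the event \<open>\<bar>Y m \<omega>\<bar> > a\<close>, the part of
      \<open>\<bar>X T \<omega>\<bar>\<close> below \<open>b\<close> is at most
      \<open>b / a * \<bar>Y m \<omega>\<bar>\<close>, whose mean there is at most
      \<open>b / a * I\<close>; this \<open>a\<close> makes it at most \<open>e / 2\<close>. The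
      summand \<open>1\<close> keeps \<open>a\<close> positive.\<close>
    define a where "a = 2 * (real b * I + 1) / e"
    have a0: "a > 0" unfolding a_def using e I0 by (intro divide_pos_pos mult_pos_pos add_nonneg_pos) auto
    have "(\<integral>\<omega>. \<bar>Y m \<omega>\<bar> * of_bool (\<bar>Y m \<omega>\<bar> > a) \<partial>M) \<le> e" for m
    proof -
      have iT: "integrable M (\<lambda>\<omega>. \<bar>X T \<omega>\<bar> * of_bool (\<bar>Y m \<omega>\<bar> > a))"
        by (rule Bochner_Integration.integrable_bound[OF XT]) auto
      have iT': "integrable M (\<lambda>\<omega>. \<bar>X T \<omega>\<bar> * of_bool (\<bar>X T \<omega>\<bar> > real b))"
        by (rule Bochner_Integration.integrable_bound[OF XT]) auto
      have iY: "integrable M (\<lambda>\<omega>. \<bar>Y m \<omega>\<bar> * of_bool (\<bar>Y m \<omega>\<bar> > a))"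
        by (rule Bochner_Integration.integrable_bound[OF Yi[of m]]) auto
      let ?y = "\<integral>\<omega>. \<bar>Y m \<omega>\<bar> * of_bool (\<bar>Y m \<omega>\<bar> > a) \<partial>M"
      have "(\<integral>\<omega>. \<bar>X T \<omega>\<bar> * of_bool (\<bar>Y m \<omega>\<bar> > a) \<partial>M) \<le> I"
        unfolding I_def by (rule integral_mono) (use iT XT in auto)
      then have yI: "?y \<le> I" using tail[of m a] by linarith
      have "?y \<le> (\<integral>\<omega>. \<bar>X T \<omega>\<bar> * of_bool (\<bar>Y m \<omega>\<bar> > a) \<partial>M)" by (rule tail)
      also have "\<dots> \<le> (\<integral>\<omega>. \<bar>X T \<omega>\<bar> * of_bool (\<bar>X T \<omega>\<bar> > real b) + real b / a * (\<bar>Y m \<omega>\<bar> * of_bool (\<bar>Y m \<omega>\<bar> > a)) \<partial>M)"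
      proof (rule integral_mono[OF iT])
        show "integrable M (\<lambda>\<omega>. \<bar>X T \<omega>\<bar> * of_bool (\<bar>X T \<omega>\<bar> > real b) + real b / a * (\<bar>Y m \<omega>\<bar> * of_bool (\<bar>Y m \<omega>\<bar> > a)))"
          by (intro Bochner_Integration.integrable_add iT' integrable_mult_right iY)
        fix \<omega>
        have "real b \<le> real b / a * \<bar>Y m \<omega>\<bar>" if "\<bar>Y m \<omega>\<bar> > a"
        proof -
          have "real b * a \<le> real b * \<bar>Y m \<omega>\<bar>" using that by (intro mult_left_mono) auto
          then show ?thesis using a0 by (simp add: field_simps)
        qed
        moreover have "0 \<le> real b / a * \<bar>Y m \<omega>\<bar>" using a0 by simp
        ultimately show "\<bar>X T \<omega>\<bar> * of_bool (\<bar>Y m \<omega>\<bar> > a) \<le> \<bar>X T \<omega>\<bar> * of_bool (\<bar>X T \<omega>\<bar> > real b) + real b / a * (\<bar>Y m \<omega>\<bar> * of_bool (\<bar>Y m \<omega>\<bar> > a))"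
          by (auto simp: of_bool_def)
      qed
      also have "\<dots> = (\<integral>\<omega>. \<bar>X T \<omega>\<bar> * of_bool (\<bar>X T \<omega>\<bar> > real b) \<partial>M) + real b / a * ?y"
        using iT' iY by simp
      also have "\<dots> \<le> e/2 + real b / a * I"
        using b yI a0 by (intro add_mono mult_left_mono) auto
      also have "real b / a * I \<le> e / 2"
      proof -
        have "real b * I \<le> e / 2 * a" unfolding a_def using e by simp
        then show ?thesis using a0 by (simp add: field_simps)
      qed
      finally show ?thesis by simp
    qed
    then show ?thesis using a0 by blast
  qed
  note U = UI_limit[OF Yi Ylim UI]
  show Xi: "integrable M (\<lambda>\<omega>. X (\<tau> \<omega>) \<omega>)" by (rule U(1))
  have fm[measurable]: "f \<in> borel_measurable M" by (rule borel_pre_sigma_M[OF \<tau> f(1)])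
  have [measurable]: "(\<lambda>\<omega>. X (\<tau> \<omega>) \<omega>) \<in> borel_measurable M" using Xi by auto
  have fY: "(\<integral>\<omega>. f \<omega> * Y m \<omega> \<partial>M) = (\<integral>\<omega>. f \<omega> * X T \<omega> \<partial>M)" "integrable M (\<lambda>\<omega>. f \<omega> * Y m \<omega>)" for m
    using sums[OF pre[OF f(1)] f(2), of m] unfolding Y_def by auto
  have fX: "integrable M (\<lambda>\<omega>. f \<omega> * X (\<tau> \<omega>) \<omega>)"
  proof (rule Bochner_Integration.integrable_bound[OF integrable_mult_right[OF Xi, of c]])
    show "AE \<omega> in M. norm (f \<omega> * X (\<tau> \<omega>) \<omega>) \<le> norm (c * X (\<tau> \<omega>) \<omega>)"
    proof (rule AE_I2)
      fix \<omega> assume "\<omega> \<in> space M"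
      then have "\<bar>f \<omega>\<bar> \<le> \<bar>c\<bar>" using f(2)[of \<omega>] by linarith
      then show "norm (f \<omega> * X (\<tau> \<omega>) \<omega>) \<le> norm (c * X (\<tau> \<omega>) \<omega>)" by (simp add: abs_mult mult_right_mono)
    qed
  qed auto
  have bnd: "\<bar>(\<integral>\<omega>. f \<omega> * X T \<omega> \<partial>M) - (\<integral>\<omega>. f \<omega> * X (\<tau> \<omega>) \<omega> \<partial>M)\<bar> \<le> c * (\<integral>\<omega>. \<bar>Y m \<omega> - X (\<tau> \<omega>) \<omega>\<bar> \<partial>M)" for m
  proof -
    have "(\<integral>\<omega>. f \<omega> * X T \<omega> \<partial>M) - (\<integral>\<omega>. f \<omega> * X (\<tau> \<omega>) \<omega> \<partial>M) = (\<integral>\<omega>. f \<omega> * (Y m \<omega> - X (\<tau> \<omega>) \<omega>) \<partial>M)"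
      unfolding fY(1)[of m, symmetric] using fY(2)[of m] fX by (simp add: right_diff_distrib)
    also have "\<bar>\<dots>\<bar> \<le> (\<integral>\<omega>. \<bar>f \<omega> * (Y m \<omega> - X (\<tau> \<omega>) \<omega>)\<bar> \<partial>M)" by (rule integral_abs_bound)
    also have "\<dots> \<le> (\<integral>\<omega>. c * \<bar>Y m \<omega> - X (\<tau> \<omega>) \<omega>\<bar> \<partial>M)"
    proof (rule integral_mono)
      show "integrable M (\<lambda>\<omega>. \<bar>f \<omega> * (Y m \<omega> - X (\<tau> \<omega>) \<omega>)\<bar>)"
        using Bochner_Integration.integrable_diff[OF fY(2)[of m] fX] by (simp add: right_diff_distrib)
      show "\<bar>f \<omega> * (Y m \<omega> - X (\<tau> \<omega>) \<omega>)\<bar> \<le> c * \<bar>Y m \<omega> - X (\<tau> \<omega>) \<omega>\<bar>" if "\<omega> \<in> space M" for \<omega>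
        using f(2)[OF that] by (simp add: abs_mult mult_right_mono)
    qed (use Yi Xi in auto)
    finally show ?thesis by simp
  qed
  have "(\<lambda>m. c * (\<integral>\<omega>. \<bar>Y m \<omega> - X (\<tau> \<omega>) \<omega>\<bar> \<partial>M)) \<longlonglongrightarrow> c * 0"
    by (intro tendsto_mult tendsto_const U(2))
  then have "\<bar>(\<integral>\<omega>. f \<omega> * X T \<omega> \<partial>M) - (\<integral>\<omega>. f \<omega> * X (\<tau> \<omega>) \<omega> \<partial>M)\<bar> \<le> 0"
    by (intro tendsto_lowerbound[where F=sequentially and f="\<lambda>m. c * (\<integral>\<omega>. \<bar>Y m \<omega> - X (\<tau> \<omega>) \<omega>\<bar> \<partial>M)"])
      (use bnd in auto)
  then show "(\<integral>\<omega>. f \<omega> * X (\<tau> \<omega>) \<omega> \<partial>M) = (\<integral>\<omega>. f \<omega> * X T \<omega> \<partial>M)" by simp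
qed

text \<open>On \<open>{\<tau> \<le> s}\<close> the stopped values at \<open>s\<close> and
  \<open>t\<close> coincide. On the part of \<open>A\<close> where \<open>s < \<tau>\<close>, the
  indicator is known at the minimum of \<open>\<tau>\<close> and \<open>s\<close>, so optional
  stopping at both times leads to the same integral against \<open>X T\<close>.\<close>

theorem stopped_martingale:
  assumes X: "martingale M F T X" "cadlag M T X"
    and \<tau>: "stopping_time F \<tau>" "\<And>\<omega>. \<omega> \<in> space M \<Longrightarrow> \<tau> \<omega> \<in> {0..T}"
  shows "martingale M F T (\<lambda>t \<omega>. X (min (\<tau> \<omega>) t) \<omega>)"
proof (rule martingaleI)
  have aX: "adapted F T X" using X(1) unfolding martingale_def by auto
  show "adapted F T (\<lambda>t \<omega>. X (min (\<tau> \<omega>) t) \<omega>)"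
    unfolding adapted_def using stopped_value_measurable[OF aX X(2) \<tau>] by blast
  have st: "stopping_time F (\<lambda>\<omega>. min (\<tau> \<omega>) t)" for t
    by (rule stopping_time_min[OF \<tau>(1) stopping_time_const])
  have v: "min (\<tau> \<omega>) t \<in> {0..T}" if "t \<in> {0..T}" "\<omega> \<in> space M" for t \<omega> using \<tau>(2)[of \<omega>] that by auto
  show i: "integrable M (\<lambda>\<omega>. X (min (\<tau> \<omega>) t) \<omega>)" if "t \<in> {0..T}" for t
    by (rule optional_stopping(1)[OF X st v[OF that], of "\<lambda>_. 0" 0]) auto
  fix s t A assume s: "s \<in> {0..T}" and t: "t \<in> {s..T}" and A: "A \<in> sets (F s)"
  have t': "t \<in> {0..T}" using s t by auto
  have AM[measurable]: "A \<in> sets M" using A F_sub[OF s] by auto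
  have "indicator A \<in> borel_measurable (pre_sigma (\<lambda>_. s))"
  proof (rule borel_measurable_indicator, rule sets_pre_sigmaI[OF stopping_time_const])
    fix u show "{\<omega> \<in> A. s \<le> u} \<in> sets (F u)"
    proof (cases "s \<le> u")
      case True
      then show ?thesis using A sets_F_mono[OF True] by auto
    qed simp
  qed
  from pre_sigma_min[OF stopping_time_const \<tau>(1) this]
  have g: "(\<lambda>\<omega>. if s < \<tau> \<omega> then indicator A \<omega> else 0 :: real) \<in> borel_measurable (pre_sigma (\<lambda>\<omega>. min (\<tau> \<omega>) s))"
    by (simp add: min.commute)
  define g where "g \<omega> = (if s < \<tau> \<omega> then indicator A \<omega> else 0 :: real)" for \<omega>
  have gs: "g \<in> borel_measurable (pre_sigma (\<lambda>\<omega>. min (\<tau> \<omega>) s))" using g unfolding g_def .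
  have gt: "g \<in> borel_measurable (pre_sigma (\<lambda>\<omega>. min (\<tau> \<omega>) t))"
    by (rule borel_pre_sigma_mono[OF st st _ gs]) (use t in auto)
  have gb: "\<bar>g \<omega>\<bar> \<le> 1" for \<omega> unfolding g_def by (auto simp: indicator_def)
  have e: "(\<integral>\<omega>. g \<omega> * X (min (\<tau> \<omega>) s) \<omega> \<partial>M) = (\<integral>\<omega>. g \<omega> * X (min (\<tau> \<omega>) t) \<omega> \<partial>M)"
    using optional_stopping(2)[OF X st v[OF s] gs gb] optional_stopping(2)[OF X st v[OF t'] gt gb] by simp
  have [measurable]: "g \<in> borel_measurable M" by (rule borel_pre_sigma_M[OF st v[OF s] gs])
  have ig: "integrable M (\<lambda>\<omega>. g \<omega> * X (min (\<tau> \<omega>) u) \<omega>)" if "u \<in> {0..T}" for u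
    by (rule Bochner_Integration.integrable_bound[OF i[OF that]])
      (use gb i[OF that] in \<open>auto simp: abs_mult intro!: mult_left_le_one_le\<close>)
  have iA: "integrable M (\<lambda>\<omega>. indicator A \<omega> * X (min (\<tau> \<omega>) u) \<omega>)" if "u \<in> {0..T}" for u
    using integrable_mult_indicator[OF AM i[OF that]] by simp
  have "(\<integral>\<omega>. indicator A \<omega> * X (min (\<tau> \<omega>) t) \<omega> \<partial>M) - (\<integral>\<omega>. g \<omega> * X (min (\<tau> \<omega>) t) \<omega> \<partial>M) =
     (\<integral>\<omega>. indicator A \<omega> * X (min (\<tau> \<omega>) t) \<omega> - g \<omega> * X (min (\<tau> \<omega>) t) \<omega> \<partial>M)"
    using ig[OF t'] iA[OF t'] by simp
  also have "\<dots> = (\<integral>\<omega>. indicator A \<omega> * X (min (\<tau> \<omega>) s) \<omega> - g \<omega> * X (min (\<tau> \<omega>) s) \<omega> \<partial>M)"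
    by (rule Bochner_Integration.integral_cong) (use t in \<open>auto simp: g_def min_def\<close>)
  also have "\<dots> = (\<integral>\<omega>. indicator A \<omega> * X (min (\<tau> \<omega>) s) \<omega> \<partial>M) - (\<integral>\<omega>. g \<omega> * X (min (\<tau> \<omega>) s) \<omega> \<partial>M)"
    using ig[OF s] iA[OF s] by simp
  finally show "(\<integral>\<omega>. indicator A \<omega> * X (min (\<tau> \<omega>) t) \<omega> \<partial>M) = (\<integral>\<omega>. indicator A \<omega> * X (min (\<tau> \<omega>) s) \<omega> \<partial>M)"
    using e by simp
qed

text \<open>Capping at \<open>T\<close> identifies the values \<open>T\<close> and
  \<open>\<infinity>\<close>, which no path stopped on \<open>[0, T]\<close> can tell apart. Results
  on real-valued stopping times then apply, while the extended time keeps the event of never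
  stopping.\<close>

definition ext_real :: "('a \<Rightarrow> ereal) \<Rightarrow> 'a \<Rightarrow> real" where
  "ext_real \<sigma> \<omega> = real_of_ereal (min (ereal T) (\<sigma> \<omega>))"

lemma ext_real_cases:
  assumes "ext_stopping_time M F T \<sigma>" "\<omega> \<in> space M"
  obtains r where "r \<in> {0..T}" "\<sigma> \<omega> = ereal r" "ext_real \<sigma> \<omega> = r"
  | "\<sigma> \<omega> = \<infinity>" "ext_real \<sigma> \<omega> = T"
  using assms unfolding ext_stopping_time_def ext_real_def by (fastforce simp: min_def)

lemma ext_real_range: "ext_stopping_time M F T \<sigma> \<Longrightarrow> \<omega> \<in> space M \<Longrightarrow> ext_real \<sigma> \<omega> \<in> {0..T}"
  by (erule ext_real_cases) (use T_pos in auto)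

lemma ext_real_stopping_time:
  assumes "ext_stopping_time M F T \<sigma>" shows "stopping_time F (ext_real \<sigma>)"
proof (rule stopping_timeI)
  fix t
  consider "t < 0" | "T \<le> t" | "0 \<le> t" "t < T" by linarith
  then have "{\<omega>\<in>space M. ext_real \<sigma> \<omega> \<le> t} \<in> sets (F t)"
  proof cases
    case 1
    then have "{\<omega>\<in>space M. ext_real \<sigma> \<omega> \<le> t} = {}" using ext_real_range[OF assms] by fastforce
    then show ?thesis by (metis sets.empty_sets)
  next
    case 2
    then have "{\<omega>\<in>space M. ext_real \<sigma> \<omega> \<le> t} = space (F t)" using ext_real_range[OF assms] by fastforce
    then show ?thesis by (metis sets.top)
  next
    case 3
    then have "{\<omega>\<in>space M. \<sigma> \<omega> \<le> ereal t} \<in> sets (F t)" using assms unfolding ext_stopping_time_def by auto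
    also have "{\<omega>\<in>space M. \<sigma> \<omega> \<le> ereal t} = {\<omega>\<in>space M. ext_real \<sigma> \<omega> \<le> t}"
    proof (intro Collect_cong conj_cong refl)
      fix \<omega> assume "\<omega> \<in> space M"
      with assms show "(\<sigma> \<omega> \<le> ereal t) = (ext_real \<sigma> \<omega> \<le> t)"
        by (rule ext_real_cases) (use 3 in auto)
    qed
    finally show ?thesis .
  qed
  then show "Measurable.pred (F t) (\<lambda>\<omega>. ext_real \<sigma> \<omega> \<le> t)" by (simp add: pred_def)
qed

lemma stopped_eq:
  assumes "ext_stopping_time M F T \<sigma>" "\<omega> \<in> space M" "t \<in> {0..T}"
  shows "stopped X \<sigma> t \<omega> = X (min (ext_real \<sigma> \<omega>) t) \<omega>"
  using assms(1,2) by (rule ext_real_cases) (use assms(3) in \<open>auto simp: stopped_def min_def\<close>)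

text \<open>By right-continuity of the filtration it suffices to control the events \<open>\<sigma> < t\<close>.\<close>

lemma ext_stopping_timeI:
  assumes v: "\<And>\<omega>. \<omega> \<in> space M \<Longrightarrow> \<sigma> \<omega> \<in> ereal ` {0..T} \<union> {\<infinity>}"
    and l: "\<And>t. t \<in> {0<..T} \<Longrightarrow> {\<omega>\<in>space M. \<sigma> \<omega> < ereal t} \<in> sets (F t)"
    and e: "{\<omega>\<in>space M. \<sigma> \<omega> \<noteq> \<infinity>} \<in> sets (F T)"
  shows "ext_stopping_time M F T \<sigma>"
  unfolding ext_stopping_time_def
proof (intro conjI ballI v)
  fix t assume t: "t \<in> {0..T}"
  show "{\<omega>\<in>space M. \<sigma> \<omega> \<le> ereal t} \<in> sets (F t)"
  proof (cases "t = T")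
    case True
    have "{\<omega>\<in>space M. \<sigma> \<omega> \<le> ereal t} = {\<omega>\<in>space M. \<sigma> \<omega> \<noteq> \<infinity>}" using v True by fastforce
    then show ?thesis using e True by simp
  next
    case False
    have "{\<omega>\<in>space M. \<sigma> \<omega> \<le> ereal t} \<in> sets (F r)" if r: "r \<in> {t<..T}" for r
    proof -
      define s where "s n = t + (r - t) / real (Suc n)" for n
      have s: "s n \<in> {t<..r}" for n
      proof -
        have "(r - t) / real (Suc n) \<le> (r - t) / 1" using r by (intro divide_left_mono) auto
        then show ?thesis using r by (auto simp: s_def)
      qed
      have sl: "s \<longlonglongrightarrow> t"
        unfolding s_def using tendsto_add[OF tendsto_const lim_const_over_n, of t "r - t"] LIMSEQ_Suc by force
      have "{\<omega>\<in>space M. \<sigma> \<omega> \<le> ereal t} = (\<Inter>n. {\<omega>\<in>space M. \<sigma> \<omega> < ereal (s n)})"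
      proof (intro equalityI subsetI)
        fix \<omega> assume "\<omega> \<in> {\<omega>\<in>space M. \<sigma> \<omega> \<le> ereal t}"
        then show "\<omega> \<in> (\<Inter>n. {\<omega>\<in>space M. \<sigma> \<omega> < ereal (s n)})" using s by (auto intro: le_less_trans)
      next
        fix \<omega> assume w: "\<omega> \<in> (\<Inter>n. {\<omega>\<in>space M. \<sigma> \<omega> < ereal (s n)})"
        have "(\<lambda>n. ereal (s n)) \<longlonglongrightarrow> ereal t" using sl by simp
        then have "\<sigma> \<omega> \<le> ereal t" by (rule Lim_bounded2[of _ _ 0]) (use w in \<open>auto simp: less_imp_le\<close>)
        then show "\<omega> \<in> {\<omega>\<in>space M. \<sigma> \<omega> \<le> ereal t}" using w by auto
      qed
      moreover have "{\<omega>\<in>space M. \<sigma> \<omega> < ereal (s n)} \<in> sets (F r)" for n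
        using l[of "s n"] s[of n] r t sets_F_mono[of "s n" r] by auto
      ultimately show ?thesis by auto
    qed
    then show ?thesis using F_right_cont[of t] t False by auto
  qed
qed

section \<open>Semimartingales admit no free lunch\<close>

definition dyadics :: "real set" where "dyadics = {T * real i / 2 ^ m | i m. i \<le> 2 ^ m}"

text \<open>For \<open>t\<close> in \<open>[0, T)\<close> this is the first point of the
  level-\<open>m\<close> grid strictly after \<open>t\<close>. Strictness makes sampling along it a
  genuine right limit, even when \<open>t\<close> is dyadic and the value there differs from the
  limit.\<close>

definition dyadic_next :: "nat \<Rightarrow> real \<Rightarrow> real" where
  "dyadic_next m t = T * real (min (2 ^ m) (nat (\<lfloor>t * 2 ^ m / T\<rfloor> + 1))) / 2 ^ m"

text \<open>Only cells whose right end is at most \<open>t\<close> count, so the value at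
  \<open>t\<close> depends on the path up to \<open>t\<close> and inherits adaptedness.\<close>

definition dyadic_var :: "nat \<Rightarrow> real \<Rightarrow> (real \<Rightarrow> real) \<Rightarrow> real" where
  "dyadic_var m t a = (\<Sum>i<2^m. if T * real (Suc i) / 2 ^ m \<le> t
     then \<bar>a (T * real (Suc i) / 2 ^ m) - a (T * real i / 2 ^ m)\<bar> else 0)"

lemma countable_dyadics: "countable dyadics"
proof -
  have "dyadics \<subseteq> range (\<lambda>(i, m). T * real i / 2 ^ m)" unfolding dyadics_def by auto
  then show ?thesis by (rule countable_subset) auto
qed

lemma dyadics_range: "dyadics \<subseteq> {0..T}" unfolding dyadics_def using dyadic_in by auto

lemma dyadics_grid: "i \<le> 2 ^ m \<Longrightarrow> T * real i / 2 ^ m \<in> dyadics" unfolding dyadics_def by auto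

lemma dyadic_next_dyadic: "dyadic_next m t \<in> dyadics"
  unfolding dyadic_next_def by (rule dyadics_grid) simp

lemma dyadic_next_cases:
  assumes "0 \<le> t" "t < T"
  shows "dyadic_next m t = T * (of_int \<lfloor>t * 2 ^ m / T\<rfloor> + 1) / 2 ^ m" "t < dyadic_next m t" "dyadic_next m t \<le> t + T / 2 ^ m"
proof -
  define c where "c = t * 2 ^ m / T"
  have c: "0 \<le> c" "c < 2 ^ m" "t = T * c / 2 ^ m" using assms T_pos unfolding c_def by (auto simp: field_simps)
  have "of_int \<lfloor>c\<rfloor> < (of_int (2 ^ m) :: real)" using le_less_trans[OF of_int_floor_le c(2)] by (simp only: of_int_power of_int_numeral)
  then have f: "\<lfloor>c\<rfloor> + 1 \<le> 2 ^ m" "0 \<le> \<lfloor>c\<rfloor>" using c(1) by (simp_all only: of_int_less_iff zero_le_floor add1_zle_eq)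
  then have "min (2 ^ m) (nat (\<lfloor>c\<rfloor> + 1)) = nat (\<lfloor>c\<rfloor> + 1)" by (simp add: min_def nat_le_iff)
  then have e: "dyadic_next m t = T * (of_int \<lfloor>c\<rfloor> + 1) / 2 ^ m"
    using f unfolding dyadic_next_def c_def by simp
  then show "dyadic_next m t = T * (of_int \<lfloor>t * 2 ^ m / T\<rfloor> + 1) / 2 ^ m" unfolding c_def .
  have "c < of_int \<lfloor>c\<rfloor> + 1" "of_int \<lfloor>c\<rfloor> + 1 \<le> c + 1" by linarith+
  then have "T * c < T * (of_int \<lfloor>c\<rfloor> + 1)" "T * (of_int \<lfloor>c\<rfloor> + 1) \<le> T * (c + 1)" using T_pos by simp_all
  then have "T * c / 2 ^ m < T * (of_int \<lfloor>c\<rfloor> + 1) / 2 ^ m" "T * (of_int \<lfloor>c\<rfloor> + 1) / 2 ^ m \<le> T * (c + 1) / 2 ^ m"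
    by (auto intro: divide_strict_right_mono divide_right_mono)
  moreover have "T * (c + 1) / 2 ^ m = T * c / 2 ^ m + T / 2 ^ m" by (simp add: field_simps)
  ultimately show "t < dyadic_next m t" "dyadic_next m t \<le> t + T / 2 ^ m" unfolding e using c(3) by auto
qed

lemma dyadic_next_T: "dyadic_next m T = T"
proof -
  have "T * 2 ^ m / T = of_int (2 ^ m)" using T_pos by simp
  then have "\<lfloor>T * 2 ^ m / T\<rfloor> = 2 ^ m" by (simp only: floor_of_int)
  then show ?thesis unfolding dyadic_next_def by (simp add: nat_add_distrib nat_power_eq)
qed

lemma dyadic_next_range: "t \<in> {0..T} \<Longrightarrow> dyadic_next m t \<in> {t..T}"
  using dyadic_next_dyadic[of m t] dyadics_range dyadic_next_cases(2)[of t m] dyadic_next_T[of m]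
  by (cases "t = T") (auto intro: less_imp_le)

lemma dyadic_next_tendsto:
  assumes "t \<in> {0..T}" shows "(\<lambda>m. dyadic_next m t) \<longlonglongrightarrow> t"
proof (cases "t = T")
  case True then show ?thesis by (simp add: dyadic_next_T)
next
  case False
  have "(\<lambda>m. t + T * (1/2)^m) \<longlonglongrightarrow> t + T * 0" by (intro tendsto_intros) auto
  then have l: "(\<lambda>m. t + T / 2 ^ m) \<longlonglongrightarrow> t" by (simp add: power_divide)
  show ?thesis
    by (rule tendsto_sandwich[OF _ _ tendsto_const l])
      (use dyadic_next_cases(2,3)[of t] assms False in \<open>auto intro!: always_eventually less_imp_le\<close>)
qed

lemma dyadic_next_mono: "s \<le> t \<Longrightarrow> dyadic_next m s \<le> dyadic_next m t"
proof -
  assume "s \<le> t"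
  then have "s * 2 ^ m / T \<le> t * 2 ^ m / T" using T_pos by (simp add: divide_right_mono)
  then have "\<lfloor>s * 2 ^ m / T\<rfloor> \<le> \<lfloor>t * 2 ^ m / T\<rfloor>" by (rule floor_mono)
  then have "min (2 ^ m) (nat (\<lfloor>s * 2 ^ m / T\<rfloor> + 1)) \<le> min (2 ^ m) (nat (\<lfloor>t * 2 ^ m / T\<rfloor> + 1))"
    by (intro min.mono nat_mono) auto
  then have "real (min (2 ^ m) (nat (\<lfloor>s * 2 ^ m / T\<rfloor> + 1))) \<le> real (min (2 ^ m) (nat (\<lfloor>t * 2 ^ m / T\<rfloor> + 1)))"
    by (simp only: of_nat_le_iff)
  then show ?thesis unfolding dyadic_next_def using T_pos by (intro divide_right_mono mult_left_mono) auto
qed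

lemma dyadic_next_between:
  assumes "0 \<le> s" "s < t" "t \<le> T"
  obtains q where "q \<in> dyadics" "s < q" "q < t"
proof -
  have "(\<lambda>m. dyadic_next m s) \<longlonglongrightarrow> s" using assms by (intro dyadic_next_tendsto) auto
  from order_tendstoD(2)[OF this assms(2)] obtain m where "dyadic_next m s < t"
    by (auto simp: eventually_sequentially)
  then show ?thesis using that[of "dyadic_next m s"] dyadic_next_cases(2)[of s m] dyadic_next_dyadic assms by auto
qed

lemma dyadic_grid_le: "T * real i / 2 ^ m \<le> T * real j / 2 ^ m \<longleftrightarrow> i \<le> j"
  using T_pos by (simp add: divide_le_cancel)

lemma dyadic_var_grid:
  assumes "j \<le> 2 ^ m"
  shows "dyadic_var m (T * real j / 2 ^ m) a = (\<Sum>i<j. \<bar>a (T * real (Suc i) / 2 ^ m) - a (T * real i / 2 ^ m)\<bar>)"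
proof -
  have "dyadic_var m (T * real j / 2 ^ m) a =
    (\<Sum>i<2^m. if i < j then \<bar>a (T * real (Suc i) / 2 ^ m) - a (T * real i / 2 ^ m)\<bar> else 0)"
    unfolding dyadic_var_def by (rule sum.cong[OF refl]) (simp only: dyadic_grid_le Suc_le_eq)
  also have "\<dots> = (\<Sum>i\<in>{i\<in>{..<2^m}. i < j}. \<bar>a (T * real (Suc i) / 2 ^ m) - a (T * real i / 2 ^ m)\<bar>)"
    by (rule sum.inter_filter[symmetric]) simp
  also have "{i\<in>{..<2^m}. i < j} = {..<j}" using assms by auto
  finally show ?thesis .
qed

lemma abs_diff_le_sum:
  fixes g :: "nat \<Rightarrow> real" assumes "i \<le> j" shows "\<bar>g j - g i\<bar> \<le> (\<Sum>l\<in>{i..<j}. \<bar>g (Suc l) - g l\<bar>)"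
  using assms
proof (induction rule: dec_induct)
  case (step n) then show ?case by (simp add: sum.atLeastLessThan_Suc)
qed simp

lemma subsequence_var_le:
  fixes g :: "nat \<Rightarrow> real"
  assumes "\<And>i. i < n \<Longrightarrow> c i \<le> (c (Suc i) :: nat)"
  shows "(\<Sum>i<n. \<bar>g (c (Suc i)) - g (c i)\<bar>) \<le> (\<Sum>l\<in>{c 0..<c n}. \<bar>g (Suc l) - g l\<bar>) \<and> c 0 \<le> c n"
  using assms
proof (induction n)
  case (Suc n)
  then have IH: "(\<Sum>i<n. \<bar>g (c (Suc i)) - g (c i)\<bar>) \<le> (\<Sum>l\<in>{c 0..<c n}. \<bar>g (Suc l) - g l\<bar>)" "c 0 \<le> c n" by auto
  have "c n \<le> c (Suc n)" using Suc by auto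
  from abs_diff_le_sum[OF this, of g] IH
  have "(\<Sum>i<Suc n. \<bar>g (c (Suc i)) - g (c i)\<bar>) \<le> (\<Sum>l\<in>{c 0..<c n}. \<bar>g (Suc l) - g l\<bar>) + (\<Sum>l\<in>{c n..<c (Suc n)}. \<bar>g (Suc l) - g l\<bar>)"
    by simp
  also have "\<dots> = (\<Sum>l\<in>{c 0..<c (Suc n)}. \<bar>g (Suc l) - g l\<bar>)"
    using IH(2) \<open>c n \<le> c (Suc n)\<close> by (rule sum.atLeastLessThan_concat)
  finally show ?case using IH(2) \<open>c n \<le> c (Suc n)\<close> by auto
qed simp

text \<open>Partition points are rounded up to the grid; the rounded sums are dominated by the grid
  variation and converge by right-continuity. The bound is asked only eventually because on coarse
  grids the rounded end point may lie beyond the range where the variation is controlled.\<close>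

lemma partition_var_le:
  assumes X: "cadlag M T X" "\<omega> \<in> space M"
    and p: "\<And>i. i < n \<Longrightarrow> p i \<le> p (Suc i)" "\<And>i. i \<le> n \<Longrightarrow> p i \<in> {0..T}"
    and K: "\<forall>\<^sub>F m in sequentially. dyadic_var m (dyadic_next m (p n)) (\<lambda>t. X t \<omega>) \<le> K"
  shows "(\<Sum>i<n. \<bar>X (p (Suc i)) \<omega> - X (p i) \<omega>\<bar>) \<le> K"
proof -
  have lim: "(\<lambda>m. X (dyadic_next m (p i)) \<omega>) \<longlonglongrightarrow> X (p i) \<omega>" if "i \<le> n" for i
    by (rule cadlag_right_limit[OF X p(2)[OF that] dyadic_next_tendsto[OF p(2)[OF that]] dyadic_next_range[OF p(2)[OF that]]])
  have "(\<lambda>m. \<Sum>i<n. \<bar>X (dyadic_next m (p (Suc i))) \<omega> - X (dyadic_next m (p i)) \<omega>\<bar>) \<longlonglongrightarrow> (\<Sum>i<n. \<bar>X (p (Suc i)) \<omega> - X (p i) \<omega>\<bar>)"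
    by (intro tendsto_sum tendsto_rabs tendsto_diff lim) auto
  moreover have "\<forall>\<^sub>F m in sequentially. (\<Sum>i<n. \<bar>X (dyadic_next m (p (Suc i))) \<omega> - X (dyadic_next m (p i)) \<omega>\<bar>) \<le> K"
    using K
  proof eventually_elim
    case (elim m)
    define c where "c i = min (2 ^ m) (nat (\<lfloor>p i * 2 ^ m / T\<rfloor> + 1))" for i
    define g where "g l = X (T * real l / 2 ^ m) \<omega>" for l
    have dn: "dyadic_next m (p i) = T * real (c i) / 2 ^ m" for i unfolding dyadic_next_def c_def by simp
    have cm: "c i \<le> c (Suc i)" if "i < n" for i
      using dyadic_next_mono[OF p(1)[OF that], of m] unfolding dn dyadic_grid_le .
    have c2: "c n \<le> 2 ^ m" unfolding c_def by simp
    have "(\<Sum>i<n. \<bar>X (dyadic_next m (p (Suc i))) \<omega> - X (dyadic_next m (p i)) \<omega>\<bar>) = (\<Sum>i<n. \<bar>g (c (Suc i)) - g (c i)\<bar>)"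
      unfolding dn g_def ..
    also have "\<dots> \<le> (\<Sum>l\<in>{c 0..<c n}. \<bar>g (Suc l) - g l\<bar>)" using subsequence_var_le[of n c g] cm by blast
    also have "\<dots> \<le> (\<Sum>l\<in>{..<c n}. \<bar>g (Suc l) - g l\<bar>)" by (rule sum_mono2) auto
    also have "\<dots> = dyadic_var m (dyadic_next m (p n)) (\<lambda>t. X t \<omega>)"
      unfolding dn dyadic_var_grid[OF c2] g_def ..
    also have "\<dots> \<le> K" by (rule elim)
    finally show ?case .
  qed
  ultimately show ?thesis by (intro tendsto_upperbound[where F=sequentially]) auto
qed

lemma dyadic_var_le_total:
  assumes "\<And>n p. p 0 = 0 \<Longrightarrow> p n = T \<Longrightarrow> (\<forall>i<n. p i \<le> p (Suc i)) \<Longrightarrow> (\<Sum>i<n. \<bar>a (p (Suc i)) - a (p i)\<bar>) \<le> C"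
  shows "dyadic_var m t a \<le> C"
proof -
  have "dyadic_var m t a \<le> (\<Sum>i<2^m. \<bar>a (T * real (Suc i) / 2 ^ m) - a (T * real i / 2 ^ m)\<bar>)"
    unfolding dyadic_var_def by (rule sum_mono) auto
  also have "\<dots> \<le> C"
  proof (rule assms[of "\<lambda>i. T * real i / 2 ^ m" "2 ^ m"])
    show "\<forall>i<2 ^ m. T * real i / 2 ^ m \<le> T * real (Suc i) / 2 ^ m" unfolding dyadic_grid_le by simp
  qed simp_all
  finally show ?thesis .
qed

text \<open>The infimum runs over countably many times, so its strict sublevel events are countable
  unions. It need not be attained, which is where right-continuity of the filtration enters; the
  empty infimum supplies the value \<open>\<infinity>\<close>.\<close>

definition dyadic_hit :: "(real \<Rightarrow> 'a set) \<Rightarrow> 'a \<Rightarrow> ereal" where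
  "dyadic_hit B \<omega> = Inf (ereal ` {q\<in>dyadics. \<omega> \<in> B q})"

lemma dyadic_hit_less: "dyadic_hit B \<omega> < x \<longleftrightarrow> (\<exists>q\<in>dyadics. \<omega> \<in> B q \<and> ereal q < x)"
  unfolding dyadic_hit_def by (auto simp: Inf_less_iff)

lemma dyadic_hit_stopping_time:
  assumes B: "\<And>q. q \<in> dyadics \<Longrightarrow> B q \<in> sets (F q)"
  shows "ext_stopping_time M F T (dyadic_hit B)"
proof (rule ext_stopping_timeI)
  have Bs: "B q \<in> sets (F t)" if "q \<in> dyadics" "q \<le> t" for q t using B[OF that(1)] sets_F_mono[OF that(2)] by auto
  have BM: "B q \<subseteq> space M" if "q \<in> dyadics" for q using sets.sets_into_space[OF B[OF that]] by simp
  show "dyadic_hit B \<omega> \<in> ereal ` {0..T} \<union> {\<infinity>}" if "\<omega> \<in> space M" for \<omega>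
  proof (cases "{q\<in>dyadics. \<omega> \<in> B q} = {}")
    case True then show ?thesis unfolding dyadic_hit_def True by (simp add: top_ereal_def)
  next
    case False
    then obtain q where q: "q \<in> dyadics" "\<omega> \<in> B q" by auto
    have u: "dyadic_hit B \<omega> \<le> ereal q" unfolding dyadic_hit_def by (rule Inf_lower) (use q in auto)
    have l: "ereal 0 \<le> dyadic_hit B \<omega>" unfolding dyadic_hit_def
      by (rule Inf_greatest) (use dyadics_range in auto)
    obtain r where r: "dyadic_hit B \<omega> = ereal r" using u l by (cases "dyadic_hit B \<omega>") auto
    have "q \<le> T" using q dyadics_range by auto
    then have "r \<in> {0..T}" using u l r by auto
    then show ?thesis using r by auto
  qed
  show "{\<omega>\<in>space M. dyadic_hit B \<omega> < ereal t} \<in> sets (F t)" for t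
  proof -
    have "{\<omega>\<in>space M. dyadic_hit B \<omega> < ereal t} = (\<Union>q\<in>{q\<in>dyadics. q < t}. B q)"
      unfolding dyadic_hit_less using BM by auto
    also have "\<dots> \<in> sets (F t)"
      by (rule sets.countable_UN'') (use countable_dyadics Bs in auto)
    finally show ?thesis .
  qed
  have "{\<omega>\<in>space M. dyadic_hit B \<omega> \<noteq> \<infinity>} = (\<Union>q\<in>dyadics. B q)"
  proof -
    have "dyadic_hit B \<omega> \<noteq> \<infinity> \<longleftrightarrow> dyadic_hit B \<omega> < \<infinity>" for \<omega> by simp
    then show ?thesis unfolding dyadic_hit_less using BM by auto
  qed
  also have "\<dots> \<in> sets (F T)"
    by (rule sets.countable_UN'') (use countable_dyadics Bs dyadics_range in auto)
  finally show "{\<omega>\<in>space M. dyadic_hit B \<omega> \<noteq> \<infinity>} \<in> sets (F T)" .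
qed

lemma dyadic_hit_infinity: "dyadic_hit B \<omega> = \<infinity> \<longleftrightarrow> (\<forall>q\<in>dyadics. \<omega> \<notin> B q)"
  using dyadic_hit_less[of B \<omega> \<infinity>] by auto

section \<open>Pathwise bounds and expectations for gains of simple integrands\<close>

lemma simple_integral_diff:
  assumes mono: "\<And>i. i < steps H \<Longrightarrow> times H i \<omega> \<le> times H (Suc i) \<omega>"
    and j: "j < steps H" and t: "times H j \<omega> \<le> t" "t \<le> times H (Suc j) \<omega>"
  shows "simple_integral H X t \<omega> = simple_integral H X (times H j \<omega>) \<omega> + coeff H (Suc j) \<omega> * (X t \<omega> - X (times H j \<omega>) \<omega>)"
proof -
  let ?s = "times H j \<omega>"
  have le: "times H i \<omega> \<le> times H k \<omega>" if "i \<le> k" "k \<le> steps H" for i k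
    using that
  proof (induction rule: dec_induct)
    case (step n) then show ?case using mono[of n] by auto
  qed simp
  have "simple_integral H X t \<omega> - simple_integral H X ?s \<omega> = (\<Sum>i=1..steps H. coeff H i \<omega> *
        ((X (min (times H i \<omega>) t) \<omega> - X (min (times H (i - 1) \<omega>) t) \<omega>) - (X (min (times H i \<omega>) ?s) \<omega> - X (min (times H (i - 1) \<omega>) ?s) \<omega>)))"
    unfolding simple_integral_def by (simp add: sum_subtractf right_diff_distrib)
  also have "\<dots> = (\<Sum>i=1..steps H. if i = Suc j then coeff H (Suc j) \<omega> * (X t \<omega> - X ?s \<omega>) else 0)"
  proof (rule sum.cong[OF refl])
    fix i assume i: "i \<in> {1..steps H}"
    consider "i \<le> j" | "i = Suc j" | "Suc j < i" by linarith
    then show "coeff H i \<omega> * ((X (min (times H i \<omega>) t) \<omega> - X (min (times H (i - 1) \<omega>) t) \<omega>) - (X (min (times H i \<omega>) ?s) \<omega> - X (min (times H (i - 1) \<omega>) ?s) \<omega>))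
      = (if i = Suc j then coeff H (Suc j) \<omega> * (X t \<omega> - X ?s \<omega>) else 0)"
    proof cases
      case 1
      have "times H i \<omega> \<le> ?s" "times H (i - 1) \<omega> \<le> ?s" using le[of i j] le[of "i-1" j] 1 j by auto
      then show ?thesis using t 1 by (simp add: min_absorb1)
    next
      case 2
      then show ?thesis using t by (simp add: min_absorb1 min_absorb2)
    next
      case 3
      have "Suc j \<le> i - 1" "i - 1 \<le> steps H" using 3 i by auto
      then have "t \<le> times H i \<omega>" "t \<le> times H (i - 1) \<omega>" using le[of "Suc j" i] le[of "Suc j" "i-1"] 3 i t by auto
      then show ?thesis using t 3 by (simp add: min_absorb2)
    qed
  qed
  also have "\<dots> = coeff H (Suc j) \<omega> * (X t \<omega> - X ?s \<omega>)" using j by simp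
  finally show ?thesis by simp
qed

lemma simple_integral_right_limit:
  assumes X: "cadlag M T X" "\<omega> \<in> space M"
    and tm: "\<And>j. j \<le> steps H \<Longrightarrow> times H j \<omega> \<in> {0..T}"
    and s: "t \<in> {0..T}" "s \<longlonglongrightarrow> t" "\<And>m. s m \<in> {t..T}"
  shows "(\<lambda>m. simple_integral H X (s m) \<omega>) \<longlonglongrightarrow> simple_integral H X t \<omega>"
proof -
  have "(\<lambda>m. X (min (times H j \<omega>) (s m)) \<omega>) \<longlonglongrightarrow> X (min (times H j \<omega>) t) \<omega>" if j: "j \<le> steps H" for j
  proof (rule cadlag_right_limit[OF X])
    show "(\<lambda>m. min (times H j \<omega>) (s m)) \<longlonglongrightarrow> min (times H j \<omega>) t" by (intro tendsto_min tendsto_const s)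
    show "min (times H j \<omega>) (s m) \<in> {min (times H j \<omega>) t..T}" for m using s(3)[of m] tm[OF j] by auto
  qed (use tm[OF j] s(1) in auto)
  then show ?thesis unfolding simple_integral_def by (intro tendsto_sum tendsto_mult tendsto_const tendsto_diff) auto
qed

lemma simple_integrand_times:
  assumes "simple_integrand M F T H" "\<omega> \<in> space M"
  shows "\<And>i. i < steps H \<Longrightarrow> times H i \<omega> \<le> times H (Suc i) \<omega>" "times H 0 \<omega> = 0" "times H (steps H) \<omega> = T"
    "\<And>i j. i \<le> j \<Longrightarrow> j \<le> steps H \<Longrightarrow> times H i \<omega> \<le> times H j \<omega>"
    "\<And>j. j \<le> steps H \<Longrightarrow> times H j \<omega> \<in> {0..T}"
proof -
  show m: "\<And>i. i < steps H \<Longrightarrow> times H i \<omega> \<le> times H (Suc i) \<omega>" and 0: "times H 0 \<omega> = 0" and T: "times H (steps H) \<omega> = T"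
    using assms unfolding simple_integrand_def by auto
  show le: "times H i \<omega> \<le> times H k \<omega>" if "i \<le> k" "k \<le> steps H" for i k
    using that
  proof (induction rule: dec_induct)
    case (step n) then show ?case using m[of n] by auto
  qed simp
  show "times H j \<omega> \<in> {0..T}" if "j \<le> steps H" for j using le[of 0 j] le[of j "steps H"] that 0 T by auto
qed

text \<open>\<open>sup_norm\<close> takes essential suprema time by time, so a common exceptional
  set is available only for countably many times. The dyadics are dense enough: every nondegenerate
  interval of constancy of an integrand contains one, and gains are right-continuous.\<close>

lemma sup_norm_AE:
  assumes "sup_norm M T G \<le> ereal \<epsilon>"
  shows "AE \<omega> in M. \<forall>q\<in>dyadics. \<bar>G q \<omega>\<bar> \<le> \<epsilon>"
  unfolding AE_ball_countable[OF countable_dyadics]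
proof
  fix q assume "q \<in> dyadics"
  then have "esssup M (\<lambda>\<omega>. ereal \<bar>G q \<omega>\<bar>) \<le> sup_norm M T G"
    unfolding sup_norm_def using dyadics_range by (intro SUP_upper) auto
  then have "esssup M (\<lambda>\<omega>. ereal \<bar>G q \<omega>\<bar>) \<le> ereal \<epsilon>" using assms by (rule order_trans)
  moreover have "AE \<omega> in M. ereal \<bar>G q \<omega>\<bar> \<le> esssup M (\<lambda>\<omega>. ereal \<bar>G q \<omega>\<bar>)" by (rule esssup_AE)
  ultimately show "AE \<omega> in M. \<bar>G q \<omega>\<bar> \<le> \<epsilon>" by (auto elim!: eventually_mono dest: order_trans)
qed

text \<open>A nondegenerate interval contains a dyadic time strictly inside, and there the process
  equals this coefficient alone. On degenerate intervals the norm says nothing about the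
  coefficient, but it then multiplies a zero increment.\<close>

lemma simple_process_coeff:
  assumes H: "simple_integrand M F T H" "\<omega> \<in> space M" and j: "j < steps H"
    and lt: "times H j \<omega> < times H (Suc j) \<omega>" and b: "\<forall>q\<in>dyadics. \<bar>simple_process H q \<omega>\<bar> \<le> \<epsilon>"
  shows "\<bar>coeff H (Suc j) \<omega>\<bar> \<le> \<epsilon>"
proof -
  note tm = simple_integrand_times[OF H]
  have "0 \<le> times H j \<omega>" "times H (Suc j) \<omega> \<le> T" using tm(5)[of j] tm(5)[of "Suc j"] j by auto
  then obtain q where q: "q \<in> dyadics" "times H j \<omega> < q" "q < times H (Suc j) \<omega>"
    using dyadic_next_between[OF _ lt] by auto
  have "simple_process H q \<omega> = (\<Sum>i=1..steps H. if i = Suc j then coeff H (Suc j) \<omega> else 0)"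
    unfolding simple_process_def
  proof (rule sum.cong[OF refl])
    fix i assume i: "i \<in> {1..steps H}"
    consider "i \<le> j" | "i = Suc j" | "Suc j < i" by linarith
    then show "coeff H i \<omega> * indicator {times H (i - 1) \<omega><..times H i \<omega>} q = (if i = Suc j then coeff H (Suc j) \<omega> else 0)"
    proof cases
      case 1 then show ?thesis using tm(4)[of i j] j q by auto
    next
      case 2 then show ?thesis using q by simp
    next
      case 3
      then have "Suc j \<le> i - 1" "i - 1 \<le> steps H" using i by auto
      then show ?thesis using 3 tm(4)[of "Suc j" "i - 1"] i q by auto
    qed
  qed
  also have "\<dots> = coeff H (Suc j) \<omega>" using j by simp
  finally show ?thesis using b q(1) by metis
qed

lemma simple_integral_var_bound:
  assumes H: "simple_integrand M F T H" "\<omega> \<in> space M" and A: "cadlag M T A"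
    and b: "\<forall>q\<in>dyadics. \<bar>simple_process H q \<omega>\<bar> \<le> \<epsilon>" and "0 \<le> \<epsilon>" and s: "s \<in> {0..T}"
    and K: "\<forall>\<^sub>F m in sequentially. dyadic_var m (dyadic_next m s) (\<lambda>t. A t \<omega>) \<le> K"
  shows "\<bar>simple_integral H A s \<omega>\<bar> \<le> \<epsilon> * K"
proof -
  note tm = simple_integrand_times[OF H]
  define p where "p i = min (times H i \<omega>) s" for i
  have pn: "p (steps H) = s" using tm(3) s unfolding p_def by auto
  have "(\<Sum>i<steps H. \<bar>A (p (Suc i)) \<omega> - A (p i) \<omega>\<bar>) \<le> K"
    by (rule partition_var_le[OF A H(2)]) (use tm s K pn in \<open>auto simp: p_def min.coboundedI1\<close>)
  moreover have "\<bar>simple_integral H A s \<omega>\<bar> \<le> (\<Sum>i<steps H. \<epsilon> * \<bar>A (p (Suc i)) \<omega> - A (p i) \<omega>\<bar>)"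
  proof -
    have "simple_integral H A s \<omega> = (\<Sum>i<steps H. coeff H (Suc i) \<omega> * (A (p (Suc i)) \<omega> - A (p i) \<omega>))"
      unfolding simple_integral_def p_def by (simp add: sum.atLeast1_atMost_eq)
    also have "\<bar>\<dots>\<bar> \<le> (\<Sum>i<steps H. \<bar>coeff H (Suc i) \<omega> * (A (p (Suc i)) \<omega> - A (p i) \<omega>)\<bar>)" by (rule sum_abs)
    also have "\<dots> \<le> (\<Sum>i<steps H. \<epsilon> * \<bar>A (p (Suc i)) \<omega> - A (p i) \<omega>\<bar>)"
    proof (rule sum_mono)
      fix i assume i: "i \<in> {..<steps H}"
      show "\<bar>coeff H (Suc i) \<omega> * (A (p (Suc i)) \<omega> - A (p i) \<omega>)\<bar> \<le> \<epsilon> * \<bar>A (p (Suc i)) \<omega> - A (p i) \<omega>\<bar>"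
      proof (cases "times H i \<omega> < times H (Suc i) \<omega>")
        case True
        with simple_process_coeff[OF H _ True b] i show ?thesis by (auto simp: abs_mult intro: mult_right_mono)
      next
        case False
        then have "times H i \<omega> = times H (Suc i) \<omega>" using tm(1)[of i] i by auto
        then show ?thesis unfolding p_def by simp
      qed
    qed
    finally show ?thesis .
  qed
  ultimately show ?thesis using \<open>0 \<le> \<epsilon>\<close> by (simp add: sum_distrib_left[symmetric]) (meson mult_left_mono order_trans)
qed

text \<open>Each summand is a difference of two optionally stopped values tested against one weight
  that is known at the earlier of the two times, so both integrals agree.\<close>

lemma simple_integral_martingale_expectation:
  assumes H: "simple_integrand M F T H" and X: "martingale M F T X" "cadlag M T X"
    and \<rho>: "stopping_time F \<rho>" "\<And>\<omega>. \<omega> \<in> space M \<Longrightarrow> \<rho> \<omega> \<in> {0..T}"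
  shows "integrable M (\<lambda>\<omega>. simple_integral H X (\<rho> \<omega>) \<omega>)" "(\<integral>\<omega>. simple_integral H X (\<rho> \<omega>) \<omega> \<partial>M) = 0"
proof -
  have trm: "integrable M (\<lambda>\<omega>. coeff H j \<omega> * (X (min (times H j \<omega>) (\<rho> \<omega>)) \<omega> - X (min (times H (j - 1) \<omega>) (\<rho> \<omega>)) \<omega>)) \<and>
    (\<integral>\<omega>. coeff H j \<omega> * (X (min (times H j \<omega>) (\<rho> \<omega>)) \<omega> - X (min (times H (j - 1) \<omega>) (\<rho> \<omega>)) \<omega>) \<partial>M) = 0"
    if j: "j \<in> {1..steps H}" for j
  proof -
    let ?s = "times H (j - 1)" and ?t = "times H j"
    have st: "stopping_time F ?s" "stopping_time F ?t"
      and f: "coeff H j \<in> borel_measurable (pre_sigma ?s)" using H j unfolding simple_integrand_def by auto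
    obtain C where C: "AE \<omega> in M. \<bar>coeff H j \<omega>\<bar> \<le> C" using H j unfolding simple_integrand_def by blast
    have rg: "?s \<omega> \<in> {0..T}" "?t \<omega> \<in> {0..T}" "?s \<omega> \<le> ?t \<omega>" if "\<omega> \<in> space M" for \<omega>
      using simple_integrand_times(5)[OF H that] simple_integrand_times(4)[OF H that, of "j-1" j] j by auto
    \<comment> \<open>The coefficient is clipped because optional stopping asks for a bound
      everywhere, while a simple integrand is bounded only almost surely. It is cut off where
      \<open>\<rho>\<close> has already come, so as to be known at the minimum of the two times; the
      increment vanishes there anyway.\<close>
    define g where "g \<omega> = (if ?s \<omega> < \<rho> \<omega> then max (-\<bar>C\<bar>) (min \<bar>C\<bar> (coeff H j \<omega>)) else 0)" for \<omega>
    have m: "stopping_time F (\<lambda>\<omega>. min (?s \<omega>) (\<rho> \<omega>))" "stopping_time F (\<lambda>\<omega>. min (?t \<omega>) (\<rho> \<omega>))"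
      using st \<rho>(1) by (auto intro: stopping_time_min)
    have mr: "min (?s \<omega>) (\<rho> \<omega>) \<in> {0..T}" "min (?t \<omega>) (\<rho> \<omega>) \<in> {0..T}" if "\<omega> \<in> space M" for \<omega>
      using rg(1,2)[OF that] \<rho>(2)[OF that] by auto
    have "(\<lambda>\<omega>. max (-\<bar>C\<bar>) (min \<bar>C\<bar> (coeff H j \<omega>))) \<in> borel_measurable (pre_sigma ?s)" using f by measurable
    from pre_sigma_min[OF st(1) \<rho>(1) this]
    have gs: "g \<in> borel_measurable (pre_sigma (\<lambda>\<omega>. min (?s \<omega>) (\<rho> \<omega>)))" unfolding g_def .
    have gt: "g \<in> borel_measurable (pre_sigma (\<lambda>\<omega>. min (?t \<omega>) (\<rho> \<omega>)))"
      by (rule borel_pre_sigma_mono[OF m _ gs]) (use rg(3) in \<open>auto simp: min_def intro: order_trans\<close>)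
    have gb: "\<bar>g \<omega>\<bar> \<le> \<bar>C\<bar>" for \<omega> unfolding g_def by auto
    have gm[measurable]: "g \<in> borel_measurable M" by (rule borel_pre_sigma_M[OF m(1) mr(1) gs])
    note os = optional_stopping[OF X m(1) mr(1) gs gb]
    note ot = optional_stopping[OF X m(2) mr(2) gt gb]
    have gi: "integrable M (\<lambda>\<omega>. g \<omega> * h \<omega>)" if h: "integrable M h" for h
    proof (rule Bochner_Integration.integrable_bound[OF integrable_mult_right[OF h, of C]])
      show "AE \<omega> in M. norm (g \<omega> * h \<omega>) \<le> norm (C * h \<omega>)"
        using gb by (intro AE_I2) (simp add: abs_mult mult_right_mono)
    qed (use h in auto)
    have ig: "integrable M (\<lambda>\<omega>. g \<omega> * (X (min (?t \<omega>) (\<rho> \<omega>)) \<omega> - X (min (?s \<omega>) (\<rho> \<omega>)) \<omega>))"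
      by (rule gi[OF Bochner_Integration.integrable_diff[OF ot(1) os(1)]])
    have ez: "(\<integral>\<omega>. g \<omega> * (X (min (?t \<omega>) (\<rho> \<omega>)) \<omega> - X (min (?s \<omega>) (\<rho> \<omega>)) \<omega>) \<partial>M) = 0"
      using os(2) ot(2) gi[OF os(1)] gi[OF ot(1)] by (simp add: right_diff_distrib)
    have cm: "coeff H j \<in> borel_measurable M" by (rule borel_pre_sigma_M[OF st(1) rg(1) f])
    have ae: "AE \<omega> in M. g \<omega> * (X (min (?t \<omega>) (\<rho> \<omega>)) \<omega> - X (min (?s \<omega>) (\<rho> \<omega>)) \<omega>) =
      coeff H j \<omega> * (X (min (?t \<omega>) (\<rho> \<omega>)) \<omega> - X (min (?s \<omega>) (\<rho> \<omega>)) \<omega>)"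
      using C AE_space
    proof eventually_elim
      case (elim \<omega>)
      show ?case
      proof (cases "?s \<omega> < \<rho> \<omega>")
        case True
        have "max (-\<bar>C\<bar>) (min \<bar>C\<bar> (coeff H j \<omega>)) = coeff H j \<omega>" using elim(1) by linarith
        then show ?thesis using True unfolding g_def by simp
      next
        case False
        then have "min (?t \<omega>) (\<rho> \<omega>) = min (?s \<omega>) (\<rho> \<omega>)" using rg(3)[OF elim(2)] by auto
        then show ?thesis by simp
      qed
    qed
    have [measurable]: "(\<lambda>\<omega>. X (min (?t \<omega>) (\<rho> \<omega>)) \<omega>) \<in> borel_measurable M" "(\<lambda>\<omega>. X (min (?s \<omega>) (\<rho> \<omega>)) \<omega>) \<in> borel_measurable M"
      "coeff H j \<in> borel_measurable M" using ot(1) os(1) cm by auto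
    show ?thesis
    proof
      show "integrable M (\<lambda>\<omega>. coeff H j \<omega> * (X (min (?t \<omega>) (\<rho> \<omega>)) \<omega> - X (min (?s \<omega>) (\<rho> \<omega>)) \<omega>))"
        by (rule integrable_cong_AE_imp[OF ig _ ae]) measurable
      have "(\<integral>\<omega>. g \<omega> * (X (min (?t \<omega>) (\<rho> \<omega>)) \<omega> - X (min (?s \<omega>) (\<rho> \<omega>)) \<omega>) \<partial>M) =
        (\<integral>\<omega>. coeff H j \<omega> * (X (min (?t \<omega>) (\<rho> \<omega>)) \<omega> - X (min (?s \<omega>) (\<rho> \<omega>)) \<omega>) \<partial>M)"
        by (rule integral_cong_AE[OF _ _ ae]) measurable
      then show "(\<integral>\<omega>. coeff H j \<omega> * (X (min (?t \<omega>) (\<rho> \<omega>)) \<omega> - X (min (?s \<omega>) (\<rho> \<omega>)) \<omega>) \<partial>M) = 0"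
        using ez by simp
    qed
  qed
  show "integrable M (\<lambda>\<omega>. simple_integral H X (\<rho> \<omega>) \<omega>)"
    unfolding simple_integral_def by (intro Bochner_Integration.integrable_sum) (use trm in blast)
  show "(\<integral>\<omega>. simple_integral H X (\<rho> \<omega>) \<omega> \<partial>M) = 0"
    unfolding simple_integral_def using trm by (subst Bochner_Integration.integral_sum) auto
qed


lemma martingale_cong:
  assumes X: "martingale M F T X" and e: "\<And>t \<omega>. t \<in> {0..T} \<Longrightarrow> \<omega> \<in> space M \<Longrightarrow> X t \<omega> = Y t \<omega>"
  shows "martingale M F T Y"
proof (rule martingaleI)
  show "adapted F T Y"
    unfolding adapted_def
  proof
    fix t assume t: "t \<in> {0..T}"
    have "X t \<in> borel_measurable (F t)" using X t unfolding martingale_def adapted_def by auto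
    then show "Y t \<in> borel_measurable (F t)" using measurable_cong[of "F t" "X t" "Y t"] e[OF t] by auto
  qed
  show "integrable M (Y t)" if t: "t \<in> {0..T}" for t
  proof -
    have "integrable M (X t)" using X t unfolding martingale_def by auto
    then show ?thesis using Bochner_Integration.integrable_cong[of M M "X t" "Y t"] e[OF t] by simp
  qed
  fix s t A assume s: "s \<in> {0..T}" and t: "t \<in> {s..T}" and A: "A \<in> sets (F s)"
  have t': "t \<in> {0..T}" using s t by auto
  have "(\<integral>\<omega>. indicator A \<omega> * X t \<omega> \<partial>M) = (\<integral>\<omega>. indicator A \<omega> * X s \<omega> \<partial>M)"
    by (rule martingale_integral(2)[OF X s t _, of _ 1]) (use A in \<open>auto simp: indicator_def\<close>)
  then show "(\<integral>\<omega>. indicator A \<omega> * Y t \<omega> \<partial>M) = (\<integral>\<omega>. indicator A \<omega> * Y s \<omega> \<partial>M)"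
    using e[OF s] e[OF t'] by (simp cong: Bochner_Integration.integral_cong)
qed

lemma cadlag_stopped:
  assumes X: "cadlag M T X"
  shows "cadlag M T (\<lambda>t \<omega>. X (min (r \<omega>) t) \<omega>)"
  unfolding cadlag_def
proof (intro ballI conjI)
  fix \<omega> t assume w: "\<omega> \<in> space M" and t: "t \<in> {0..<T}"
  show "((\<lambda>s. X (min (r \<omega>) s) \<omega>) \<longlongrightarrow> X (min (r \<omega>) t) \<omega>) (at_right t)"
  proof (cases "t < r \<omega>")
    case True
    have "((\<lambda>s. X s \<omega>) \<longlongrightarrow> X t \<omega>) (at_right t)" using X w t unfolding cadlag_def by auto
    moreover have "\<forall>\<^sub>F s in at_right t. X s \<omega> = X (min (r \<omega>) s) \<omega>"
      using eventually_at_right_real[OF True] by eventually_elim auto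
    ultimately show ?thesis using True by (simp add: tendsto_cong min_absorb2)
  next
    case False
    have "\<forall>\<^sub>F s in at_right t. X (min (r \<omega>) s) \<omega> = X (min (r \<omega>) t) \<omega>"
      by (rule eventually_mono[OF eventually_at_right_less[of t]]) (use False in \<open>auto simp: min_absorb1\<close>)
    then show ?thesis by (rule tendsto_eventually)
  qed
next
  fix \<omega> t assume w: "\<omega> \<in> space M" and t: "t \<in> {0<..T}"
  show "\<exists>l. ((\<lambda>s. X (min (r \<omega>) s) \<omega>) \<longlongrightarrow> l) (at_left t)"
  proof (cases "t \<le> r \<omega>")
    case True
    obtain l where "((\<lambda>s. X s \<omega>) \<longlongrightarrow> l) (at_left t)" using X w t unfolding cadlag_def by blast
    moreover have "\<forall>\<^sub>F s in at_left t. X s \<omega> = X (min (r \<omega>) s) \<omega>"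
      using eventually_at_left_real[of 0 t] t True by (auto elim!: eventually_mono simp: min_absorb2)
    ultimately show ?thesis by (auto simp: tendsto_cong)
  next
    case False
    have "\<forall>\<^sub>F s in at_left t. X (min (r \<omega>) s) \<omega> = X (r \<omega>) \<omega>"
      using eventually_at_left_real[of "r \<omega>" t] False by (auto elim!: eventually_mono simp: min_absorb1)
    then show ?thesis by (intro exI tendsto_eventually)
  qed
qed

section \<open>Times at which the variation becomes large\<close>

lemma dyadic_var_measurable:
  assumes "\<And>q. q \<in> dyadics \<Longrightarrow> q \<le> t \<Longrightarrow> a q \<in> borel_measurable (F t)"
  shows "(\<lambda>\<omega>. dyadic_var m t (\<lambda>s. a s \<omega>)) \<in> borel_measurable (F t)"
  unfolding dyadic_var_def
proof (rule borel_measurable_sum)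
  fix i :: nat assume i: "i \<in> {..<2^m}"
  show "(\<lambda>\<omega>. if T * real (Suc i) / 2 ^ m \<le> t then \<bar>a (T * real (Suc i) / 2 ^ m) \<omega> - a (T * real i / 2 ^ m) \<omega>\<bar> else 0) \<in> borel_measurable (F t)"
  proof (cases "T * real (Suc i) / 2 ^ m \<le> t")
    case True
    have "T * real i / 2 ^ m \<le> T * real (Suc i) / 2 ^ m" unfolding dyadic_grid_le by simp
    then have "a (T * real (Suc i) / 2 ^ m) \<in> borel_measurable (F t)" "a (T * real i / 2 ^ m) \<in> borel_measurable (F t)"
      using assms[of "T * real (Suc i) / 2 ^ m"] assms[of "T * real i / 2 ^ m"]
        dyadics_grid[of "Suc i" m] dyadics_grid[of i m] True i by auto
    then show ?thesis using True by simp
  qed simp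
qed

text \<open>If this time is finite, the variation is bounded by \<open>K\<close> only strictly
  before it, since the path may jump there. Estimates on the finite variation part are therefore
  made at earlier trading times.\<close>

definition var_time :: "(real \<Rightarrow> 'a \<Rightarrow> real) \<Rightarrow> real \<Rightarrow> 'a \<Rightarrow> ereal" where
  "var_time A K = dyadic_hit (\<lambda>q. {\<omega>\<in>space M. \<exists>m. K < dyadic_var m q (\<lambda>t. A t \<omega>)})"

lemma var_time_stopping_time:
  assumes "adapted F T A" shows "ext_stopping_time M F T (var_time A K)"
  unfolding var_time_def
proof (rule dyadic_hit_stopping_time)
  fix q assume q: "q \<in> dyadics"
  have [measurable]: "(\<lambda>\<omega>. dyadic_var m q (\<lambda>t. A t \<omega>)) \<in> borel_measurable (F q)" for m
  proof (rule dyadic_var_measurable)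
    fix r assume "r \<in> dyadics" "r \<le> q"
    then show "A r \<in> borel_measurable (F q)"
      using assms dyadics_range unfolding adapted_def by (intro borel_F_mono[of "A r" r q]) auto
  qed
  have "{\<omega>\<in>space (F q). \<exists>m. K < dyadic_var m q (\<lambda>t. A t \<omega>)} \<in> sets (F q)" by measurable
  then show "{\<omega>\<in>space M. \<exists>m. K < dyadic_var m q (\<lambda>t. A t \<omega>)} \<in> sets (F q)" by simp
qed

lemma var_time_before:
  assumes "\<omega> \<in> space M" "q \<in> dyadics" "ereal q < var_time A K \<omega>"
  shows "dyadic_var m q (\<lambda>t. A t \<omega>) \<le> K"
proof (rule ccontr)
  assume "\<not> ?thesis"
  then have "var_time A K \<omega> \<le> ereal q"
    unfolding var_time_def dyadic_hit_def by (intro Inf_lower) (use assms in \<open>auto simp: not_le\<close>)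
  then show False using assms(3) by simp
qed

lemma var_time_eventually:
  assumes "\<omega> \<in> space M" "s \<in> {0..T}" "ereal s < var_time A K \<omega>"
  shows "\<forall>\<^sub>F m in sequentially. dyadic_var m (dyadic_next m s) (\<lambda>t. A t \<omega>) \<le> K"
proof -
  have "(\<lambda>m. ereal (dyadic_next m s)) \<longlonglongrightarrow> ereal s" using dyadic_next_tendsto[OF assms(2)] by simp
  from order_tendstoD(2)[OF this assms(3)] show ?thesis
    by eventually_elim (rule var_time_before[OF assms(1) dyadic_next_dyadic])
qed

lemma ext_real_less:
  assumes "ext_stopping_time M F T \<sigma>" "\<omega> \<in> space M" "s < ext_real \<sigma> \<omega>"
  shows "ereal s < \<sigma> \<omega>"
  using assms(1,2) by (rule ext_real_cases) (use assms(3) in auto)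

lemma ext_stopping_time_infinity_sets:
  assumes "ext_stopping_time M F T \<sigma>" shows "{\<omega>\<in>space M. \<sigma> \<omega> = \<infinity>} \<in> sets M"
proof -
  have "{\<omega>\<in>space M. \<sigma> \<omega> \<le> ereal T} \<in> sets M" using assms F_sub[of T] T_pos unfolding ext_stopping_time_def by auto
  then have "space M - {\<omega>\<in>space M. \<sigma> \<omega> \<le> ereal T} \<in> sets M" by auto
  also have "space M - {\<omega>\<in>space M. \<sigma> \<omega> \<le> ereal T} = {\<omega>\<in>space M. \<sigma> \<omega> = \<infinity>}"
    using assms unfolding ext_stopping_time_def by fastforce
  finally show ?thesis .
qed

lemma var_time_tendsto:
  assumes A: "finite_variation_process M F T A"
  shows "(\<lambda>k. measure M {\<omega>\<in>space M. var_time A (real k) \<omega> = \<infinity>}) \<longlonglongrightarrow> 1"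
proof -
  define E where "E k = {\<omega>\<in>space M. var_time A (real k) \<omega> = \<infinity>}" for k
  have aA: "adapted F T A" using A unfolding finite_variation_process_def by auto
  have Em: "E k \<in> sets M" for k
    unfolding E_def by (rule ext_stopping_time_infinity_sets[OF var_time_stopping_time[OF aA]])
  have Ee: "E k = {\<omega>\<in>space M. \<forall>q\<in>dyadics. \<forall>m. dyadic_var m q (\<lambda>t. A t \<omega>) \<le> real k}" for k
    unfolding E_def var_time_def dyadic_hit_infinity by (auto simp: not_less)
  have inc: "incseq E" unfolding incseq_def Ee
  proof (intro allI impI subsetI CollectI conjI ballI)
    fix k l :: nat and \<omega> q m
    assume kl: "k \<le> l" and w: "\<omega> \<in> {\<omega> \<in> space M. \<forall>q\<in>dyadics. \<forall>m. dyadic_var m q (\<lambda>t. A t \<omega>) \<le> real k}"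
    then show "\<omega> \<in> space M" by simp
    assume "q \<in> dyadics"
    then have "dyadic_var m q (\<lambda>t. A t \<omega>) \<le> real k" using w by simp
    also have "\<dots> \<le> real l" using kl by simp
    finally show "dyadic_var m q (\<lambda>t. A t \<omega>) \<le> real l" .
  qed
  have "AE \<omega> in M. finite_total_variation T (\<lambda>t. A t \<omega>)" using A unfolding finite_variation_process_def by auto
  then have "AE \<omega> in M. \<omega> \<in> (\<Union>k. E k)"
    using AE_space
  proof eventually_elim
    case (elim \<omega>)
    then obtain C where C: "\<And>n p. p 0 = 0 \<and> p n = T \<and> (\<forall>i<n. p i \<le> p (Suc i)) \<Longrightarrow> (\<Sum>i<n. \<bar>A (p (Suc i)) \<omega> - A (p i) \<omega>\<bar>) \<le> C"
      unfolding finite_total_variation_def by blast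
    obtain k where "C \<le> real k" using real_arch_simple by blast
    moreover have "dyadic_var m q (\<lambda>t. A t \<omega>) \<le> C" for m q by (rule dyadic_var_le_total) (use C in blast)
    ultimately show ?case unfolding Ee using elim(2) by (auto intro: order_trans)
  qed
  then have "measure M (\<Union>k. E k) = 1" using Em by (intro prob_eq_1[THEN iffD2]) auto
  then show ?thesis using finite_Lim_measure_incseq[of E] Em inc unfolding E_def by auto
qed

lemma simple_integral_add:
  assumes "simple_integrand M F T H" "\<omega> \<in> space M" "t \<in> {0..T}" "\<And>t. t \<in> {0..T} \<Longrightarrow> S t \<omega> = N t \<omega> + A t \<omega>"
  shows "simple_integral H S t \<omega> = simple_integral H N t \<omega> + simple_integral H A t \<omega>"
proof -
  have "S (min (times H i \<omega>) t) \<omega> = N (min (times H i \<omega>) t) \<omega> + A (min (times H i \<omega>) t) \<omega>" if "i \<le> steps H" for i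
    using simple_integrand_times(5)[OF assms(1,2) that] assms(3) by (intro assms(4)) auto
  then show ?thesis unfolding simple_integral_def sum.distrib[symmetric]
    by (intro sum.cong) (auto simp: algebra_simps)
qed

text \<open>The gains of \<open>H\<close> against \<open>N\<close> stopped at \<open>\<rho>\<close> are bounded below by the last jump time before
  \<open>\<rho>\<close>: up to there \<open>H \<cdot> N = H \<cdot> S - H \<cdot> A\<close> is controlled, and afterwards \<open>H\<close> is constant.\<close>

lemma stopped_gains_lower_bound:
  assumes H: "simple_integrand M F T H" and w: "\<omega> \<in> space M"
    and S: "cadlag M T S" and A: "cadlag M T A" and e: "\<And>t. t \<in> {0..T} \<Longrightarrow> S t \<omega> = N t \<omega> + A t \<omega>"
    and b: "\<forall>q\<in>dyadics. \<bar>simple_process H q \<omega>\<bar> \<le> \<epsilon>"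
    and l: "\<forall>q\<in>dyadics. \<bar>max (- simple_integral H S q \<omega>) 0\<bar> \<le> \<epsilon>"
    and "0 \<le> \<epsilon>" "0 \<le> K" and \<rho>: "\<rho> \<in> {0..T}"
    and C: "\<And>s. s \<in> {0..\<rho>} \<Longrightarrow> \<bar>S s \<omega>\<bar> \<le> C"
    and K: "\<And>s. 0 \<le> s \<Longrightarrow> s < \<rho> \<Longrightarrow> \<forall>\<^sub>F m in sequentially. dyadic_var m (dyadic_next m s) (\<lambda>t. A t \<omega>) \<le> K"
  shows "simple_integral H N \<rho> \<omega> \<ge> - (\<epsilon> * (1 + 2 * K + 2 * C + \<bar>N 0 \<omega>\<bar> + \<bar>N \<rho> \<omega>\<bar>))"
proof (cases "\<rho> = 0")
  case True
  have "simple_integral H N \<rho> \<omega> = 0" unfolding simple_integral_def True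
    using simple_integrand_times(5)[OF H w] by (intro sum.neutral) (auto simp: min_absorb2)
  moreover have "0 \<le> C" using C[of 0] True by force
  ultimately show ?thesis using \<open>0 \<le> \<epsilon>\<close> \<open>0 \<le> K\<close> by simp
next
  case False
  note tm = simple_integrand_times[OF H w]
  have \<rho>0: "0 < \<rho>" using \<rho> False by auto
  \<comment> \<open>The index \<open>k\<close> marks the first trading time that reaches
    \<open>\<rho>\<close>. With \<open>k = Suc j\<close>, the time \<open>s\<close> of index
    \<open>j\<close> is the last one strictly before \<open>\<rho>\<close>, and a single coefficient
    is in force in between.\<close>
  define k where "k = (LEAST k. \<rho> \<le> times H k \<omega>)"
  have ex: "\<rho> \<le> times H (steps H) \<omega>" using tm(3) \<rho> by auto
  have k: "\<rho> \<le> times H k \<omega>" "k \<le> steps H" unfolding k_def using LeastI[of "\<lambda>k. \<rho> \<le> times H k \<omega>", OF ex] Least_le[of "\<lambda>k. \<rho> \<le> times H k \<omega>", OF ex] by auto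
  have "k \<noteq> 0" using k(1) tm(2) \<rho>0 by (intro notI) simp
  then obtain j where j: "k = Suc j" by (cases k) auto
  have "\<not> \<rho> \<le> times H j \<omega>" using not_less_Least[of j "\<lambda>k. \<rho> \<le> times H k \<omega>"] j unfolding k_def by auto
  then have s: "times H j \<omega> < \<rho>" by simp
  define s where "s = times H j \<omega>"
  have sr: "0 \<le> s" "s < \<rho>" "s \<in> {0..T}" using tm(5)[of j] k(2) j s unfolding s_def by auto
  have Is: "- \<epsilon> \<le> simple_integral H S s \<omega>"
  proof -
    have "(\<lambda>m. simple_integral H S (dyadic_next m s) \<omega>) \<longlonglongrightarrow> simple_integral H S s \<omega>"
      by (rule simple_integral_right_limit[OF S w tm(5) sr(3) dyadic_next_tendsto[OF sr(3)] dyadic_next_range[OF sr(3)]])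
    moreover have "- \<epsilon> \<le> simple_integral H S (dyadic_next m s) \<omega>" for m
      using l[rule_format, OF dyadic_next_dyadic[of m s]] by linarith
    ultimately show ?thesis by (intro tendsto_lowerbound[where F=sequentially]) auto
  qed
  have IA: "\<bar>simple_integral H A s \<omega>\<bar> \<le> \<epsilon> * K"
    by (rule simple_integral_var_bound[OF H w A b \<open>0 \<le> \<epsilon>\<close> sr(3) K[OF sr(1,2)]])
  have IN: "simple_integral H N s \<omega> = simple_integral H S s \<omega> - simple_integral H A s \<omega>"
    using simple_integral_add[of H \<omega> s S N A] H w sr(3) e by simp
  have c: "\<bar>coeff H (Suc j) \<omega>\<bar> \<le> \<epsilon>"
    by (rule simple_process_coeff[OF H w _ _ b]) (use j k s in auto)
  have A0: "\<bar>A s \<omega> - A 0 \<omega>\<bar> \<le> K"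
    using partition_var_le[OF A w, of 1 "\<lambda>i. if i = 0 then 0 else s" K] K[OF sr(1,2)] sr by auto
  \<comment> \<open>Here \<open>N s\<close> equals \<open>N 0 + (S s - S 0) - (A s - A 0)\<close>,
    which is controlled. The value \<open>N \<rho>\<close> after a possible jump is kept as it
    stands; optional stopping will make it integrable.\<close>
  have "\<bar>N \<rho> \<omega> - N s \<omega>\<bar> \<le> 2 * C + K + \<bar>N 0 \<omega>\<bar> + \<bar>N \<rho> \<omega>\<bar>"
    using A0 C[of s] C[of 0] e[of s] e[of 0] sr \<rho> by auto
  then have "\<bar>coeff H (Suc j) \<omega> * (N \<rho> \<omega> - N s \<omega>)\<bar> \<le> \<epsilon> * (2 * C + K + \<bar>N 0 \<omega>\<bar> + \<bar>N \<rho> \<omega>\<bar>)"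
    using c \<open>0 \<le> \<epsilon>\<close> unfolding abs_mult by (intro mult_mono) auto
  moreover have "simple_integral H N \<rho> \<omega> = simple_integral H N s \<omega> + coeff H (Suc j) \<omega> * (N \<rho> \<omega> - N s \<omega>)"
    unfolding s_def by (rule simple_integral_diff) (use tm(1) j k s in auto)
  ultimately show ?thesis using Is IA IN by (auto simp: algebra_simps)
qed

text \<open>The stopped gains \<open>G\<close> have mean zero and are at least
  \<open>- \<epsilon> * Q\<close>, with \<open>Q\<close> integrable and independent of the strategy,
  so their mean absolute value is at most \<open>2 * \<epsilon>\<close> times the mean of
  \<open>Q\<close>. When all three times are infinite, \<open>G\<close> is the full gain against
  \<open>N\<close> and the gain against \<open>A\<close> is at most \<open>\<epsilon> * K\<close>.
  The constant \<open>q\<close> is quantified before \<open>H\<close> so that it serves a whole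
  sequence of strategies.\<close>

lemma stopped_gains_estimate:
  assumes S: "cadlag M T S" "adapted F T S" and N: "cadlag M T N" and A: "cadlag M T A" "adapted F T A"
    and e: "\<And>t \<omega>. t \<in> {0..T} \<Longrightarrow> \<omega> \<in> space M \<Longrightarrow> S t \<omega> = N t \<omega> + A t \<omega>"
    and \<sigma>: "ext_stopping_time M F T \<sigma>" "AE \<omega> in M. \<forall>t\<in>{0..T}. \<bar>stopped S \<sigma> t \<omega>\<bar> \<le> C"
    and \<nu>: "ext_stopping_time M F T \<nu>" "martingale M F T (stopped N \<nu>)"
    and "0 \<le> K"
  shows "\<exists>q\<ge>0. \<forall>H \<epsilon> c. simple_integrand M F T H \<and> 0 \<le> \<epsilon> \<and> 0 < c \<and> \<epsilon> * K \<le> c \<and>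
    sup_norm M T (\<lambda>t \<omega>. max (- simple_integral H S t \<omega>) 0) \<le> ereal \<epsilon> \<and> sup_norm M T (simple_process H) \<le> ereal \<epsilon> \<longrightarrow>
    measure M {\<omega>\<in>space M. \<bar>max (simple_integral H S T \<omega>) 0 - 0\<bar> > 2 * c} \<le>
      measure M (space M - {\<omega>\<in>space M. \<sigma> \<omega> = \<infinity>}) + measure M (space M - {\<omega>\<in>space M. \<nu> \<omega> = \<infinity>})
      + measure M (space M - {\<omega>\<in>space M. var_time A K \<omega> = \<infinity>}) + \<epsilon> * q / c"
proof -
  define \<tau> where "\<tau> = var_time A K"
  have \<tau>: "ext_stopping_time M F T \<tau>" unfolding \<tau>_def by (rule var_time_stopping_time[OF A(2)])
  define \<rho> where "\<rho> \<omega> = min (ext_real \<sigma> \<omega>) (min (ext_real \<nu> \<omega>) (ext_real \<tau> \<omega>))" for \<omega>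
  have \<rho>st: "stopping_time F \<rho>" unfolding \<rho>_def
    by (intro stopping_time_min ext_real_stopping_time \<sigma> \<nu> \<tau>)
  have \<rho>r: "\<rho> \<omega> \<in> {0..T}" if "\<omega> \<in> space M" for \<omega>
    using ext_real_range[OF \<sigma>(1) that] ext_real_range[OF \<nu>(1) that] ext_real_range[OF \<tau> that] unfolding \<rho>_def by auto
  define X where "X t \<omega> = N (min (ext_real \<nu> \<omega>) t) \<omega>" for t \<omega>
  have Xm: "martingale M F T X"
    by (rule martingale_cong[OF \<nu>(2)]) (use stopped_eq[OF \<nu>(1)] in \<open>auto simp: X_def\<close>)
  have Xc: "cadlag M T X" unfolding X_def by (rule cadlag_stopped[OF N])
  have X\<rho>: "X (\<rho> \<omega>) \<omega> = N (\<rho> \<omega>) \<omega>" for \<omega> unfolding X_def \<rho>_def by (simp add: min_absorb2)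
  have X0: "X 0 \<omega> = N 0 \<omega>" if "\<omega> \<in> space M" for \<omega>
    using ext_real_range[OF \<nu>(1) that] unfolding X_def by (simp add: min_absorb2)
  have iX: "integrable M (\<lambda>\<omega>. X (\<rho> \<omega>) \<omega>)"
    by (rule optional_stopping(1)[OF Xm Xc \<rho>st \<rho>r, of "\<lambda>_. 0" 0]) auto
  have iX0: "integrable M (X 0)" using Xm T_pos unfolding martingale_def by auto
  define Q where "Q \<omega> = 1 + 2 * K + 2 * \<bar>C\<bar> + \<bar>X 0 \<omega>\<bar> + \<bar>X (\<rho> \<omega>) \<omega>\<bar>" for \<omega>
  have Qi: "integrable M Q" unfolding Q_def using iX iX0 by auto
  have Q0: "0 \<le> Q \<omega>" for \<omega> unfolding Q_def using \<open>0 \<le> K\<close> by simp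
  have main: "measure M {\<omega>\<in>space M. \<bar>max (simple_integral H S T \<omega>) 0 - 0\<bar> > 2 * c} \<le>
      measure M (space M - {\<omega>\<in>space M. \<sigma> \<omega> = \<infinity>}) + measure M (space M - {\<omega>\<in>space M. \<nu> \<omega> = \<infinity>})
      + measure M (space M - {\<omega>\<in>space M. \<tau> \<omega> = \<infinity>}) + \<epsilon> * (2 * (\<integral>\<omega>. Q \<omega> \<partial>M)) / c"
    if H: "simple_integrand M F T H" and eps: "0 \<le> \<epsilon>" "0 < c" "\<epsilon> * K \<le> c"
      and neg: "sup_norm M T (\<lambda>t \<omega>. max (- simple_integral H S t \<omega>) 0) \<le> ereal \<epsilon>"
      and pr: "sup_norm M T (simple_process H) \<le> ereal \<epsilon>" for H \<epsilon> c
  proof -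
    define G where "G \<omega> = simple_integral H X (\<rho> \<omega>) \<omega>" for \<omega>
    have Gi: "integrable M G" and G0: "(\<integral>\<omega>. G \<omega> \<partial>M) = 0"
      unfolding G_def using simple_integral_martingale_expectation[OF H Xm Xc \<rho>st \<rho>r] by auto
    have GN: "G \<omega> = simple_integral H N (\<rho> \<omega>) \<omega>" for \<omega>
    proof -
      have "min (ext_real \<nu> \<omega>) (min x (\<rho> \<omega>)) = min x (\<rho> \<omega>)" for x unfolding \<rho>_def by auto
      then show ?thesis unfolding G_def simple_integral_def X_def by simp
    qed
    have sS: "\<bar>S s \<omega>\<bar> \<le> \<bar>C\<bar>" if w: "\<omega> \<in> space M" and b: "\<forall>t\<in>{0..T}. \<bar>stopped S \<sigma> t \<omega>\<bar> \<le> C" and s: "s \<in> {0..\<rho> \<omega>}" for s \<omega>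
    proof -
      have sT: "s \<in> {0..T}" using s \<rho>r[OF w] by auto
      have "min (ext_real \<sigma> \<omega>) s = s" using s unfolding \<rho>_def by auto
      then show ?thesis using b[rule_format, OF sT] stopped_eq[OF \<sigma>(1) w sT, of S] by simp
    qed
    have vK: "\<forall>\<^sub>F m in sequentially. dyadic_var m (dyadic_next m s) (\<lambda>t. A t \<omega>) \<le> K"
      if w: "\<omega> \<in> space M" and s: "0 \<le> s" "s < \<rho> \<omega> \<or> \<tau> \<omega> = \<infinity>" "s \<le> T" for s \<omega>
    proof (rule var_time_eventually[OF w])
      show "s \<in> {0..T}" using s by auto
      show "ereal s < var_time A K \<omega>"
        using s(2)
      proof
        assume "s < \<rho> \<omega>"
        then have "s < ext_real \<tau> \<omega>" unfolding \<rho>_def by auto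
        from ext_real_less[OF \<tau> w this] show ?thesis unfolding \<tau>_def .
      qed (simp add: \<tau>_def)
    qed
    note ae = sup_norm_AE[OF neg] sup_norm_AE[OF pr] \<sigma>(2) AE_space
    have lb: "AE \<omega> in M. G \<omega> \<ge> - (\<epsilon> * Q \<omega>)"
      using ae
    proof eventually_elim
      case (elim \<omega>)
      have "simple_integral H N (\<rho> \<omega>) \<omega> \<ge> - (\<epsilon> * (1 + 2 * K + 2 * \<bar>C\<bar> + \<bar>N 0 \<omega>\<bar> + \<bar>N (\<rho> \<omega>) \<omega>\<bar>))"
      proof (rule stopped_gains_lower_bound[OF H elim(4) S(1) A(1) _ elim(2) elim(1) eps(1) \<open>0 \<le> K\<close> \<rho>r[OF elim(4)] sS[OF elim(4) elim(3)]])
        show "S t \<omega> = N t \<omega> + A t \<omega>" if "t \<in> {0..T}" for t by (rule e[OF that elim(4)])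
        show "\<forall>\<^sub>F m in sequentially. dyadic_var m (dyadic_next m s) (\<lambda>t. A t \<omega>) \<le> K" if "0 \<le> s" "s < \<rho> \<omega>" for s
          using vK[OF elim(4), of s] that \<rho>r[OF elim(4)] by auto
      qed
      then show ?case unfolding GN Q_def X\<rho> X0[OF elim(4)] .
    qed
    have aG: "(\<integral>\<omega>. \<bar>G \<omega>\<bar> \<partial>M) \<le> \<epsilon> * (2 * (\<integral>\<omega>. Q \<omega> \<partial>M))"
    proof -
      have "(\<integral>\<omega>. \<bar>G \<omega>\<bar> \<partial>M) \<le> (\<integral>\<omega>. G \<omega> + 2 * (\<epsilon> * Q \<omega>) \<partial>M)"
      proof (rule integral_mono_AE)
        show "AE \<omega> in M. \<bar>G \<omega>\<bar> \<le> G \<omega> + 2 * (\<epsilon> * Q \<omega>)"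
          using lb
        proof eventually_elim
          case (elim \<omega>)
          have "0 \<le> \<epsilon> * Q \<omega>" using eps(1) Q0 by simp
          then show ?case using elim by linarith
        qed
      qed (use Gi Qi in auto)
      also have "\<dots> = \<epsilon> * (2 * (\<integral>\<omega>. Q \<omega> \<partial>M))" using Gi Qi G0 by simp
      finally show ?thesis .
    qed
    have [measurable]: "G \<in> borel_measurable M" using Gi by auto
    have mk: "measure M {\<omega>\<in>space M. \<bar>G \<omega>\<bar> \<ge> c} \<le> \<epsilon> * (2 * (\<integral>\<omega>. Q \<omega> \<partial>M)) / c"
    proof -
      have "measure M {\<omega>\<in>space M. \<bar>G \<omega>\<bar> \<ge> c} \<le> (\<integral>\<omega>. \<bar>G \<omega>\<bar> \<partial>M) / c"
        by (rule integral_Markov_inequality_measure[where A="{}"]) (use Gi eps in auto)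
      also have "\<dots> \<le> \<epsilon> * (2 * (\<integral>\<omega>. Q \<omega> \<partial>M)) / c" using aG eps by (intro divide_right_mono) auto
      finally show ?thesis .
    qed
    let ?a = "space M - {\<omega>\<in>space M. \<sigma> \<omega> = \<infinity>}" and ?b = "space M - {\<omega>\<in>space M. \<nu> \<omega> = \<infinity>}"
      and ?d = "space M - {\<omega>\<in>space M. \<tau> \<omega> = \<infinity>}" and ?g = "{\<omega>\<in>space M. \<bar>G \<omega>\<bar> \<ge> c}"
    have ms: "?a \<in> sets M" "?b \<in> sets M" "?d \<in> sets M" "?g \<in> sets M"
      using ext_stopping_time_infinity_sets[OF \<sigma>(1)] ext_stopping_time_infinity_sets[OF \<nu>(1)] ext_stopping_time_infinity_sets[OF \<tau>] by auto
    have "measure M {\<omega>\<in>space M. \<bar>max (simple_integral H S T \<omega>) 0 - 0\<bar> > 2 * c} \<le> measure M (((?a \<union> ?b) \<union> ?d) \<union> ?g)"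
    proof (rule finite_measure_mono_AE)
      show "AE \<omega> in M. \<omega> \<in> {\<omega>\<in>space M. \<bar>max (simple_integral H S T \<omega>) 0 - 0\<bar> > 2 * c} \<longrightarrow> \<omega> \<in> ((?a \<union> ?b) \<union> ?d) \<union> ?g"
        using ae
      proof eventually_elim
        case (elim \<omega>)
        show ?case
        proof (intro impI, rule ccontr)
          assume big: "\<omega> \<in> {\<omega>\<in>space M. \<bar>max (simple_integral H S T \<omega>) 0 - 0\<bar> > 2 * c}"
            and n: "\<omega> \<notin> ((?a \<union> ?b) \<union> ?d) \<union> ?g"
          then have inf: "\<sigma> \<omega> = \<infinity>" "\<nu> \<omega> = \<infinity>" "\<tau> \<omega> = \<infinity>" and Gc: "\<bar>G \<omega>\<bar> < c" by (auto simp: not_le)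
          have "\<rho> \<omega> = T" unfolding \<rho>_def ext_real_def inf by simp
          then have GT: "G \<omega> = simple_integral H N T \<omega>" using GN[of \<omega>] by simp
          have T: "T \<in> {0..T}" using T_pos by auto
          have "\<bar>simple_integral H A T \<omega>\<bar> \<le> \<epsilon> * K"
            by (rule simple_integral_var_bound[OF H elim(4) A(1) elim(2) eps(1) T]) (use vK[OF elim(4), of T] inf T_pos in auto)
          moreover have "simple_integral H S T \<omega> = simple_integral H N T \<omega> + simple_integral H A T \<omega>"
            by (rule simple_integral_add[OF H elim(4) T]) (rule e[OF _ elim(4)])
          ultimately have "simple_integral H S T \<omega> < 2 * c" using Gc GT eps(3) by linarith
          then show False using big eps(2) by auto
        qed
      qed
    qed (use ms in auto)
    also have "\<dots> \<le> measure M ?a + measure M ?b + measure M ?d + measure M ?g"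
      using measure_Un_le[OF ms(1,2)] measure_Un_le[OF sets.Un[OF ms(1,2)] ms(3)]
        measure_Un_le[OF sets.Un[OF sets.Un[OF ms(1,2)] ms(3)] ms(4)] by linarith
    finally show ?thesis using mk by linarith
  qed
  show ?thesis
    by (rule exI[of _ "2 * (\<integral>\<omega>. Q \<omega> \<partial>M)"]) (use main Q0 in \<open>auto simp: \<tau>_def intro!: integral_nonneg\<close>)
qed

lemma ereal_tendsto_0_le:
  assumes "(x :: nat \<Rightarrow> ereal) \<longlonglongrightarrow> 0" "0 < \<epsilon>" shows "\<forall>\<^sub>F n in sequentially. x n \<le> ereal \<epsilon>"
  using order_tendstoD(2)[OF assms(1), of "ereal \<epsilon>"] assms(2) by (auto elim: eventually_mono)

theorem semimartingale_no_free_lunch: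
  assumes S: "cadlag M T S" "adapted F T S" "locally_bounded M F T S" and semi: "semimartingale M F T S"
  shows "no_free_lunch_vrli M F T S"
  unfolding no_free_lunch_vrli_def tendsto_in_prob_def
proof (intro allI impI)
  fix H :: "nat \<Rightarrow> 'a simple_data" and c' :: real
  assume H: "\<forall>n. simple_integrand M F T (H n)"
    and neg: "(\<lambda>n. sup_norm M T (\<lambda>t \<omega>. max (- simple_integral (H n) S t \<omega>) 0)) \<longlonglongrightarrow> 0"
    and pr: "(\<lambda>n. sup_norm M T (simple_process (H n))) \<longlonglongrightarrow> 0" and c': "0 < c'"
  obtain N A where N: "local_martingale M F T N" and A: "finite_variation_process M F T A"
    and e: "\<And>t \<omega>. t \<in> {0..T} \<Longrightarrow> \<omega> \<in> space M \<Longrightarrow> S t \<omega> = N t \<omega> + A t \<omega>"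
    using semi unfolding semimartingale_def by blast
  have A': "cadlag M T A" "adapted F T A" using A unfolding finite_variation_process_def by auto
  have N': "cadlag M T N" using N unfolding local_martingale_def by auto
  obtain \<nu> where \<nu>: "localizing_seq M F T \<nu>" "\<And>k. martingale M F T (stopped N (\<nu> k))"
    using N unfolding local_martingale_def by blast
  obtain \<sigma> where \<sigma>: "localizing_seq M F T \<sigma>" "\<And>k. \<exists>C. AE \<omega> in M. \<forall>t\<in>{0..T}. \<bar>stopped S (\<sigma> k) t \<omega>\<bar> \<le> C"
    using S(3) unfolding locally_bounded_def by blast
  define c where "c = c' / 2"
  have c: "0 < c" unfolding c_def using c' by simp
  show "(\<lambda>n. measure M {\<omega>\<in>space M. \<bar>max (simple_integral (H n) S T \<omega>) 0 - 0\<bar> > c'}) \<longlonglongrightarrow> 0"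
  proof (rule LIMSEQ_I)
    fix r :: real assume r: "0 < r"
    have compl: "measure M (space M - E) < r / 4" if "1 - r/4 < measure M E" "E \<in> sets M" for E
      using prob_compl[OF that(2)] that(1) by simp
    have lim: "\<exists>k. 1 - r/4 < f k" if "f \<longlonglongrightarrow> 1" for f :: "nat \<Rightarrow> real"
      using order_tendstoD(1)[OF that, of "1 - r/4"] r by (auto simp: eventually_sequentially)
    obtain k1 where k1: "1 - r/4 < measure M {\<omega>\<in>space M. \<sigma> k1 \<omega> = \<infinity>}"
      using lim[of "\<lambda>k. measure M {\<omega>\<in>space M. \<sigma> k \<omega> = \<infinity>}"] \<sigma>(1) unfolding localizing_seq_def by blast
    obtain k2 where k2: "1 - r/4 < measure M {\<omega>\<in>space M. \<nu> k2 \<omega> = \<infinity>}"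
      using lim[of "\<lambda>k. measure M {\<omega>\<in>space M. \<nu> k \<omega> = \<infinity>}"] \<nu>(1) unfolding localizing_seq_def by blast
    obtain k3 where k3: "1 - r/4 < measure M {\<omega>\<in>space M. var_time A (real k3) \<omega> = \<infinity>}"
      using lim[OF var_time_tendsto[OF A]] by blast
    have st: "ext_stopping_time M F T (\<sigma> k1)" "ext_stopping_time M F T (\<nu> k2)"
      using \<sigma>(1) \<nu>(1) unfolding localizing_seq_def by auto
    obtain C where C: "AE \<omega> in M. \<forall>t\<in>{0..T}. \<bar>stopped S (\<sigma> k1) t \<omega>\<bar> \<le> C" using \<sigma>(2) by blast
    obtain q where q: "0 \<le> q" and est: "\<And>H \<epsilon> c. simple_integrand M F T H \<and> 0 \<le> \<epsilon> \<and> 0 < c \<and> \<epsilon> * real k3 \<le> c \<and>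
        sup_norm M T (\<lambda>t \<omega>. max (- simple_integral H S t \<omega>) 0) \<le> ereal \<epsilon> \<and> sup_norm M T (simple_process H) \<le> ereal \<epsilon> \<Longrightarrow>
        measure M {\<omega>\<in>space M. \<bar>max (simple_integral H S T \<omega>) 0 - 0\<bar> > 2 * c} \<le>
          measure M (space M - {\<omega>\<in>space M. \<sigma> k1 \<omega> = \<infinity>}) + measure M (space M - {\<omega>\<in>space M. \<nu> k2 \<omega> = \<infinity>})
          + measure M (space M - {\<omega>\<in>space M. var_time A (real k3) \<omega> = \<infinity>}) + \<epsilon> * q / c"
      using stopped_gains_estimate[OF S(1,2) N' A' e st(1) C st(2) \<nu>(2), of "real k3"] by auto
    \<comment> \<open>The first entry makes the gain against \<open>A\<close> at most
      \<open>c\<close>, the second makes the Markov term at most \<open>r / 4\<close>; the three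
      exceptional events have probability below \<open>r / 4\<close> each.\<close>
    define \<epsilon> where "\<epsilon> = min (c / (real k3 + 1)) (r * c / (4 * (q + 1)))"
    have e0: "0 < \<epsilon>" unfolding \<epsilon>_def using c r q by simp
    have e1: "\<epsilon> * real k3 \<le> c"
    proof -
      have "\<epsilon> * real k3 \<le> \<epsilon> * (real k3 + 1)" using e0 by simp
      also have "\<dots> \<le> c / (real k3 + 1) * (real k3 + 1)" unfolding \<epsilon>_def by (intro mult_right_mono) auto
      finally show ?thesis by simp
    qed
    have e2: "\<epsilon> * q / c \<le> r / 4"
    proof -
      have "\<epsilon> * q \<le> \<epsilon> * (q + 1)" using e0 by simp
      also have "\<dots> \<le> r * c / (4 * (q + 1)) * (q + 1)" unfolding \<epsilon>_def using q by (intro mult_right_mono) auto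
      also have "\<dots> = r * c / 4"
      proof -
        have "q + 1 \<noteq> 0" using q by linarith
        then show ?thesis by (metis nonzero_mult_div_cancel_right times_divide_eq_left mult_divide_mult_cancel_right mult.commute)
      qed
      finally show ?thesis using c by (simp add: field_simps)
    qed
    have "\<forall>\<^sub>F n in sequentially. measure M {\<omega>\<in>space M. \<bar>max (simple_integral (H n) S T \<omega>) 0 - 0\<bar> > c'} < r"
      using ereal_tendsto_0_le[OF neg e0] ereal_tendsto_0_le[OF pr e0]
    proof eventually_elim
      case (elim n)
      have "measure M {\<omega>\<in>space M. \<bar>max (simple_integral (H n) S T \<omega>) 0 - 0\<bar> > 2 * c} \<le>
          measure M (space M - {\<omega>\<in>space M. \<sigma> k1 \<omega> = \<infinity>}) + measure M (space M - {\<omega>\<in>space M. \<nu> k2 \<omega> = \<infinity>})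
          + measure M (space M - {\<omega>\<in>space M. var_time A (real k3) \<omega> = \<infinity>}) + \<epsilon> * q / c"
        by (rule est) (use H e0 e1 c elim in auto)
      then show ?case
        using compl[OF k1 ext_stopping_time_infinity_sets[OF st(1)]] compl[OF k2 ext_stopping_time_infinity_sets[OF st(2)]]
          compl[OF k3 ext_stopping_time_infinity_sets[OF var_time_stopping_time[OF A'(2)]]] e2
        unfolding c_def by simp
    qed
    then show "\<exists>no. \<forall>n\<ge>no. norm (measure M {\<omega>\<in>space M. \<bar>max (simple_integral (H n) S T \<omega>) 0 - 0\<bar> > c'} - 0) < r"
      unfolding eventually_sequentially by simp
  qed
qed

end

section \<open>Tightness of the dyadic drifts\<close>

text \<open>In the application \<open>Y\<close> is a stopped and rescaled \<open>S\<close>.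
  \<open>Y_nfl\<close> is absence of free lunches in quantitative form: uniformly over all grids,
  gains of strategies bounded by \<open>1\<close> that never lose more than \<open>1\<close> at a
  grid time are bounded in probability.\<close>

locale bounded_nfl = usual_filtered_prob_space +
  fixes Y :: "real \<Rightarrow> 'a \<Rightarrow> real"
  assumes Y_cadlag: "cadlag M T Y" and Y_adapted: "adapted F T Y"
    and Y_bound: "\<And>t \<omega>. t \<in> {0..T} \<Longrightarrow> \<omega> \<in> space M \<Longrightarrow> \<bar>Y t \<omega>\<bar> \<le> 1"
    and Y_nfl: "\<And>\<epsilon>. 0 < \<epsilon> \<Longrightarrow> \<exists>K. \<forall>n f.
      (\<forall>i<2^n. f i \<in> borel_measurable (F (T * real i / 2 ^ n)) \<and> (\<forall>\<omega>\<in>space M. \<bar>f i \<omega>\<bar> \<le> 1)) \<and>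
      (\<forall>m\<le>2^n. \<forall>\<omega>\<in>space M. - 1 \<le> (\<Sum>i<m. f i \<omega> * (Y (T * real (Suc i) / 2 ^ n) \<omega> - Y (T * real i / 2 ^ n) \<omega>))) \<longrightarrow>
      measure M {\<omega>\<in>space M. (\<Sum>i<2^n. f i \<omega> * (Y (T * real (Suc i) / 2 ^ n) \<omega> - Y (T * real i / 2 ^ n) \<omega>)) > K} \<le> \<epsilon>"
begin

definition grid :: "nat \<Rightarrow> nat \<Rightarrow> real" where "grid n i = T * real i / 2 ^ n"

definition incr :: "nat \<Rightarrow> nat \<Rightarrow> 'a \<Rightarrow> real" where "incr n i \<omega> = Y (grid n (Suc i)) \<omega> - Y (grid n i) \<omega>"

text \<open>The drift is clipped to \<open>[-2, 2]\<close>, which changes the conditional expectation only on a null set,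
  so that all discrete processes below are bounded everywhere.\<close>

definition drift :: "nat \<Rightarrow> nat \<Rightarrow> 'a \<Rightarrow> real" where
  "drift n i \<omega> = max (-2) (min 2 (real_cond_exp M (F (grid n i)) (incr n i) \<omega>))"

lemma grid_in: "i \<le> 2 ^ n \<Longrightarrow> grid n i \<in> {0..T}" unfolding grid_def by (rule dyadic_in)
lemma grid_dyadic: "i \<le> 2 ^ n \<Longrightarrow> grid n i \<in> dyadics" unfolding grid_def by (rule dyadics_grid)
lemma grid_le: "grid n i \<le> grid n j \<longleftrightarrow> i \<le> j" unfolding grid_def by (rule dyadic_grid_le)
lemma grid_0[simp]: "grid n 0 = 0" unfolding grid_def by simp
lemma grid_T: "grid n (2 ^ n) = T" unfolding grid_def by simp

lemma grid_refine:
  assumes "k \<le> j" shows "grid k i = grid j (i * 2 ^ (j - k))"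
proof -
  have "(2::real) ^ j = 2 ^ k * 2 ^ (j - k)" using assms by (simp add: power_add[symmetric])
  then show ?thesis unfolding grid_def by (simp add: field_simps)
qed

lemma Y_grid_measurable: "i \<le> 2 ^ n \<Longrightarrow> Y (grid n i) \<in> borel_measurable (F (grid n i))"
  using Y_adapted grid_in[of i n] unfolding adapted_def by auto

lemma Y_grid_M[measurable]: "i \<le> 2 ^ n \<Longrightarrow> Y (grid n i) \<in> borel_measurable M"
  using borel_F_M[OF Y_grid_measurable grid_in] by auto

lemma incr_M: "i < 2 ^ n \<Longrightarrow> incr n i \<in> borel_measurable M"
  unfolding incr_def by (intro borel_measurable_diff Y_grid_M) auto

lemma incr_measurable: "i < j \<Longrightarrow> j \<le> 2 ^ n \<Longrightarrow> incr n i \<in> borel_measurable (F (grid n j))"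
  unfolding incr_def
  by (intro borel_measurable_diff borel_F_mono[OF Y_grid_measurable]) (auto simp: grid_le)

lemma incr_bound: "i < 2 ^ n \<Longrightarrow> \<omega> \<in> space M \<Longrightarrow> \<bar>incr n i \<omega>\<bar> \<le> 2"
  using Y_bound[OF grid_in[of i n], of \<omega>] Y_bound[OF grid_in[of "Suc i" n], of \<omega>] unfolding incr_def by auto

lemma bounded_integrable:
  fixes f :: "'a \<Rightarrow> real"
  assumes "f \<in> borel_measurable M" "\<And>\<omega>. \<omega> \<in> space M \<Longrightarrow> \<bar>f \<omega>\<bar> \<le> c" shows "integrable M f"
  by (rule integrable_const_bound[of _ c]) (use assms in auto)

lemma drift_measurable: "drift n i \<in> borel_measurable (F (grid n i))" unfolding drift_def by measurable
lemma drift_bound: "\<bar>drift n i \<omega>\<bar> \<le> 2" unfolding drift_def by auto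
lemma drift_M: "i \<le> 2 ^ n \<Longrightarrow> drift n i \<in> borel_measurable M" using borel_F_M[OF drift_measurable grid_in] by auto

lemma drift_measurable_mono: "i \<le> j \<Longrightarrow> drift n i \<in> borel_measurable (F (grid n j))"
  by (rule borel_F_mono[OF drift_measurable]) (simp add: grid_le)

text \<open>This testing identity is all that the later arguments use of the conditional
  expectation. Clipping respects it because increments are bounded by \<open>2\<close>.\<close>

lemma drift_integral:
  assumes i: "i < 2 ^ n" and g: "g \<in> borel_measurable (F (grid n i))" "\<And>\<omega>. \<omega> \<in> space M \<Longrightarrow> \<bar>g \<omega>\<bar> \<le> c"
  shows "integrable M (\<lambda>\<omega>. g \<omega> * incr n i \<omega>)" "integrable M (\<lambda>\<omega>. g \<omega> * drift n i \<omega>)"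
    "(\<integral>\<omega>. g \<omega> * incr n i \<omega> \<partial>M) = (\<integral>\<omega>. g \<omega> * drift n i \<omega> \<partial>M)"
proof -
  have ti: "grid n i \<in> {0..T}" using grid_in[of i n] i by simp
  interpret sigma_finite_subalgebra M "F (grid n i)" by (rule sigma_finite_F[OF ti])
  have gM[measurable]: "g \<in> borel_measurable M" by (rule borel_F_M[OF g(1) ti])
  have [measurable]: "incr n i \<in> borel_measurable M" by (rule incr_M[OF i])
  have dM[measurable]: "drift n i \<in> borel_measurable M" using drift_M[of i n] i by simp
  have ii: "integrable M (incr n i)" by (rule bounded_integrable[of _ 2]) (use incr_bound[OF i] in auto)
  have b: "\<bar>g \<omega> * x\<bar> \<le> \<bar>c\<bar> * 2" if "\<omega> \<in> space M" "\<bar>x\<bar> \<le> 2" for \<omega> x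
    unfolding abs_mult using g(2)[OF that(1)] that(2) by (intro mult_mono) auto
  show I: "integrable M (\<lambda>\<omega>. g \<omega> * incr n i \<omega>)"
    by (rule bounded_integrable[of _ "\<bar>c\<bar> * 2"]) (use b incr_bound[OF i] in auto)
  show "integrable M (\<lambda>\<omega>. g \<omega> * drift n i \<omega>)"
    by (rule bounded_integrable[of _ "\<bar>c\<bar> * 2"]) (use b drift_bound in auto)
  have "AE \<omega> in M. real_cond_exp M (F (grid n i)) (incr n i) \<omega> \<le> 2"
    "AE \<omega> in M. -2 \<le> real_cond_exp M (F (grid n i)) (incr n i) \<omega>"
    using incr_bound[OF i] by (intro real_cond_exp_le_c real_cond_exp_ge_c ii AE_I2; force simp: abs_le_iff)+
  then have ae: "AE \<omega> in M. g \<omega> * drift n i \<omega> = g \<omega> * real_cond_exp M (F (grid n i)) (incr n i) \<omega>"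
    by eventually_elim (simp add: drift_def)
  have "(\<integral>\<omega>. g \<omega> * drift n i \<omega> \<partial>M) = (\<integral>\<omega>. g \<omega> * real_cond_exp M (F (grid n i)) (incr n i) \<omega> \<partial>M)"
    by (rule integral_cong_AE[OF _ _ ae]) measurable
  also have "\<dots> = (\<integral>\<omega>. g \<omega> * incr n i \<omega> \<partial>M)" by (rule real_cond_exp_intg(2)[OF I g(1)]) measurable
  finally show "(\<integral>\<omega>. g \<omega> * incr n i \<omega> \<partial>M) = (\<integral>\<omega>. g \<omega> * drift n i \<omega> \<partial>M)" by simp
qed

text \<open>Compensated increments are orthogonal, so the second moment is the sum of the individual
  ones, and subtracting a conditional expectation does not increase a second moment.\<close>

lemma compensated_square:
  assumes g: "\<And>i. i < 2 ^ n \<Longrightarrow> g i \<in> borel_measurable (F (grid n i))"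
      "\<And>i \<omega>. i < 2 ^ n \<Longrightarrow> \<omega> \<in> space M \<Longrightarrow> \<bar>g i \<omega>\<bar> \<le> 1"
    and m: "m \<le> 2 ^ n"
  shows "(\<integral>\<omega>. (\<Sum>i<m. g i \<omega> * (incr n i \<omega> - drift n i \<omega>))\<^sup>2 \<partial>M) \<le> (\<integral>\<omega>. (\<Sum>i<m. (g i \<omega>)\<^sup>2 * (incr n i \<omega>)\<^sup>2) \<partial>M)"
  using m
proof (induction m)
  case (Suc m)
  then have m: "m < 2 ^ n" "m \<le> 2 ^ n" by auto
  define Z where "Z \<omega> = (\<Sum>i<m. g i \<omega> * (incr n i \<omega> - drift n i \<omega>))" for \<omega>
  define D where "D \<omega> = incr n m \<omega> - drift n m \<omega>" for \<omega>
  have gm: "g i \<in> borel_measurable (F (grid n m))" if "i \<le> m" for i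
    by (rule borel_F_mono[OF g(1)]) (use that m in \<open>auto simp: grid_le\<close>)
  have Zm: "Z \<in> borel_measurable (F (grid n m))" unfolding Z_def
    by (intro borel_measurable_sum borel_measurable_times borel_measurable_diff gm incr_measurable drift_measurable_mono) (use m in auto)
  have Zb: "\<bar>Z \<omega>\<bar> \<le> real m * 4" if w: "\<omega> \<in> space M" for \<omega>
  proof -
    have "\<bar>Z \<omega>\<bar> \<le> (\<Sum>i<m. \<bar>g i \<omega> * (incr n i \<omega> - drift n i \<omega>)\<bar>)" unfolding Z_def by (rule sum_abs)
    also have "\<dots> \<le> (\<Sum>i<m. 1 * 4)"
    proof (rule sum_mono)
      fix i assume i: "i \<in> {..<m}"
      then have "i < 2 ^ n" using m by auto
      show "\<bar>g i \<omega> * (incr n i \<omega> - drift n i \<omega>)\<bar> \<le> 1 * 4" unfolding abs_mult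
        using g(2)[OF \<open>i < 2 ^ n\<close> w] incr_bound[OF \<open>i < 2 ^ n\<close> w] drift_bound[of n i \<omega>] by (intro mult_mono) auto
    qed
    finally show ?thesis by simp
  qed
  have ti: "grid n m \<in> {0..T}" by (rule grid_in[OF m(2)])
  note [measurable] = borel_F_M[OF Zm ti] borel_F_M[OF g(1)[OF m(1)] ti] incr_M[OF m(1)] drift_M[OF m(2)]
  have Db: "\<bar>D \<omega>\<bar> \<le> 4" if "\<omega> \<in> space M" for \<omega> using incr_bound[OF m(1) that] drift_bound[of n m \<omega>] unfolding D_def by auto
  have mb: "\<bar>x * y\<bar> \<le> a * b" if "\<bar>x\<bar> \<le> a" "\<bar>y\<bar> \<le> b" for x y a b :: real
    unfolding abs_mult using that by (intro mult_mono) auto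
  have gmb: "\<bar>g m \<omega>\<bar> \<le> 1" if "\<omega> \<in> space M" for \<omega> by (rule g(2)[OF m(1) that])
  have Dm[measurable]: "D \<in> borel_measurable M" unfolding D_def by measurable
  have i1: "integrable M (\<lambda>\<omega>. (Z \<omega>)\<^sup>2)" unfolding power2_eq_square
  proof (rule bounded_integrable)
    fix \<omega> assume w: "\<omega> \<in> space M"
    show "\<bar>Z \<omega> * Z \<omega>\<bar> \<le> (real m * 4) * (real m * 4)"
      by (rule mb[OF Zb[OF w] Zb[OF w]])
  qed measurable
  have i2: "integrable M (\<lambda>\<omega>. (Z \<omega> * g m \<omega>) * D \<omega>)" unfolding power2_eq_square
  proof (rule bounded_integrable)
    fix \<omega> assume w: "\<omega> \<in> space M"
    show "\<bar>(Z \<omega> * g m \<omega>) * D \<omega>\<bar> \<le> ((real m * 4) * 1) * 4"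
      by (rule mb[OF mb[OF Zb[OF w] gmb[OF w]] Db[OF w]])
  qed measurable
  have i3: "integrable M (\<lambda>\<omega>. (g m \<omega>)\<^sup>2 * (D \<omega>)\<^sup>2)" unfolding power2_eq_square
  proof (rule bounded_integrable)
    fix \<omega> assume w: "\<omega> \<in> space M"
    show "\<bar>(g m \<omega> * g m \<omega>) * (D \<omega> * D \<omega>)\<bar> \<le> (1 * 1) * (4 * 4)"
      by (rule mb[OF mb[OF gmb[OF w] gmb[OF w]] mb[OF Db[OF w] Db[OF w]]])
  qed measurable
  have i4: "integrable M (\<lambda>\<omega>. (g m \<omega>)\<^sup>2 * (incr n m \<omega>)\<^sup>2)" unfolding power2_eq_square
  proof (rule bounded_integrable)
    fix \<omega> assume w: "\<omega> \<in> space M"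
    show "\<bar>(g m \<omega> * g m \<omega>) * (incr n m \<omega> * incr n m \<omega>)\<bar> \<le> (1 * 1) * (2 * 2)"
      by (rule mb[OF mb[OF gmb[OF w] gmb[OF w]] mb[OF incr_bound[OF m(1) w] incr_bound[OF m(1) w]]])
  qed measurable
  have i5: "integrable M (\<lambda>\<omega>. ((g m \<omega>)\<^sup>2 * drift n m \<omega>) * incr n m \<omega>)" unfolding power2_eq_square
  proof (rule bounded_integrable)
    fix \<omega> assume w: "\<omega> \<in> space M"
    show "\<bar>((g m \<omega> * g m \<omega>) * drift n m \<omega>) * incr n m \<omega>\<bar> \<le> ((1 * 1) * 2) * 2"
      by (rule mb[OF mb[OF mb[OF gmb[OF w] gmb[OF w]] drift_bound] incr_bound[OF m(1) w]])
  qed measurable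
  have i6: "integrable M (\<lambda>\<omega>. ((g m \<omega>)\<^sup>2 * drift n m \<omega>) * drift n m \<omega>)" unfolding power2_eq_square
  proof (rule bounded_integrable)
    fix \<omega> assume w: "\<omega> \<in> space M"
    show "\<bar>((g m \<omega> * g m \<omega>) * drift n m \<omega>) * drift n m \<omega>\<bar> \<le> ((1 * 1) * 2) * 2"
      by (rule mb[OF mb[OF mb[OF gmb[OF w] gmb[OF w]] drift_bound] drift_bound])
  qed measurable
  have i7: "integrable M (\<lambda>\<omega>. (\<Sum>i<m. (g i \<omega>)\<^sup>2 * (incr n i \<omega>)\<^sup>2))"
  proof (rule Bochner_Integration.integrable_sum)
    fix i assume i: "i \<in> {..<m}"
    then have i': "i < 2 ^ n" "i \<le> 2 ^ n" using m by auto
    note [measurable] = borel_F_M[OF g(1)[OF i'(1)] grid_in[OF i'(2)]] incr_M[OF i'(1)]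
    show "integrable M (\<lambda>\<omega>. (g i \<omega>)\<^sup>2 * (incr n i \<omega>)\<^sup>2)" unfolding power2_eq_square
    proof (rule bounded_integrable)
      fix \<omega> assume w: "\<omega> \<in> space M"
      show "\<bar>(g i \<omega> * g i \<omega>) * (incr n i \<omega> * incr n i \<omega>)\<bar> \<le> (1 * 1) * (2 * 2)"
        by (rule mb[OF mb[OF g(2)[OF i'(1) w] g(2)[OF i'(1) w]] mb[OF incr_bound[OF i'(1) w] incr_bound[OF i'(1) w]]])
    qed measurable
  qed
  have e2: "(\<integral>\<omega>. (Z \<omega> * g m \<omega>) * D \<omega> \<partial>M) = 0"
  proof -
    have zm: "(\<lambda>\<omega>. Z \<omega> * g m \<omega>) \<in> borel_measurable (F (grid n m))" using Zm g(1)[OF m(1)] by (intro borel_measurable_times)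
    have zb: "\<bar>Z \<omega> * g m \<omega>\<bar> \<le> (real m * 4) * 1" if "\<omega> \<in> space M" for \<omega> by (rule mb[OF Zb[OF that] gmb[OF that]])
    show ?thesis using drift_integral[OF m(1) zm zb] unfolding D_def by (simp add: right_diff_distrib)
  qed
  have e3: "(\<integral>\<omega>. (g m \<omega>)\<^sup>2 * (D \<omega>)\<^sup>2 \<partial>M) \<le> (\<integral>\<omega>. (g m \<omega>)\<^sup>2 * (incr n m \<omega>)\<^sup>2 \<partial>M)"
  proof -
    have zm: "(\<lambda>\<omega>. (g m \<omega>)\<^sup>2 * drift n m \<omega>) \<in> borel_measurable (F (grid n m))"
      using g(1)[OF m(1)] drift_measurable[of n m] by measurable
    have zb: "\<bar>(g m \<omega>)\<^sup>2 * drift n m \<omega>\<bar> \<le> (1 * 1) * 2" if "\<omega> \<in> space M" for \<omega>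
      unfolding power2_eq_square by (rule mb[OF mb[OF gmb[OF that] gmb[OF that]] drift_bound])
    have eq: "(\<integral>\<omega>. ((g m \<omega>)\<^sup>2 * drift n m \<omega>) * incr n m \<omega> \<partial>M) = (\<integral>\<omega>. ((g m \<omega>)\<^sup>2 * drift n m \<omega>) * drift n m \<omega> \<partial>M)"
      by (rule drift_integral(3)[OF m(1) zm zb])
    have "(\<integral>\<omega>. (g m \<omega>)\<^sup>2 * (D \<omega>)\<^sup>2 \<partial>M) = (\<integral>\<omega>. (g m \<omega>)\<^sup>2 * (incr n m \<omega>)\<^sup>2 - 2 * (((g m \<omega>)\<^sup>2 * drift n m \<omega>) * incr n m \<omega>) + ((g m \<omega>)\<^sup>2 * drift n m \<omega>) * drift n m \<omega> \<partial>M)"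
      by (rule Bochner_Integration.integral_cong) (auto simp: D_def power2_eq_square algebra_simps)
    also have "\<dots> = (\<integral>\<omega>. (g m \<omega>)\<^sup>2 * (incr n m \<omega>)\<^sup>2 \<partial>M) - (\<integral>\<omega>. ((g m \<omega>)\<^sup>2 * drift n m \<omega>) * drift n m \<omega> \<partial>M)"
      using i4 i5 i6 eq by simp
    moreover have "0 \<le> (\<integral>\<omega>. ((g m \<omega>)\<^sup>2 * drift n m \<omega>) * drift n m \<omega> \<partial>M)"
      by (rule Bochner_Integration.integral_nonneg) (simp add: mult.assoc)
    ultimately show ?thesis by simp
  qed
  have "(\<integral>\<omega>. (\<Sum>i<Suc m. g i \<omega> * (incr n i \<omega> - drift n i \<omega>))\<^sup>2 \<partial>M) = (\<integral>\<omega>. (Z \<omega>)\<^sup>2 + 2 * ((Z \<omega> * g m \<omega>) * D \<omega>) + (g m \<omega>)\<^sup>2 * (D \<omega>)\<^sup>2 \<partial>M)"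
  proof (rule Bochner_Integration.integral_cong[OF refl])
    fix \<omega>
    have "(\<Sum>i<Suc m. g i \<omega> * (incr n i \<omega> - drift n i \<omega>)) = Z \<omega> + g m \<omega> * D \<omega>" unfolding Z_def D_def by simp
    then show "(\<Sum>i<Suc m. g i \<omega> * (incr n i \<omega> - drift n i \<omega>))\<^sup>2 = (Z \<omega>)\<^sup>2 + 2 * ((Z \<omega> * g m \<omega>) * D \<omega>) + (g m \<omega>)\<^sup>2 * (D \<omega>)\<^sup>2"
      by (simp add: power2_eq_square algebra_simps)
  qed
  also have "\<dots> = (\<integral>\<omega>. (Z \<omega>)\<^sup>2 \<partial>M) + (\<integral>\<omega>. (g m \<omega>)\<^sup>2 * (D \<omega>)\<^sup>2 \<partial>M)" using i1 i2 i3 e2 by simp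
  also have "\<dots> \<le> (\<integral>\<omega>. (\<Sum>i<m. (g i \<omega>)\<^sup>2 * (incr n i \<omega>)\<^sup>2) \<partial>M) + (\<integral>\<omega>. (g m \<omega>)\<^sup>2 * (incr n m \<omega>)\<^sup>2 \<partial>M)"
    using Suc.IH[OF m(2)] e3 unfolding Z_def by (rule add_mono)
  also have "\<dots> = (\<integral>\<omega>. (\<Sum>i<Suc m. (g i \<omega>)\<^sup>2 * (incr n i \<omega>)\<^sup>2) \<partial>M)" using i7 i4 by simp
  finally show ?case .
qed simp

text \<open>The strategy \<open>sgn (drift) - 2 Y\<close> produces the total drift plus the quadratic variation,
  up to a martingale and a bounded term; it is stopped once the gain reaches \<open>K\<close> or the martingale falls below \<open>-c\<close>.\<close>

lemma drift_tight:
  assumes e: "0 < \<epsilon>"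
  shows "\<exists>K\<ge>0. \<forall>n. measure M {\<omega>\<in>space M. (\<Sum>i<2^n. \<bar>drift n i \<omega>\<bar>) > K} \<le> \<epsilon>"
proof -
  obtain K0 where K0: "\<And>n f. (\<forall>i<2^n. f i \<in> borel_measurable (F (grid n i)) \<and> (\<forall>\<omega>\<in>space M. \<bar>f i \<omega>\<bar> \<le> 1)) \<and>
      (\<forall>m\<le>2^n. \<forall>\<omega>\<in>space M. - 1 \<le> (\<Sum>i<m. f i \<omega> * incr n i \<omega>)) \<Longrightarrow>
      measure M {\<omega>\<in>space M. (\<Sum>i<2^n. f i \<omega> * incr n i \<omega>) > K0} \<le> \<epsilon> / 2"
    using Y_nfl[of "\<epsilon>/2"] e unfolding incr_def grid_def by auto
  \<comment> \<open>With \<open>K = \<epsilon> * c\<^sup>2 / 2 - 4\<close> the Chebyshev bound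
    \<open>(K + 4) / c\<^sup>2\<close> is exactly \<open>\<epsilon> / 2\<close>. As \<open>K\<close>
    is quadratic in \<open>c\<close>, a large \<open>c\<close> makes \<open>K - c - 1\<close> exceed
    \<open>K0 * (c + 7)\<close>, which is the threshold \<open>K0\<close> before the strategy is
    divided by \<open>c + 7\<close>.\<close>
  define c where "c = 2 / \<epsilon> * (8 * \<bar>K0\<bar> + 7) + 1"
  have c1: "1 \<le> c" unfolding c_def using e by simp
  define K where "K = \<epsilon> * c\<^sup>2 / 2 - 4"
  have Kc: "K0 * (c + 7) < K - c - 1"
  proof -
    have "\<epsilon> / 2 * (c - 1) = 8 * \<bar>K0\<bar> + 7" unfolding c_def using e by (simp add: field_simps)
    then have "8 * \<bar>K0\<bar> + 7 \<le> \<epsilon> / 2 * c" using e by (simp add: algebra_simps)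
    then have "(8 * \<bar>K0\<bar> + 7) * c \<le> \<epsilon> / 2 * c * c" using c1 by (intro mult_right_mono) auto
    then have "8 * (\<bar>K0\<bar> * c) + 7 * c \<le> K + 4" unfolding K_def power2_eq_square by (simp add: algebra_simps)
    moreover have "K0 * (c + 7) \<le> \<bar>K0\<bar> * (c + 7 * c)" using c1 by (intro mult_mono) auto
    then have "K0 * (c + 7) \<le> 8 * (\<bar>K0\<bar> * c)" by (simp add: algebra_simps)
    ultimately show ?thesis using c1 by linarith
  qed
  have K00: "0 \<le> K"
  proof -
    have "\<epsilon> / 2 * (c - 1) = 8 * \<bar>K0\<bar> + 7" unfolding c_def using e by (simp add: field_simps)
    then have "7 \<le> \<epsilon> / 2 * c" using e by (simp add: algebra_simps)
    then have "7 * 1 \<le> \<epsilon> / 2 * c * c" using c1 by (intro mult_mono) auto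
    then show ?thesis unfolding K_def power2_eq_square by simp
  qed
  have "measure M {\<omega>\<in>space M. (\<Sum>i<2^n. \<bar>drift n i \<omega>\<bar>) > K} \<le> \<epsilon>" for n
  proof -
    define W where "W j \<omega> = (\<Sum>i<j. \<bar>drift n i \<omega>\<bar> + (incr n i \<omega>)\<^sup>2)" for j \<omega>
    define N where "N j \<omega> = (\<Sum>i<j. sgn (drift n i \<omega>) * (incr n i \<omega> - drift n i \<omega>))" for j \<omega>
    define ok where "ok j \<omega> \<longleftrightarrow> W j \<omega> \<le> K \<and> - c \<le> N j \<omega>" for j \<omega>
    define act where "act i \<omega> = (of_bool (\<forall>j\<le>i. ok j \<omega>) :: real)" for i \<omega>
    define U where "U m \<omega> = (\<Sum>i<m. act i \<omega> * (sgn (drift n i \<omega>) - 2 * Y (grid n i) \<omega>) * incr n i \<omega>)" for m \<omega>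
    define N' where "N' m \<omega> = (\<Sum>i<m. act i \<omega> * sgn (drift n i \<omega>) * (incr n i \<omega> - drift n i \<omega>))" for m \<omega>
    have act_cases: "act i \<omega> = 1 \<and> (\<forall>j\<le>i. ok j \<omega>) \<or> act i \<omega> = 0 \<and> \<not> (\<forall>j\<le>i. ok j \<omega>)" for i \<omega> unfolding act_def by auto
    have ok_meas: "Measurable.pred (F (grid n i)) (ok j)" if "j \<le> i" "i < 2 ^ n" for i j
    proof -
      have sg: "(\<lambda>\<omega>. sgn (drift n l \<omega>)) \<in> borel_measurable (F (grid n i))" if "l \<le> i" for l
        using drift_measurable_mono[OF that, of n] by measurable
      have "W j \<in> borel_measurable (F (grid n i))" "N j \<in> borel_measurable (F (grid n i))"
        unfolding W_def N_def using that
        by (auto intro!: borel_measurable_sum borel_measurable_add borel_measurable_abs borel_measurable_power borel_measurable_times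
          borel_measurable_diff sg incr_measurable drift_measurable_mono)
      then show ?thesis unfolding ok_def by measurable
    qed
    have act_meas: "act i \<in> borel_measurable (F (grid n i))" if "i < 2 ^ n" for i
    proof -
      have [measurable]: "Measurable.pred (F (grid n i)) (\<lambda>\<omega>. \<forall>j\<in>{..i}. ok j \<omega>)"
        by (intro pred_intros_finite ok_meas) (use that in auto)
      have "act i = (\<lambda>\<omega>. of_bool (\<forall>j\<in>{..i}. ok j \<omega>))" unfolding act_def by (simp add: Ball_def)
      then show ?thesis by simp
    qed
    have sgn_meas: "(\<lambda>\<omega>. sgn (drift n i \<omega>)) \<in> borel_measurable (F (grid n i))" for i
      using drift_measurable[of n i] by measurable
    have step: "\<bar>act i \<omega> * (sgn (drift n i \<omega>) - 2 * Y (grid n i) \<omega>)\<bar> \<le> 3" if "i < 2 ^ n" "\<omega> \<in> space M" for i \<omega>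
    proof -
      have "\<bar>sgn (drift n i \<omega>) - 2 * Y (grid n i) \<omega>\<bar> \<le> 3"
        using Y_bound[OF grid_in[of i n] that(2)] that(1) by (auto simp: sgn_if)
      then show ?thesis using act_cases[of i \<omega>] by auto
    qed
    \<comment> \<open>The term \<open>- 2 * Y\<close> contributes the squared increment of
      \<open>Y\<close> minus the increment of the square of \<open>Y\<close>, and the latter
      telescopes.\<close>
    have full: "U m \<omega> = W m \<omega> + N m \<omega> - (Y (grid n m) \<omega>)\<^sup>2 + (Y (grid n 0) \<omega>)\<^sup>2 \<and> N' m \<omega> = N m \<omega>"
      if "\<And>i. i < m \<Longrightarrow> act i \<omega> = 1" for m \<omega>
      using that
    proof (induction m)
      case 0 then show ?case unfolding U_def W_def N_def N'_def by simp
    next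
      case (Suc m)
      have "act m \<omega> = 1" using Suc.prems by simp
      moreover have "\<bar>drift n m \<omega>\<bar> = sgn (drift n m \<omega>) * drift n m \<omega>" by (simp add: abs_sgn mult.commute)
      moreover have "U m \<omega> = W m \<omega> + N m \<omega> - (Y (grid n m) \<omega>)\<^sup>2 + (Y (grid n 0) \<omega>)\<^sup>2 \<and> N' m \<omega> = N m \<omega>"
        using Suc by simp
      ultimately show ?case unfolding U_def W_def N_def N'_def incr_def
        by (auto simp: algebra_simps power2_eq_square)
    qed
    \<comment> \<open>Whenever a trade is still made, the gain so far is at least
      \<open>- c - 1\<close>, from the bound on \<open>N\<close> and
      \<open>\<bar>Y\<bar> \<le> 1\<close>. A single trade loses at most \<open>3 * 2\<close>,
      whence \<open>c + 7\<close>.\<close>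
    have lower: "- (c + 7) \<le> U m \<omega>" if m: "m \<le> 2 ^ n" and w: "\<omega> \<in> space M" for m \<omega>
      using m
    proof (induction m)
      case 0 then show ?case unfolding U_def using c1 by simp
    next
      case (Suc m)
      have Um: "U (Suc m) \<omega> = U m \<omega> + act m \<omega> * (sgn (drift n m \<omega>) - 2 * Y (grid n m) \<omega>) * incr n m \<omega>" unfolding U_def by simp
      show ?case
      proof (cases "act m \<omega> = 1")
        case True
        then have ok: "\<forall>j\<le>m. ok j \<omega>" using act_cases[of m \<omega>] by auto
        then have "act i \<omega> = 1" if "i < m" for i using that unfolding act_def by auto
        then have eq: "U m \<omega> = W m \<omega> + N m \<omega> - (Y (grid n m) \<omega>)\<^sup>2 + (Y (grid n 0) \<omega>)\<^sup>2" using full by blast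
        have "0 \<le> W m \<omega>" unfolding W_def by (intro sum_nonneg) auto
        moreover have "(Y (grid n m) \<omega>)\<^sup>2 \<le> 1" using Y_bound[OF grid_in[of m n] w] Suc.prems by (simp add: abs_square_le_1)
        moreover have "-c \<le> N m \<omega>" using ok unfolding ok_def by auto
        moreover have "0 \<le> (Y (grid n 0) \<omega>)\<^sup>2" by simp
        ultimately have 1: "- c - 1 \<le> U m \<omega>" unfolding eq by linarith
        have "\<bar>act m \<omega> * (sgn (drift n m \<omega>) - 2 * Y (grid n m) \<omega>) * incr n m \<omega>\<bar> \<le> 3 * 2"
          unfolding abs_mult[of _ "incr n m \<omega>"] using step[OF _ w, of m] incr_bound[OF _ w, of m n] Suc.prems by (intro mult_mono) auto
        then show ?thesis using 1 unfolding Um by linarith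
      next
        case False
        then have "act m \<omega> = 0" using act_cases by metis
        then show ?thesis using Suc unfolding Um by simp
      qed
    qed
    \<comment> \<open>All active steps but the last are counted in a \<open>W\<close> not exceeding
      \<open>K\<close>; the last one adds at most \<open>4\<close>.\<close>
    have upper: "(\<Sum>i<m. (act i \<omega> * sgn (drift n i \<omega>))\<^sup>2 * (incr n i \<omega>)\<^sup>2) \<le> K + 4" if m: "m \<le> 2 ^ n" and w: "\<omega> \<in> space M" for m \<omega>
      using m
    proof (induction m)
      case 0 then show ?case using K00 by simp
    next
      case (Suc m)
      show ?case
      proof (cases "act m \<omega> = 1")
        case True
        then have ok: "W m \<omega> \<le> K" using act_cases[of m \<omega>] unfolding ok_def by auto
        have s1: "(act i \<omega> * sgn (drift n i \<omega>))\<^sup>2 \<le> 1" for i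
          using act_cases[of i \<omega>] by (auto simp: sgn_if)
        have "(\<Sum>i<m. (act i \<omega> * sgn (drift n i \<omega>))\<^sup>2 * (incr n i \<omega>)\<^sup>2) \<le> W m \<omega>"
          unfolding W_def by (rule sum_mono) (use mult_right_mono[OF s1] in \<open>auto intro: add_increasing\<close>)
        moreover have "(incr n m \<omega>)\<^sup>2 \<le> 2\<^sup>2" using incr_bound[OF _ w, of m n] Suc.prems by (intro abs_le_square_iff[THEN iffD1]) auto
        then have "(act m \<omega> * sgn (drift n m \<omega>))\<^sup>2 * (incr n m \<omega>)\<^sup>2 \<le> 4"
          using mult_right_mono[OF s1[of m], of "(incr n m \<omega>)\<^sup>2"] by auto
        ultimately show ?thesis using ok by simp
      next
        case False
        then have "act m \<omega> = 0" using act_cases by metis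
        then show ?thesis using Suc by simp
      qed
    qed
    have gm: "(\<lambda>\<omega>. act i \<omega> * sgn (drift n i \<omega>)) \<in> borel_measurable (F (grid n i))" if "i < 2 ^ n" for i
      using act_meas[OF that] sgn_meas by (rule borel_measurable_times)
    have gb: "\<bar>act i \<omega> * sgn (drift n i \<omega>)\<bar> \<le> 1" for i \<omega> using act_cases[of i \<omega>] by (auto simp: sgn_if)
    have N'm: "N' (2^n) \<in> borel_measurable M" unfolding N'_def
    proof (rule borel_measurable_sum)
      fix i :: nat assume i: "i \<in> {..<2^n}"
      then have i': "i < 2 ^ n" "i \<le> 2 ^ n" by auto
      show "(\<lambda>\<omega>. act i \<omega> * sgn (drift n i \<omega>) * (incr n i \<omega> - drift n i \<omega>)) \<in> borel_measurable M"
        using borel_F_M[OF gm[OF i'(1)] grid_in[OF i'(2)]] incr_M[OF i'(1)] drift_M[OF i'(2)] by measurable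
    qed
    have Nsq: "(\<integral>\<omega>. (N' (2^n) \<omega>)\<^sup>2 \<partial>M) \<le> K + 4"
    proof -
      have "(\<integral>\<omega>. (N' (2^n) \<omega>)\<^sup>2 \<partial>M) \<le> (\<integral>\<omega>. (\<Sum>i<2^n. (act i \<omega> * sgn (drift n i \<omega>))\<^sup>2 * (incr n i \<omega>)\<^sup>2) \<partial>M)"
        unfolding N'_def by (rule compensated_square) (use gm gb in auto)
      also have "\<dots> \<le> (\<integral>\<omega>. K + 4 \<partial>M)"
      proof (rule integral_mono)
        show "integrable M (\<lambda>\<omega>. (\<Sum>i<2^n. (act i \<omega> * sgn (drift n i \<omega>))\<^sup>2 * (incr n i \<omega>)\<^sup>2))"
        proof (rule bounded_integrable[of _ "K + 4"])
          show "\<bar>\<Sum>i<2^n. (act i \<omega> * sgn (drift n i \<omega>))\<^sup>2 * (incr n i \<omega>)\<^sup>2\<bar> \<le> K + 4" if "\<omega> \<in> space M" for \<omega>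
            using upper[OF order_refl that] by (subst abs_of_nonneg) (auto intro!: sum_nonneg)
          show "(\<lambda>\<omega>. \<Sum>i<2^n. (act i \<omega> * sgn (drift n i \<omega>))\<^sup>2 * (incr n i \<omega>)\<^sup>2) \<in> borel_measurable M"
          proof (rule borel_measurable_sum)
            fix i :: nat assume i: "i \<in> {..<2^n}"
            then have i': "i < 2 ^ n" "i \<le> 2 ^ n" by auto
            show "(\<lambda>\<omega>. (act i \<omega> * sgn (drift n i \<omega>))\<^sup>2 * (incr n i \<omega>)\<^sup>2) \<in> borel_measurable M"
              using borel_F_M[OF gm[OF i'(1)] grid_in[OF i'(2)]] incr_M[OF i'(1)] by measurable
          qed
        qed
      qed (use upper in auto)
      finally show ?thesis by (simp add: prob_space)
    qed
    have N'i: "integrable M (\<lambda>\<omega>. (N' (2^n) \<omega>)\<^sup>2)"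
    proof (rule bounded_integrable[of _ "(real (2^n) * 4)\<^sup>2"])
      fix \<omega> assume w: "\<omega> \<in> space M"
      have "\<bar>N' (2^n) \<omega>\<bar> \<le> (\<Sum>i<2^n. \<bar>act i \<omega> * sgn (drift n i \<omega>) * (incr n i \<omega> - drift n i \<omega>)\<bar>)" unfolding N'_def by (rule sum_abs)
      also have "\<dots> \<le> (\<Sum>i<(2::nat)^n. 1 * 4)"
      proof (rule sum_mono)
        fix i :: nat assume "i \<in> {..<2^n}"
        then have i: "i < 2 ^ n" by auto
        show "\<bar>act i \<omega> * sgn (drift n i \<omega>) * (incr n i \<omega> - drift n i \<omega>)\<bar> \<le> 1 * 4" unfolding abs_mult[of _ "incr n i \<omega> - drift n i \<omega>"]
          using gb[of i \<omega>] incr_bound[OF i w] drift_bound[of n i \<omega>] by (intro mult_mono) auto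
      qed
      finally have "\<bar>N' (2^n) \<omega>\<bar> \<le> \<bar>real (2^n) * 4\<bar>" by simp
      then have "(N' (2^n) \<omega>)\<^sup>2 \<le> (real (2^n) * 4)\<^sup>2" by (simp only: abs_le_square_iff)
      then show "\<bar>(N' (2^n) \<omega>)\<^sup>2\<bar> \<le> (real (2^n) * 4)\<^sup>2" by (simp only: abs_power2)
    qed (use N'm in measurable)
    have mk: "measure M {\<omega>\<in>space M. (N' (2^n) \<omega>)\<^sup>2 \<ge> c\<^sup>2} \<le> \<epsilon> / 2"
    proof -
      have "measure M {\<omega>\<in>space M. (N' (2^n) \<omega>)\<^sup>2 \<ge> c\<^sup>2} \<le> (\<integral>\<omega>. (N' (2^n) \<omega>)\<^sup>2 \<partial>M) / c\<^sup>2"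
        by (rule integral_Markov_inequality_measure[where A="{}"]) (use N'i c1 in auto)
      also have "\<dots> \<le> (K + 4) / c\<^sup>2" using Nsq by (rule divide_right_mono) simp
      also have "\<dots> = \<epsilon> / 2" unfolding K_def using c1 by simp
      finally show ?thesis .
    qed
    \<comment> \<open>Division by \<open>c + 7\<close> brings the losses down to at most
      \<open>1\<close> and the coefficients, at most \<open>3\<close> before, below
      \<open>1\<close>.\<close>
    define f where "f i \<omega> = act i \<omega> * (sgn (drift n i \<omega>) - 2 * Y (grid n i) \<omega>) / (c + 7)" for i \<omega>
    have fU: "(\<Sum>i<m. f i \<omega> * incr n i \<omega>) = U m \<omega> / (c + 7)" for m \<omega>
      unfolding f_def U_def sum_divide_distrib by (rule sum.cong) auto
    have "measure M {\<omega>\<in>space M. (\<Sum>i<2^n. f i \<omega> * incr n i \<omega>) > K0} \<le> \<epsilon> / 2"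
    proof (rule K0, intro conjI allI impI ballI)
      fix i :: nat assume i: "i < 2 ^ n"
      show "f i \<in> borel_measurable (F (grid n i))" unfolding f_def
        using act_meas[OF i] sgn_meas[of i] Y_grid_measurable[OF less_imp_le[OF i]] by measurable
      fix \<omega> assume w: "\<omega> \<in> space M"
      have "\<bar>f i \<omega>\<bar> \<le> 3 / (c + 7)" unfolding f_def using step[OF i w] c1 by (simp add: divide_right_mono)
      also have "\<dots> \<le> 1" using c1 by simp
      finally show "\<bar>f i \<omega>\<bar> \<le> 1" .
    next
      fix m \<omega> assume "m \<le> (2::nat) ^ n" "\<omega> \<in> space M"
      then show "- 1 \<le> (\<Sum>i<m. f i \<omega> * incr n i \<omega>)" unfolding fU using lower c1 by (simp add: pos_le_divide_eq)
    qed
    then have mU: "measure M {\<omega>\<in>space M. U (2^n) \<omega> / (c + 7) > K0} \<le> \<epsilon> / 2" unfolding fU .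
    have Um: "U (2^n) \<in> borel_measurable M" unfolding U_def
    proof (rule borel_measurable_sum)
      fix i :: nat assume i: "i \<in> {..<2^n}"
      then have i': "i < 2 ^ n" "i \<le> 2 ^ n" by auto
      show "(\<lambda>\<omega>. act i \<omega> * (sgn (drift n i \<omega>) - 2 * Y (grid n i) \<omega>) * incr n i \<omega>) \<in> borel_measurable M"
        using borel_F_M[OF act_meas[OF i'(1)] grid_in[OF i'(2)]] borel_F_M[OF sgn_meas grid_in[OF i'(2)]] incr_M[OF i'(1)] Y_grid_M[OF i'(2)] by measurable
    qed
    have sub: "{\<omega>\<in>space M. (\<Sum>i<2^n. \<bar>drift n i \<omega>\<bar>) > K} \<subseteq> {\<omega>\<in>space M. U (2^n) \<omega> / (c + 7) > K0} \<union> {\<omega>\<in>space M. (N' (2^n) \<omega>)\<^sup>2 \<ge> c\<^sup>2}"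
    proof
      fix \<omega> assume "\<omega> \<in> {\<omega>\<in>space M. (\<Sum>i<2^n. \<bar>drift n i \<omega>\<bar>) > K}"
      then have w: "\<omega> \<in> space M" and big: "(\<Sum>i<2^n. \<bar>drift n i \<omega>\<bar>) > K" by auto
      have "(\<Sum>i<2^n. \<bar>drift n i \<omega>\<bar>) \<le> W (2^n) \<omega>" unfolding W_def by (rule sum_mono) simp
      then have nok: "\<not> ok (2^n) \<omega>" using big unfolding ok_def by auto
      \<comment> \<open>A total drift above \<open>K\<close> forces a failure of \<open>ok\<close>
        by the last grid time. At the first failure either \<open>W\<close> has passed
        \<open>K\<close>, and the gain exceeds the threshold, or the martingale has fallen below
        \<open>- c\<close>.\<close>
      define k where "k = (LEAST k. \<not> ok k \<omega>)"
      have k: "\<not> ok k \<omega>" "k \<le> 2 ^ n" "\<And>j. j < k \<Longrightarrow> ok j \<omega>"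
        unfolding k_def using LeastI[of "\<lambda>k. \<not> ok k \<omega>", OF nok] Least_le[of "\<lambda>k. \<not> ok k \<omega>", OF nok]
          not_less_Least[of _ "\<lambda>k. \<not> ok k \<omega>"] by blast+
      have a1: "act i \<omega> = 1" if "i < k" for i unfolding act_def using k(3) that by auto
      have a0: "act i \<omega> = 0" if "k \<le> i" for i unfolding act_def using k(1) that by auto
      have split: "(\<Sum>i<2^n. act i \<omega> * h i) = (\<Sum>i<k. act i \<omega> * h i)" for h :: "nat \<Rightarrow> real"
        by (rule sum.mono_neutral_right) (use k(2) a0 in \<open>auto simp: not_less\<close>)
      have "U (2^n) \<omega> = U k \<omega>" "N' (2^n) \<omega> = N' k \<omega>"
        unfolding U_def N'_def mult.assoc by (rule split)+
      then have UN: "U (2^n) \<omega> = W k \<omega> + N k \<omega> - (Y (grid n k) \<omega>)\<^sup>2 + (Y (grid n 0) \<omega>)\<^sup>2" "N' (2^n) \<omega> = N k \<omega>"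
        using full[of k \<omega>] a1 by auto
      show "\<omega> \<in> {\<omega>\<in>space M. U (2^n) \<omega> / (c + 7) > K0} \<union> {\<omega>\<in>space M. (N' (2^n) \<omega>)\<^sup>2 \<ge> c\<^sup>2}"
      proof (cases "- c \<le> N k \<omega>")
        case True
        then have "W k \<omega> > K" using k(1) unfolding ok_def by auto
        moreover have "(Y (grid n k) \<omega>)\<^sup>2 \<le> 1" using Y_bound[OF grid_in[OF k(2)] w] by (simp add: abs_square_le_1)
        moreover have "0 \<le> (Y (grid n 0) \<omega>)\<^sup>2" by simp
        ultimately have "U (2^n) \<omega> > K0 * (c + 7)" using UN(1) True Kc by linarith
        then show ?thesis using w c1 by (simp add: pos_less_divide_eq)
      next
        case False
        then have "\<bar>c\<bar> \<le> \<bar>N' (2^n) \<omega>\<bar>" using UN(2) c1 by linarith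
        then have "c\<^sup>2 \<le> (N' (2^n) \<omega>)\<^sup>2" by (simp only: abs_le_square_iff)
        then show ?thesis using w by simp
      qed
    qed
    have s1: "{\<omega>\<in>space M. U (2^n) \<omega> / (c + 7) > K0} \<in> sets M" "{\<omega>\<in>space M. (N' (2^n) \<omega>)\<^sup>2 \<ge> c\<^sup>2} \<in> sets M"
      using Um N'm by measurable
    have "measure M {\<omega>\<in>space M. (\<Sum>i<2^n. \<bar>drift n i \<omega>\<bar>) > K} \<le> measure M ({\<omega>\<in>space M. U (2^n) \<omega> / (c + 7) > K0} \<union> {\<omega>\<in>space M. (N' (2^n) \<omega>)\<^sup>2 \<ge> c\<^sup>2})"
      by (rule finite_measure_mono[OF sub sets.Un[OF s1]])
    also have "\<dots> \<le> \<epsilon>" using measure_Un_le[OF s1] mU mk by linarith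
    finally show ?thesis .
  qed
  then show ?thesis using K00 by blast
qed

end

section \<open>Replacing a coarse weight by fine ones\<close>

lemma antitone_indicator_sum:
  fixes r y :: "nat \<Rightarrow> real"
  assumes "a \<le> b" "\<And>u. u \<in> {a..b} \<Longrightarrow> r u = 0 \<or> r u = 1"
    and "\<And>u v. a \<le> u \<Longrightarrow> u \<le> v \<Longrightarrow> v \<le> b \<Longrightarrow> r v \<le> r u"
  shows "\<exists>c\<in>{a..b}. (\<Sum>u\<in>{a..<b}. (1 - r u) * (y (Suc u) - y u)) = y b - y c"
  using assms
proof (induction b rule: dec_induct)
  case base
  then show ?case by auto
next
  case (step b)
  then obtain c where c: "c \<in> {a..b}" "(\<Sum>u\<in>{a..<b}. (1 - r u) * (y (Suc u) - y u)) = y b - y c" by fastforce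
  have rb: "r b = 0 \<or> r b = 1" using step by auto
  then show ?case
  proof
    assume "r b = 0"
    then have "(\<Sum>u\<in>{a..<Suc b}. (1 - r u) * (y (Suc u) - y u)) = y (Suc b) - y c"
      using c step(1) by (simp add: sum.atLeastLessThan_Suc)
    then show ?thesis using c(1) by auto
  next
    assume 1: "r b = 1"
    have "r u = 1" if "u \<in> {a..<Suc b}" for u
      using step.prems(1)[of u] step.prems(2)[of u b] that 1 by auto
    then have "(\<Sum>u\<in>{a..<Suc b}. (1 - r u) * (y (Suc u) - y u)) = 0" by (intro sum.neutral) auto
    then show ?thesis using step(1) by (intro bexI[of _ "Suc b"]) auto
  qed
qed

text \<open>The weights are \<open>1\<close> up to a switching index and \<open>0\<close>
  afterwards, so the error telescopes to a single difference of \<open>y\<close>, and it vanishes on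
  a block without a switch. Writing the bound as a difference of weights lets it telescope over
  consecutive blocks.\<close>

lemma antitone_indicator_block:
  fixes r y :: "nat \<Rightarrow> real"
  assumes ab: "a \<le> b" and r: "\<And>u. u \<in> {a..b} \<Longrightarrow> r u = 0 \<or> r u = 1"
    "\<And>u v. a \<le> u \<Longrightarrow> u \<le> v \<Longrightarrow> v \<le> b \<Longrightarrow> r v \<le> r u"
    and y: "\<And>u. u \<in> {a..b} \<Longrightarrow> \<bar>y u\<bar> \<le> 1"
  shows "\<bar>\<Sum>u\<in>{a..<b}. (r a - r u) * (y (Suc u) - y u)\<bar> \<le> 2 * (r a - r b)"
proof -
  have range: "0 \<le> r u \<and> r u \<le> 1" if "u \<in> {a..b}" for u using r(1)[OF that] by auto
  have mono: "r b \<le> r u \<and> r u \<le> r a" if "u \<in> {a..b}" for u using r(2)[of u b] r(2)[of a u] that by auto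
  consider "r a = r b" | "r a = 1" "r b = 0" using r(1)[of a] r(1)[of b] mono[of b] ab by auto
  then show ?thesis
  proof cases
    case 1
    then have "r a - r u = 0" if "u \<in> {a..<b}" for u using mono[of u] that by auto
    then have "(\<Sum>u\<in>{a..<b}. (r a - r u) * (y (Suc u) - y u)) = 0" by (intro sum.neutral) auto
    then show ?thesis using 1 by simp
  next
    case 2
    obtain c where c: "c \<in> {a..b}" "(\<Sum>u\<in>{a..<b}. (1 - r u) * (y (Suc u) - y u)) = y b - y c"
      using antitone_indicator_sum[of a b r y] ab r by blast
    show ?thesis unfolding 2 c(2) using y[OF c(1)] y[of b] ab by auto
  qed
qed

lemma sum_blocks:
  fixes h :: "nat \<Rightarrow> real"
  assumes "a \<le> b"
  shows "(\<Sum>i\<in>{a..<b}. \<Sum>u\<in>{i * L..<Suc i * L}. h u) = (\<Sum>u\<in>{a * L..<b * L}. h u)"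
  using assms
proof (induction rule: dec_induct)
  case (step b)
  have "(\<Sum>i\<in>{a..<Suc b}. \<Sum>u\<in>{i * L..<Suc i * L}. h u) = (\<Sum>u\<in>{a * L..<b * L}. h u) + (\<Sum>u\<in>{b * L..<Suc b * L}. h u)"
    using step by (simp add: sum.atLeastLessThan_Suc)
  also have "\<dots> = (\<Sum>u\<in>{a * L..<Suc b * L}. h u)"
    by (rule sum.atLeastLessThan_concat) (use step in \<open>auto simp: mult_right_mono\<close>)
  finally show ?case .
qed simp

section \<open>Survival indicators of the cumulative drift\<close>

context bounded_nfl
begin

text \<open>The drift of a cell is known at its left end and is counted from there on. Hence
  \<open>alive\<close> at a grid point already accounts for the drift of the coming cell, and the
  surviving drifts sum to at most \<open>K\<close> with no overshoot.\<close>

definition cumdrift :: "nat \<Rightarrow> real \<Rightarrow> 'a \<Rightarrow> real" where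
  "cumdrift n t \<omega> = (\<Sum>i<2^n. if grid n i \<le> t then \<bar>drift n i \<omega>\<bar> else 0)"

definition alive :: "real \<Rightarrow> nat \<Rightarrow> real \<Rightarrow> 'a \<Rightarrow> real" where
  "alive K n t \<omega> = of_bool (cumdrift n t \<omega> \<le> K)"

lemma cumdrift_grid:
  assumes "u < 2 ^ n" shows "cumdrift n (grid n u) \<omega> = (\<Sum>i<Suc u. \<bar>drift n i \<omega>\<bar>)"
proof -
  have "cumdrift n (grid n u) \<omega> = (\<Sum>i\<in>{i\<in>{..<2^n}. i \<le> u}. \<bar>drift n i \<omega>\<bar>)"
    unfolding cumdrift_def grid_le by (rule sum.inter_filter[symmetric]) simp
  also have "{i\<in>{..<2^n}. i \<le> u} = {..<Suc u}" using assms by auto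
  finally show ?thesis .
qed

lemma cumdrift_T: "cumdrift n T \<omega> = (\<Sum>i<2^n. \<bar>drift n i \<omega>\<bar>)"
  unfolding cumdrift_def using grid_in[of _ n] by (intro sum.cong) auto

lemma cumdrift_mono: "s \<le> t \<Longrightarrow> cumdrift n s \<omega> \<le> cumdrift n t \<omega>"
  unfolding cumdrift_def by (rule sum_mono) auto

lemma cumdrift_measurable: "cumdrift n t \<in> borel_measurable (F t)"
  unfolding cumdrift_def
proof (rule borel_measurable_sum)
  fix i :: nat assume "i \<in> {..<2^n}"
  show "(\<lambda>\<omega>. if grid n i \<le> t then \<bar>drift n i \<omega>\<bar> else 0) \<in> borel_measurable (F t)"
  proof (cases "grid n i \<le> t")
    case True
    then have "drift n i \<in> borel_measurable (F t)" by (rule borel_F_mono[OF drift_measurable])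
    then show ?thesis using True by simp
  qed simp
qed

lemma alive_measurable: "alive K n t \<in> borel_measurable (F t)"
  unfolding alive_def using cumdrift_measurable[of n t] by measurable

lemma alive_cases: "alive K n t \<omega> = 0 \<or> alive K n t \<omega> = 1" unfolding alive_def by auto
lemma alive_bounds: "0 \<le> alive K n t \<omega>" "alive K n t \<omega> \<le> 1" unfolding alive_def by auto
lemma alive_antimono: "s \<le> t \<Longrightarrow> alive K n t \<omega> \<le> alive K n s \<omega>"
  unfolding alive_def using cumdrift_mono[of s t n \<omega>] by auto

lemma alive_drift_sum:
  assumes "0 \<le> K" "m \<le> 2 ^ n"
  shows "(\<Sum>u<m. alive K n (grid n u) \<omega> * \<bar>drift n u \<omega>\<bar>) \<le> K"
  using assms(2)
proof (induction m)
  case 0 then show ?case using assms by simp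
next
  case (Suc m)
  show ?case
  proof (cases "alive K n (grid n m) \<omega> = 1")
    case True
    have "(\<Sum>u<Suc m. alive K n (grid n u) \<omega> * \<bar>drift n u \<omega>\<bar>) \<le> (\<Sum>u<Suc m. 1 * \<bar>drift n u \<omega>\<bar>)"
      by (intro sum_mono mult_right_mono alive_bounds) auto
    also have "\<dots> = cumdrift n (grid n m) \<omega>" using cumdrift_grid[of m n \<omega>] Suc.prems by simp
    also have "\<dots> \<le> K" using True unfolding alive_def by (auto split: if_splits)
    finally show ?thesis .
  next
    case False
    then have "alive K n (grid n m) \<omega> = 0" using alive_cases by metis
    then show ?thesis using Suc by simp
  qed
qed

text \<open>The drift over a coarse interval is the sum of the fine drifts, up to conditioning. Replacing the
  value of \<open>alive\<close> at the left endpoint by its fine values costs only on the single interval where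
  \<open>alive\<close> drops, and there at most the oscillation \<open>2\<close> of \<open>Y\<close>.\<close>

lemma alive_coarse_drift:
  assumes K: "0 \<le> K" and kj: "k \<le> j" and i0: "i0 \<le> 2 ^ k"
    and g: "g \<in> borel_measurable (F (grid k i0))" "\<And>\<omega>. \<omega> \<in> space M \<Longrightarrow> 0 \<le> g \<omega>" "\<And>\<omega>. \<omega> \<in> space M \<Longrightarrow> g \<omega> \<le> c"
  shows "(\<integral>\<omega>. g \<omega> * (\<Sum>i\<in>{i0..<2^k}. alive K j (grid k i) \<omega> * \<bar>drift k i \<omega>\<bar>) \<partial>M) \<le> (K + 2) * (\<integral>\<omega>. g \<omega> \<partial>M)"
proof -
  define L where "L = (2::nat) ^ (j - k)"
  have L: "2 ^ k * L = 2 ^ j" "0 < L" unfolding L_def using kj by (auto simp: power_add[symmetric])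
  have gr: "grid k i = grid j (i * L)" for i unfolding L_def by (rule grid_refine[OF kj])
  have uL: "u < 2 ^ j" if "i < 2 ^ k" "u < Suc i * L" for i u
  proof -
    have "Suc i * L \<le> 2 ^ k * L" using that(1) by (intro mult_right_mono) auto
    then show ?thesis using that(2) L by simp
  qed
  define s where "s i \<omega> = sgn (drift k i \<omega>)" for i \<omega>
  \<comment> \<open>\<open>h\<close> carries survival at the left end of the coarse cell;
    \<open>p\<close> carries survival on the fine cells, with the sign of the coarse drift frozen.
    Each is known when the cell it multiplies begins, so increment and drift may be exchanged under
    either integral.\<close>
  define h where "h i \<omega> = g \<omega> * alive K j (grid k i) \<omega> * s i \<omega>" for i \<omega>
  define p where "p i u \<omega> = g \<omega> * s i \<omega> * alive K j (grid j u) \<omega>" for i u \<omega>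
  have gm: "g \<in> borel_measurable (F t)" if "grid k i0 \<le> t" for t by (rule borel_F_mono[OF g(1) that])
  have sm: "s i \<in> borel_measurable (F t)" if "grid k i \<le> t" for i t
    unfolding s_def using borel_F_mono[OF drift_measurable that] by measurable
  have am: "alive K j r \<in> borel_measurable (F t)" if "r \<le> t" for r t by (rule borel_F_mono[OF alive_measurable that])
  have gb: "\<bar>g \<omega>\<bar> \<le> c" if "\<omega> \<in> space M" for \<omega> using g(2,3)[OF that] by auto
  have sb: "\<bar>s i \<omega>\<bar> \<le> 1" for i \<omega> unfolding s_def by (auto simp: sgn_if)
  have ab: "\<bar>alive K n t \<omega>\<bar> \<le> 1" for n t \<omega> using alive_bounds[of K n t \<omega>] by auto
  have c0: "\<omega> \<in> space M \<Longrightarrow> 0 \<le> c" for \<omega> using g(2,3)[of \<omega>] by auto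
  have b3: "\<bar>g \<omega> * x * y\<bar> \<le> c" if "\<omega> \<in> space M" "\<bar>x\<bar> \<le> 1" "\<bar>y\<bar> \<le> 1" for \<omega> x y
  proof -
    have "\<bar>g \<omega> * x * y\<bar> \<le> c * 1 * 1" unfolding abs_mult using gb[OF that(1)] that c0[OF that(1)] by (intro mult_mono) auto
    then show ?thesis by simp
  qed
  have hI: "integrable M (\<lambda>\<omega>. h i \<omega> * incr k i \<omega>)" "integrable M (\<lambda>\<omega>. h i \<omega> * drift k i \<omega>)"
    "(\<integral>\<omega>. h i \<omega> * incr k i \<omega> \<partial>M) = (\<integral>\<omega>. h i \<omega> * drift k i \<omega> \<partial>M)" if i: "i \<in> {i0..<2^k}" for i
  proof -
    have i': "i < 2 ^ k" "grid k i0 \<le> grid k i" using i by (auto simp: grid_le)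
    have m: "h i \<in> borel_measurable (F (grid k i))" unfolding h_def
      using gm[OF i'(2)] sm[OF order_refl] am[OF order_refl] by (intro borel_measurable_times) auto
    have b: "\<bar>h i \<omega>\<bar> \<le> c" if "\<omega> \<in> space M" for \<omega> unfolding h_def by (rule b3[OF that ab sb])
    show "integrable M (\<lambda>\<omega>. h i \<omega> * incr k i \<omega>)" "integrable M (\<lambda>\<omega>. h i \<omega> * drift k i \<omega>)"
      "(\<integral>\<omega>. h i \<omega> * incr k i \<omega> \<partial>M) = (\<integral>\<omega>. h i \<omega> * drift k i \<omega> \<partial>M)"
      using drift_integral[OF i'(1) m b] by auto
  qed
  have pI: "integrable M (\<lambda>\<omega>. p i u \<omega> * incr j u \<omega>)" "integrable M (\<lambda>\<omega>. p i u \<omega> * drift j u \<omega>)"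
    "(\<integral>\<omega>. p i u \<omega> * incr j u \<omega> \<partial>M) = (\<integral>\<omega>. p i u \<omega> * drift j u \<omega> \<partial>M)"
    if i: "i \<in> {i0..<2^k}" and u: "u \<in> {i*L..<Suc i*L}" for i u
  proof -
    have u': "u < 2 ^ j" using uL[of i u] i u by auto
    have le: "grid k i \<le> grid j u" unfolding gr grid_le using u by auto
    have le0: "grid k i0 \<le> grid j u" using le i grid_le[of k i0 i] by auto
    have m: "p i u \<in> borel_measurable (F (grid j u))" unfolding p_def
      using gm[OF le0] sm[OF le] am[OF order_refl] by (intro borel_measurable_times) auto
    have b: "\<bar>p i u \<omega>\<bar> \<le> c" if "\<omega> \<in> space M" for \<omega> unfolding p_def by (rule b3[OF that sb ab])
    show "integrable M (\<lambda>\<omega>. p i u \<omega> * incr j u \<omega>)" "integrable M (\<lambda>\<omega>. p i u \<omega> * drift j u \<omega>)"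
      "(\<integral>\<omega>. p i u \<omega> * incr j u \<omega> \<partial>M) = (\<integral>\<omega>. p i u \<omega> * drift j u \<omega> \<partial>M)"
      using drift_integral[OF u' m b] by auto
  qed
  have gi: "integrable M g"
    by (rule bounded_integrable[of _ c]) (use borel_F_M[OF g(1) grid_in[OF i0]] gb in auto)
  \<comment> \<open>\<open>D\<close> is the error of refining the survival weight inside one coarse
    cell. Its bounds telescope over the cells to at most \<open>2 * g\<close>; together with the
    fine surviving drifts, at most \<open>K\<close>, this yields the factor
    \<open>K + 2\<close>.\<close>
  define D where "D i \<omega> = h i \<omega> * incr k i \<omega> - (\<Sum>u\<in>{i*L..<Suc i*L}. p i u \<omega> * incr j u \<omega>)" for i \<omega>
  have Di: "integrable M (D i)" if "i \<in> {i0..<2^k}" for i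
    unfolding D_def using hI(1)[OF that] pI(1)[OF that] by (intro Bochner_Integration.integrable_diff Bochner_Integration.integrable_sum) auto
  have D: "\<bar>D i \<omega>\<bar> \<le> g \<omega> * (2 * (alive K j (grid k i) \<omega> - alive K j (grid k (Suc i)) \<omega>))"
    if i: "i \<in> {i0..<2^k}" and w: "\<omega> \<in> space M" for i \<omega>
  proof -
    define r where "r u = alive K j (grid j u) \<omega>" for u
    define y where "y u = Y (grid j u) \<omega>" for u
    have "incr k i \<omega> = (\<Sum>u\<in>{i*L..<Suc i*L}. y (Suc u) - y u)"
      unfolding incr_def gr y_def by (subst sum_Suc_diff') auto
    then have "D i \<omega> = g \<omega> * s i \<omega> * (r (i*L) * (\<Sum>u\<in>{i*L..<Suc i*L}. y (Suc u) - y u) - (\<Sum>u\<in>{i*L..<Suc i*L}. r u * (y (Suc u) - y u)))"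
      unfolding D_def h_def p_def r_def gr by (simp add: sum_distrib_left incr_def y_def algebra_simps)
    also have "\<dots> = g \<omega> * s i \<omega> * (\<Sum>u\<in>{i*L..<Suc i*L}. (r (i*L) - r u) * (y (Suc u) - y u))"
      by (simp add: sum_distrib_left sum_subtractf[symmetric] left_diff_distrib)
    finally have "\<bar>D i \<omega>\<bar> = g \<omega> * \<bar>s i \<omega>\<bar> * \<bar>\<Sum>u\<in>{i*L..<Suc i*L}. (r (i*L) - r u) * (y (Suc u) - y u)\<bar>"
      using g(2)[OF w] by (simp add: abs_mult)
    also have "\<dots> \<le> g \<omega> * 1 * (2 * (r (i*L) - r (Suc i*L)))"
    proof (intro mult_mono antitone_indicator_block)
      show "r u = 0 \<or> r u = 1" for u unfolding r_def by (rule alive_cases)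
      show "r v \<le> r u" if "u \<le> v" for u v unfolding r_def by (rule alive_antimono) (simp add: grid_le that)
      show "\<bar>y u\<bar> \<le> 1" if "u \<in> {i*L..Suc i*L}" for u
      proof -
        have "Suc i * L \<le> 2 ^ k * L" using i by (intro mult_right_mono) auto
        then show ?thesis unfolding y_def using that L by (intro Y_bound grid_in w) auto
      qed
    qed (use g(2)[OF w] sb in auto)
    finally show ?thesis unfolding r_def gr by simp
  qed
  have lhs: "g \<omega> * (\<Sum>i\<in>{i0..<2^k}. alive K j (grid k i) \<omega> * \<bar>drift k i \<omega>\<bar>) = (\<Sum>i\<in>{i0..<2^k}. h i \<omega> * drift k i \<omega>)" for \<omega>
    unfolding sum_distrib_left h_def s_def by (rule sum.cong) (auto simp: abs_sgn mult_ac)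
  have "(\<integral>\<omega>. g \<omega> * (\<Sum>i\<in>{i0..<2^k}. alive K j (grid k i) \<omega> * \<bar>drift k i \<omega>\<bar>) \<partial>M) = (\<Sum>i\<in>{i0..<2^k}. \<integral>\<omega>. h i \<omega> * incr k i \<omega> \<partial>M)"
    unfolding lhs using hI by (subst Bochner_Integration.integral_sum) auto
  also have "\<dots> = (\<Sum>i\<in>{i0..<2^k}. (\<integral>\<omega>. D i \<omega> \<partial>M) + (\<Sum>u\<in>{i*L..<Suc i*L}. \<integral>\<omega>. p i u \<omega> * drift j u \<omega> \<partial>M))"
  proof (rule sum.cong[OF refl])
    fix i assume i: "i \<in> {i0..<2^k}"
    have si: "integrable M (\<lambda>\<omega>. \<Sum>u\<in>{i*L..<Suc i*L}. p i u \<omega> * incr j u \<omega>)"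
      using pI(1)[OF i] by (intro Bochner_Integration.integrable_sum) auto
    have "(\<Sum>u\<in>{i*L..<Suc i*L}. \<integral>\<omega>. p i u \<omega> * drift j u \<omega> \<partial>M) = (\<Sum>u\<in>{i*L..<Suc i*L}. \<integral>\<omega>. p i u \<omega> * incr j u \<omega> \<partial>M)"
      by (rule sum.cong[OF refl]) (rule pI(3)[OF i, symmetric])
    also have "\<dots> = (\<integral>\<omega>. (\<Sum>u\<in>{i*L..<Suc i*L}. p i u \<omega> * incr j u \<omega>) \<partial>M)"
      using pI(1)[OF i] by (subst Bochner_Integration.integral_sum) auto
    finally show "(\<integral>\<omega>. h i \<omega> * incr k i \<omega> \<partial>M) = (\<integral>\<omega>. D i \<omega> \<partial>M) + (\<Sum>u\<in>{i*L..<Suc i*L}. \<integral>\<omega>. p i u \<omega> * drift j u \<omega> \<partial>M)"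
      unfolding D_def using hI(1)[OF i] si by simp
  qed
  also have "\<dots> = (\<Sum>i\<in>{i0..<2^k}. \<integral>\<omega>. D i \<omega> + (\<Sum>u\<in>{i*L..<Suc i*L}. p i u \<omega> * drift j u \<omega>) \<partial>M)"
  proof (rule sum.cong[OF refl])
    fix i assume i: "i \<in> {i0..<2^k}"
    have "integrable M (\<lambda>\<omega>. \<Sum>u\<in>{i*L..<Suc i*L}. p i u \<omega> * drift j u \<omega>)"
      using pI(2)[OF i] by (intro Bochner_Integration.integrable_sum) auto
    moreover have "(\<Sum>u\<in>{i*L..<Suc i*L}. \<integral>\<omega>. p i u \<omega> * drift j u \<omega> \<partial>M) = (\<integral>\<omega>. (\<Sum>u\<in>{i*L..<Suc i*L}. p i u \<omega> * drift j u \<omega>) \<partial>M)"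
      using pI(2)[OF i] by (subst Bochner_Integration.integral_sum) auto
    ultimately show "(\<integral>\<omega>. D i \<omega> \<partial>M) + (\<Sum>u\<in>{i*L..<Suc i*L}. \<integral>\<omega>. p i u \<omega> * drift j u \<omega> \<partial>M) = (\<integral>\<omega>. D i \<omega> + (\<Sum>u\<in>{i*L..<Suc i*L}. p i u \<omega> * drift j u \<omega>) \<partial>M)"
      using Di[OF i] by simp
  qed
  also have "\<dots> = (\<integral>\<omega>. (\<Sum>i\<in>{i0..<2^k}. D i \<omega> + (\<Sum>u\<in>{i*L..<Suc i*L}. p i u \<omega> * drift j u \<omega>)) \<partial>M)"
    by (rule Bochner_Integration.integral_sum[symmetric])
      (intro Bochner_Integration.integrable_add Bochner_Integration.integrable_sum Di pI(2))
  also have "\<dots> \<le> (\<integral>\<omega>. (K + 2) * g \<omega> \<partial>M)"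
  proof (rule integral_mono)
    show "integrable M (\<lambda>\<omega>. \<Sum>i\<in>{i0..<2^k}. D i \<omega> + (\<Sum>u\<in>{i*L..<Suc i*L}. p i u \<omega> * drift j u \<omega>))"
      using Di pI(2) by (intro Bochner_Integration.integrable_sum Bochner_Integration.integrable_add) auto
    fix \<omega> assume w: "\<omega> \<in> space M"
    have "(\<Sum>i\<in>{i0..<2^k}. D i \<omega>) \<le> (\<Sum>i\<in>{i0..<2^k}. g \<omega> * (2 * (alive K j (grid k i) \<omega> - alive K j (grid k (Suc i)) \<omega>)))"
      by (rule sum_mono) (use D[OF _ w] in fastforce)
    also have "\<dots> = g \<omega> * (2 * (alive K j (grid k i0) \<omega> - alive K j (grid k (2^k)) \<omega>))"
    proof -
      have "(\<Sum>i\<in>{i0..<2^k}. alive K j (grid k (Suc i)) \<omega> - alive K j (grid k i) \<omega>) = alive K j (grid k (2^k)) \<omega> - alive K j (grid k i0) \<omega>"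
        by (rule sum_Suc_diff') (rule i0)
      then have "(\<Sum>i\<in>{i0..<2^k}. alive K j (grid k i) \<omega> - alive K j (grid k (Suc i)) \<omega>) = alive K j (grid k i0) \<omega> - alive K j (grid k (2^k)) \<omega>"
        by (simp add: sum_subtractf)
      then show ?thesis by (simp only: sum_distrib_left[symmetric])
    qed
    also have "\<dots> \<le> g \<omega> * 2"
      using g(2)[OF w] alive_bounds[of K j "grid k i0" \<omega>] alive_bounds[of K j "grid k (2^k)" \<omega>] by (intro mult_left_mono) auto
    finally have 1: "(\<Sum>i\<in>{i0..<2^k}. D i \<omega>) \<le> g \<omega> * 2" .
    have "(\<Sum>i\<in>{i0..<2^k}. \<Sum>u\<in>{i*L..<Suc i*L}. p i u \<omega> * drift j u \<omega>) \<le> (\<Sum>i\<in>{i0..<2^k}. \<Sum>u\<in>{i*L..<Suc i*L}. g \<omega> * (alive K j (grid j u) \<omega> * \<bar>drift j u \<omega>\<bar>))"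
    proof (intro sum_mono)
      fix i u
      have "s i \<omega> * drift j u \<omega> \<le> 1 * \<bar>drift j u \<omega>\<bar>"
        using mult_right_mono[OF sb[of i \<omega>], of "\<bar>drift j u \<omega>\<bar>"] unfolding abs_mult[symmetric] by linarith
      then have "(g \<omega> * alive K j (grid j u) \<omega>) * (s i \<omega> * drift j u \<omega>) \<le> (g \<omega> * alive K j (grid j u) \<omega>) * \<bar>drift j u \<omega>\<bar>"
        using g(2)[OF w] alive_bounds(1)[of K j "grid j u" \<omega>] by (intro mult_left_mono) auto
      then show "p i u \<omega> * drift j u \<omega> \<le> g \<omega> * (alive K j (grid j u) \<omega> * \<bar>drift j u \<omega>\<bar>)"
        unfolding p_def by (simp add: mult_ac)
    qed
    also have "\<dots> = g \<omega> * (\<Sum>u\<in>{i0*L..<2^j}. alive K j (grid j u) \<omega> * \<bar>drift j u \<omega>\<bar>)"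
      unfolding L(1)[symmetric] sum_blocks[OF i0, symmetric] by (simp add: sum_distrib_left)
    also have "\<dots> \<le> g \<omega> * (\<Sum>u<2^j. alive K j (grid j u) \<omega> * \<bar>drift j u \<omega>\<bar>)"
      using g(2)[OF w] alive_bounds(1) by (intro mult_left_mono sum_mono2) auto
    also have "\<dots> \<le> g \<omega> * K" using g(2)[OF w] alive_drift_sum[OF K order_refl] by (intro mult_left_mono) auto
    finally show "(\<Sum>i\<in>{i0..<2^k}. D i \<omega> + (\<Sum>u\<in>{i*L..<Suc i*L}. p i u \<omega> * drift j u \<omega>)) \<le> (K + 2) * g \<omega>"
      using 1 by (simp add: sum.distrib algebra_simps)
  qed (use gi in auto)
  finally show ?thesis by simp
qed

text \<open>The enumeration turns families indexed by dyadic times into families indexed by natural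
  numbers, the form in which limits are extracted simultaneously.\<close>

definition idx :: "real \<Rightarrow> nat" where "idx q = to_nat_on dyadics q"

lemma from_idx: "q \<in> dyadics \<Longrightarrow> from_nat_into dyadics (idx q) = q"
  unfolding idx_def by (rule from_nat_into_to_nat_on[OF countable_dyadics])

lemma T_dyadic: "T \<in> dyadics" using grid_dyadic[of "2^0" 0] grid_T[of 0] by simp

text \<open>Each of these properties is preserved by midpoints; being an indicator is not, and is
  given up. The last one is restricted to \<open>k \<le> m\<close> because members of the hull
  average levels at least \<open>m\<close>, and \<open>alive_coarse_drift\<close> compares a level
  only with finer ones.\<close>

lemma alive_midhull:
  assumes f: "f \<in> midhull ((\<lambda>n (k, x). alive K n (from_nat_into dyadics k) x) ` {m..})"
    and K: "0 \<le> K" and tight: "\<And>n. measure M {\<omega>\<in>space M. (\<Sum>i<2^n. \<bar>drift n i \<omega>\<bar>) > K} \<le> \<epsilon>"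
  shows "(\<forall>q\<in>dyadics. (\<lambda>\<omega>. f (idx q, \<omega>)) \<in> borel_measurable (F q)) \<and>
    (\<forall>q\<in>dyadics. \<forall>\<omega>. 0 \<le> f (idx q, \<omega>) \<and> f (idx q, \<omega>) \<le> 1) \<and>
    (\<forall>q\<in>dyadics. \<forall>q'\<in>dyadics. \<forall>\<omega>. q \<le> q' \<longrightarrow> f (idx q', \<omega>) \<le> f (idx q, \<omega>)) \<and>
    1 - \<epsilon> \<le> (\<integral>\<omega>. f (idx T, \<omega>) \<partial>M) \<and>
    (\<forall>k\<le>m. \<forall>i0\<le>2^k. \<forall>g c. g \<in> borel_measurable (F (grid k i0)) \<and> (\<forall>\<omega>\<in>space M. 0 \<le> g \<omega> \<and> g \<omega> \<le> c) \<longrightarrow>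
      (\<integral>\<omega>. g \<omega> * (\<Sum>i\<in>{i0..<2^k}. f (idx (grid k i), \<omega>) * \<bar>drift k i \<omega>\<bar>) \<partial>M) \<le> (K + 2) * (\<integral>\<omega>. g \<omega> \<partial>M))"
  using f
proof induction
  case (base f)
  then obtain n where n: "m \<le> n" "f = (\<lambda>(k, x). alive K n (from_nat_into dyadics k) x)" by auto
  have fe: "f (idx q, \<omega>) = alive K n q \<omega>" if "q \<in> dyadics" for q \<omega> unfolding n(2) by (simp add: from_idx[OF that])
  show ?case
  proof (intro conjI ballI allI impI)
    fix q assume q: "q \<in> dyadics"
    show "(\<lambda>\<omega>. f (idx q, \<omega>)) \<in> borel_measurable (F q)" unfolding fe[OF q] by (rule alive_measurable)
    show "0 \<le> f (idx q, \<omega>)" "f (idx q, \<omega>) \<le> 1" for \<omega> unfolding fe[OF q] by (rule alive_bounds)+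
    fix q' \<omega> assume "q' \<in> dyadics" "q \<le> q'"
    then show "f (idx q', \<omega>) \<le> f (idx q, \<omega>)" unfolding fe[OF q] fe[OF \<open>q' \<in> dyadics\<close>] by (intro alive_antimono)
  next
    let ?A = "{\<omega>\<in>space M. (\<Sum>i<2^n. \<bar>drift n i \<omega>\<bar>) > K}"
    have c[measurable]: "cumdrift n T \<in> borel_measurable M" using borel_F_M[OF cumdrift_measurable] T_pos by auto
    have A: "?A \<in> sets M" unfolding cumdrift_T[symmetric] by measurable
    have "(\<integral>\<omega>. f (idx T, \<omega>) \<partial>M) = (\<integral>\<omega>. indicator (space M - ?A) \<omega> \<partial>M)"
      by (rule Bochner_Integration.integral_cong) (auto simp: fe[OF T_dyadic] alive_def cumdrift_T indicator_def)
    also have "\<dots> = measure M (space M - ?A)" using A by simp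
    also have "\<dots> = 1 - measure M ?A" by (rule prob_compl[OF A])
    finally show "1 - \<epsilon> \<le> (\<integral>\<omega>. f (idx T, \<omega>) \<partial>M)" using tight[of n] by linarith
  next
    fix k i0 and g :: "'a \<Rightarrow> real" and c :: real assume k: "k \<le> m" and i0: "i0 \<le> 2 ^ k" and g: "g \<in> borel_measurable (F (grid k i0)) \<and> (\<forall>\<omega>\<in>space M. 0 \<le> g \<omega> \<and> g \<omega> \<le> c)"
    have "(\<Sum>i\<in>{i0..<2^k}. f (idx (grid k i), \<omega>) * \<bar>drift k i \<omega>\<bar>) = (\<Sum>i\<in>{i0..<2^k}. alive K n (grid k i) \<omega> * \<bar>drift k i \<omega>\<bar>)" for \<omega>
      by (rule sum.cong) (auto simp: fe grid_dyadic)
    then show "(\<integral>\<omega>. g \<omega> * (\<Sum>i\<in>{i0..<2^k}. f (idx (grid k i), \<omega>) * \<bar>drift k i \<omega>\<bar>) \<partial>M) \<le> (K + 2) * (\<integral>\<omega>. g \<omega> \<partial>M)"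
      using alive_coarse_drift[OF K, of k n i0 g c] k n(1) i0 g by simp
  qed
next
  case (mid f1 f2)
  note M1 = mid.IH(1)[THEN conjunct1, rule_format] mid.IH(2)[THEN conjunct1, rule_format]
  note B1 = mid.IH(1)[THEN conjunct2, THEN conjunct1, rule_format] mid.IH(2)[THEN conjunct2, THEN conjunct1, rule_format]
  note A1 = mid.IH(1)[THEN conjunct2, THEN conjunct2, THEN conjunct1, rule_format] mid.IH(2)[THEN conjunct2, THEN conjunct2, THEN conjunct1, rule_format]
  note T1 = mid.IH(1)[THEN conjunct2, THEN conjunct2, THEN conjunct2, THEN conjunct1] mid.IH(2)[THEN conjunct2, THEN conjunct2, THEN conjunct2, THEN conjunct1]
  note G1 = mid.IH(1)[THEN conjunct2, THEN conjunct2, THEN conjunct2, THEN conjunct2, rule_format] mid.IH(2)[THEN conjunct2, THEN conjunct2, THEN conjunct2, THEN conjunct2, rule_format]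
  have fm: "(\<lambda>\<omega>. f1 (idx q, \<omega>)) \<in> borel_measurable (F q)" "(\<lambda>\<omega>. f2 (idx q, \<omega>)) \<in> borel_measurable (F q)" if "q \<in> dyadics" for q
    by (rule M1[OF that])+
  have fb: "0 \<le> f1 (idx q, \<omega>)" "f1 (idx q, \<omega>) \<le> 1" "0 \<le> f2 (idx q, \<omega>)" "f2 (idx q, \<omega>) \<le> 1" if "q \<in> dyadics" for q \<omega>
    using B1(1)[OF that, of \<omega>] B1(2)[OF that, of \<omega>] by auto
  have fM[measurable]: "(\<lambda>\<omega>. f1 (idx q, \<omega>)) \<in> borel_measurable M" "(\<lambda>\<omega>. f2 (idx q, \<omega>)) \<in> borel_measurable M" if "q \<in> dyadics" for q
    using borel_F_M[OF fm(1)[OF that]] borel_F_M[OF fm(2)[OF that]] that dyadics_range by auto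
  have fi: "integrable M (\<lambda>\<omega>. f1 (idx q, \<omega>))" "integrable M (\<lambda>\<omega>. f2 (idx q, \<omega>))" if "q \<in> dyadics" for q
    by (rule bounded_integrable[of _ 1]; use fM[OF that] fb[OF that] in auto)+
  show ?case
  proof (intro conjI ballI allI impI)
    fix q assume q: "q \<in> dyadics"
    show "(\<lambda>\<omega>. (f1 (idx q, \<omega>) + f2 (idx q, \<omega>)) / 2) \<in> borel_measurable (F q)" using fm[OF q] by measurable
    show "0 \<le> (f1 (idx q, \<omega>) + f2 (idx q, \<omega>)) / 2" "(f1 (idx q, \<omega>) + f2 (idx q, \<omega>)) / 2 \<le> 1" for \<omega>
      using fb[OF q, of \<omega>] by auto
    fix q' \<omega> assume q': "q' \<in> dyadics" "q \<le> q'"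
    have "f1 (idx q', \<omega>) \<le> f1 (idx q, \<omega>)" "f2 (idx q', \<omega>) \<le> f2 (idx q, \<omega>)" by (rule A1[OF q q'])+
    then show "(f1 (idx q', \<omega>) + f2 (idx q', \<omega>)) / 2 \<le> (f1 (idx q, \<omega>) + f2 (idx q, \<omega>)) / 2" by simp
  next
    have "1 - \<epsilon> \<le> (\<integral>\<omega>. f1 (idx T, \<omega>) \<partial>M)" "1 - \<epsilon> \<le> (\<integral>\<omega>. f2 (idx T, \<omega>) \<partial>M)" by (rule T1)+
    then show "1 - \<epsilon> \<le> (\<integral>\<omega>. (f1 (idx T, \<omega>) + f2 (idx T, \<omega>)) / 2 \<partial>M)" using fi[OF T_dyadic] by simp
  next
    fix k i0 and g :: "'a \<Rightarrow> real" and c :: real assume k: "k \<le> m" and i0: "i0 \<le> 2 ^ k" and g: "g \<in> borel_measurable (F (grid k i0)) \<and> (\<forall>\<omega>\<in>space M. 0 \<le> g \<omega> \<and> g \<omega> \<le> c)"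
    have gM[measurable]: "g \<in> borel_measurable M" using borel_F_M[OF _ grid_in[OF i0]] g by blast
    have it: "integrable M (\<lambda>\<omega>. g \<omega> * (\<Sum>i\<in>{i0..<2^k}. f (idx (grid k i), \<omega>) * \<bar>drift k i \<omega>\<bar>))"
      if f: "\<And>q. q \<in> dyadics \<Longrightarrow> (\<lambda>\<omega>. f (idx q, \<omega>)) \<in> borel_measurable M" "\<And>q \<omega>. q \<in> dyadics \<Longrightarrow> \<bar>f (idx q, \<omega>)\<bar> \<le> 1" for f
      unfolding sum_distrib_left
    proof (rule Bochner_Integration.integrable_sum)
      fix i assume "i \<in> {i0..<2^k}"
      then have q: "grid k i \<in> dyadics" "i \<le> 2 ^ k" using grid_dyadic[of i k] by auto
      show "integrable M (\<lambda>\<omega>. g \<omega> * (f (idx (grid k i), \<omega>) * \<bar>drift k i \<omega>\<bar>))"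
      proof (rule bounded_integrable)
        show "(\<lambda>\<omega>. g \<omega> * (f (idx (grid k i), \<omega>) * \<bar>drift k i \<omega>\<bar>)) \<in> borel_measurable M"
          using gM f(1)[OF q(1)] drift_M[OF q(2)] by measurable
        show "\<bar>g \<omega> * (f (idx (grid k i), \<omega>) * \<bar>drift k i \<omega>\<bar>)\<bar> \<le> \<bar>c\<bar> * (1 * 2)" if "\<omega> \<in> space M" for \<omega>
          unfolding abs_mult using g that f(2)[OF q(1), of \<omega>] drift_bound[of k i \<omega>] by (intro mult_mono) (auto simp: abs_if)
      qed
    qed
    have i1: "integrable M (\<lambda>\<omega>. g \<omega> * (\<Sum>i\<in>{i0..<2^k}. f1 (idx (grid k i), \<omega>) * \<bar>drift k i \<omega>\<bar>))"
      by (rule it) (use fM fb in auto)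
    have i2: "integrable M (\<lambda>\<omega>. g \<omega> * (\<Sum>i\<in>{i0..<2^k}. f2 (idx (grid k i), \<omega>) * \<bar>drift k i \<omega>\<bar>))"
      by (rule it) (use fM fb in auto)
    have "(\<integral>\<omega>. g \<omega> * (\<Sum>i\<in>{i0..<2^k}. (f1 (idx (grid k i), \<omega>) + f2 (idx (grid k i), \<omega>)) / 2 * \<bar>drift k i \<omega>\<bar>) \<partial>M)
      = (\<integral>\<omega>. (g \<omega> * (\<Sum>i\<in>{i0..<2^k}. f1 (idx (grid k i), \<omega>) * \<bar>drift k i \<omega>\<bar>) + g \<omega> * (\<Sum>i\<in>{i0..<2^k}. f2 (idx (grid k i), \<omega>) * \<bar>drift k i \<omega>\<bar>)) / 2 \<partial>M)"
    proof (rule Bochner_Integration.integral_cong[OF refl])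
      fix \<omega>
      have "(\<Sum>i\<in>{i0..<2^k}. (f1 (idx (grid k i), \<omega>) + f2 (idx (grid k i), \<omega>)) / 2 * \<bar>drift k i \<omega>\<bar>) =
        ((\<Sum>i\<in>{i0..<2^k}. f1 (idx (grid k i), \<omega>) * \<bar>drift k i \<omega>\<bar>) + (\<Sum>i\<in>{i0..<2^k}. f2 (idx (grid k i), \<omega>) * \<bar>drift k i \<omega>\<bar>)) / 2"
        unfolding sum.distrib[symmetric] sum_divide_distrib by (rule sum.cong) (auto simp: field_simps)
      then show "g \<omega> * (\<Sum>i\<in>{i0..<2^k}. (f1 (idx (grid k i), \<omega>) + f2 (idx (grid k i), \<omega>)) / 2 * \<bar>drift k i \<omega>\<bar>)
        = (g \<omega> * (\<Sum>i\<in>{i0..<2^k}. f1 (idx (grid k i), \<omega>) * \<bar>drift k i \<omega>\<bar>) + g \<omega> * (\<Sum>i\<in>{i0..<2^k}. f2 (idx (grid k i), \<omega>) * \<bar>drift k i \<omega>\<bar>)) / 2"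
        by (simp only: distrib_left times_divide_eq_right)
    qed
    also have "\<dots> = ((\<integral>\<omega>. g \<omega> * (\<Sum>i\<in>{i0..<2^k}. f1 (idx (grid k i), \<omega>) * \<bar>drift k i \<omega>\<bar>) \<partial>M) + (\<integral>\<omega>. g \<omega> * (\<Sum>i\<in>{i0..<2^k}. f2 (idx (grid k i), \<omega>) * \<bar>drift k i \<omega>\<bar>) \<partial>M)) / 2"
      using i1 i2 by simp
    also have "\<dots> \<le> (K + 2) * (\<integral>\<omega>. g \<omega> \<partial>M)"
    proof -
      have "(\<integral>\<omega>. g \<omega> * (\<Sum>i\<in>{i0..<2^k}. f1 (idx (grid k i), \<omega>) * \<bar>drift k i \<omega>\<bar>) \<partial>M) \<le> (K + 2) * (\<integral>\<omega>. g \<omega> \<partial>M)"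
        "(\<integral>\<omega>. g \<omega> * (\<Sum>i\<in>{i0..<2^k}. f2 (idx (grid k i), \<omega>) * \<bar>drift k i \<omega>\<bar>) \<partial>M) \<le> (K + 2) * (\<integral>\<omega>. g \<omega> \<partial>M)"
        by (rule G1[OF k i0 g])+
      then show ?thesis by simp
    qed
    finally show "(\<integral>\<omega>. g \<omega> * (\<Sum>i\<in>{i0..<2^k}. (f1 (idx (grid k i), \<omega>) + f2 (idx (grid k i), \<omega>)) / 2 * \<bar>drift k i \<omega>\<bar>) \<partial>M) \<le> (K + 2) * (\<integral>\<omega>. g \<omega> \<partial>M)" .
  qed
qed


text \<open>The stopping time is the first dyadic time at which the limit \<open>R\<close> of convex combinations of the indicators
  \<open>alive\<close> is below \<open>1/2\<close>; before it, \<open>1 \<le> 2 * R\<close> transfers the bounds on the weighted drifts.\<close>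

lemma tight_stopping_time:
  assumes e: "0 < \<epsilon>"
  shows "\<exists>\<rho> C. ext_stopping_time M F T \<rho> \<and> 1 - \<epsilon> \<le> measure M {\<omega>\<in>space M. \<rho> \<omega> = \<infinity>} \<and> 0 \<le> C \<and>
    (\<forall>k i0 g c. i0 \<le> 2 ^ k \<and> g \<in> borel_measurable (F (grid k i0)) \<and> (\<forall>\<omega>\<in>space M. 0 \<le> g \<omega> \<and> g \<omega> \<le> c) \<longrightarrow>
      (\<integral>\<omega>. g \<omega> * (\<Sum>i\<in>{i0..<2^k}. of_bool (ereal (grid k i) < \<rho> \<omega>) * \<bar>drift k i \<omega>\<bar>) \<partial>M) \<le> C * (\<integral>\<omega>. g \<omega> \<partial>M))"
proof -
  obtain K where K: "0 \<le> K" and tight: "\<And>n. measure M {\<omega>\<in>space M. (\<Sum>i<2^n. \<bar>drift n i \<omega>\<bar>) > K} \<le> \<epsilon> / 2"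
    using drift_tight[of "\<epsilon>/2"] e by auto
  define u where "u n k = alive K n (from_nat_into dyadics k)" for n k
  have ne: "dyadics \<noteq> {}" using T_dyadic by auto
  have um: "u n k \<in> borel_measurable M" for n k
    using borel_F_M[OF alive_measurable] from_nat_into[OF ne, of k] dyadics_range unfolding u_def by blast
  have ub: "\<bar>(u n k \<omega>)\<^sup>2\<bar> \<le> 1" for n k \<omega> using alive_cases[of K n "from_nat_into dyadics k" \<omega>] unfolding u_def by auto
  have ui: "integrable M (\<lambda>\<omega>. (u n k \<omega>)\<^sup>2)" for n k
    by (rule bounded_integrable[of _ 1]) (use um ub in auto)
  have uC: "(\<integral>\<omega>. (u n k \<omega>)\<^sup>2 \<partial>M) \<le> 1" for n k
  proof -
    have "(\<integral>\<omega>. (u n k \<omega>)\<^sup>2 \<partial>M) \<le> (\<integral>\<omega>. 1 \<partial>M)" by (rule integral_mono) (use ui ub in \<open>auto simp: abs_le_iff\<close>)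
    then show ?thesis by (simp add: prob_space)
  qed
  obtain f G where fh: "\<forall>m. f m \<in> midhull ((\<lambda>n (k, x). u n k x) ` {m..})"
    and fG: "\<forall>k. integrable M (G k) \<and> (AE x in M. (\<lambda>n. f n (k, x)) \<longlonglongrightarrow> G k x) \<and> (\<lambda>n. \<integral>x. \<bar>f n (k, x) - G k x\<bar> \<partial>M) \<longlonglongrightarrow> 0"
    using komlos_midhull_family[of u, OF um ui uC] by (elim exE conjE) (rule that)
  have fh': "f m \<in> midhull ((\<lambda>n (k, x). alive K n (from_nat_into dyadics k) x) ` {m..})" for m
    using fh unfolding u_def by blast
  note P = alive_midhull[OF fh' K tight]
  note Pm = P[THEN conjunct1, rule_format]
    and Pb = P[THEN conjunct2, THEN conjunct1, rule_format]
    and Pa = P[THEN conjunct2, THEN conjunct2, THEN conjunct1, rule_format]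
    and PT = P[THEN conjunct2, THEN conjunct2, THEN conjunct2, THEN conjunct1]
    and Pg = P[THEN conjunct2, THEN conjunct2, THEN conjunct2, THEN conjunct2, rule_format]
  \<comment> \<open>The pointwise \<open>lim\<close> is used rather than the limit \<open>G\<close>
    from compactness: it agrees with \<open>G\<close> almost everywhere and is visibly measurable at
    time \<open>q\<close>, as a limit of functions known at that time.\<close>
  define R where "R q \<omega> = lim (\<lambda>m. f m (idx q, \<omega>))" for q \<omega>
  have Rm: "R q \<in> borel_measurable (F q)" if "q \<in> dyadics" for q
    unfolding R_def by (rule borel_measurable_lim_metric) (rule Pm[OF that])
  have RM: "R q \<in> borel_measurable M" "(\<lambda>\<omega>. f m (idx q, \<omega>)) \<in> borel_measurable M" if "q \<in> dyadics" for q m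
    using borel_F_M[OF Rm[OF that]] borel_F_M[OF Pm[OF that]] that dyadics_range by blast+
  have good: "AE \<omega> in M. \<forall>k. (\<lambda>m. f m (k, \<omega>)) \<longlonglongrightarrow> lim (\<lambda>m. f m (k, \<omega>))"
    unfolding AE_all_countable
  proof
    fix k
    have "AE x in M. (\<lambda>n. f n (k, x)) \<longlonglongrightarrow> G k x" using fG by blast
    then show "AE \<omega> in M. (\<lambda>m. f m (k, \<omega>)) \<longlonglongrightarrow> lim (\<lambda>m. f m (k, \<omega>))"
      by eventually_elim (simp add: limI)
  qed
  have goodR: "AE \<omega> in M. \<forall>q. (\<lambda>m. f m (idx q, \<omega>)) \<longlonglongrightarrow> R q \<omega>"
    using good by eventually_elim (simp add: R_def)
  have R01: "AE \<omega> in M. \<forall>q\<in>dyadics. 0 \<le> R q \<omega> \<and> R q \<omega> \<le> 1"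
    using goodR
  proof eventually_elim
    case (elim \<omega>)
    show ?case
    proof (intro ballI conjI)
      fix q assume q: "q \<in> dyadics"
      show "0 \<le> R q \<omega>" by (rule LIMSEQ_le_const[OF elim[rule_format]]) (use Pb[OF q] in auto)
      show "R q \<omega> \<le> 1" by (rule LIMSEQ_le_const2[OF elim[rule_format]]) (use Pb[OF q] in auto)
    qed
  qed
  have Rmono: "AE \<omega> in M. \<forall>q\<in>dyadics. R T \<omega> \<le> R q \<omega>"
    using goodR
  proof eventually_elim
    case (elim \<omega>)
    show ?case
    proof
      fix q assume q: "q \<in> dyadics"
      have "q \<le> T" using q dyadics_range by auto
      then show "R T \<omega> \<le> R q \<omega>"
        by (intro LIMSEQ_le[OF elim[rule_format] elim[rule_format]] exI[of _ 0]) (use Pa[OF q T_dyadic] in auto)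
    qed
  qed
  define B where "B q = {\<omega>\<in>space M. R q \<omega> < 1/2}" for q
  have BF: "B q \<in> sets (F q)" if "q \<in> dyadics" for q
  proof -
    have "{\<omega>\<in>space (F q). R q \<omega> < 1/2} \<in> sets (F q)" using Rm[OF that] by measurable
    then show ?thesis unfolding B_def by simp
  qed
  define \<rho> where "\<rho> = dyadic_hit B"
  have \<rho>: "ext_stopping_time M F T \<rho>" unfolding \<rho>_def by (rule dyadic_hit_stopping_time[OF BF])
  have RT: "1 - \<epsilon>/2 \<le> (\<integral>\<omega>. R T \<omega> \<partial>M)"
  proof -
    have "(\<lambda>m. \<integral>\<omega>. f m (idx T, \<omega>) \<partial>M) \<longlonglongrightarrow> (\<integral>\<omega>. R T \<omega> \<partial>M)"
    proof (rule integral_dominated_convergence[where w="\<lambda>_. 1"])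
      show "AE \<omega> in M. (\<lambda>m. f m (idx T, \<omega>)) \<longlonglongrightarrow> R T \<omega>" using goodR by eventually_elim simp
      show "AE \<omega> in M. norm (f m (idx T, \<omega>)) \<le> 1" for m using Pb[OF T_dyadic, of m] by auto
    qed (use RM[OF T_dyadic] in auto)
    then show ?thesis by (rule LIMSEQ_le_const) (use PT in auto)
  qed
  \<comment> \<open>On \<open>B T\<close> almost surely \<open>1 - R T > 1/2\<close>, so its
    probability is at most twice the mean of \<open>1 - R T\<close>, hence at most
    \<open>\<epsilon>\<close>. By monotonicity \<open>R T \<ge> 1/2\<close> keeps every
    \<open>R q\<close> at or above the level as well, so \<open>\<rho>\<close> is infinite
    there.\<close>
  have prob: "1 - \<epsilon> \<le> measure M {\<omega>\<in>space M. \<rho> \<omega> = \<infinity>}"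
  proof -
    have BT: "B T \<in> sets M" using BF[OF T_dyadic] F_sub[of T] T_pos by auto
    have iR: "integrable M (R T)" by (rule integrable_const_bound[of _ 1]) (use R01 T_dyadic RM[OF T_dyadic] in auto)
    have "measure M (B T) / 2 = (\<integral>\<omega>. indicator (B T) \<omega> / 2 \<partial>M)" using BT by simp
    also have "\<dots> \<le> (\<integral>\<omega>. 1 - R T \<omega> \<partial>M)"
    proof (rule integral_mono_AE)
      show "AE \<omega> in M. indicator (B T) \<omega> / 2 \<le> 1 - R T \<omega>"
        using R01 by eventually_elim (use T_dyadic in \<open>auto simp: B_def indicator_def\<close>)
      show "integrable M (\<lambda>\<omega>. indicator (B T) \<omega> / 2 :: real)" using BT by (auto simp: less_top[symmetric])
    qed (use iR in auto)
    also have "\<dots> = 1 - (\<integral>\<omega>. R T \<omega> \<partial>M)" using iR by (simp add: prob_space)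
    finally have bT: "measure M (B T) \<le> \<epsilon>" using RT by simp
    have "measure M (space M - B T) \<le> measure M {\<omega>\<in>space M. \<rho> \<omega> = \<infinity>}"
    proof (rule finite_measure_mono_AE[OF _ ext_stopping_time_infinity_sets[OF \<rho>]])
      show "AE \<omega> in M. \<omega> \<in> space M - B T \<longrightarrow> \<omega> \<in> {\<omega>\<in>space M. \<rho> \<omega> = \<infinity>}"
        using Rmono
      proof eventually_elim
        case (elim \<omega>)
        show ?case unfolding \<rho>_def dyadic_hit_infinity using elim unfolding B_def by fastforce
      qed
    qed
    then show ?thesis using prob_compl[OF BT] bT by linarith
  qed
  have bound: "(\<integral>\<omega>. g \<omega> * (\<Sum>i\<in>{i0..<2^k}. of_bool (ereal (grid k i) < \<rho> \<omega>) * \<bar>drift k i \<omega>\<bar>) \<partial>M) \<le> 2 * (K + 2) * (\<integral>\<omega>. g \<omega> \<partial>M)"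
    if i0: "i0 \<le> 2 ^ k" and g: "g \<in> borel_measurable (F (grid k i0))" "\<And>\<omega>. \<omega> \<in> space M \<Longrightarrow> 0 \<le> g \<omega> \<and> g \<omega> \<le> c" for k i0 g c
  proof -
    have gM[measurable]: "g \<in> borel_measurable M" by (rule borel_F_M[OF g(1) grid_in[OF i0]])
    have gr: "grid k i \<in> dyadics" "i \<le> 2 ^ k" if "i \<in> {i0..<2^k}" for i using grid_dyadic[of i k] that by auto
    have dM: "drift k i \<in> borel_measurable M" if "i \<in> {i0..<2^k}" for i by (rule drift_M[OF gr(2)[OF that]])
    have bd: "\<bar>g \<omega> * (\<Sum>i\<in>{i0..<2^k}. x i * \<bar>drift k i \<omega>\<bar>)\<bar> \<le> \<bar>c\<bar> * (\<Sum>i\<in>{i0..<2^k}. 1 * 2)"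
      if w: "\<omega> \<in> space M" and x: "\<And>i. i \<in> {i0..<2^k} \<Longrightarrow> \<bar>x i\<bar> \<le> 1" for x \<omega>
    proof -
      have "\<bar>\<Sum>i\<in>{i0..<2^k}. x i * \<bar>drift k i \<omega>\<bar>\<bar> \<le> (\<Sum>i\<in>{i0..<2^k}. \<bar>x i * \<bar>drift k i \<omega>\<bar>\<bar>)" by (rule sum_abs)
      also have "\<dots> \<le> (\<Sum>i\<in>{i0..<2^k}. 1 * 2)" unfolding abs_mult
        using x drift_bound[of k _ \<omega>] by (intro sum_mono mult_mono) auto
      finally show ?thesis unfolding abs_mult[of "g \<omega>"] using g(2)[OF w] by (intro mult_mono) auto
    qed
    have RMi: "(\<lambda>\<omega>. g \<omega> * (\<Sum>i\<in>{i0..<2^k}. R (grid k i) \<omega> * \<bar>drift k i \<omega>\<bar>)) \<in> borel_measurable M"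
      using RM(1)[OF gr(1)] dM by (intro borel_measurable_times borel_measurable_sum gM) auto
    have lim: "(\<lambda>m. \<integral>\<omega>. g \<omega> * (\<Sum>i\<in>{i0..<2^k}. f m (idx (grid k i), \<omega>) * \<bar>drift k i \<omega>\<bar>) \<partial>M)
      \<longlonglongrightarrow> (\<integral>\<omega>. g \<omega> * (\<Sum>i\<in>{i0..<2^k}. R (grid k i) \<omega> * \<bar>drift k i \<omega>\<bar>) \<partial>M)"
    proof (rule integral_dominated_convergence[where w="\<lambda>_. \<bar>c\<bar> * (\<Sum>i\<in>{i0..<2^k}. 1 * 2)"])
      show "AE \<omega> in M. (\<lambda>m. g \<omega> * (\<Sum>i\<in>{i0..<2^k}. f m (idx (grid k i), \<omega>) * \<bar>drift k i \<omega>\<bar>)) \<longlonglongrightarrow> g \<omega> * (\<Sum>i\<in>{i0..<2^k}. R (grid k i) \<omega> * \<bar>drift k i \<omega>\<bar>)"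
        using goodR
      proof eventually_elim
        case (elim \<omega>)
        show ?case using elim by (intro tendsto_mult tendsto_const tendsto_sum) auto
      qed
      show "AE \<omega> in M. norm (g \<omega> * (\<Sum>i\<in>{i0..<2^k}. f m (idx (grid k i), \<omega>) * \<bar>drift k i \<omega>\<bar>)) \<le> \<bar>c\<bar> * (\<Sum>i\<in>{i0..<2^k}. 1 * 2)" for m
        unfolding real_norm_def
      proof (rule AE_I2, rule bd)
        fix \<omega> i assume "i \<in> {i0..<2^k}"
        then show "\<bar>f m (idx (grid k i), \<omega>)\<bar> \<le> 1" using Pb[OF gr(1), of i m \<omega>] by auto
      qed
      show "(\<lambda>\<omega>. g \<omega> * (\<Sum>i\<in>{i0..<2^k}. f m (idx (grid k i), \<omega>) * \<bar>drift k i \<omega>\<bar>)) \<in> borel_measurable M" for m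
        using RM(2)[OF gr(1)] dM by (intro borel_measurable_times borel_measurable_sum gM) auto
    qed (use RMi in auto)
    have le: "(\<integral>\<omega>. g \<omega> * (\<Sum>i\<in>{i0..<2^k}. R (grid k i) \<omega> * \<bar>drift k i \<omega>\<bar>) \<partial>M) \<le> (K + 2) * (\<integral>\<omega>. g \<omega> \<partial>M)"
    proof (rule LIMSEQ_le_const2[OF lim], intro exI[of _ k] allI impI)
      fix m assume "k \<le> m"
      then show "(\<integral>\<omega>. g \<omega> * (\<Sum>i\<in>{i0..<2^k}. f m (idx (grid k i), \<omega>) * \<bar>drift k i \<omega>\<bar>) \<partial>M) \<le> (K + 2) * (\<integral>\<omega>. g \<omega> \<partial>M)"
        by (rule Pg[OF _ i0]) (use g in blast)
    qed
    have iR: "integrable M (\<lambda>\<omega>. g \<omega> * (\<Sum>i\<in>{i0..<2^k}. R (grid k i) \<omega> * \<bar>drift k i \<omega>\<bar>))"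
    proof (rule integrable_const_bound[OF _ RMi])
      show "AE \<omega> in M. norm (g \<omega> * (\<Sum>i\<in>{i0..<2^k}. R (grid k i) \<omega> * \<bar>drift k i \<omega>\<bar>)) \<le> \<bar>c\<bar> * (\<Sum>i\<in>{i0..<2^k}. 1 * 2)"
        using R01 AE_space unfolding real_norm_def
      proof eventually_elim
        case (elim \<omega>)
        show ?case
        proof (rule bd[OF elim(2)])
          fix i assume i: "i \<in> {i0..<2^k}"
          show "\<bar>R (grid k i) \<omega>\<bar> \<le> 1" using elim(1)[rule_format, OF gr(1)[OF i]] by auto
        qed
      qed
    qed
    have "(\<integral>\<omega>. g \<omega> * (\<Sum>i\<in>{i0..<2^k}. of_bool (ereal (grid k i) < \<rho> \<omega>) * \<bar>drift k i \<omega>\<bar>) \<partial>M)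
      \<le> (\<integral>\<omega>. 2 * (g \<omega> * (\<Sum>i\<in>{i0..<2^k}. R (grid k i) \<omega> * \<bar>drift k i \<omega>\<bar>)) \<partial>M)"
    proof (rule integral_mono_AE')
      show "integrable M (\<lambda>\<omega>. 2 * (g \<omega> * (\<Sum>i\<in>{i0..<2^k}. R (grid k i) \<omega> * \<bar>drift k i \<omega>\<bar>)))" using iR by simp
      show "AE \<omega> in M. g \<omega> * (\<Sum>i\<in>{i0..<2^k}. of_bool (ereal (grid k i) < \<rho> \<omega>) * \<bar>drift k i \<omega>\<bar>)
        \<le> 2 * (g \<omega> * (\<Sum>i\<in>{i0..<2^k}. R (grid k i) \<omega> * \<bar>drift k i \<omega>\<bar>))"
        using R01 AE_space
      proof eventually_elim
        case (elim \<omega>)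
        have "of_bool (ereal (grid k i) < \<rho> \<omega>) \<le> 2 * R (grid k i) \<omega>" if i: "i \<in> {i0..<2^k}" for i
        proof (cases "ereal (grid k i) < \<rho> \<omega>")
          case True
          then have "\<omega> \<notin> B (grid k i)"
            unfolding \<rho>_def dyadic_hit_def using gr(1)[OF i] by (auto simp: not_le[symmetric] intro: Inf_lower)
          then show ?thesis using True elim(2) unfolding B_def by auto
        next
          case False
          then show ?thesis using elim(1)[rule_format, OF gr(1)[OF i]] by simp
        qed
        then have "(\<Sum>i\<in>{i0..<2^k}. of_bool (ereal (grid k i) < \<rho> \<omega>) * \<bar>drift k i \<omega>\<bar>) \<le> (\<Sum>i\<in>{i0..<2^k}. 2 * R (grid k i) \<omega> * \<bar>drift k i \<omega>\<bar>)"
          by (intro sum_mono mult_right_mono) auto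
        also have "\<dots> = 2 * (\<Sum>i\<in>{i0..<2^k}. R (grid k i) \<omega> * \<bar>drift k i \<omega>\<bar>)" by (simp add: sum_distrib_left mult.assoc)
        finally have "g \<omega> * (\<Sum>i\<in>{i0..<2^k}. of_bool (ereal (grid k i) < \<rho> \<omega>) * \<bar>drift k i \<omega>\<bar>) \<le> g \<omega> * (2 * (\<Sum>i\<in>{i0..<2^k}. R (grid k i) \<omega> * \<bar>drift k i \<omega>\<bar>))"
          using g(2)[OF elim(2)] by (intro mult_left_mono) auto
        then show ?case by (simp only: mult.left_commute)
      qed
      show "AE \<omega> in M. 0 \<le> 2 * (g \<omega> * (\<Sum>i\<in>{i0..<2^k}. R (grid k i) \<omega> * \<bar>drift k i \<omega>\<bar>))"
        using R01 AE_space
      proof eventually_elim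
        case (elim \<omega>)
        have "0 \<le> (\<Sum>i\<in>{i0..<2^k}. R (grid k i) \<omega> * \<bar>drift k i \<omega>\<bar>)"
          by (intro sum_nonneg mult_nonneg_nonneg) (use elim(1) gr(1) in auto)
        then show ?case using g(2)[OF elim(2)] by simp
      qed
    qed
    also have "\<dots> = 2 * (\<integral>\<omega>. g \<omega> * (\<Sum>i\<in>{i0..<2^k}. R (grid k i) \<omega> * \<bar>drift k i \<omega>\<bar>) \<partial>M)" by simp
    also have "\<dots> \<le> 2 * ((K + 2) * (\<integral>\<omega>. g \<omega> \<partial>M))" using le by (intro mult_left_mono) auto
    finally show ?thesis by (simp only: mult.assoc)
  qed
  show ?thesis
  proof (intro exI[of _ \<rho>] exI[of _ "2 * (K + 2)"] conjI \<rho> prob allI impI)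
    show "0 \<le> 2 * (K + 2)" using K by simp
    fix k i0 and g :: "'a \<Rightarrow> real" and c :: real
    assume a: "i0 \<le> 2 ^ k \<and> g \<in> borel_measurable (F (grid k i0)) \<and> (\<forall>\<omega>\<in>space M. 0 \<le> g \<omega> \<and> g \<omega> \<le> c)"
    show "(\<integral>\<omega>. g \<omega> * (\<Sum>i\<in>{i0..<2^k}. of_bool (ereal (grid k i) < \<rho> \<omega>) * \<bar>drift k i \<omega>\<bar>) \<partial>M) \<le> 2 * (K + 2) * (\<integral>\<omega>. g \<omega> \<partial>M)"
      by (rule bound[of i0 k g c]) (use a in blast)+
  qed
qed

end

section \<open>The limiting compensator\<close>

text \<open>Discrete integration by parts: the square counts each off-diagonal product twice and
  each diagonal one once, while the right-hand side counts both twice. The tail sums on the right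
  are what a potential bound controls.\<close>

lemma square_sum_le:
  fixes b :: "nat \<Rightarrow> real"
  shows "(\<Sum>i<n. b i)\<^sup>2 \<le> 2 * (\<Sum>i<n. b i * (\<Sum>l\<in>{i..<n}. b l))"
proof (induction n)
  case (Suc n)
  have "(\<Sum>i<Suc n. b i * (\<Sum>l\<in>{i..<Suc n}. b l)) = (\<Sum>i<n. b i * (\<Sum>l\<in>{i..<n}. b l) + b i * b n) + b n * b n"
    by (simp add: sum.atLeastLessThan_Suc distrib_left)
  also have "\<dots> = (\<Sum>i<n. b i * (\<Sum>l\<in>{i..<n}. b l)) + (\<Sum>i<n. b i) * b n + b n * b n"
    by (simp add: sum.distrib sum_distrib_right)
  finally have eq: "(\<Sum>i<Suc n. b i * (\<Sum>l\<in>{i..<Suc n}. b l)) = (\<Sum>i<n. b i * (\<Sum>l\<in>{i..<n}. b l)) + (\<Sum>i<n. b i) * b n + b n * b n" .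
  have "(\<Sum>i<Suc n. b i)\<^sup>2 = (\<Sum>i<n. b i)\<^sup>2 + 2 * ((\<Sum>i<n. b i) * b n) + b n * b n"
    by (simp add: power2_eq_square algebra_simps)
  moreover have "0 \<le> b n * b n" by simp
  moreover have "x \<le> 2 * (a + p + q)" if "x = y + 2 * p + q" "0 \<le> q" "y \<le> 2 * a" for x y a p q :: real
    using that by auto
  ultimately show ?case unfolding eq using Suc by blast
qed simp

text \<open>\<open>potential\<close> says that the conditional expectation of the total drift still
  to come before \<open>r\<close> is at most \<open>C\<close>. It is written against nonnegative
  test functions, so that it passes to limits without handling conditional expectations.\<close>

locale bounded_stop = bounded_nfl +
  fixes r :: "'a \<Rightarrow> real" and C :: real
  assumes r_stop: "stopping_time F r" and r_range: "\<And>\<omega>. \<omega> \<in> space M \<Longrightarrow> r \<omega> \<in> {0..T}"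
    and C_nonneg: "0 \<le> C"
    and potential: "\<And>k i0 g c. i0 \<le> 2 ^ k \<Longrightarrow> g \<in> borel_measurable (F (grid k i0)) \<Longrightarrow> (\<And>\<omega>. \<omega> \<in> space M \<Longrightarrow> 0 \<le> g \<omega> \<and> g \<omega> \<le> c) \<Longrightarrow>
      (\<integral>\<omega>. g \<omega> * (\<Sum>i\<in>{i0..<2^k}. of_bool (grid k i < r \<omega>) * \<bar>drift k i \<omega>\<bar>) \<partial>M) \<le> C * (\<integral>\<omega>. g \<omega> \<partial>M)"
begin

text \<open>A cell is kept whole as soon as it begins before \<open>r\<close>, which is decided at
  its left end. The stopped grid path therefore runs to the first grid point at or after
  \<open>r\<close> and approaches \<open>r\<close> from the right as the mesh shrinks.\<close>

definition alpha :: "nat \<Rightarrow> nat \<Rightarrow> 'a \<Rightarrow> real" where "alpha n l \<omega> = of_bool (grid n l < r \<omega>) * drift n l \<omega>"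
definition eta :: "nat \<Rightarrow> nat \<Rightarrow> 'a \<Rightarrow> real" where "eta n l \<omega> = of_bool (grid n l < r \<omega>) * incr n l \<omega>"
definition comp :: "nat \<Rightarrow> real \<Rightarrow> 'a \<Rightarrow> real" where
  "comp n t \<omega> = (\<Sum>l<2^n. if grid n (Suc l) \<le> t then alpha n l \<omega> else 0)"
definition stopped_incr :: "nat \<Rightarrow> real \<Rightarrow> 'a \<Rightarrow> real" where
  "stopped_incr n t \<omega> = (\<Sum>l<2^n. if grid n (Suc l) \<le> t then eta n l \<omega> else 0)"

lemma before_measurable: "(\<lambda>\<omega>. of_bool (grid n l < r \<omega>) :: real) \<in> borel_measurable (F (grid n l))"
proof -
  have [measurable]: "Measurable.pred (F (grid n l)) (\<lambda>\<omega>. grid n l < r \<omega>)" by (rule stopping_timeD2[OF r_stop])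
  show ?thesis by measurable
qed

lemma alpha_measurable: "alpha n l \<in> borel_measurable (F (grid n l))"
  unfolding alpha_def by (intro borel_measurable_times before_measurable drift_measurable)

lemma eta_measurable: "l < 2 ^ n \<Longrightarrow> eta n l \<in> borel_measurable (F (grid n (Suc l)))"
  unfolding eta_def
  by (intro borel_measurable_times borel_F_mono[OF before_measurable] incr_measurable) (auto simp: grid_le)

lemma alpha_bound: "\<bar>alpha n l \<omega>\<bar> \<le> 2" using drift_bound[of n l \<omega>] unfolding alpha_def by auto

lemma alpha_M: "l \<le> 2 ^ n \<Longrightarrow> alpha n l \<in> borel_measurable M" using borel_F_M[OF alpha_measurable grid_in] by auto
lemma eta_M: "l < 2 ^ n \<Longrightarrow> eta n l \<in> borel_measurable M" using borel_F_M[OF eta_measurable grid_in] by auto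

lemma comp_measurable: "comp n t \<in> borel_measurable (F t)"
  unfolding comp_def
proof (rule borel_measurable_sum)
  fix l :: nat assume "l \<in> {..<2^n}"
  show "(\<lambda>\<omega>. if grid n (Suc l) \<le> t then alpha n l \<omega> else 0) \<in> borel_measurable (F t)"
  proof (cases "grid n (Suc l) \<le> t")
    case True
    have "grid n l \<le> grid n (Suc l)" by (simp add: grid_le)
    then have "alpha n l \<in> borel_measurable (F t)" using True by (intro borel_F_mono[OF alpha_measurable]) auto
    then show ?thesis using True by simp
  qed simp
qed

lemma stopped_incr_measurable: "stopped_incr n t \<in> borel_measurable (F t)"
  unfolding stopped_incr_def
proof (rule borel_measurable_sum)
  fix l :: nat assume l: "l \<in> {..<2^n}"
  show "(\<lambda>\<omega>. if grid n (Suc l) \<le> t then eta n l \<omega> else 0) \<in> borel_measurable (F t)"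
  proof (cases "grid n (Suc l) \<le> t")
    case True
    then have "eta n l \<in> borel_measurable (F t)" using l by (intro borel_F_mono[OF eta_measurable True]) auto
    then show ?thesis using True by simp
  qed simp
qed

lemma alpha_var_expectation: "(\<integral>\<omega>. (\<Sum>l<2^n. \<bar>alpha n l \<omega>\<bar>) \<partial>M) \<le> C"
proof -
  have "(\<integral>\<omega>. 1 * (\<Sum>i\<in>{0..<2^n}. of_bool (grid n i < r \<omega>) * \<bar>drift n i \<omega>\<bar>) \<partial>M) \<le> C * (\<integral>\<omega>. 1 \<partial>M)"
    by (rule potential[of _ _ _ 1]) auto
  then show ?thesis unfolding alpha_def by (simp add: abs_mult prob_space atLeast0LessThan)
qed

lemma alpha_var_integrable: "integrable M (\<lambda>\<omega>. \<Sum>l<2^n. \<bar>alpha n l \<omega>\<bar>)"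
proof (rule Bochner_Integration.integrable_sum)
  fix l :: nat assume "l \<in> {..<2^n}"
  then show "integrable M (\<lambda>\<omega>. \<bar>alpha n l \<omega>\<bar>)"
    by (intro bounded_integrable[of _ 2]) (use alpha_M[of l n] alpha_bound in auto)
qed

lemma alpha_var_bound: "(\<Sum>l<2^n. \<bar>alpha n l \<omega>\<bar>) \<le> 2 ^ n * 2"
proof -
  have "(\<Sum>l<2^n. \<bar>alpha n l \<omega>\<bar>) \<le> (\<Sum>l<(2::nat)^n. 2)" by (intro sum_mono alpha_bound)
  then show ?thesis by simp
qed

text \<open>A predictable increasing process whose potential is bounded by \<open>C\<close> has second moment at most \<open>2 C\<^sup>2\<close>.\<close>

lemma alpha_var_square:
  "integrable M (\<lambda>\<omega>. (\<Sum>l<2^n. \<bar>alpha n l \<omega>\<bar>)\<^sup>2)" "(\<integral>\<omega>. (\<Sum>l<2^n. \<bar>alpha n l \<omega>\<bar>)\<^sup>2 \<partial>M) \<le> 2 * C\<^sup>2"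
proof -
  let ?b = "\<lambda>l \<omega>. \<bar>alpha n l \<omega>\<bar>"
  have m: "(\<lambda>\<omega>. \<Sum>l\<in>L. ?b l \<omega>) \<in> borel_measurable M" if "L \<subseteq> {..<2^n}" for L
    using alpha_M[of _ n] that by (intro borel_measurable_sum borel_measurable_abs) auto
  show I: "integrable M (\<lambda>\<omega>. (\<Sum>l<2^n. ?b l \<omega>)\<^sup>2)"
  proof (rule bounded_integrable[of _ "(2 ^ n * 2)\<^sup>2"])
    show "\<bar>(\<Sum>l<2^n. ?b l \<omega>)\<^sup>2\<bar> \<le> (2 ^ n * 2)\<^sup>2" for \<omega>
      unfolding abs_power2 by (rule power_mono[OF alpha_var_bound]) (auto intro: sum_nonneg)
  qed (use m[of "{..<2^n}"] in auto)
  have ii: "integrable M (\<lambda>\<omega>. ?b i \<omega> * (\<Sum>l\<in>{i..<2^n}. ?b l \<omega>))" if i: "i < 2 ^ n" for i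
  proof (rule bounded_integrable[of _ "2 * (2 ^ n * 2)"])
    have [measurable]: "alpha n i \<in> borel_measurable M" using alpha_M[of i n] i by auto
    show "(\<lambda>\<omega>. ?b i \<omega> * (\<Sum>l\<in>{i..<2^n}. ?b l \<omega>)) \<in> borel_measurable M"
      by (intro borel_measurable_times m borel_measurable_abs) auto
    fix \<omega>
    have "(\<Sum>l\<in>{i..<2^n}. ?b l \<omega>) \<le> (\<Sum>l<2^n. ?b l \<omega>)" by (rule sum_mono2) auto
    also have "\<dots> \<le> 2 ^ n * 2" by (rule alpha_var_bound)
    finally show "\<bar>?b i \<omega> * (\<Sum>l\<in>{i..<2^n}. ?b l \<omega>)\<bar> \<le> 2 * (2 ^ n * 2)"
      unfolding abs_mult using alpha_bound[of n i \<omega>] by (intro mult_mono) (auto simp: abs_of_nonneg sum_nonneg)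
  qed
  have "(\<integral>\<omega>. (\<Sum>l<2^n. ?b l \<omega>)\<^sup>2 \<partial>M) \<le> (\<integral>\<omega>. 2 * (\<Sum>i<2^n. ?b i \<omega> * (\<Sum>l\<in>{i..<2^n}. ?b l \<omega>)) \<partial>M)"
    by (rule integral_mono[OF I]) (use ii square_sum_le in \<open>auto intro!: Bochner_Integration.integrable_sum\<close>)
  also have "\<dots> = 2 * (\<Sum>i<2^n. \<integral>\<omega>. ?b i \<omega> * (\<Sum>l\<in>{i..<2^n}. ?b l \<omega>) \<partial>M)"
    using ii by simp
  also have "\<dots> \<le> 2 * (\<Sum>i<2^n. C * (\<integral>\<omega>. ?b i \<omega> \<partial>M))"
  proof (intro mult_left_mono sum_mono)
    fix i :: nat assume i: "i \<in> {..<2^n}"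
    have "(\<integral>\<omega>. ?b i \<omega> * (\<Sum>l\<in>{i..<2^n}. of_bool (grid n l < r \<omega>) * \<bar>drift n l \<omega>\<bar>) \<partial>M) \<le> C * (\<integral>\<omega>. ?b i \<omega> \<partial>M)"
      by (rule potential[of _ _ _ 2]) (use i alpha_bound alpha_measurable[of n i] in auto)
    then show "(\<integral>\<omega>. ?b i \<omega> * (\<Sum>l\<in>{i..<2^n}. ?b l \<omega>) \<partial>M) \<le> C * (\<integral>\<omega>. ?b i \<omega> \<partial>M)"
      unfolding alpha_def by (simp add: abs_mult)
  qed simp
  also have "\<dots> = 2 * C * (\<integral>\<omega>. (\<Sum>i<2^n. ?b i \<omega>) \<partial>M)"
  proof -
    have "(\<integral>\<omega>. (\<Sum>i<2^n. ?b i \<omega>) \<partial>M) = (\<Sum>i<2^n. \<integral>\<omega>. ?b i \<omega> \<partial>M)"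
    proof (rule Bochner_Integration.integral_sum)
      fix l :: nat assume "l \<in> {..<2^n}"
      then show "integrable M (\<lambda>\<omega>. ?b l \<omega>)"
        by (intro bounded_integrable[of _ 2]) (use alpha_M[of l n] alpha_bound in auto)
    qed
    then show ?thesis by (simp add: sum_distrib_left mult.assoc)
  qed
  also have "\<dots> \<le> 2 * C * C" using alpha_var_expectation[of n] C_nonneg by (intro mult_left_mono) auto
  finally show "(\<integral>\<omega>. (\<Sum>l<2^n. ?b l \<omega>)\<^sup>2 \<partial>M) \<le> 2 * C\<^sup>2" by (simp add: power2_eq_square)
qed

lemma comp_bound: "\<bar>comp n t \<omega>\<bar> \<le> (\<Sum>l<2^n. \<bar>alpha n l \<omega>\<bar>)"
proof -
  have "\<bar>comp n t \<omega>\<bar> \<le> (\<Sum>l<2^n. \<bar>if grid n (Suc l) \<le> t then alpha n l \<omega> else 0\<bar>)" unfolding comp_def by (rule sum_abs)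
  also have "\<dots> \<le> (\<Sum>l<2^n. \<bar>alpha n l \<omega>\<bar>)" by (rule sum_mono) auto
  finally show ?thesis .
qed

lemma comp_grid:
  assumes "i \<le> 2 ^ n" shows "comp n (grid n i) \<omega> = (\<Sum>l<i. alpha n l \<omega>)"
proof -
  have "comp n (grid n i) \<omega> = (\<Sum>l\<in>{l\<in>{..<2^n}. Suc l \<le> i}. alpha n l \<omega>)"
    unfolding comp_def grid_le by (rule sum.inter_filter[symmetric]) simp
  also have "{l\<in>{..<2^n}. Suc l \<le> i} = {..<i}" using assms by auto
  finally show ?thesis .
qed

lemma stopped_incr_grid:
  assumes "i \<le> 2 ^ n" shows "stopped_incr n (grid n i) \<omega> = (\<Sum>l<i. eta n l \<omega>)"
proof -
  have "stopped_incr n (grid n i) \<omega> = (\<Sum>l\<in>{l\<in>{..<2^n}. Suc l \<le> i}. eta n l \<omega>)"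
    unfolding stopped_incr_def grid_le by (rule sum.inter_filter[symmetric]) simp
  also have "{l\<in>{..<2^n}. Suc l \<le> i} = {..<i}" using assms by auto
  finally show ?thesis .
qed

lemma stopped_incr_telescope:
  obtains c where "c \<le> 2 ^ n" "stopped_incr n t \<omega> = Y (grid n c) \<omega> - Y 0 \<omega>"
    "c = 2 ^ n \<or> \<not> (grid n (Suc c) \<le> t \<and> grid n c < r \<omega>)"
    "\<And>l. l < c \<Longrightarrow> grid n (Suc l) \<le> t \<and> grid n l < r \<omega>"
proof -
  let ?P = "\<lambda>l. l < 2 ^ n \<and> grid n (Suc l) \<le> t \<and> grid n l < r \<omega>"
  define c where "c = (LEAST l. \<not> ?P l)"
  have ex: "\<not> ?P (2 ^ n)" by simp
  have c1: "\<not> ?P c" unfolding c_def by (rule LeastI[of "\<lambda>l. \<not> ?P l", OF ex])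
  have c2: "c \<le> 2 ^ n" unfolding c_def by (rule Least_le[of "\<lambda>l. \<not> ?P l", OF ex])
  have c3: "?P l" if "l < c" for l using not_less_Least[of l "\<lambda>l. \<not> ?P l"] that unfolding c_def by blast
  have c4: "\<not> ?P l" if "c \<le> l" for l
  proof
    assume P: "?P l"
    have "grid n (Suc c) \<le> grid n (Suc l)" "grid n c \<le> grid n l" using that by (auto simp: grid_le)
    then show False using c1 P that by auto
  qed
  have "stopped_incr n t \<omega> = (\<Sum>l<2^n. if l < c then incr n l \<omega> else 0)"
    unfolding stopped_incr_def
  proof (rule sum.cong[OF refl])
    fix l :: nat assume "l \<in> {..<2^n}"
    then show "(if grid n (Suc l) \<le> t then eta n l \<omega> else 0) = (if l < c then incr n l \<omega> else 0)"
      using c3[of l] c4[of l] unfolding eta_def by (auto simp: not_less)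
  qed
  also have "\<dots> = (\<Sum>l\<in>{l\<in>{..<2^n}. l < c}. incr n l \<omega>)" by (rule sum.inter_filter[symmetric]) simp
  also have "{l\<in>{..<2^n}. l < c} = {..<c}" using c2 by auto
  also have "(\<Sum>l<c. incr n l \<omega>) = Y (grid n c) \<omega> - Y (grid n 0) \<omega>"
    unfolding incr_def by (rule sum_lessThan_telescope)
  finally have "stopped_incr n t \<omega> = Y (grid n c) \<omega> - Y 0 \<omega>" by simp
  then show ?thesis by (rule that[OF c2]) (use c1 c2 c3 in auto)
qed

lemma stopped_incr_bound:
  assumes "\<omega> \<in> space M" shows "\<bar>stopped_incr n t \<omega>\<bar> \<le> 2"
proof -
  obtain c where c: "c \<le> 2 ^ n" "stopped_incr n t \<omega> = Y (grid n c) \<omega> - Y 0 \<omega>" by (rule stopped_incr_telescope)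
  show ?thesis unfolding c(2) using Y_bound[OF grid_in[OF c(1)] assms] Y_bound[of 0 \<omega>] assms T_pos by auto
qed

text \<open>From the level on at which \<open>q\<close> is a grid point, the path is stopped at a
  grid point between \<open>min (r \<omega>) q\<close> and that time plus one mesh width, so
  right-continuity of \<open>Y\<close> applies.\<close>

lemma stopped_incr_tendsto:
  assumes w: "\<omega> \<in> space M" and q: "q \<in> dyadics"
  shows "(\<lambda>n. stopped_incr n q \<omega>) \<longlonglongrightarrow> Y (min (r \<omega>) q) \<omega> - Y 0 \<omega>"
proof -
  obtain i k where k: "q = grid k i" "i \<le> 2 ^ k" using q unfolding dyadics_def grid_def by auto
  have "\<exists>c. c \<le> 2 ^ n \<and> stopped_incr n q \<omega> = Y (grid n c) \<omega> - Y 0 \<omega> \<and> (k \<le> n \<longrightarrow> min (r \<omega>) q \<le> grid n c \<and> grid n c \<le> min (r \<omega>) q + T / 2 ^ n)" for n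
  proof -
    obtain c where c: "c \<le> 2 ^ n" "stopped_incr n q \<omega> = Y (grid n c) \<omega> - Y 0 \<omega>"
      "c = 2 ^ n \<or> \<not> (grid n (Suc c) \<le> q \<and> grid n c < r \<omega>)"
      "\<And>l. l < c \<Longrightarrow> grid n (Suc l) \<le> q \<and> grid n l < r \<omega>" using stopped_incr_telescope[of n q \<omega>] by blast
    have "min (r \<omega>) q \<le> grid n c \<and> grid n c \<le> min (r \<omega>) q + T / 2 ^ n" if kn: "k \<le> n"
    proof
      define j where "j = i * 2 ^ (n - k)"
      have qj: "q = grid n j" unfolding k j_def by (rule grid_refine[OF kn])
      show "min (r \<omega>) q \<le> grid n c"
      proof (cases "c = 2 ^ n")
        case True then show ?thesis using r_range[OF w] grid_T[of n] by auto
      next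
        case False
        then have "\<not> grid n (Suc c) \<le> q \<or> r \<omega> \<le> grid n c" using c(3) by auto
        then show ?thesis unfolding qj grid_le by (auto simp: grid_le min.coboundedI1 min.coboundedI2 not_le less_Suc_eq_le)
      qed
      show "grid n c \<le> min (r \<omega>) q + T / 2 ^ n"
      proof (cases c)
        case 0
        have "0 \<le> q" using q dyadics_range by auto
        then show ?thesis using 0 r_range[OF w] T_pos by auto
      next
        case (Suc l)
        have "grid n (Suc l) = grid n l + T / 2 ^ n" unfolding grid_def by (simp add: field_simps)
        moreover have "0 \<le> T / 2 ^ n" using T_pos by simp
        ultimately show ?thesis using c(4)[of l] Suc by auto
      qed
    qed
    then show ?thesis using c(1,2) by blast
  qed
  then obtain c where c: "\<And>n. c n \<le> 2 ^ n" "\<And>n. stopped_incr n q \<omega> = Y (grid n (c n)) \<omega> - Y 0 \<omega>"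
    "\<And>n. k \<le> n \<Longrightarrow> min (r \<omega>) q \<le> grid n (c n) \<and> grid n (c n) \<le> min (r \<omega>) q + T / 2 ^ n" by metis
  have mT: "min (r \<omega>) q \<in> {0..T}" using r_range[OF w] q dyadics_range by auto
  have "(\<lambda>n. Y (grid (n + k) (c (n + k))) \<omega>) \<longlonglongrightarrow> Y (min (r \<omega>) q) \<omega>"
  proof (rule cadlag_right_limit[OF Y_cadlag w mT])
    have "(\<lambda>n. min (r \<omega>) q + T * (1/2)^n) \<longlonglongrightarrow> min (r \<omega>) q + T * 0" by (intro tendsto_intros) auto
    then have l: "(\<lambda>n. min (r \<omega>) q + T / 2 ^ n) \<longlonglongrightarrow> min (r \<omega>) q" by (simp add: power_divide)
    show "(\<lambda>n. grid (n + k) (c (n + k))) \<longlonglongrightarrow> min (r \<omega>) q"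
      by (rule tendsto_sandwich[OF _ _ tendsto_const LIMSEQ_ignore_initial_segment[OF l, of k]]) (use c(3) in auto)
    show "grid (m + k) (c (m + k)) \<in> {min (r \<omega>) q..T}" for m using c(3)[of "m + k"] grid_in[OF c(1)[of "m + k"]] by auto
  qed
  then have "(\<lambda>n. Y (grid n (c n)) \<omega>) \<longlonglongrightarrow> Y (min (r \<omega>) q) \<omega>" by (rule LIMSEQ_offset)
  then show ?thesis unfolding c(2) by (intro tendsto_diff tendsto_const)
qed

lemma comp_coarse_var:
  assumes kn: "k \<le> n"
  shows "(\<Sum>i<2^k. \<bar>comp n (grid k (Suc i)) \<omega> - comp n (grid k i) \<omega>\<bar>) \<le> (\<Sum>l<2^n. \<bar>alpha n l \<omega>\<bar>)"
proof -
  define L where "L = (2::nat) ^ (n - k)"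
  have L: "2 ^ k * L = 2 ^ n" unfolding L_def using kn by (simp add: power_add[symmetric])
  have gr: "grid k i = grid n (i * L)" for i unfolding L_def by (rule grid_refine[OF kn])
  have le: "i * L \<le> 2 ^ n" if "i \<le> 2 ^ k" for i using mult_right_mono[OF that, of L] L by simp
  have "(\<Sum>i<2^k. \<bar>comp n (grid k (Suc i)) \<omega> - comp n (grid k i) \<omega>\<bar>) \<le> (\<Sum>i\<in>{0..<2^k}. \<Sum>l\<in>{i*L..<Suc i*L}. \<bar>alpha n l \<omega>\<bar>)"
    unfolding atLeast0LessThan
  proof (rule sum_mono)
    fix i :: nat assume i: "i \<in> {..<2^k}"
    have "{..<Suc i * L} = {..<i*L} \<union> {i*L..<Suc i*L}" by auto
    then have "(\<Sum>l<Suc i*L. alpha n l \<omega>) = (\<Sum>l<i*L. alpha n l \<omega>) + (\<Sum>l\<in>{i*L..<Suc i*L}. alpha n l \<omega>)"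
      by (simp add: sum.union_disjoint ivl_disj_int)
    then have "comp n (grid k (Suc i)) \<omega> - comp n (grid k i) \<omega> = (\<Sum>l\<in>{i*L..<Suc i*L}. alpha n l \<omega>)"
      unfolding gr using i by (simp add: comp_grid le del: mult_Suc)
    then show "\<bar>comp n (grid k (Suc i)) \<omega> - comp n (grid k i) \<omega>\<bar> \<le> (\<Sum>l\<in>{i*L..<Suc i*L}. \<bar>alpha n l \<omega>\<bar>)"
      by (simp only: sum_abs)
  qed
  also have "\<dots> = (\<Sum>l<2^n. \<bar>alpha n l \<omega>\<bar>)" unfolding sum_blocks[OF le0] L by (simp add: atLeast0LessThan)
  finally show ?thesis .
qed

text \<open>The identity is stated on a coarse grid because convex combinations mix fine levels and
  can be compared only at points common to all of them. It is proved by adding one fine cell at a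
  time.\<close>

lemma compensated_martingale:
  assumes kn: "k \<le> n" and i: "i \<le> i'" "i' \<le> 2 ^ k"
    and g: "g \<in> borel_measurable (F (grid k i))" "\<And>\<omega>. \<omega> \<in> space M \<Longrightarrow> \<bar>g \<omega>\<bar> \<le> c"
  shows "(\<integral>\<omega>. g \<omega> * (stopped_incr n (grid k i') \<omega> - comp n (grid k i') \<omega>) \<partial>M) =
    (\<integral>\<omega>. g \<omega> * (stopped_incr n (grid k i) \<omega> - comp n (grid k i) \<omega>) \<partial>M)"
proof -
  define L where "L = (2::nat) ^ (n - k)"
  have L: "2 ^ k * L = 2 ^ n" unfolding L_def using kn by (simp add: power_add[symmetric])
  have gr: "grid k i = grid n (i * L)" for i unfolding L_def by (rule grid_refine[OF kn])
  have le: "i * L \<le> 2 ^ n" if "i \<le> 2 ^ k" for i using mult_right_mono[OF that, of L] L by simp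
  have main: "i * L \<le> j \<Longrightarrow> j \<le> 2 ^ n \<Longrightarrow> integrable M (\<lambda>\<omega>. g \<omega> * (\<Sum>l<j. eta n l \<omega> - alpha n l \<omega>)) \<and>
    (\<integral>\<omega>. g \<omega> * (\<Sum>l<j. eta n l \<omega> - alpha n l \<omega>) \<partial>M) = (\<integral>\<omega>. g \<omega> * (\<Sum>l<i*L. eta n l \<omega> - alpha n l \<omega>) \<partial>M)" for j
  proof (induction j rule: dec_induct)
    case base
    have gM: "g \<in> borel_measurable M" by (rule borel_F_M[OF g(1) grid_in]) (use i in auto)
    have "integrable M (\<lambda>\<omega>. g \<omega> * (\<Sum>l<i*L. eta n l \<omega> - alpha n l \<omega>))"
    proof (rule bounded_integrable)
      show "(\<lambda>\<omega>. g \<omega> * (\<Sum>l<i*L. eta n l \<omega> - alpha n l \<omega>)) \<in> borel_measurable M"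
        by (intro borel_measurable_times borel_measurable_sum borel_measurable_diff gM eta_M alpha_M) (use base in auto)
      fix \<omega> assume w: "\<omega> \<in> space M"
      have "\<bar>\<Sum>l<i*L. eta n l \<omega> - alpha n l \<omega>\<bar> \<le> (\<Sum>l<i*L. \<bar>eta n l \<omega> - alpha n l \<omega>\<bar>)" by (rule sum_abs)
      also have "\<dots> \<le> (\<Sum>l<i*L. 4)"
      proof (rule sum_mono)
        fix l assume "l \<in> {..<i*L}"
        then have "l < 2 ^ n" using base by auto
        then show "\<bar>eta n l \<omega> - alpha n l \<omega>\<bar> \<le> 4"
          using incr_bound[OF _ w, of l n] drift_bound[of n l \<omega>] unfolding eta_def alpha_def by auto
      qed
      finally show "\<bar>g \<omega> * (\<Sum>l<i*L. eta n l \<omega> - alpha n l \<omega>)\<bar> \<le> \<bar>c\<bar> * (\<Sum>l<i*L. 4)"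
        unfolding abs_mult using g(2)[OF w] by (intro mult_mono) auto
    qed
    then show ?case by simp
  next
    case (step j)
    then have j: "j < 2 ^ n" and IH: "integrable M (\<lambda>\<omega>. g \<omega> * (\<Sum>l<j. eta n l \<omega> - alpha n l \<omega>))"
      "(\<integral>\<omega>. g \<omega> * (\<Sum>l<j. eta n l \<omega> - alpha n l \<omega>) \<partial>M) = (\<integral>\<omega>. g \<omega> * (\<Sum>l<i*L. eta n l \<omega> - alpha n l \<omega>) \<partial>M)" by auto
    have gm: "(\<lambda>\<omega>. g \<omega> * of_bool (grid n j < r \<omega>)) \<in> borel_measurable (F (grid n j))"
      by (intro borel_measurable_times before_measurable borel_F_mono[OF g(1)]) (use step(1) in \<open>auto simp: gr grid_le\<close>)
    have gb: "\<bar>g \<omega> * of_bool (grid n j < r \<omega>)\<bar> \<le> \<bar>c\<bar>" if "\<omega> \<in> space M" for \<omega> using g(2)[OF that] by auto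
    note d = drift_integral[OF j gm gb]
    have eq: "(\<lambda>\<omega>. g \<omega> * (\<Sum>l<Suc j. eta n l \<omega> - alpha n l \<omega>)) = (\<lambda>\<omega>. g \<omega> * (\<Sum>l<j. eta n l \<omega> - alpha n l \<omega>) +
      (g \<omega> * of_bool (grid n j < r \<omega>) * incr n j \<omega> - g \<omega> * of_bool (grid n j < r \<omega>) * drift n j \<omega>))"
      by (rule ext) (simp add: eta_def alpha_def algebra_simps)
    show ?case unfolding eq using IH d by simp
  qed
  have "stopped_incr n (grid k m) \<omega> - comp n (grid k m) \<omega> = (\<Sum>l<m*L. eta n l \<omega> - alpha n l \<omega>)" if "m \<le> 2 ^ k" for m \<omega>
    unfolding gr stopped_incr_grid[OF le[OF that]] comp_grid[OF le[OF that]] sum_subtractf ..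
  then show ?thesis using main[of "i' * L"] i le[OF i(2)] by simp
qed

text \<open>The compensators (even indices) and the stopped processes (odd indices) form one family, so that
  the same convex combinations are taken of both.\<close>

definition pair_seq :: "nat \<Rightarrow> nat \<Rightarrow> 'a \<Rightarrow> real" where
  "pair_seq n k = (if even k then comp n (from_nat_into dyadics (k div 2)) else stopped_incr n (from_nat_into dyadics (k div 2)))"

section \<open>Convex combinations of the discrete compensators\<close>

abbreviation tail_hull :: "nat \<Rightarrow> (nat \<times> 'a \<Rightarrow> real) set" where
  "tail_hull m \<equiv> midhull ((\<lambda>n (k, x). pair_seq n k x) ` {m..})"

abbreviation c_idx :: "real \<Rightarrow> nat" where "c_idx q \<equiv> 2 * idx q"
abbreviation s_idx :: "real \<Rightarrow> nat" where "s_idx q \<equiv> Suc (2 * idx q)"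

lemma pair_seq_idx:
  assumes "q \<in> dyadics" shows "pair_seq n (c_idx q) = comp n q" "pair_seq n (s_idx q) = stopped_incr n q"
  unfolding pair_seq_def using from_idx[OF assms] by auto

lemma comp_integrable: "0 \<le> t \<Longrightarrow> t \<le> T \<Longrightarrow> integrable M (comp n t)"
  using borel_F_M[OF comp_measurable, of t n] comp_bound[of n t] alpha_var_bound[of n]
  by (intro bounded_integrable[of _ "2 ^ n * 2"]) (auto intro: order_trans)

lemma tail_hull_measurable:
  assumes f: "f \<in> tail_hull m" and q: "q \<in> dyadics"
  shows "(\<lambda>\<omega>. f (c_idx q, \<omega>)) \<in> borel_measurable (F q) \<and> (\<lambda>\<omega>. f (s_idx q, \<omega>)) \<in> borel_measurable (F q) \<and> integrable M (\<lambda>\<omega>. f (c_idx q, \<omega>))"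
  using f
proof induction
  case (base f)
  then obtain n where n: "f = (\<lambda>(k, x). pair_seq n k x)" by auto
  show ?case unfolding n using q dyadics_range
    by (auto simp: pair_seq_idx comp_measurable stopped_incr_measurable intro!: comp_integrable)
qed auto

text \<open>Intervals are convex, so pointwise convergence of the stopped paths survives any
  averaging of late levels. For them the limit is thus known at every point, unlike for the
  compensators.\<close>

lemma tail_hull_stopped:
  assumes f: "f \<in> tail_hull m" and q: "q \<in> dyadics" and b: "\<And>n. m \<le> n \<Longrightarrow> \<bar>stopped_incr n q \<omega> - y\<bar> \<le> \<delta>"
  shows "\<bar>f (s_idx q, \<omega>) - y\<bar> \<le> \<delta>"
  using f
proof induction
  case (base f)
  then obtain n where n: "m \<le> n" "f = (\<lambda>(k, x). pair_seq n k x)" by auto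
  show ?case unfolding n(2) using b[OF n(1)] by (simp add: pair_seq_idx[OF q])
next
  case (mid f g)
  then show ?case by (auto simp: abs_le_iff field_simps)
qed

lemma tail_hull_zero:
  assumes f: "f \<in> tail_hull m" shows "f (c_idx 0, \<omega>) = 0"
  using f
proof induction
  case (base f)
  then obtain n where n: "f = (\<lambda>(k, x). pair_seq n k x)" by auto
  have "(0::real) \<in> dyadics" using grid_dyadic[of 0 0] by simp
  moreover have "comp n 0 \<omega> = 0" using comp_grid[of 0 n \<omega>] by simp
  ultimately show ?case unfolding n by (simp add: pair_seq_idx)
qed auto

lemma tail_hull_var:
  assumes f: "f \<in> tail_hull m" and k: "k \<le> m"
  shows "(\<integral>\<omega>. (\<Sum>i<2^k. \<bar>f (c_idx (grid k (Suc i)), \<omega>) - f (c_idx (grid k i), \<omega>)\<bar>) \<partial>M) \<le> C"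
  using f
proof induction
  case (base f)
  then obtain n where n: "m \<le> n" "f = (\<lambda>(k, x). pair_seq n k x)" by auto
  have ci: "integrable M (comp n (grid k i))" if "i \<le> 2 ^ k" for i using grid_in[OF that] by (intro comp_integrable) auto
  have "(\<integral>\<omega>. (\<Sum>i<2^k. \<bar>f (c_idx (grid k (Suc i)), \<omega>) - f (c_idx (grid k i), \<omega>)\<bar>) \<partial>M) =
    (\<integral>\<omega>. (\<Sum>i<2^k. \<bar>comp n (grid k (Suc i)) \<omega> - comp n (grid k i) \<omega>\<bar>) \<partial>M)"
    unfolding n(2) by (intro Bochner_Integration.integral_cong sum.cong) (auto simp: pair_seq_idx grid_dyadic Suc_le_eq)
  also have "\<dots> \<le> (\<integral>\<omega>. (\<Sum>l<2^n. \<bar>alpha n l \<omega>\<bar>) \<partial>M)"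
    by (rule integral_mono[OF _ alpha_var_integrable comp_coarse_var])
      (use ci k n(1) in \<open>auto intro!: Bochner_Integration.integrable_sum integrable_abs Bochner_Integration.integrable_diff\<close>)
  also have "\<dots> \<le> C" by (rule alpha_var_expectation)
  finally show ?case .
next
  case (mid f g)
  let ?V = "\<lambda>f \<omega>. \<Sum>i<2^k. \<bar>f (c_idx (grid k (Suc i)), \<omega>) - f (c_idx (grid k i), \<omega>)\<bar>"
  have vi: "integrable M (?V h)" if "h \<in> tail_hull m" for h
    using tail_hull_measurable[OF that] grid_dyadic[of _ k]
    by (intro Bochner_Integration.integrable_sum integrable_abs Bochner_Integration.integrable_diff) (auto simp: Suc_le_eq)
  have h: "(\<lambda>x. (f x + g x) / 2) \<in> tail_hull m" using mid by (intro midhull.mid)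
  have "(\<integral>\<omega>. ?V (\<lambda>x. (f x + g x) / 2) \<omega> \<partial>M) \<le> (\<integral>\<omega>. (?V f \<omega> + ?V g \<omega>) / 2 \<partial>M)"
  proof (rule integral_mono[OF vi[OF h]])
    show "integrable M (\<lambda>\<omega>. (?V f \<omega> + ?V g \<omega>) / 2)" using vi[OF mid(1)] vi[OF mid(2)] by simp
    fix \<omega>
    show "?V (\<lambda>x. (f x + g x) / 2) \<omega> \<le> (?V f \<omega> + ?V g \<omega>) / 2"
      unfolding sum.distrib[symmetric] sum_divide_distrib by (rule sum_mono) (auto simp: abs_if field_simps)
  qed
  also have "\<dots> \<le> C" using vi[OF mid(1)] vi[OF mid(2)] mid.IH by simp
  finally show ?case .
qed

lemma tail_hull_stopped_bound:
  assumes "f \<in> tail_hull m" "q \<in> dyadics" "\<omega> \<in> space M" shows "\<bar>f (s_idx q, \<omega>)\<bar> \<le> 2"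
  using tail_hull_stopped[OF assms(1,2), of \<omega> 0 2] stopped_incr_bound[OF assms(3)] by simp

lemma tail_hull_integrable:
  assumes f: "f \<in> tail_hull m" and q: "q \<in> dyadics" and A: "A \<in> sets M"
  shows "integrable M (\<lambda>\<omega>. indicator A \<omega> * f (s_idx q, \<omega>))" "integrable M (\<lambda>\<omega>. indicator A \<omega> * f (c_idx q, \<omega>))"
proof -
  have "(\<lambda>\<omega>. f (s_idx q, \<omega>)) \<in> borel_measurable M"
    using borel_F_M[of "\<lambda>\<omega>. f (s_idx q, \<omega>)" q] tail_hull_measurable[OF f q] q dyadics_range by auto
  then have "integrable M (\<lambda>\<omega>. f (s_idx q, \<omega>))"
    by (rule bounded_integrable) (rule tail_hull_stopped_bound[OF f q])
  from integrable_mult_indicator[OF A this] show "integrable M (\<lambda>\<omega>. indicator A \<omega> * f (s_idx q, \<omega>))" by simp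
  have "integrable M (\<lambda>\<omega>. f (c_idx q, \<omega>))" using tail_hull_measurable[OF f q] by blast
  from integrable_mult_indicator[OF A this] show "integrable M (\<lambda>\<omega>. indicator A \<omega> * f (c_idx q, \<omega>))" by simp
qed

lemma tail_hull_martingale:
  assumes f: "f \<in> tail_hull m" and k: "k \<le> m" and i: "i \<le> i'" "i' \<le> 2 ^ k" and A: "A \<in> sets (F (grid k i))"
  shows "(\<integral>\<omega>. indicator A \<omega> * (f (s_idx (grid k i'), \<omega>) - f (c_idx (grid k i'), \<omega>)) \<partial>M) =
    (\<integral>\<omega>. indicator A \<omega> * (f (s_idx (grid k i), \<omega>) - f (c_idx (grid k i), \<omega>)) \<partial>M)"
  using f
proof induction
  case (base f)
  then obtain n where n: "m \<le> n" "f = (\<lambda>(k, x). pair_seq n k x)" by auto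
  have "(\<integral>\<omega>. indicator A \<omega> * (stopped_incr n (grid k i') \<omega> - comp n (grid k i') \<omega>) \<partial>M) =
    (\<integral>\<omega>. indicator A \<omega> * (stopped_incr n (grid k i) \<omega> - comp n (grid k i) \<omega>) \<partial>M)"
    by (rule compensated_martingale[of _ _ _ _ _ 1]) (use k n(1) i A in \<open>auto simp: indicator_def\<close>)
  then show ?case unfolding n(2) using i by (simp add: pair_seq_idx grid_dyadic)
next
  case (mid f g)
  have AM: "A \<in> sets M" using A F_sub[OF grid_in[of i k]] i by auto
  have *: "(\<integral>\<omega>. indicator A \<omega> * ((f (s_idx q, \<omega>) + g (s_idx q, \<omega>)) / 2 - (f (c_idx q, \<omega>) + g (c_idx q, \<omega>)) / 2) \<partial>M) =
    ((\<integral>\<omega>. indicator A \<omega> * (f (s_idx q, \<omega>) - f (c_idx q, \<omega>)) \<partial>M) + (\<integral>\<omega>. indicator A \<omega> * (g (s_idx q, \<omega>) - g (c_idx q, \<omega>)) \<partial>M)) / 2"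
    if q: "q \<in> dyadics" for q
  proof -
    have "integrable M (\<lambda>\<omega>. indicator A \<omega> * (f (s_idx q, \<omega>) - f (c_idx q, \<omega>)))" "integrable M (\<lambda>\<omega>. indicator A \<omega> * (g (s_idx q, \<omega>) - g (c_idx q, \<omega>)))"
      using tail_hull_integrable[OF mid(1) q AM] tail_hull_integrable[OF mid(2) q AM] by (auto simp: right_diff_distrib)
    then have "((\<integral>\<omega>. indicator A \<omega> * (f (s_idx q, \<omega>) - f (c_idx q, \<omega>)) \<partial>M) + (\<integral>\<omega>. indicator A \<omega> * (g (s_idx q, \<omega>) - g (c_idx q, \<omega>)) \<partial>M)) / 2
      = (\<integral>\<omega>. (indicator A \<omega> * (f (s_idx q, \<omega>) - f (c_idx q, \<omega>)) + indicator A \<omega> * (g (s_idx q, \<omega>) - g (c_idx q, \<omega>))) / 2 \<partial>M)" by simp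
    also have "\<dots> = (\<integral>\<omega>. indicator A \<omega> * ((f (s_idx q, \<omega>) + g (s_idx q, \<omega>)) / 2 - (f (c_idx q, \<omega>) + g (c_idx q, \<omega>)) / 2) \<partial>M)"
      by (rule Bochner_Integration.integral_cong) (auto simp: field_simps)
    finally show ?thesis by simp
  qed
  show ?case unfolding *[OF grid_dyadic[OF i(2)]] *[OF grid_dyadic[OF order_trans[OF i]]] mid.IH ..
qed

lemma dyadics_common_grid:
  assumes "q \<in> dyadics" "q' \<in> dyadics"
  obtains k i i' where "q = grid k i" "q' = grid k i'" "i \<le> 2 ^ k" "i' \<le> 2 ^ k"
proof -
  obtain i k where 1: "q = grid k i" "i \<le> 2 ^ k" using assms(1) unfolding dyadics_def grid_def by auto
  obtain i' k' where 2: "q' = grid k' i'" "i' \<le> 2 ^ k'" using assms(2) unfolding dyadics_def grid_def by auto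
  define K where "K = max k k'"
  have e: "j * 2 ^ (K - l) \<le> 2 ^ K" if "j \<le> 2 ^ l" "l \<le> K" for j l :: nat
  proof -
    have "j * 2 ^ (K - l) \<le> 2 ^ l * 2 ^ (K - l)" using that by (intro mult_right_mono) auto
    then show ?thesis using that by (simp add: power_add[symmetric])
  qed
  show ?thesis
    by (rule that[of K "i * 2 ^ (K - k)" "i' * 2 ^ (K - k')"])
      (use 1 2 e grid_refine[of k K i] grid_refine[of k' K i'] in \<open>auto simp: K_def\<close>)
qed

text \<open>Convergence in mean carries the variation bound and the testing identity from the
  averaged compensators to \<open>a\<close>; the averaged stopped paths converge everywhere and
  boundedly. All assertions concern dyadic times, where the approximating identities hold from some
  level on.\<close>

theorem limit_compensator:
  "\<exists>a. (\<forall>q\<in>dyadics. a q \<in> borel_measurable (F q) \<and> integrable M (a q)) \<and> (\<forall>\<omega>. a 0 \<omega> = 0) \<and>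
    (\<forall>k. (\<integral>\<omega>. (\<Sum>i<2^k. \<bar>a (grid k (Suc i)) \<omega> - a (grid k i) \<omega>\<bar>) \<partial>M) \<le> C) \<and>
    (\<forall>q\<in>dyadics. \<forall>q'\<in>dyadics. q \<le> q' \<longrightarrow> (\<forall>A\<in>sets (F q).
      (\<integral>\<omega>. indicator A \<omega> * (Y (min (r \<omega>) q') \<omega> - a q' \<omega>) \<partial>M) = (\<integral>\<omega>. indicator A \<omega> * (Y (min (r \<omega>) q) \<omega> - a q \<omega>) \<partial>M)))"
proof -
  have ne: "dyadics \<noteq> {}" using T_dyadic by auto
  have dk: "from_nat_into dyadics k \<in> dyadics" for k by (rule from_nat_into[OF ne])
  have rg: "from_nat_into dyadics k \<in> {0..T}" for k by (rule subsetD[OF dyadics_range dk])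
  have um: "pair_seq n k \<in> borel_measurable M" for n k
    unfolding pair_seq_def using borel_F_M[OF comp_measurable rg] borel_F_M[OF stopped_incr_measurable rg] by auto
  have c2: "(comp n t \<omega>)\<^sup>2 \<le> (\<Sum>l<2^n. \<bar>alpha n l \<omega>\<bar>)\<^sup>2" for n t \<omega>
    using comp_bound[of n t \<omega>] by (intro abs_le_square_iff[THEN iffD1]) (auto simp: abs_of_nonneg sum_nonneg)
  have s2: "(stopped_incr n t \<omega>)\<^sup>2 \<le> 2\<^sup>2" if "\<omega> \<in> space M" for n t \<omega>
    using stopped_incr_bound[OF that, of n t] by (intro abs_le_square_iff[THEN iffD1]) auto
  \<comment> \<open>One bound has to serve both kinds of index: \<open>2 * C\<^sup>2\<close> is the
    second moment bound for the compensators, and \<open>4\<close> comes from the stopped paths,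
    which are at most \<open>2\<close> in absolute value.\<close>
  have ui: "integrable M (\<lambda>\<omega>. (pair_seq n k \<omega>)\<^sup>2) \<and> (\<integral>\<omega>. (pair_seq n k \<omega>)\<^sup>2 \<partial>M) \<le> 2 * C\<^sup>2 + 4" for n k
  proof (cases "even k")
    case True
    then have e: "pair_seq n k = comp n (from_nat_into dyadics (k div 2))" unfolding pair_seq_def by simp
    have i: "integrable M (\<lambda>\<omega>. (pair_seq n k \<omega>)\<^sup>2)"
    proof (rule Bochner_Integration.integrable_bound[OF alpha_var_square(1)[of n]])
      show "(\<lambda>\<omega>. (pair_seq n k \<omega>)\<^sup>2) \<in> borel_measurable M" using um[of n k] by measurable
      show "AE \<omega> in M. norm ((pair_seq n k \<omega>)\<^sup>2) \<le> norm ((\<Sum>l<2^n. \<bar>alpha n l \<omega>\<bar>)\<^sup>2)"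
        unfolding e real_norm_def abs_power2 by (rule AE_I2) (rule c2)
    qed
    have "(\<integral>\<omega>. (pair_seq n k \<omega>)\<^sup>2 \<partial>M) \<le> (\<integral>\<omega>. (\<Sum>l<2^n. \<bar>alpha n l \<omega>\<bar>)\<^sup>2 \<partial>M)"
      by (rule integral_mono[OF i alpha_var_square(1)]) (use c2 e in auto)
    then show ?thesis using i alpha_var_square(2)[of n] by linarith
  next
    case False
    then have e: "pair_seq n k = stopped_incr n (from_nat_into dyadics (k div 2))" unfolding pair_seq_def by simp
    have i: "integrable M (\<lambda>\<omega>. (pair_seq n k \<omega>)\<^sup>2)"
    proof (rule bounded_integrable[of _ "2\<^sup>2"])
      show "(\<lambda>\<omega>. (pair_seq n k \<omega>)\<^sup>2) \<in> borel_measurable M" using um[of n k] by measurable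
      show "\<bar>(pair_seq n k \<omega>)\<^sup>2\<bar> \<le> 2\<^sup>2" if "\<omega> \<in> space M" for \<omega> unfolding e abs_power2 by (rule s2[OF that])
    qed
    have "(\<integral>\<omega>. (pair_seq n k \<omega>)\<^sup>2 \<partial>M) \<le> (\<integral>\<omega>. 2\<^sup>2 \<partial>M)" by (rule integral_mono[OF i]) (use s2 e in auto)
    then show ?thesis using i by (simp add: prob_space add_increasing)
  qed
  obtain f G where fh: "\<forall>m. f m \<in> tail_hull m"
    and fG: "\<forall>k. integrable M (G k) \<and> (AE x in M. (\<lambda>n. f n (k, x)) \<longlonglongrightarrow> G k x) \<and> (\<lambda>n. \<integral>x. \<bar>f n (k, x) - G k x\<bar> \<partial>M) \<longlonglongrightarrow> 0"
    using komlos_midhull_family[of pair_seq, OF um conjunct1[OF ui] conjunct2[OF ui]] by (elim exE conjE) (rule that)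
  note fh = fh[rule_format]
  \<comment> \<open>As a pointwise limit of functions known at time \<open>q\<close>, this version
    is adapted, and it vanishes at time zero on every path; the limit \<open>G\<close> is determined
    only up to null sets.\<close>
  define a where "a q \<omega> = lim (\<lambda>m. f m (c_idx q, \<omega>))" for q \<omega>
  have am: "a q \<in> borel_measurable (F q)" if "q \<in> dyadics" for q
    unfolding a_def by (rule borel_measurable_lim_metric) (use tail_hull_measurable[OF fh that] in blast)
  have aM: "a q \<in> borel_measurable M" if "q \<in> dyadics" for q using borel_F_M[OF am[OF that]] that dyadics_range by blast
  have fi: "integrable M (\<lambda>\<omega>. f m (c_idx q, \<omega>))" if "q \<in> dyadics" for q m using tail_hull_measurable[OF fh that] by blast
  have aG: "AE \<omega> in M. a q \<omega> = G (c_idx q) \<omega>" for q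
  proof -
    have "AE x in M. (\<lambda>n. f n (c_idx q, x)) \<longlonglongrightarrow> G (c_idx q) x" using fG by blast
    then show ?thesis unfolding a_def by eventually_elim (rule limI)
  qed
  have ai: "integrable M (a q)" if "q \<in> dyadics" for q
  proof (rule integrable_cong_AE_imp[of M "G (c_idx q)"])
    show "integrable M (G (c_idx q))" using fG by blast
    show "a q \<in> borel_measurable M" by (rule aM[OF that])
    show "AE x in M. G (c_idx q) x = a q x" using aG[of q] by eventually_elim simp
  qed
  have L1: "(\<lambda>m. \<integral>\<omega>. \<bar>f m (c_idx q, \<omega>) - a q \<omega>\<bar> \<partial>M) \<longlonglongrightarrow> 0" if q: "q \<in> dyadics" for q
  proof -
    have "(\<integral>\<omega>. \<bar>f m (c_idx q, \<omega>) - a q \<omega>\<bar> \<partial>M) = (\<integral>\<omega>. \<bar>f m (c_idx q, \<omega>) - G (c_idx q) \<omega>\<bar> \<partial>M)" for m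
    proof (rule integral_cong_AE)
      show "AE x in M. \<bar>f m (c_idx q, x) - a q x\<bar> = \<bar>f m (c_idx q, x) - G (c_idx q) x\<bar>" using aG[of q] by eventually_elim simp
      have [measurable]: "(\<lambda>\<omega>. f m (c_idx q, \<omega>)) \<in> borel_measurable M" "G (c_idx q) \<in> borel_measurable M" using fi[OF q, of m] fG by blast+
      show "(\<lambda>\<omega>. \<bar>f m (c_idx q, \<omega>) - a q \<omega>\<bar>) \<in> borel_measurable M" using aM[OF q] by measurable
      show "(\<lambda>\<omega>. \<bar>f m (c_idx q, \<omega>) - G (c_idx q) \<omega>\<bar>) \<in> borel_measurable M" by measurable
    qed
    then show ?thesis using fG by simp
  qed
  have a0: "a 0 \<omega> = 0" for \<omega> unfolding a_def tail_hull_zero[OF fh] by (rule limI) simp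
  have var: "(\<integral>\<omega>. (\<Sum>i<2^k. \<bar>a (grid k (Suc i)) \<omega> - a (grid k i) \<omega>\<bar>) \<partial>M) \<le> C" for k
  proof -
    have gd: "grid k (Suc i) \<in> dyadics" "grid k i \<in> dyadics" if "i \<in> {..<2^k}" for i using that grid_dyadic[of "Suc i" k] grid_dyadic[of i k] by auto
    define E where "E m q = (\<integral>\<omega>. \<bar>f m (c_idx q, \<omega>) - a q \<omega>\<bar> \<partial>M)" for m q
    have di: "integrable M (\<lambda>\<omega>. \<bar>f m (c_idx q, \<omega>) - a q \<omega>\<bar>)" if "q \<in> dyadics" for m q
      using fi[OF that, of m] ai[OF that] by (intro integrable_abs Bochner_Integration.integrable_diff)
    have le: "(\<integral>\<omega>. (\<Sum>i<2^k. \<bar>a (grid k (Suc i)) \<omega> - a (grid k i) \<omega>\<bar>) \<partial>M) \<le> C + (\<Sum>i<2^k. E m (grid k (Suc i)) + E m (grid k i))"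
      if km: "k \<le> m" for m
    proof -
      let ?V = "\<lambda>\<omega>. \<Sum>i<2^k. \<bar>f m (c_idx (grid k (Suc i)), \<omega>) - f m (c_idx (grid k i), \<omega>)\<bar>"
      let ?D = "\<lambda>\<omega>. \<Sum>i<2^k. \<bar>f m (c_idx (grid k (Suc i)), \<omega>) - a (grid k (Suc i)) \<omega>\<bar> + \<bar>f m (c_idx (grid k i), \<omega>) - a (grid k i) \<omega>\<bar>"
      have vi: "integrable M ?V" using fi gd by (intro Bochner_Integration.integrable_sum integrable_abs Bochner_Integration.integrable_diff) auto
      have Di: "integrable M ?D" using di gd by (intro Bochner_Integration.integrable_sum Bochner_Integration.integrable_add) auto
      have "(\<integral>\<omega>. (\<Sum>i<2^k. \<bar>a (grid k (Suc i)) \<omega> - a (grid k i) \<omega>\<bar>) \<partial>M) \<le> (\<integral>\<omega>. ?V \<omega> + ?D \<omega> \<partial>M)"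
      proof (rule integral_mono)
        show "integrable M (\<lambda>\<omega>. \<Sum>i<2^k. \<bar>a (grid k (Suc i)) \<omega> - a (grid k i) \<omega>\<bar>)"
          using ai gd by (intro Bochner_Integration.integrable_sum integrable_abs Bochner_Integration.integrable_diff) auto
        show "(\<Sum>i<2^k. \<bar>a (grid k (Suc i)) \<omega> - a (grid k i) \<omega>\<bar>) \<le> ?V \<omega> + ?D \<omega>" for \<omega>
          unfolding sum.distrib[symmetric] by (rule sum_mono) linarith
      qed (use vi Di in auto)
      also have "\<dots> = (\<integral>\<omega>. ?V \<omega> \<partial>M) + (\<integral>\<omega>. ?D \<omega> \<partial>M)" using vi Di by simp
      also have "(\<integral>\<omega>. ?D \<omega> \<partial>M) = (\<Sum>i<2^k. E m (grid k (Suc i)) + E m (grid k i))"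
        unfolding E_def using di gd by (subst Bochner_Integration.integral_sum) auto
      finally show ?thesis using tail_hull_var[OF fh km] by linarith
    qed
    have "(\<lambda>m. C + (\<Sum>i<2^k. E m (grid k (Suc i)) + E m (grid k i))) \<longlonglongrightarrow> C + (\<Sum>i<(2::nat)^k. 0 + 0)"
      unfolding E_def by (intro tendsto_add tendsto_const tendsto_sum L1 gd)
    then show ?thesis by (intro LIMSEQ_le_const[where X="\<lambda>m. C + (\<Sum>i<2^k. E m (grid k (Suc i)) + E m (grid k i))"] exI[of _ k]) (use le in auto)
  qed
  have Ym: "(\<lambda>\<omega>. Y (min (r \<omega>) q) \<omega>) \<in> borel_measurable M" if "q \<in> dyadics" for q
    using stopped_value_measurable[OF Y_adapted Y_cadlag r_stop r_range, of q] that dyadics_range borel_F_M by blast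
  have Y0m: "Y 0 \<in> borel_measurable M" using Y_grid_M[of 0 0] by simp
  have Yb: "\<bar>Y (min (r \<omega>) q) \<omega>\<bar> \<le> 1" if "q \<in> dyadics" "\<omega> \<in> space M" for q \<omega>
  proof (rule Y_bound[OF _ that(2)])
    show "min (r \<omega>) q \<in> {0..T}" using r_range[OF that(2)] that(1) dyadics_range by auto
  qed
  \<comment> \<open>The stopped grid paths are measured from \<open>Y 0\<close>. The corresponding
    term of the limit does not depend on \<open>q\<close> and cancels when two times are
    compared.\<close>
  have lim: "(\<lambda>m. \<integral>\<omega>. indicator A \<omega> * (f m (s_idx q, \<omega>) - f m (c_idx q, \<omega>)) \<partial>M) \<longlonglongrightarrow>
    (\<integral>\<omega>. indicator A \<omega> * (Y (min (r \<omega>) q) \<omega> - a q \<omega>) \<partial>M) - (\<integral>\<omega>. indicator A \<omega> * Y 0 \<omega> \<partial>M)"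
    if q: "q \<in> dyadics" and A: "A \<in> sets M" for q A
  proof -
    note ti = tail_hull_integrable[OF fh q A]
    have sm: "(\<lambda>\<omega>. indicator A \<omega> * (Y (min (r \<omega>) q) \<omega> - Y 0 \<omega>)) \<in> borel_measurable M"
      using A Ym[OF q] Y0m by measurable
    have l1: "(\<lambda>m. \<integral>\<omega>. indicator A \<omega> * f m (s_idx q, \<omega>) \<partial>M) \<longlonglongrightarrow> (\<integral>\<omega>. indicator A \<omega> * (Y (min (r \<omega>) q) \<omega> - Y 0 \<omega>) \<partial>M)"
    proof (rule integral_dominated_convergence[where w="\<lambda>_. 2"])
      show "AE \<omega> in M. (\<lambda>m. indicator A \<omega> * f m (s_idx q, \<omega>)) \<longlonglongrightarrow> indicator A \<omega> * (Y (min (r \<omega>) q) \<omega> - Y 0 \<omega>)"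
      proof (rule AE_I2)
        fix \<omega> assume w: "\<omega> \<in> space M"
        let ?y = "Y (min (r \<omega>) q) \<omega> - Y 0 \<omega>"
        have "(\<lambda>m. f m (s_idx q, \<omega>)) \<longlonglongrightarrow> ?y"
        proof (rule LIMSEQ_I)
          fix e :: real assume e: "0 < e"
          obtain m0 where m0: "\<And>n. m0 \<le> n \<Longrightarrow> norm (stopped_incr n q \<omega> - ?y) < e / 2"
            using LIMSEQ_D[OF stopped_incr_tendsto[OF w q], of "e/2"] e by auto
          have "norm (f m (s_idx q, \<omega>) - ?y) < e" if m: "m0 \<le> m" for m
          proof -
            have "\<bar>f m (s_idx q, \<omega>) - ?y\<bar> \<le> e / 2"
            proof (rule tail_hull_stopped[OF fh q])
              fix n assume "m \<le> n"
              then show "\<bar>stopped_incr n q \<omega> - ?y\<bar> \<le> e / 2" using m0[of n] m by auto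
            qed
            then show ?thesis using e by auto
          qed
          then show "\<exists>no. \<forall>m\<ge>no. norm (f m (s_idx q, \<omega>) - ?y) < e" by blast
        qed
        then show "(\<lambda>m. indicator A \<omega> * f m (s_idx q, \<omega>)) \<longlonglongrightarrow> indicator A \<omega> * ?y" by (intro tendsto_mult tendsto_const)
      qed
      show "AE \<omega> in M. norm (indicator A \<omega> * f m (s_idx q, \<omega>)) \<le> 2" for m
        using tail_hull_stopped_bound[OF fh q] by (intro AE_I2) (auto simp: indicator_def)
    qed (use ti sm in auto)
    have l2: "(\<lambda>m. \<integral>\<omega>. indicator A \<omega> * f m (c_idx q, \<omega>) \<partial>M) \<longlonglongrightarrow> (\<integral>\<omega>. indicator A \<omega> * a q \<omega> \<partial>M)"
    proof (rule LIM_zero_cancel, rule tendsto_rabs_zero_cancel, rule tendsto_sandwich[OF _ _ tendsto_const L1[OF q]])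
      have Ai: "integrable M (\<lambda>\<omega>. indicator A \<omega> * a q \<omega>)" using integrable_mult_indicator[OF A ai[OF q]] by simp
      show "\<forall>\<^sub>F m in sequentially. \<bar>(\<integral>\<omega>. indicator A \<omega> * f m (c_idx q, \<omega>) \<partial>M) - (\<integral>\<omega>. indicator A \<omega> * a q \<omega> \<partial>M)\<bar> \<le> (\<integral>\<omega>. \<bar>f m (c_idx q, \<omega>) - a q \<omega>\<bar> \<partial>M)"
      proof (rule always_eventually, rule allI)
        fix m
        have "(\<integral>\<omega>. indicator A \<omega> * f m (c_idx q, \<omega>) \<partial>M) - (\<integral>\<omega>. indicator A \<omega> * a q \<omega> \<partial>M) = (\<integral>\<omega>. indicator A \<omega> * f m (c_idx q, \<omega>) - indicator A \<omega> * a q \<omega> \<partial>M)"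
          using ti(2) Ai by simp
        also have "\<bar>\<dots>\<bar> \<le> (\<integral>\<omega>. \<bar>indicator A \<omega> * f m (c_idx q, \<omega>) - indicator A \<omega> * a q \<omega>\<bar> \<partial>M)" by (rule integral_abs_bound)
        also have "\<dots> \<le> (\<integral>\<omega>. \<bar>f m (c_idx q, \<omega>) - a q \<omega>\<bar> \<partial>M)"
          by (rule integral_mono) (use ti(2) Ai fi[OF q] ai[OF q] in \<open>auto simp: indicator_def\<close>)
        finally show "\<bar>(\<integral>\<omega>. indicator A \<omega> * f m (c_idx q, \<omega>) \<partial>M) - (\<integral>\<omega>. indicator A \<omega> * a q \<omega> \<partial>M)\<bar> \<le> (\<integral>\<omega>. \<bar>f m (c_idx q, \<omega>) - a q \<omega>\<bar> \<partial>M)" .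
      qed
    qed auto
    have yi: "integrable M (\<lambda>\<omega>. Y (min (r \<omega>) q) \<omega>)" by (rule bounded_integrable[of _ 1]) (use Ym[OF q] Yb[OF q] in auto)
    have y0i: "integrable M (Y 0)" by (rule bounded_integrable[of _ 1]) (use Y0m Y_bound[of 0] T_pos in auto)
    have ii: "integrable M (\<lambda>\<omega>. indicator A \<omega> * Y (min (r \<omega>) q) \<omega>)" "integrable M (\<lambda>\<omega>. indicator A \<omega> * Y 0 \<omega>)" "integrable M (\<lambda>\<omega>. indicator A \<omega> * a q \<omega>)"
      using integrable_mult_indicator[OF A yi] integrable_mult_indicator[OF A y0i] integrable_mult_indicator[OF A ai[OF q]] by auto
    have "(\<lambda>m. (\<integral>\<omega>. indicator A \<omega> * f m (s_idx q, \<omega>) \<partial>M) - (\<integral>\<omega>. indicator A \<omega> * f m (c_idx q, \<omega>) \<partial>M)) \<longlonglongrightarrow>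
       (\<integral>\<omega>. indicator A \<omega> * (Y (min (r \<omega>) q) \<omega> - Y 0 \<omega>) \<partial>M) - (\<integral>\<omega>. indicator A \<omega> * a q \<omega> \<partial>M)"
      by (intro tendsto_diff l1 l2)
    moreover have "(\<integral>\<omega>. indicator A \<omega> * f m (s_idx q, \<omega>) \<partial>M) - (\<integral>\<omega>. indicator A \<omega> * f m (c_idx q, \<omega>) \<partial>M) =
      (\<integral>\<omega>. indicator A \<omega> * (f m (s_idx q, \<omega>) - f m (c_idx q, \<omega>)) \<partial>M)" for m
      using ti[of m] by (simp add: right_diff_distrib)
    moreover have "(\<integral>\<omega>. indicator A \<omega> * (Y (min (r \<omega>) q) \<omega> - Y 0 \<omega>) \<partial>M) - (\<integral>\<omega>. indicator A \<omega> * a q \<omega> \<partial>M) =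
      (\<integral>\<omega>. indicator A \<omega> * (Y (min (r \<omega>) q) \<omega> - a q \<omega>) \<partial>M) - (\<integral>\<omega>. indicator A \<omega> * Y 0 \<omega> \<partial>M)"
      using ii by (simp add: right_diff_distrib)
    ultimately show ?thesis by (simp only:)
  qed
  have mart: "(\<integral>\<omega>. indicator A \<omega> * (Y (min (r \<omega>) q') \<omega> - a q' \<omega>) \<partial>M) = (\<integral>\<omega>. indicator A \<omega> * (Y (min (r \<omega>) q) \<omega> - a q \<omega>) \<partial>M)"
    if q: "q \<in> dyadics" "q' \<in> dyadics" "q \<le> q'" and A: "A \<in> sets (F q)" for q q' A
  proof -
    have AM: "A \<in> sets M" using A F_sub[OF subsetD[OF dyadics_range q(1)]] by blast
    obtain k i i' where k: "q = grid k i" "q' = grid k i'" "i \<le> 2 ^ k" "i' \<le> 2 ^ k" by (rule dyadics_common_grid[OF q(1,2)])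
    have ii: "i \<le> i'" using q(3) unfolding k grid_le .
    have "\<forall>\<^sub>F m in sequentially. (\<integral>\<omega>. indicator A \<omega> * (f m (s_idx q', \<omega>) - f m (c_idx q', \<omega>)) \<partial>M) = (\<integral>\<omega>. indicator A \<omega> * (f m (s_idx q, \<omega>) - f m (c_idx q, \<omega>)) \<partial>M)"
      using eventually_ge_at_top[of k]
    proof eventually_elim
      case (elim m)
      show ?case unfolding k(1,2) by (rule tail_hull_martingale[OF fh elim ii k(4)]) (use A k(1) in simp)
    qed
    from LIMSEQ_unique[OF Lim_transform_eventually[OF lim[OF q(2) AM] this] lim[OF q(1) AM]]
    show ?thesis by simp
  qed
  show ?thesis
  proof (rule exI[of _ a], intro conjI)
    show "\<forall>q\<in>dyadics. a q \<in> borel_measurable (F q) \<and> integrable M (a q)" using am ai by simp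
    show "\<forall>\<omega>. a 0 \<omega> = 0" using a0 by simp
    show "\<forall>k. (\<integral>\<omega>. (\<Sum>i<2^k. \<bar>a (grid k (Suc i)) \<omega> - a (grid k i) \<omega>\<bar>) \<partial>M) \<le> C" by (rule allI) (rule var)
    show "\<forall>q\<in>dyadics. \<forall>q'\<in>dyadics. q \<le> q' \<longrightarrow> (\<forall>A\<in>sets (F q).
      (\<integral>\<omega>. indicator A \<omega> * (Y (min (r \<omega>) q') \<omega> - a q' \<omega>) \<partial>M) = (\<integral>\<omega>. indicator A \<omega> * (Y (min (r \<omega>) q) \<omega> - a q \<omega>) \<partial>M))"
      by (intro ballI impI) (rule mart)
  qed
qed

end

section \<open>Right limits along the dyadics\<close>

context usual_filtered_prob_space
begin

text \<open>For a function increasing on the dyadics, the infimum over strictly later points is its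
  right limit. At \<open>T\<close> nothing comes later, so the value itself is taken.\<close>

definition rlim :: "(real \<Rightarrow> real) \<Rightarrow> real \<Rightarrow> real" where
  "rlim h t = (if t < T then Inf (h ` {q\<in>dyadics. t < q}) else h T)"

context
  fixes h :: "real \<Rightarrow> real"
  assumes h: "\<And>q q'. q \<in> dyadics \<Longrightarrow> q' \<in> dyadics \<Longrightarrow> q \<le> q' \<Longrightarrow> h q \<le> h q'"
begin

lemma zero_T_dyadic: "0 \<in> dyadics" "T \<in> dyadics"
  using dyadics_grid[of 0 0] dyadics_grid[of 1 0] by auto

lemma rlim_bdd: "bdd_below (h ` {q\<in>dyadics. t < q})"
proof (rule bdd_belowI[of _ "h 0"])
  fix x assume "x \<in> h ` {q\<in>dyadics. t < q}"
  then obtain q where q: "q \<in> dyadics" "x = h q" by auto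
  have "0 \<le> q" using q dyadics_range by auto
  then show "h 0 \<le> x" unfolding q(2) by (rule h[OF zero_T_dyadic(1) q(1)])
qed

lemma rlim_le: "q \<in> dyadics \<Longrightarrow> t < q \<Longrightarrow> rlim h t \<le> h q"
proof -
  assume q: "q \<in> dyadics" "t < q"
  then have "t < T" using dyadics_range by auto
  then show ?thesis unfolding rlim_def using q rlim_bdd[of t] by (auto intro!: cInf_lower)
qed

lemma rlim_less:
  assumes "t < T" "rlim h t < x" obtains q where "q \<in> dyadics" "t < q" "h q < x"
proof -
  have "h ` {q\<in>dyadics. t < q} \<noteq> {}" using zero_T_dyadic assms(1) by auto
  then show ?thesis using assms cInf_less_iff[OF _ rlim_bdd, of t x] that unfolding rlim_def by auto
qed

lemma rlim_tendsto:
  assumes t: "t \<in> {0..T}" shows "(\<lambda>m. h (dyadic_next m t)) \<longlonglongrightarrow> rlim h t"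
proof (cases "t = T")
  case True
  then show ?thesis by (simp add: dyadic_next_T rlim_def)
next
  case False
  then have tT: "t < T" "0 \<le> t" using t by auto
  show ?thesis
  proof (rule order_tendstoI)
    fix x assume x: "x < rlim h t"
    have "rlim h t \<le> h (dyadic_next m t)" for m by (rule rlim_le[OF dyadic_next_dyadic dyadic_next_cases(2)[OF tT(2,1)]])
    then show "\<forall>\<^sub>F m in sequentially. x < h (dyadic_next m t)" using x by (auto intro: always_eventually less_le_trans)
  next
    fix x assume "rlim h t < x"
    then obtain q where q: "q \<in> dyadics" "t < q" "h q < x" by (rule rlim_less[OF tT(1)])
    have "\<forall>\<^sub>F m in sequentially. dyadic_next m t < q" by (rule order_tendstoD(2)[OF dyadic_next_tendsto[OF t] q(2)])
    then show "\<forall>\<^sub>F m in sequentially. h (dyadic_next m t) < x"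
    proof eventually_elim
      case (elim m)
      then show ?case using h[OF dyadic_next_dyadic q(1), of m t] q(3) by auto
    qed
  qed
qed

lemma rlim_mono:
  assumes "s \<in> {0..T}" "t \<in> {0..T}" "s \<le> t" shows "rlim h s \<le> rlim h t"
  by (rule LIMSEQ_le[OF rlim_tendsto[OF assms(1)] rlim_tendsto[OF assms(2)]])
    (use h[OF dyadic_next_dyadic dyadic_next_dyadic dyadic_next_mono[OF assms(3)]] in auto)

lemma rlim_right:
  assumes t: "t \<in> {0..<T}" shows "(rlim h \<longlongrightarrow> rlim h t) (at_right t)"
proof (rule order_tendstoI)
  have tT: "t < T" using t by auto
  fix x assume x: "x < rlim h t"
  show "\<forall>\<^sub>F s in at_right t. x < rlim h s"
    using eventually_at_right_real[OF tT]
  proof eventually_elim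
    case (elim s)
    have "rlim h t \<le> rlim h s" by (rule rlim_mono) (use elim t in auto)
    then show ?case using x by simp
  qed
next
  fix x assume "rlim h t < x"
  then obtain q where q: "q \<in> dyadics" "t < q" "h q < x" using rlim_less[of t x] t by auto
  show "\<forall>\<^sub>F s in at_right t. rlim h s < x"
    using eventually_at_right_real[OF q(2)]
  proof eventually_elim
    case (elim s)
    then have "rlim h s \<le> h q" using q(1) by (intro rlim_le) auto
    then show ?case using q(3) by simp
  qed
qed

lemma rlim_left:
  assumes t: "t \<in> {0<..T}" shows "\<exists>l. (rlim h \<longlongrightarrow> l) (at_left t)"
proof -
  have t0: "0 < t" using t by auto
  have bdd: "bdd_above (rlim h ` {0..<t})"
  proof (rule bdd_aboveI)
    fix x assume "x \<in> rlim h ` {0..<t}"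
    then show "x \<le> rlim h t" using t by (auto intro!: rlim_mono)
  qed
  have "(rlim h \<longlongrightarrow> Sup (rlim h ` {0..<t})) (at_left t)"
  proof (rule order_tendstoI)
    fix x assume "x < Sup (rlim h ` {0..<t})"
    moreover have "rlim h ` {0..<t} \<noteq> {}" using t0 by auto
    ultimately obtain s0 where s0: "s0 \<in> {0..<t}" "x < rlim h s0" using less_cSup_iff[OF _ bdd] by auto
    have "s0 < t" using s0 by auto
    show "\<forall>\<^sub>F s in at_left t. x < rlim h s"
      using eventually_at_left_real[OF \<open>s0 < t\<close>]
    proof eventually_elim
      case (elim s)
      have "rlim h s0 \<le> rlim h s" by (rule rlim_mono) (use elim s0 t in auto)
      then show ?case using s0 by simp
    qed
  next
    fix x assume x: "Sup (rlim h ` {0..<t}) < x"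
    show "\<forall>\<^sub>F s in at_left t. rlim h s < x"
      using eventually_at_left_real[OF t0]
    proof eventually_elim
      case (elim s)
      have "rlim h s \<le> Sup (rlim h ` {0..<t})" by (rule cSup_upper[OF _ bdd]) (use elim in auto)
      then show ?case using x by simp
    qed
  qed
  then show ?thesis by blast
qed

end

text \<open>Halving a cell can only increase its contribution, by the triangle inequality. The finer
  grid may also see one more half cell before \<open>t\<close>, which is nonnegative.\<close>

lemma dyadic_var_Suc: "dyadic_var k t a \<le> dyadic_var (Suc k) t a"
proof -
  define g where "g i = T * real i / 2 ^ Suc k" for i :: nat
  define d where "d u = (if g (Suc u) \<le> t then \<bar>a (g (Suc u)) - a (g u)\<bar> else 0)" for u
  have e: "T * real i / 2 ^ k = g (2 * i)" for i unfolding g_def by simp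
  have "dyadic_var k t a = (\<Sum>i<2^k. if g (2 * Suc i) \<le> t then \<bar>a (g (2 * Suc i)) - a (g (2 * i))\<bar> else 0)"
    unfolding dyadic_var_def e ..
  also have "\<dots> \<le> (\<Sum>i<2^k. d (2 * i) + d (Suc (2 * i)))"
  proof (rule sum_mono)
    fix i
    have gl: "g (Suc (2 * i)) \<le> g (2 * Suc i)" unfolding g_def dyadic_grid_le by simp
    have "d (2 * i) + d (Suc (2 * i)) = \<bar>a (g (Suc (2 * i))) - a (g (2 * i))\<bar> + \<bar>a (g (2 * Suc i)) - a (g (Suc (2 * i)))\<bar>" if "g (2 * Suc i) \<le> t"
      using that gl unfolding d_def by simp
    moreover have "0 \<le> d u" for u unfolding d_def by simp
    ultimately show "(if g (2 * Suc i) \<le> t then \<bar>a (g (2 * Suc i)) - a (g (2 * i))\<bar> else 0) \<le> d (2 * i) + d (Suc (2 * i))"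
      by (cases "g (2 * Suc i) \<le> t") (auto intro: add_nonneg_nonneg)
  qed
  also have "\<dots> = (\<Sum>i\<in>{0..<2^k}. \<Sum>u\<in>{i*2..<Suc i*2}. d u)"
    unfolding atLeast0LessThan by (rule sum.cong[OF refl]) (simp add: sum.atLeastLessThan_Suc mult.commute numeral_2_eq_2)
  also have "\<dots> = (\<Sum>u\<in>{0*2..<2^k*2}. d u)" by (rule sum_blocks) simp
  also have "\<dots> = dyadic_var (Suc k) t a" unfolding dyadic_var_def d_def g_def by (simp add: atLeast0LessThan mult.commute)
  finally show ?thesis .
qed

lemma dyadic_var_level_mono: "k \<le> l \<Longrightarrow> dyadic_var k t a \<le> dyadic_var l t a"
  by (induction rule: dec_induct) (auto intro: order_trans dyadic_var_Suc)

lemma dyadic_var_time_mono: "s \<le> t \<Longrightarrow> dyadic_var k s a \<le> dyadic_var k t a"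
  unfolding dyadic_var_def by (rule sum_mono) auto

lemma dyadic_var_nonneg: "0 \<le> dyadic_var k t a"
  unfolding dyadic_var_def by (rule sum_nonneg) auto

end

section \<open>Decomposition of the stopped process\<close>

context bounded_stop
begin

text \<open>This is a Jordan decomposition on the dyadics: off a null set, \<open>a\<close> is the
  difference of its variation \<open>p\<close> and an increasing \<open>n\<close>. Monotone
  functions have one-sided limits, so both parts extend to cadlag paths; since the stopped
  \<open>Y\<close> is cadlag, the martingale extends along with them.\<close>

theorem stopped_decomposition:
  "\<exists>X P Q. cadlag M T X \<and> martingale M F T X \<and> (\<forall>\<omega>\<in>space M.
     (\<forall>s\<in>{0..T}. \<forall>t\<in>{s..T}. P s \<omega> \<le> P t \<omega> \<and> Q s \<omega> \<le> Q t \<omega>) \<and>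
     (\<forall>t\<in>{0..T}. Y (min (r \<omega>) t) \<omega> = X t \<omega> + P t \<omega> - (Q t \<omega> :: real)))"
proof -
  have "\<exists>a. (\<forall>q\<in>dyadics. a q \<in> borel_measurable (F q) \<and> integrable M (a q)) \<and> (\<forall>\<omega>. a 0 \<omega> = 0) \<and>
    (\<forall>k. (\<integral>\<omega>. dyadic_var k T (\<lambda>s. a s \<omega>) \<partial>M) \<le> C) \<and>
    (\<forall>q\<in>dyadics. \<forall>q'\<in>dyadics. q \<le> q' \<longrightarrow> (\<forall>A\<in>sets (F q).
      (\<integral>\<omega>. indicator A \<omega> * (Y (min (r \<omega>) q') \<omega> - a q' \<omega>) \<partial>M) = (\<integral>\<omega>. indicator A \<omega> * (Y (min (r \<omega>) q) \<omega> - a q \<omega>) \<partial>M)))"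
  proof -
    have "dyadic_var k T a = (\<Sum>i<2^k. \<bar>a (grid k (Suc i)) - a (grid k i)\<bar>)" for k a
      using dyadic_var_grid[of "2^k" k a] unfolding grid_def by simp
    then show ?thesis using limit_compensator by simp
  qed
  then obtain a where am: "\<And>q. q \<in> dyadics \<Longrightarrow> a q \<in> borel_measurable (F q)" and ai: "\<And>q. q \<in> dyadics \<Longrightarrow> integrable M (a q)"
    and a0: "\<And>\<omega>. a 0 \<omega> = 0" and av: "\<And>k. (\<integral>\<omega>. dyadic_var k T (\<lambda>s. a s \<omega>) \<partial>M) \<le> C"
    and amart: "\<And>q q' A. q \<in> dyadics \<Longrightarrow> q' \<in> dyadics \<Longrightarrow> q \<le> q' \<Longrightarrow> A \<in> sets (F q) \<Longrightarrow>
      (\<integral>\<omega>. indicator A \<omega> * (Y (min (r \<omega>) q') \<omega> - a q' \<omega>) \<partial>M) = (\<integral>\<omega>. indicator A \<omega> * (Y (min (r \<omega>) q) \<omega> - a q \<omega>) \<partial>M)"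
    by blast
  have zT: "0 \<in> dyadics" "T \<in> dyadics" using grid_dyadic[of 0 0] T_dyadic by auto
  have dr: "q \<in> {0..T}" if "q \<in> dyadics" for q using that dyadics_range by auto
  define V where "V k \<omega> = dyadic_var k T (\<lambda>s. a s \<omega>)" for k \<omega>
  have V0: "0 \<le> V k \<omega>" for k \<omega> unfolding V_def by (rule dyadic_var_nonneg)
  have Vi: "integrable M (V k)" for k
    unfolding V_def dyadic_var_def
  proof (rule Bochner_Integration.integrable_sum)
    fix i :: nat assume i: "i \<in> {..<2^k}"
    have "integrable M (a (T * real (Suc i) / 2 ^ k))" "integrable M (a (T * real i / 2 ^ k))"
      using ai[OF dyadics_grid[of "Suc i" k]] ai[OF dyadics_grid[of i k]] i by auto
    then show "integrable M (\<lambda>\<omega>. if T * real (Suc i) / 2 ^ k \<le> T then \<bar>a (T * real (Suc i) / 2 ^ k) \<omega> - a (T * real i / 2 ^ k) \<omega>\<bar> else 0)"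
      by (cases "T * real (Suc i) / 2 ^ k \<le> T") auto
  qed
  have VC: "(\<integral>\<^sup>+\<omega>. ennreal (V k \<omega>) \<partial>M) \<le> ennreal C" for k
    using nn_integral_eq_integral[OF Vi, of k] V0 av[of k] unfolding V_def by (auto intro: ennreal_leI)
  have Vinc: "incseq (\<lambda>k \<omega>. ennreal (V k \<omega>))"
    unfolding incseq_def le_fun_def V_def by (auto intro!: ennreal_leI dyadic_var_level_mono)
  have [measurable]: "V k \<in> borel_measurable M" for k using Vi by auto
  have supC: "(\<integral>\<^sup>+\<omega>. (SUP k. ennreal (V k \<omega>)) \<partial>M) \<le> ennreal C"
    using nn_integral_monotone_convergence_SUP[OF Vinc] VC by (auto intro: SUP_least)
  \<comment> \<open>Monotone convergence over the levels makes the variation finite almost surely.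
    Setting the compensator to zero on the remaining null set makes both Jordan parts finite and
    monotone on every path, without loss of adaptedness.\<close>
  define \<Omega>0 where "\<Omega>0 = {\<omega>\<in>space M. \<exists>c. \<forall>k. V k \<omega> \<le> c}"
  have ae: "AE \<omega> in M. \<exists>c. \<forall>k. V k \<omega> \<le> c"
  proof -
    have "(\<integral>\<^sup>+\<omega>. (SUP k. ennreal (V k \<omega>)) \<partial>M) \<noteq> \<infinity>" using supC by (auto simp: top_unique)
    then have "AE \<omega> in M. (SUP k. ennreal (V k \<omega>)) \<noteq> \<infinity>" by (intro nn_integral_noteq_infinite) auto
    then show ?thesis
    proof eventually_elim
      case (elim \<omega>)
      then obtain c where c: "0 \<le> c" "(SUP k. ennreal (V k \<omega>)) = ennreal c" by (cases "SUP k. ennreal (V k \<omega>)") auto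
      have "ennreal (V k \<omega>) \<le> ennreal c" for k unfolding c(2)[symmetric] by (rule SUP_upper) simp
      then show ?case using c(1) by (auto simp: ennreal_le_iff)
    qed
  qed
  have \<Omega>F: "\<Omega>0 \<in> sets (F t)" if "0 \<le> t" for t unfolding \<Omega>0_def by (rule AE_set_F[OF ae that])
  define b where "b q \<omega> = (if \<omega> \<in> \<Omega>0 then a q \<omega> else 0)" for q \<omega>
  have bm: "b q \<in> borel_measurable (F q)" if "q \<in> dyadics" for q
  proof -
    have "\<Omega>0 \<inter> space M = \<Omega>0" unfolding \<Omega>0_def by auto
    then show ?thesis unfolding b_def using am[OF that] \<Omega>F[of q] dr[OF that] by (intro measurable_If_set) auto
  qed
  have ab: "AE \<omega> in M. b q \<omega> = a q \<omega>" for q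
    using ae AE_space by eventually_elim (auto simp: b_def \<Omega>0_def)
  have b0: "b 0 \<omega> = 0" for \<omega> unfolding b_def using a0 by simp
  have bz: "dyadic_var k t (\<lambda>s. b s \<omega>) = 0" if "\<omega> \<notin> \<Omega>0" for k t \<omega>
    unfolding dyadic_var_def by (intro sum.neutral ballI) (simp add: b_def that)
  have bbd: "\<exists>c. \<forall>k t. dyadic_var k t (\<lambda>s. b s \<omega>) \<le> c" for \<omega>
  proof (cases "\<omega> \<in> \<Omega>0")
    case True
    then obtain c where c: "\<And>k. V k \<omega> \<le> c" unfolding \<Omega>0_def by auto
    have "dyadic_var k t (\<lambda>s. b s \<omega>) \<le> c" for k t
    proof -
      have "dyadic_var k t (\<lambda>s. b s \<omega>) \<le> (\<Sum>i<2^k. \<bar>a (T * real (Suc i) / 2 ^ k) \<omega> - a (T * real i / 2 ^ k) \<omega>\<bar>)"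
        unfolding dyadic_var_def b_def using True by (intro sum_mono) auto
      also have "\<dots> = V k \<omega>" unfolding V_def using dyadic_var_grid[of "2^k" k "\<lambda>s. a s \<omega>"] by simp
      finally show ?thesis using c[of k] by simp
    qed
    then show ?thesis by blast
  next
    case False
    then show ?thesis using bz by (intro exI[of _ 0]) simp
  qed
  define p where "p t \<omega> = (SUP k. dyadic_var k t (\<lambda>s. b s \<omega>))" for t \<omega>
  have pbdd: "bdd_above (range (\<lambda>k. dyadic_var k t (\<lambda>s. b s \<omega>)))" for t \<omega>
  proof -
    obtain c where "\<forall>k t. dyadic_var k t (\<lambda>s. b s \<omega>) \<le> c" using bbd[of \<omega>] by blast
    then show ?thesis by (intro bdd_aboveI[of _ c]) auto
  qed
  have ple: "dyadic_var k t (\<lambda>s. b s \<omega>) \<le> p t \<omega>" for k t \<omega> unfolding p_def by (rule cSUP_upper[OF _ pbdd]) simp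
  have pmono: "p s \<omega> \<le> p t \<omega>" if "s \<le> t" for s t \<omega>
    unfolding p_def by (rule cSUP_mono[OF _ pbdd]) (use dyadic_var_time_mono[OF that] in auto)
  have p0: "0 \<le> p t \<omega>" for t \<omega> using ple[of 0 t \<omega>] dyadic_var_nonneg[of 0 t] by (rule order_trans[rotated])
  have pm: "p q \<in> borel_measurable (F q)" if q: "q \<in> dyadics" for q
    unfolding p_def
  proof (rule borel_measurable_cSUP)
    show "(\<lambda>\<omega>. dyadic_var k q (\<lambda>s. b s \<omega>)) \<in> borel_measurable (F q)" for k
      by (rule dyadic_var_measurable) (use bm borel_F_mono in blast)
    show "bdd_above ((\<lambda>k. dyadic_var k q (\<lambda>s. b s \<omega>)) ` UNIV)" for \<omega> by (rule pbdd)
  qed simp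
  \<comment> \<open>Both times lie on a common fine grid, where the variation up to \<open>q\<close>
    plus the absolute increment of \<open>b\<close> is at most the variation up to
    \<open>q'\<close>. Hence \<open>p - b\<close> is increasing on the dyadics.\<close>
  have pinc: "\<bar>b q' \<omega> - b q \<omega>\<bar> \<le> p q' \<omega> - p q \<omega>" if q: "q \<in> dyadics" "q' \<in> dyadics" "q \<le> q'" for q q' \<omega>
  proof -
    obtain l i i' where l: "q = grid l i" "q' = grid l i'" "i \<le> 2 ^ l" "i' \<le> 2 ^ l" by (rule dyadics_common_grid[OF q(1,2)])
    have "dyadic_var k q (\<lambda>s. b s \<omega>) \<le> p q' \<omega> - \<bar>b q' \<omega> - b q \<omega>\<bar>" for k
    proof -
      define K where "K = max k l"
      define j where "j = i * 2 ^ (K - l)"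
      define j' where "j' = i' * 2 ^ (K - l)"
      have g: "q = grid K j" "q' = grid K j'" unfolding l j_def j'_def K_def by (auto intro: grid_refine)
      have jj: "j \<le> j'" using q(3) unfolding g grid_le .
      have e: "m * 2 ^ (K - l) \<le> 2 ^ K" if "m \<le> 2 ^ l" for m :: nat
      proof -
        have "m * 2 ^ (K - l) \<le> 2 ^ l * 2 ^ (K - l)" using that by (intro mult_right_mono) auto
        then show ?thesis unfolding K_def by (simp add: power_add[symmetric])
      qed
      have j2: "j \<le> 2 ^ K" "j' \<le> 2 ^ K" unfolding j_def j'_def using e l by auto
      define G where "G m = b (grid K m) \<omega>" for m
      have "dyadic_var K q (\<lambda>s. b s \<omega>) + \<bar>b q' \<omega> - b q \<omega>\<bar> \<le> (\<Sum>m\<in>{0..<j}. \<bar>G (Suc m) - G m\<bar>) + (\<Sum>m\<in>{j..<j'}. \<bar>G (Suc m) - G m\<bar>)"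
        using dyadic_var_grid[OF j2(1), of "\<lambda>s. b s \<omega>"] abs_diff_le_sum[OF jj, of G] unfolding g G_def grid_def by (simp add: atLeast0LessThan)
      also have "\<dots> = (\<Sum>m\<in>{0..<j'}. \<bar>G (Suc m) - G m\<bar>)" by (rule sum.atLeastLessThan_concat) (use jj in auto)
      also have "\<dots> = dyadic_var K q' (\<lambda>s. b s \<omega>)"
        using dyadic_var_grid[OF j2(2), of "\<lambda>s. b s \<omega>"] unfolding g G_def grid_def by (simp add: atLeast0LessThan)
      also have "\<dots> \<le> p q' \<omega>" by (rule ple)
      finally show ?thesis using dyadic_var_level_mono[of k K q "\<lambda>s. b s \<omega>"] unfolding K_def by auto
    qed
    then have "p q \<omega> \<le> p q' \<omega> - \<bar>b q' \<omega> - b q \<omega>\<bar>" unfolding p_def by (intro cSUP_least) auto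
    then show ?thesis by simp
  qed
  define n where "n q \<omega> = p q \<omega> - b q \<omega>" for q \<omega>
  have nmono: "n q \<omega> \<le> n q' \<omega>" if "q \<in> dyadics" "q' \<in> dyadics" "q \<le> q'" for q q' \<omega>
    using pinc[OF that, of \<omega>] unfolding n_def by auto
  have bp: "\<bar>b q \<omega>\<bar> \<le> p T \<omega>" if "q \<in> dyadics" for q \<omega>
    using pinc[OF zT(1) that, of \<omega>] dr[OF that] b0[of \<omega>] p0[of 0 \<omega>] pmono[of q T \<omega>] by auto
  have pT: "integrable M (p T)"
  proof (rule integrableI_bounded)
    show "p T \<in> borel_measurable M" using borel_F_M[OF pm[OF zT(2)]] T_pos by auto
    have "ennreal (p T \<omega>) \<le> (SUP k. ennreal (V k \<omega>))" for \<omega>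
    proof -
      have "incseq (\<lambda>k. dyadic_var k T (\<lambda>s. b s \<omega>))" unfolding incseq_def by (auto intro: dyadic_var_level_mono)
      from LIMSEQ_incseq_SUP[OF pbdd this]
      have "(\<lambda>k. ennreal (dyadic_var k T (\<lambda>s. b s \<omega>))) \<longlonglongrightarrow> ennreal (p T \<omega>)" unfolding p_def by (rule tendsto_ennrealI)
      then show ?thesis
      proof (rule LIMSEQ_le_const2, intro exI[of _ 0] allI impI)
        fix k
        have "dyadic_var k T (\<lambda>s. b s \<omega>) \<le> V k \<omega>"
        proof (cases "\<omega> \<in> \<Omega>0")
          case True
          then have "(\<lambda>s. b s \<omega>) = (\<lambda>s. a s \<omega>)" by (auto simp: b_def)
          then show ?thesis unfolding V_def by simp
        next
          case False
          then show ?thesis using bz V0 by simp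
        qed
        then show "ennreal (dyadic_var k T (\<lambda>s. b s \<omega>)) \<le> (SUP k. ennreal (V k \<omega>))"
          by (intro SUP_upper2[of k]) (auto intro: ennreal_leI)
      qed
    qed
    then have "(\<integral>\<^sup>+\<omega>. ennreal (norm (p T \<omega>)) \<partial>M) \<le> (\<integral>\<^sup>+\<omega>. (SUP k. ennreal (V k \<omega>)) \<partial>M)"
      using p0 by (intro nn_integral_mono) auto
    also have "\<dots> \<le> ennreal C" by (rule supC)
    finally show "(\<integral>\<^sup>+\<omega>. ennreal (norm (p T \<omega>)) \<partial>M) < \<infinity>" by (simp add: le_less_trans)
  qed
  \<comment> \<open>The dyadic martingale is dominated by \<open>1 + p T\<close>, a single
    integrable function for all times. This carries its integrals to the right limit
    \<open>X\<close>.\<close>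
  define Mt where "Mt q \<omega> = Y (min (r \<omega>) q) \<omega> - b q \<omega>" for q \<omega>
  have Ym: "(\<lambda>\<omega>. Y (min (r \<omega>) t) \<omega>) \<in> borel_measurable (F t)" if "t \<in> {0..T}" for t
    by (rule stopped_value_measurable[OF Y_adapted Y_cadlag r_stop r_range that])
  have Mm: "Mt q \<in> borel_measurable (F q)" if "q \<in> dyadics" for q
    unfolding Mt_def using Ym[OF dr[OF that]] bm[OF that] by (rule borel_measurable_diff)
  have MM[measurable]: "Mt q \<in> borel_measurable M" if "q \<in> dyadics" for q by (rule borel_F_M[OF Mm[OF that] dr[OF that]])
  have Mb: "\<bar>Mt q \<omega>\<bar> \<le> 1 + p T \<omega>" if "q \<in> dyadics" "\<omega> \<in> space M" for q \<omega>
  proof -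
    have "min (r \<omega>) q \<in> {0..T}" using r_range[OF that(2)] dr[OF that(1)] by auto
    from Y_bound[OF this that(2)] show ?thesis using bp[OF that(1), of \<omega>] unfolding Mt_def by auto
  qed
  have Mmart: "(\<integral>\<omega>. indicator A \<omega> * Mt q' \<omega> \<partial>M) = (\<integral>\<omega>. indicator A \<omega> * Mt q \<omega> \<partial>M)"
    if q: "q \<in> dyadics" "q' \<in> dyadics" "q \<le> q'" and A: "A \<in> sets (F q)" for q q' A
  proof -
    have AM[measurable]: "A \<in> sets M" using A F_sub[OF dr[OF q(1)]] by auto
    have "(\<integral>\<omega>. indicator A \<omega> * Mt u \<omega> \<partial>M) = (\<integral>\<omega>. indicator A \<omega> * (Y (min (r \<omega>) u) \<omega> - a u \<omega>) \<partial>M)" if u: "u \<in> dyadics" for u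
    proof (rule integral_cong_AE)
      show "AE \<omega> in M. indicator A \<omega> * Mt u \<omega> = indicator A \<omega> * (Y (min (r \<omega>) u) \<omega> - a u \<omega>)"
        using ab[of u] by eventually_elim (simp add: Mt_def)
      show "(\<lambda>\<omega>. indicator A \<omega> * Mt u \<omega>) \<in> borel_measurable M" using MM[OF u] by measurable
      show "(\<lambda>\<omega>. indicator A \<omega> * (Y (min (r \<omega>) u) \<omega> - a u \<omega>)) \<in> borel_measurable M"
        using borel_F_M[OF Ym[OF dr[OF u]] dr[OF u]] borel_F_M[OF am[OF u] dr[OF u]] by measurable
    qed
    then show ?thesis using amart[OF q A] q by simp
  qed
  define P where "P t \<omega> = rlim (\<lambda>q. p q \<omega>) t" for t \<omega>
  define Q where "Q t \<omega> = rlim (\<lambda>q. n q \<omega>) t" for t \<omega>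
  define X where "X t \<omega> = Y (min (r \<omega>) t) \<omega> - P t \<omega> + Q t \<omega>" for t \<omega>
  have pm': "p q \<omega> \<le> p q' \<omega>" if "q \<in> dyadics" "q' \<in> dyadics" "q \<le> q'" for q q' \<omega> using pmono[OF that(3)] .
  have Xlim: "(\<lambda>m. Mt (dyadic_next m t) \<omega>) \<longlonglongrightarrow> X t \<omega>" if t: "t \<in> {0..T}" and w: "\<omega> \<in> space M" for t \<omega>
  proof -
    have mt: "min (r \<omega>) t \<in> {0..T}" using r_range[OF w] t by auto
    have "(\<lambda>m. Y (min (r \<omega>) (dyadic_next m t)) \<omega>) \<longlonglongrightarrow> Y (min (r \<omega>) t) \<omega>"
    proof (rule cadlag_right_limit[OF Y_cadlag w mt])
      show "(\<lambda>m. min (r \<omega>) (dyadic_next m t)) \<longlonglongrightarrow> min (r \<omega>) t" by (intro tendsto_min tendsto_const dyadic_next_tendsto t)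
      show "min (r \<omega>) (dyadic_next m t) \<in> {min (r \<omega>) t..T}" for m using dyadic_next_range[OF t, of m] r_range[OF w] by auto
    qed
    moreover have "(\<lambda>m. p (dyadic_next m t) \<omega>) \<longlonglongrightarrow> P t \<omega>" unfolding P_def by (rule rlim_tendsto[OF pm' t])
    moreover have "(\<lambda>m. n (dyadic_next m t) \<omega>) \<longlonglongrightarrow> Q t \<omega>" unfolding Q_def by (rule rlim_tendsto[OF nmono t])
    ultimately have "(\<lambda>m. Y (min (r \<omega>) (dyadic_next m t)) \<omega> - p (dyadic_next m t) \<omega> + n (dyadic_next m t) \<omega>) \<longlonglongrightarrow> X t \<omega>"
      unfolding X_def by (intro tendsto_add tendsto_diff)
    then show ?thesis unfolding Mt_def n_def by simp
  qed
  have Xm: "X t \<in> borel_measurable (F t)" if t: "t \<in> {0..T}" for t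
    by (rule right_limit_measurable[OF t Mm[OF dyadic_next_dyadic] dyadic_next_range[OF t] dyadic_next_tendsto[OF t] Xlim[OF t]])
  have wi: "integrable M (\<lambda>\<omega>. 1 + p T \<omega>)" using pT by simp
  have Xi: "integrable M (X t)" if t: "t \<in> {0..T}" for t
  proof (rule Bochner_Integration.integrable_bound[OF wi borel_F_M[OF Xm[OF t] t]], rule AE_I2)
    fix \<omega> assume w: "\<omega> \<in> space M"
    have "\<bar>X t \<omega>\<bar> \<le> 1 + p T \<omega>"
      by (rule LIMSEQ_le_const2[OF tendsto_rabs[OF Xlim[OF t w]]]) (use Mb[OF dyadic_next_dyadic w] in auto)
    then show "norm (X t \<omega>) \<le> norm (1 + p T \<omega>)" by simp
  qed
  have Xint: "(\<lambda>m. \<integral>\<omega>. indicator A \<omega> * Mt (dyadic_next m t) \<omega> \<partial>M) \<longlonglongrightarrow> (\<integral>\<omega>. indicator A \<omega> * X t \<omega> \<partial>M)"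
    if t: "t \<in> {0..T}" and A[measurable]: "A \<in> sets M" for t A
  proof (rule integral_dominated_convergence[OF _ _ wi])
    show "(\<lambda>\<omega>. indicator A \<omega> * X t \<omega>) \<in> borel_measurable M" using borel_F_M[OF Xm[OF t] t] by measurable
    show "(\<lambda>\<omega>. indicator A \<omega> * Mt (dyadic_next m t) \<omega>) \<in> borel_measurable M" for m using MM[OF dyadic_next_dyadic] by measurable
    show "AE \<omega> in M. (\<lambda>m. indicator A \<omega> * Mt (dyadic_next m t) \<omega>) \<longlonglongrightarrow> indicator A \<omega> * X t \<omega>"
      using Xlim[OF t] by (intro AE_I2 tendsto_mult tendsto_const)
    show "AE \<omega> in M. norm (indicator A \<omega> * Mt (dyadic_next m t) \<omega>) \<le> 1 + p T \<omega>" for m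
    proof (rule AE_I2)
      fix \<omega> assume "\<omega> \<in> space M"
      from Mb[OF dyadic_next_dyadic this, of m t] p0[of T \<omega>]
      show "norm (indicator A \<omega> * Mt (dyadic_next m t) \<omega>) \<le> 1 + p T \<omega>" by (auto simp: indicator_def)
    qed
  qed
  have mart: "martingale M F T X"
  proof (rule martingaleI)
    show "adapted F T X" unfolding adapted_def using Xm by blast
    show "integrable M (X t)" if "t \<in> {0..T}" for t by (rule Xi[OF that])
    fix s t A assume s: "s \<in> {0..T}" and t: "t \<in> {s..T}" and A: "A \<in> sets (F s)"
    have t': "t \<in> {0..T}" using s t by auto
    have AM: "A \<in> sets M" using A F_sub[OF s] by auto
    have "(\<integral>\<omega>. indicator A \<omega> * Mt (dyadic_next m t) \<omega> \<partial>M) = (\<integral>\<omega>. indicator A \<omega> * Mt (dyadic_next m s) \<omega> \<partial>M)" for m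
    proof (rule Mmart[OF dyadic_next_dyadic dyadic_next_dyadic])
      show "dyadic_next m s \<le> dyadic_next m t" by (rule dyadic_next_mono) (use t in auto)
      show "A \<in> sets (F (dyadic_next m s))" using A sets_F_mono[of s "dyadic_next m s"] dyadic_next_range[OF s, of m] by auto
    qed
    then show "(\<integral>\<omega>. indicator A \<omega> * X t \<omega> \<partial>M) = (\<integral>\<omega>. indicator A \<omega> * X s \<omega> \<partial>M)"
      using Xint[OF t' AM] Xint[OF s AM] by (simp add: LIMSEQ_unique)
  qed
  have cad: "cadlag M T X"
    unfolding cadlag_def
  proof (intro ballI conjI)
    fix \<omega> t assume w: "\<omega> \<in> space M" and t: "t \<in> {0..<T}"
    have "((\<lambda>s. Y (min (r \<omega>) s) \<omega>) \<longlongrightarrow> Y (min (r \<omega>) t) \<omega>) (at_right t)"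
      using cadlag_stopped[OF Y_cadlag, of r] w t unfolding cadlag_def by blast
    then show "((\<lambda>s. X s \<omega>) \<longlongrightarrow> X t \<omega>) (at_right t)"
      unfolding X_def P_def Q_def by (intro tendsto_add tendsto_diff rlim_right pm' nmono t)
  next
    fix \<omega> t assume w: "\<omega> \<in> space M" and t: "t \<in> {0<..T}"
    obtain l1 where "((\<lambda>s. Y (min (r \<omega>) s) \<omega>) \<longlongrightarrow> l1) (at_left t)"
      using cadlag_stopped[OF Y_cadlag, of r] w t unfolding cadlag_def by blast
    moreover obtain l2 where "((\<lambda>s. P s \<omega>) \<longlongrightarrow> l2) (at_left t)"
      using rlim_left[of "\<lambda>q. p q \<omega>" t, OF pm' t] unfolding P_def by blast
    moreover obtain l3 where "((\<lambda>s. Q s \<omega>) \<longlongrightarrow> l3) (at_left t)"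
      using rlim_left[of "\<lambda>q. n q \<omega>" t, OF nmono t] unfolding Q_def by blast
    ultimately have "((\<lambda>s. X s \<omega>) \<longlongrightarrow> l1 - l2 + l3) (at_left t)"
      unfolding X_def by (intro tendsto_add tendsto_diff)
    then show "\<exists>l. ((\<lambda>s. X s \<omega>) \<longlongrightarrow> l) (at_left t)" by blast
  qed
  have PQ: "P s \<omega> \<le> P t \<omega>" "Q s \<omega> \<le> Q t \<omega>" if "s \<in> {0..T}" "t \<in> {s..T}" for s t \<omega>
    unfolding P_def Q_def using that by (auto intro!: rlim_mono pm' nmono)
  have "\<forall>\<omega>\<in>space M. (\<forall>s\<in>{0..T}. \<forall>t\<in>{s..T}. P s \<omega> \<le> P t \<omega> \<and> Q s \<omega> \<le> Q t \<omega>) \<and>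
     (\<forall>t\<in>{0..T}. Y (min (r \<omega>) t) \<omega> = X t \<omega> + P t \<omega> - Q t \<omega>)"
    using PQ by (simp add: X_def)
  then show ?thesis using cad mart by blast
qed

end

section \<open>Dyadic strategies as simple integrands\<close>

context usual_filtered_prob_space
begin

lemma sup_norm_le:
  assumes "\<And>t. t \<in> {0..T} \<Longrightarrow> G t \<in> borel_measurable M" "\<And>t. t \<in> {0..T} \<Longrightarrow> AE \<omega> in M. \<bar>G t \<omega>\<bar> \<le> e"
  shows "sup_norm M T G \<le> ereal e"
  unfolding sup_norm_def
proof (rule SUP_least)
  fix t assume t: "t \<in> {0..T}"
  have "AE \<omega> in M. ereal \<bar>G t \<omega>\<bar> \<le> ereal e" using assms(2)[OF t] by eventually_elim simp
  then show "esssup M (\<lambda>\<omega>. ereal \<bar>G t \<omega>\<bar>) \<le> ereal e" using assms(1)[OF t] by (intro esssup_I) measurable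
qed

lemma sup_norm_nonneg: "0 \<le> sup_norm M T G"
proof -
  have "0 \<le> esssup M (\<lambda>\<omega>. ereal \<bar>G 0 \<omega>\<bar>)"
  proof -
    have "esssup M (\<lambda>\<omega>. (0::ereal)) \<le> esssup M (\<lambda>\<omega>. ereal \<bar>G 0 \<omega>\<bar>)" by (rule esssup_mono) auto
    then show ?thesis using esssup_const[of M "0::ereal"] emeasure_space_1 by simp
  qed
  also have "\<dots> \<le> sup_norm M T G" unfolding sup_norm_def using T_pos by (intro SUP_upper) auto
  finally show ?thesis .
qed

lemma sup_norm_tendsto_0:
  assumes "\<And>n. sup_norm M T (G n) \<le> ereal (c / (real n + 1))"
  shows "(\<lambda>n. sup_norm M T (G n)) \<longlonglongrightarrow> 0"
proof (rule tendsto_sandwich[OF _ _ tendsto_const])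
  have "(\<lambda>n. c / (real (Suc n))) \<longlonglongrightarrow> 0" by (rule LIMSEQ_Suc[OF lim_const_over_n])
  then have "(\<lambda>n. c / (real n + 1)) \<longlonglongrightarrow> 0" by (simp add: add.commute)
  then show "(\<lambda>n. ereal (c / (real n + 1))) \<longlonglongrightarrow> 0" by (simp add: zero_ereal_def)
qed (use assms sup_norm_nonneg in auto)

lemma stopping_time_borel:
  assumes "stopping_time F \<tau>" "\<And>\<omega>. \<omega> \<in> space M \<Longrightarrow> \<tau> \<omega> \<in> {0..T}" shows "\<tau> \<in> borel_measurable M"
proof -
  have "(\<lambda>\<omega>. min (\<tau> \<omega>) T) \<in> borel_measurable M"
    using borel_F_M[OF stopping_time_measurable[OF assms(1), of T]] T_pos by auto
  then show ?thesis by (rule measurable_cong[THEN iffD2, rotated]) (use assms(2) in auto)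
qed

lemma simple_integrand_coeff_measurable:
  assumes H: "simple_integrand M F T H" and j: "j \<in> {1..steps H}"
  shows "coeff H j \<in> borel_measurable M"
proof (rule borel_pre_sigma_M)
  show "stopping_time F (times H (j - 1))" "coeff H j \<in> borel_measurable (pre_sigma (times H (j - 1)))"
    using H j unfolding simple_integrand_def by auto
  show "times H (j - 1) \<omega> \<in> {0..T}" if "\<omega> \<in> space M" for \<omega> using simple_integrand_times(5)[OF H that, of "j - 1"] j by auto
qed

lemma simple_process_measurable:
  assumes H: "simple_integrand M F T H" shows "simple_process H t \<in> borel_measurable M"
  unfolding simple_process_def
proof (rule borel_measurable_sum)
  fix j assume j: "j \<in> {1..steps H}"
  have [measurable]: "times H j \<in> borel_measurable M" "times H (j - 1) \<in> borel_measurable M"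
    using H j simple_integrand_times(5)[OF H] unfolding simple_integrand_def by (auto intro!: stopping_time_borel)
  have [measurable]: "coeff H j \<in> borel_measurable M" by (rule simple_integrand_coeff_measurable[OF H j])
  have "(\<lambda>\<omega>. coeff H j \<omega> * of_bool (times H (j - 1) \<omega> < t \<and> t \<le> times H j \<omega>)) \<in> borel_measurable M" by measurable
  then show "(\<lambda>\<omega>. coeff H j \<omega> * indicator {times H (j - 1) \<omega><..times H j \<omega>} t) \<in> borel_measurable M"
    by (simp add: indicator_def)
qed

lemma simple_integral_measurable:
  assumes H: "simple_integrand M F T H" and S: "adapted F T S" "cadlag M T S" and t: "t \<in> {0..T}"
  shows "simple_integral H S t \<in> borel_measurable M"
  unfolding simple_integral_def
proof (rule borel_measurable_sum)
  fix j assume j: "j \<in> {1..steps H}"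
  have "(\<lambda>\<omega>. S (min (times H i \<omega>) t) \<omega>) \<in> borel_measurable M" if "i \<le> steps H" for i
  proof (rule borel_F_M[OF stopped_value_measurable[OF S _ _ t] t])
    show "stopping_time F (times H i)" using H that unfolding simple_integrand_def by auto
  qed (rule simple_integrand_times(5)[OF H _ that])
  then show "(\<lambda>\<omega>. coeff H j \<omega> * (S (min (times H j \<omega>) t) \<omega> - S (min (times H (j - 1) \<omega>) t) \<omega>)) \<in> borel_measurable M"
    using simple_integrand_coeff_measurable[OF H j] j by (intro borel_measurable_times borel_measurable_diff) auto
qed

lemma simple_process_bound:
  assumes H: "simple_integrand M F T H" "\<omega> \<in> space M" and c: "\<And>j. j \<in> {1..steps H} \<Longrightarrow> \<bar>coeff H j \<omega>\<bar> \<le> e" and e: "0 \<le> e"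
  shows "\<bar>simple_process H t \<omega>\<bar> \<le> e"
proof (cases "\<exists>j\<in>{1..steps H}. t \<in> {times H (j - 1) \<omega><..times H j \<omega>}")
  case True
  then obtain j where j: "j \<in> {1..steps H}" "t \<in> {times H (j - 1) \<omega><..times H j \<omega>}" by blast
  have "simple_process H t \<omega> = (\<Sum>i=1..steps H. if i = j then coeff H j \<omega> else 0)"
    unfolding simple_process_def
  proof (rule sum.cong[OF refl])
    fix i assume i: "i \<in> {1..steps H}"
    consider "i \<le> j - 1" | "i = j" | "j \<le> i - 1" using i j by force
    then show "coeff H i \<omega> * indicator {times H (i - 1) \<omega><..times H i \<omega>} t = (if i = j then coeff H j \<omega> else 0)"
    proof cases
      case 1
      then have "times H i \<omega> \<le> times H (j - 1) \<omega>" using j by (intro simple_integrand_times(4)[OF H]) auto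
      then show ?thesis using j 1 by auto
    next
      case 2 then show ?thesis using j by auto
    next
      case 3
      then have "times H j \<omega> \<le> times H (i - 1) \<omega>" using i by (intro simple_integrand_times(4)[OF H]) auto
      then show ?thesis using j i 3 by auto
    qed
  qed
  also have "\<dots> = coeff H j \<omega>" using j by simp
  finally show ?thesis using c[OF j(1)] by simp
next
  case False
  then have "simple_process H t \<omega> = 0" unfolding simple_process_def by (intro sum.neutral) auto
  then show ?thesis using e by simp
qed

lemma borel_pre_sigma_const:
  assumes f: "f \<in> borel_measurable (F s)" shows "(f :: 'a \<Rightarrow> real) \<in> borel_measurable (pre_sigma (\<lambda>_. s))"
proof (rule borel_measurableI_le)
  fix a
  show "{\<omega> \<in> space (pre_sigma (\<lambda>_. s)). f \<omega> \<le> a} \<in> sets (pre_sigma (\<lambda>_. s))"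
  proof (rule sets_pre_sigmaI[OF stopping_time_const])
    fix u
    show "{\<omega> \<in> {\<omega> \<in> space (pre_sigma (\<lambda>_. s)). f \<omega> \<le> a}. s \<le> u} \<in> sets (F u)"
    proof (cases "s \<le> u")
      case True
      have "{\<omega> \<in> space (F s). f \<omega> \<le> a} \<in> sets (F s)" using f by measurable
      then show ?thesis using True sets_F_mono[OF True] by (auto simp: space_pre_sigma)
    qed simp
  qed
qed

text \<open>Times are capped at \<open>r\<close>, and one more interval from \<open>r\<close> to
  \<open>T\<close> with zero coefficient is appended because a simple integrand has to end at
  \<open>T\<close>. The coefficient is cut off unless the grid point comes before \<open>r\<close>,
  so as to be known at the capped time.\<close>

definition grid_strategy :: "(nat \<Rightarrow> 'a \<Rightarrow> real) \<Rightarrow> nat \<Rightarrow> ('a \<Rightarrow> real) \<Rightarrow> 'a simple_data" where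
  "grid_strategy f n r = \<lparr>steps = Suc (2 ^ n),
     times = (\<lambda>j \<omega>. if j \<le> 2 ^ n then min (T * real j / 2 ^ n) (r \<omega>) else T),
     coeff = (\<lambda>j \<omega>. if 1 \<le> j \<and> j \<le> 2 ^ n \<and> T * real (j - 1) / 2 ^ n < r \<omega> then f (j - 1) \<omega> else 0)\<rparr>"

lemma grid_strategy_simple:
  assumes r: "stopping_time F r" "\<And>\<omega>. \<omega> \<in> space M \<Longrightarrow> r \<omega> \<in> {0..T}"
    and f: "\<And>i. i < 2 ^ n \<Longrightarrow> f i \<in> borel_measurable (F (T * real i / 2 ^ n))"
    and b: "\<And>i \<omega>. i < 2 ^ n \<Longrightarrow> \<omega> \<in> space M \<Longrightarrow> \<bar>f i \<omega>\<bar> \<le> c"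
  shows "simple_integrand M F T (grid_strategy f n r)"
  unfolding simple_integrand_def
proof (intro conjI allI impI ballI)
  fix j assume "j \<le> steps (grid_strategy f n r)"
  have "stopping_time F (\<lambda>\<omega>. min (T * real j / 2 ^ n) (r \<omega>))" by (intro stopping_time_min stopping_time_const r)
  then show "stopping_time F (times (grid_strategy f n r) j)"
    unfolding grid_strategy_def by (cases "j \<le> 2 ^ n") (auto intro: stopping_time_const)
next
  fix \<omega> assume w: "\<omega> \<in> space M"
  show "times (grid_strategy f n r) 0 \<omega> = 0" "times (grid_strategy f n r) (steps (grid_strategy f n r)) \<omega> = T"
    using r(2)[OF w] unfolding grid_strategy_def by auto
  fix j assume "j < steps (grid_strategy f n r)"
  then have j: "j \<le> 2 ^ n" unfolding grid_strategy_def by simp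
  have "T * real j / 2 ^ n \<le> T * real (Suc j) / 2 ^ n" unfolding dyadic_grid_le by simp
  then have "min (T * real j / 2 ^ n) (r \<omega>) \<le> min (T * real (Suc j) / 2 ^ n) (r \<omega>)" by (rule min.mono) simp
  moreover have "min (T * real j / 2 ^ n) (r \<omega>) \<le> T" using r(2)[OF w] by auto
  ultimately show "times (grid_strategy f n r) j \<omega> \<le> times (grid_strategy f n r) (Suc j) \<omega>"
    using j unfolding grid_strategy_def simple_data.simps by (simp only: if_True simp_thms split: if_split)
next
  fix j assume j: "j \<in> {1..steps (grid_strategy f n r)}"
  show "coeff (grid_strategy f n r) j \<in> borel_measurable (pre_sigma (times (grid_strategy f n r) (j - 1)))"
  proof (cases "j \<le> 2 ^ n")
    case True
    have jn: "j - 1 < 2 ^ n" using True j by auto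
    have "coeff (grid_strategy f n r) j = (\<lambda>\<omega>. if T * real (j - 1) / 2 ^ n < r \<omega> then f (j - 1) \<omega> else 0)"
      using True j unfolding grid_strategy_def by auto
    moreover have "times (grid_strategy f n r) (j - 1) = (\<lambda>\<omega>. min (T * real (j - 1) / 2 ^ n) (r \<omega>))"
      using True unfolding grid_strategy_def by auto
    ultimately show ?thesis
      using pre_sigma_min[OF stopping_time_const r(1) borel_pre_sigma_const[OF f[OF jn]]] by simp
  next
    case False
    then have "coeff (grid_strategy f n r) j = (\<lambda>\<omega>. 0)" unfolding grid_strategy_def by auto
    then show ?thesis by simp
  qed
  show "\<exists>C. AE \<omega> in M. \<bar>coeff (grid_strategy f n r) j \<omega>\<bar> \<le> C"
  proof (intro exI[of _ "\<bar>c\<bar>"] AE_I2)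
    fix \<omega> assume w: "\<omega> \<in> space M"
    show "\<bar>coeff (grid_strategy f n r) j \<omega>\<bar> \<le> \<bar>c\<bar>"
    proof (cases "1 \<le> j \<and> j \<le> 2 ^ n")
      case True
      then have "j - 1 < 2 ^ n" by auto
      from b[OF this w] show ?thesis unfolding grid_strategy_def by auto
    qed (auto simp: grid_strategy_def)
  qed
qed

lemma grid_strategy_integral:
  "simple_integral (grid_strategy f n r) S t \<omega> =
    (\<Sum>i<2^n. f i \<omega> * (S (min (r \<omega>) (min (T * real (Suc i) / 2 ^ n) t)) \<omega> - S (min (r \<omega>) (min (T * real i / 2 ^ n) t)) \<omega>))"
proof -
  let ?H = "grid_strategy f n r"
  have "simple_integral ?H S t \<omega> = (\<Sum>i<Suc (2^n). coeff ?H (Suc i) \<omega> * (S (min (times ?H (Suc i) \<omega>) t) \<omega> - S (min (times ?H i \<omega>) t) \<omega>))"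
    unfolding simple_integral_def by (simp add: sum.atLeast1_atMost_eq grid_strategy_def)
  also have "\<dots> = (\<Sum>i<2^n. coeff ?H (Suc i) \<omega> * (S (min (times ?H (Suc i) \<omega>) t) \<omega> - S (min (times ?H i \<omega>) t) \<omega>))"
    by (simp add: grid_strategy_def)
  also have "\<dots> = (\<Sum>i<2^n. f i \<omega> * (S (min (r \<omega>) (min (T * real (Suc i) / 2 ^ n) t)) \<omega> - S (min (r \<omega>) (min (T * real i / 2 ^ n) t)) \<omega>))"
  proof (rule sum.cong[OF refl])
    fix i :: nat assume i: "i \<in> {..<2^n}"
    define u v where "u = T * real i / 2 ^ n" and "v = T * real (Suc i) / 2 ^ n"
    have uv: "u \<le> v" unfolding u_def v_def dyadic_grid_le by simp
    have "times ?H (Suc i) \<omega> = min v (r \<omega>)" "times ?H i \<omega> = min u (r \<omega>)" "coeff ?H (Suc i) \<omega> = (if u < r \<omega> then f i \<omega> else 0)"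
      using i unfolding grid_strategy_def u_def v_def by auto
    moreover have "min (min v (r \<omega>)) t = min (r \<omega>) (min v t)" "min (min u (r \<omega>)) t = min (r \<omega>) (min u t)" by auto
    moreover have "min (r \<omega>) (min v t) = min (r \<omega>) (min u t)" if "\<not> u < r \<omega>" using that uv by auto
    ultimately show "coeff ?H (Suc i) \<omega> * (S (min (times ?H (Suc i) \<omega>) t) \<omega> - S (min (times ?H i \<omega>) t) \<omega>) =
      f i \<omega> * (S (min (r \<omega>) (min (T * real (Suc i) / 2 ^ n) t)) \<omega> - S (min (r \<omega>) (min (T * real i / 2 ^ n) t)) \<omega>)"
      unfolding u_def[symmetric] v_def[symmetric] by auto
  qed
  finally show ?thesis .
qed

text \<open>Losses are controlled at grid times, but the norm looks at all times. At an intermediate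
  time only one increment is incomplete, and it changes the gain by at most \<open>2\<close>, which
  turns \<open>-1\<close> into \<open>-3\<close>.\<close>

lemma grid_gains_between:
  fixes y :: "real \<Rightarrow> real"
  assumes y: "\<And>t. t \<in> {0..T} \<Longrightarrow> \<bar>y t\<bar> \<le> 1" and f: "\<And>i. i < 2 ^ n \<Longrightarrow> \<bar>f i\<bar> \<le> (1::real)"
    and l: "\<And>m. m \<le> 2 ^ n \<Longrightarrow> - 1 \<le> (\<Sum>i<m. f i * (y (T * real (Suc i) / 2 ^ n) - y (T * real i / 2 ^ n)))"
    and t: "t \<in> {0..T}" and N: "N \<le> 2 ^ n"
  shows "- 3 \<le> (\<Sum>i<N. f i * (y (min (T * real (Suc i) / 2 ^ n) t) - y (min (T * real i / 2 ^ n) t)))"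
  using N
proof (induction N)
  case (Suc N)
  define g where "g i = T * real i / 2 ^ n" for i :: nat
  have gl: "g i \<le> g j \<longleftrightarrow> i \<le> j" for i j unfolding g_def by (rule dyadic_grid_le)
  have full: "(\<Sum>i<m. f i * (y (min (g (Suc i)) t) - y (min (g i) t))) = (\<Sum>i<m. f i * (y (g (Suc i)) - y (g i)))" if "g m \<le> t" for m
  proof (rule sum.cong[OF refl])
    fix i assume "i \<in> {..<m}"
    then have "g (Suc i) \<le> g m" "g i \<le> g m" unfolding gl by auto
    then have "min (g (Suc i)) t = g (Suc i)" "min (g i) t = g i" using that by auto
    then show "f i * (y (min (g (Suc i)) t) - y (min (g i) t)) = f i * (y (g (Suc i)) - y (g i))" by simp
  qed
  have l': "- 1 \<le> (\<Sum>i<m. f i * (y (g (Suc i)) - y (g i)))" if "m \<le> 2 ^ n" for m using l[OF that] unfolding g_def .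
  consider "g (Suc N) \<le> t" | "g N \<le> t" "t < g (Suc N)" | "t < g N" by linarith
  then have "- 3 \<le> (\<Sum>i<Suc N. f i * (y (min (g (Suc i)) t) - y (min (g i) t)))"
  proof cases
    case 1
    then show ?thesis using l'[OF Suc.prems] unfolding full[OF 1] by linarith
  next
    case 2
    have "g N \<in> {0..T}" unfolding g_def by (rule dyadic_in) (use Suc.prems in simp)
    then have "\<bar>y t - y (g N)\<bar> \<le> 2" using y[OF t] y[of "g N"] by auto
    then have "\<bar>f N * (y t - y (g N))\<bar> \<le> 1 * 2" unfolding abs_mult using f[of N] Suc.prems by (intro mult_mono) auto
    moreover have "- 1 \<le> (\<Sum>i<N. f i * (y (min (g (Suc i)) t) - y (min (g i) t)))" unfolding full[OF 2(1)] using l'[of N] Suc.prems by simp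
    ultimately show ?thesis using 2 by (simp add: min_absorb1 min_absorb2)
  next
    case 3
    then have "t < g (Suc N)" using gl[of N "Suc N"] by auto
    then show ?thesis using 3 Suc unfolding g_def by (simp add: min_absorb2)
  qed
  then show ?case unfolding g_def .
qed simp

lemma martingale_scale:
  assumes "martingale M F T X" shows "martingale M F T (\<lambda>t \<omega>. c * X t \<omega>)"
proof (rule martingaleI)
  show "adapted F T (\<lambda>t \<omega>. c * X t \<omega>)" using assms unfolding martingale_def adapted_def by auto
  show "integrable M (\<lambda>\<omega>. c * X t \<omega>)" if "t \<in> {0..T}" for t using assms that unfolding martingale_def by auto
  fix s t A assume st: "s \<in> {0..T}" "t \<in> {s..T}" and A: "A \<in> sets (F s)"
  have "(\<integral>\<omega>. (c * indicator A \<omega>) * X t \<omega> \<partial>M) = (\<integral>\<omega>. (c * indicator A \<omega>) * X s \<omega> \<partial>M)"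
    by (rule martingale_integral(2)[OF assms st, of _ "\<bar>c\<bar>"]) (use A in \<open>auto simp: indicator_def\<close>)
  then show "(\<integral>\<omega>. indicator A \<omega> * (c * X t \<omega>) \<partial>M) = (\<integral>\<omega>. indicator A \<omega> * (c * X s \<omega>) \<partial>M)"
    by (simp add: mult_ac)
qed

lemma cadlag_scale: "cadlag M T X \<Longrightarrow> cadlag M T (\<lambda>t \<omega>. c * X t \<omega>)"
  unfolding cadlag_def by (fastforce intro: tendsto_mult_left)

text \<open>If the gains were not bounded in probability, dividing the strategies by \<open>K\<close> tending to infinity would
  produce a free lunch with vanishing risk and little investment.\<close>

lemma no_free_lunch_bounded_nfl:
  assumes S: "cadlag M T S" "adapted F T S" and nfl: "no_free_lunch_vrli M F T S"
    and r: "stopping_time F r" "\<And>\<omega>. \<omega> \<in> space M \<Longrightarrow> r \<omega> \<in> {0..T}"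
    and c: "1 \<le> c" "AE \<omega> in M. \<forall>t\<in>{0..T}. \<bar>S (min (r \<omega>) t) \<omega>\<bar> \<le> c"
  shows "bounded_nfl M F T (\<lambda>t \<omega>. if \<forall>s\<in>{0..T}. \<bar>S (min (r \<omega>) s) \<omega>\<bar> \<le> c then S (min (r \<omega>) t) \<omega> / c else 0)"
    (is "bounded_nfl M F T ?Y")
proof unfold_locales
  \<comment> \<open>Paths violating the bound form a null set whose complement belongs to every
    \<open>F t\<close>. Replacing them by zero keeps \<open>?Y\<close> adapted and makes its bound
    hold on every path.\<close>
  define \<Omega> where "\<Omega> = {\<omega>\<in>space M. \<forall>s\<in>{0..T}. \<bar>S (min (r \<omega>) s) \<omega>\<bar> \<le> c}"
  have if0: "((\<lambda>s. if b then f s else 0) \<longlongrightarrow> (if b then l else 0)) net"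
    if "(f \<longlongrightarrow> l) net" for b l net and f :: "real \<Rightarrow> real"
    using that by (cases b) auto
  show Yc: "cadlag M T ?Y"
    unfolding cadlag_def
  proof (intro ballI conjI)
    note sc = cadlag_scale[OF cadlag_stopped[OF S(1), of r], of "1/c"]
    fix \<omega> t assume w: "\<omega> \<in> space M" and t: "t \<in> {0..<T}"
    have "((\<lambda>s. 1 / c * S (min (r \<omega>) s) \<omega>) \<longlongrightarrow> 1 / c * S (min (r \<omega>) t) \<omega>) (at_right t)" using sc w t unfolding cadlag_def by blast
    then have "((\<lambda>s. S (min (r \<omega>) s) \<omega> / c) \<longlongrightarrow> S (min (r \<omega>) t) \<omega> / c) (at_right t)" by simp
    then show "((\<lambda>s. ?Y s \<omega>) \<longlongrightarrow> ?Y t \<omega>) (at_right t)" by (rule if0)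
  next
    note sc = cadlag_scale[OF cadlag_stopped[OF S(1), of r], of "1/c"]
    fix \<omega> t assume w: "\<omega> \<in> space M" and t: "t \<in> {0<..T}"
    have "\<exists>l. ((\<lambda>s. 1 / c * S (min (r \<omega>) s) \<omega>) \<longlongrightarrow> l) (at_left t)" using sc w t unfolding cadlag_def by blast
    then obtain l where "((\<lambda>s. S (min (r \<omega>) s) \<omega> / c) \<longlongrightarrow> l) (at_left t)" by auto
    from if0[OF this] show "\<exists>l. ((\<lambda>s. ?Y s \<omega>) \<longlongrightarrow> l) (at_left t)" by blast
  qed
  show "adapted F T ?Y"
    unfolding adapted_def
  proof
    fix t assume t: "t \<in> {0..T}"
    have [measurable]: "(\<lambda>\<omega>. S (min (r \<omega>) t) \<omega>) \<in> borel_measurable (F t)" by (rule stopped_value_measurable[OF S(2,1) r t])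
    have "\<Omega> \<in> sets (F t)" unfolding \<Omega>_def by (rule AE_set_F[OF c(2)]) (use t in auto)
    then have [measurable]: "Measurable.pred (F t) (\<lambda>\<omega>. \<forall>s\<in>{0..T}. \<bar>S (min (r \<omega>) s) \<omega>\<bar> \<le> c)"
      unfolding \<Omega>_def pred_def by simp
    show "?Y t \<in> borel_measurable (F t)" by measurable
  qed
  show Yb: "\<bar>?Y t \<omega>\<bar> \<le> 1" if "t \<in> {0..T}" "\<omega> \<in> space M" for t \<omega> using that(1) c(1) by (auto simp: field_simps)
  fix \<epsilon> :: real assume e: "0 < \<epsilon>"
  define G where "G n f m \<omega> = (\<Sum>i<m. f i \<omega> * (?Y (T * real (Suc i) / 2 ^ n) \<omega> - ?Y (T * real i / 2 ^ n) \<omega>))" for n :: nat and f m \<omega>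
  define Cd where "Cd n f \<longleftrightarrow> (\<forall>i<2^n. f i \<in> borel_measurable (F (T * real i / 2 ^ n)) \<and> (\<forall>\<omega>\<in>space M. \<bar>f i \<omega>\<bar> \<le> 1)) \<and>
      (\<forall>m\<le>2^n. \<forall>\<omega>\<in>space M. - 1 \<le> G n f m \<omega>)" for n f
  define Pm where "Pm n f K = measure M {\<omega>\<in>space M. G n f (2^n) \<omega> > K}" for n f K
  have "\<exists>K. \<forall>n f. Cd n f \<longrightarrow> Pm n f K \<le> \<epsilon>"
  proof (rule ccontr)
    assume no: "\<not> ?thesis"
    have "\<exists>n f. Cd n f \<and> \<epsilon> < Pm n f (real k + 1)" for k :: nat
    proof (rule ccontr)
      assume "\<not> ?thesis"
      then have "\<forall>n f. Cd n f \<longrightarrow> Pm n f (real k + 1) \<le> \<epsilon>" by (simp add: not_less)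
      then show False using no by blast
    qed
    then have "\<forall>k. \<exists>z. Cd (fst z) (snd z) \<and> \<epsilon> < Pm (fst z) (snd z) (real k + 1)" by simp
    then obtain z where z: "\<And>k. Cd (fst (z k)) (snd (z k)) \<and> \<epsilon> < Pm (fst (z k)) (snd (z k)) (real k + 1)" by (rule choice[THEN exE]) blast
    define n where "n k = fst (z k)" for k
    define f where "f k = snd (z k)" for k
    have cd: "Cd (n k) (f k)" and hi: "\<epsilon> < measure M {\<omega>\<in>space M. G (n k) (f k) (2 ^ n k) \<omega> > real k + 1}" for k
      using z[of k] unfolding n_def f_def Pm_def by blast+
    have f: "f k i \<in> borel_measurable (F (T * real i / 2 ^ n k))" if "i < 2 ^ n k" for k i
      using cd[of k] that unfolding Cd_def by blast
    have fb: "\<bar>f k i \<omega>\<bar> \<le> 1" if "i < 2 ^ n k" "\<omega> \<in> space M" for k i \<omega>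
      using cd[of k] that unfolding Cd_def by blast
    note f = f fb
    have lo: "- 1 \<le> G (n k) (f k) m \<omega>" if "m \<le> 2 ^ n k" "\<omega> \<in> space M" for k m \<omega>
      using cd[of k] that unfolding Cd_def by blast
    \<comment> \<open>Division by \<open>c\<close> passes from \<open>S\<close> to
      \<open>?Y\<close>; division by \<open>real k + 1\<close> makes the coefficients and the losses
      vanish, the latter being at most \<open>3 / (real k + 1)\<close>. Gains above
      \<open>real k + 1\<close> become gains above \<open>1\<close>, still with probability above
      \<open>\<epsilon>\<close> for every \<open>k\<close>.\<close>
    define h where "h k i \<omega> = f k i \<omega> / (c * (real k + 1))" for k i \<omega>
    define H where "H k = grid_strategy (h k) (n k) r" for k
    have hb: "\<bar>h k i \<omega>\<bar> \<le> 1 / (real k + 1)" if "i < 2 ^ n k" "\<omega> \<in> space M" for k i \<omega>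
    proof -
      have "\<bar>h k i \<omega>\<bar> = \<bar>f k i \<omega>\<bar> / (c * (real k + 1))" unfolding h_def using c(1) by (simp add: abs_mult)
      also have "\<dots> \<le> 1 / (1 * (real k + 1))" using f(2)[OF that] c(1) by (intro frac_le mult_right_mono) auto
      finally show ?thesis by simp
    qed
    have Hs: "simple_integrand M F T (H k)" for k
      unfolding H_def
    proof (rule grid_strategy_simple[OF r])
      show "h k i \<in> borel_measurable (F (T * real i / 2 ^ n k))" if "i < 2 ^ n k" for i
        unfolding h_def using f(1)[OF that] by measurable
    qed (assumption, erule (1) hb)
    have HI: "simple_integral (H k) S t \<omega> = (\<Sum>i<2^n k. f k i \<omega> * (?Y (min (T * real (Suc i) / 2 ^ n k) t) \<omega> - ?Y (min (T * real i / 2 ^ n k) t) \<omega>)) / (real k + 1)"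
      if w: "\<forall>s\<in>{0..T}. \<bar>S (min (r \<omega>) s) \<omega>\<bar> \<le> c" for k t \<omega>
    proof -
      have "simple_integral (H k) S t \<omega> = (\<Sum>i<2^n k. h k i \<omega> * (c * ?Y (min (T * real (Suc i) / 2 ^ n k) t) \<omega> - c * ?Y (min (T * real i / 2 ^ n k) t) \<omega>))"
        unfolding H_def grid_strategy_integral using w c(1) by simp
      also have "\<dots> = (\<Sum>i<2^n k. f k i \<omega> * (?Y (min (T * real (Suc i) / 2 ^ n k) t) \<omega> - ?Y (min (T * real i / 2 ^ n k) t) \<omega>)) / (real k + 1)"
        unfolding sum_divide_distrib
      proof (rule sum.cong[OF refl])
        fix i
        have "f k i \<omega> / (c * (real k + 1)) * (c * x - c * y) = f k i \<omega> * (x - y) / (real k + 1)" for x y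
          using c(1) by (simp add: right_diff_distrib[symmetric])
        then show "h k i \<omega> * (c * ?Y (min (T * real (Suc i) / 2 ^ n k) t) \<omega> - c * ?Y (min (T * real i / 2 ^ n k) t) \<omega>) =
          f k i \<omega> * (?Y (min (T * real (Suc i) / 2 ^ n k) t) \<omega> - ?Y (min (T * real i / 2 ^ n k) t) \<omega>) / (real k + 1)"
          unfolding h_def by blast
      qed
      finally show ?thesis .
    qed
    have neg: "(\<lambda>k. sup_norm M T (\<lambda>t \<omega>. max (- simple_integral (H k) S t \<omega>) 0)) \<longlonglongrightarrow> 0"
    proof (rule sup_norm_tendsto_0, rule sup_norm_le)
      fix k t assume t: "t \<in> {0..T}"
      show "(\<lambda>\<omega>. max (- simple_integral (H k) S t \<omega>) 0) \<in> borel_measurable M"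
        using simple_integral_measurable[OF Hs S(2,1) t] by measurable
      show "AE \<omega> in M. \<bar>max (- simple_integral (H k) S t \<omega>) 0\<bar> \<le> 3 / (real k + 1)"
        using c(2) AE_space
      proof eventually_elim
        case (elim \<omega>)
        have "- 3 \<le> (\<Sum>i<2^n k. f k i \<omega> * (?Y (min (T * real (Suc i) / 2 ^ n k) t) \<omega> - ?Y (min (T * real i / 2 ^ n k) t) \<omega>))"
        proof (rule grid_gains_between[where y="\<lambda>t. ?Y t \<omega>" and f="\<lambda>i. f k i \<omega>"])
          show "\<bar>?Y u \<omega>\<bar> \<le> 1" if "u \<in> {0..T}" for u by (rule Yb[OF that elim(2)])
          show "\<bar>f k i \<omega>\<bar> \<le> 1" if "i < 2 ^ n k" for i by (rule f(2)[OF that elim(2)])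
          show "- 1 \<le> (\<Sum>i<m. f k i \<omega> * (?Y (T * real (Suc i) / 2 ^ n k) \<omega> - ?Y (T * real i / 2 ^ n k) \<omega>))" if "m \<le> 2 ^ n k" for m
            using lo[OF that elim(2)] unfolding G_def .
        qed (use t in auto)
        then have "- 3 / (real k + 1) \<le> simple_integral (H k) S t \<omega>" unfolding HI[OF elim(1)] by (intro divide_right_mono) auto
        then show ?case by auto
      qed
    qed
    have pr: "(\<lambda>k. sup_norm M T (simple_process (H k))) \<longlonglongrightarrow> 0"
    proof (rule sup_norm_tendsto_0, rule sup_norm_le)
      fix k t show "simple_process (H k) t \<in> borel_measurable M" by (rule simple_process_measurable[OF Hs])
      show "AE \<omega> in M. \<bar>simple_process (H k) t \<omega>\<bar> \<le> 1 / (real k + 1)"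
      proof (rule AE_I2)
        fix \<omega> assume w: "\<omega> \<in> space M"
        show "\<bar>simple_process (H k) t \<omega>\<bar> \<le> 1 / (real k + 1)"
        proof (rule simple_process_bound[OF Hs w])
          fix j assume "j \<in> {1..steps (H k)}"
          show "\<bar>coeff (H k) j \<omega>\<bar> \<le> 1 / (real k + 1)"
          proof (cases "1 \<le> j \<and> j \<le> 2 ^ n k")
            case True
            then have "j - 1 < 2 ^ n k" by auto
            from hb[OF this w] show ?thesis unfolding H_def grid_strategy_def by auto
          qed (auto simp: H_def grid_strategy_def)
        qed simp
      qed
    qed
    have "tendsto_in_prob M (\<lambda>k \<omega>. max (simple_integral (H k) S T \<omega>) 0) (\<lambda>\<omega>. 0)"
      using nfl Hs neg pr unfolding no_free_lunch_vrli_def by blast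
    then have lim: "(\<lambda>k. measure M {\<omega>\<in>space M. \<bar>max (simple_integral (H k) S T \<omega>) 0 - 0\<bar> > 1}) \<longlonglongrightarrow> 0"
      unfolding tendsto_in_prob_def by simp
    have "\<epsilon> \<le> measure M {\<omega>\<in>space M. \<bar>max (simple_integral (H k) S T \<omega>) 0 - 0\<bar> > 1}" for k
    proof -
      have TT: "T \<in> {0..T}" using T_pos by auto
      have "measure M {\<omega>\<in>space M. G (n k) (f k) (2 ^ n k) \<omega> > real k + 1} \<le> measure M {\<omega>\<in>space M. \<bar>max (simple_integral (H k) S T \<omega>) 0 - 0\<bar> > 1}"
      proof (rule finite_measure_mono_AE)
        show "AE \<omega> in M. \<omega> \<in> {\<omega>\<in>space M. G (n k) (f k) (2 ^ n k) \<omega> > real k + 1} \<longrightarrow> \<omega> \<in> {\<omega>\<in>space M. \<bar>max (simple_integral (H k) S T \<omega>) 0 - 0\<bar> > 1}"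
          using c(2)
        proof eventually_elim
          case (elim \<omega>)
          have m: "min (T * real i / 2 ^ n k) T = T * real i / 2 ^ n k" if "i \<le> 2 ^ n k" for i
            using dyadic_in[OF that] by auto
          have "simple_integral (H k) S T \<omega> = G (n k) (f k) (2 ^ n k) \<omega> / (real k + 1)"
            unfolding HI[OF elim] G_def by (intro arg_cong2[where f="(/)"] sum.cong refl) (simp only: m lessThan_iff Suc_le_eq less_imp_le)
          moreover have "1 < x / (real k + 1)" if "real k + 1 < x" for x using that by (simp add: pos_less_divide_eq)
          ultimately show ?case by auto
        qed
        show "{\<omega>\<in>space M. \<bar>max (simple_integral (H k) S T \<omega>) 0 - 0\<bar> > 1} \<in> sets M"
          using simple_integral_measurable[OF Hs[of k] S(2,1) TT] by measurable
      qed
      then show ?thesis using hi[of k] by linarith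
    qed
    then have "\<epsilon> \<le> 0" by (intro LIMSEQ_le_const[OF lim]) auto
    then show False using e by simp
  qed
  then show "\<exists>K. \<forall>n f. (\<forall>i<2^n. f i \<in> borel_measurable (F (T * real i / 2 ^ n)) \<and> (\<forall>\<omega>\<in>space M. \<bar>f i \<omega>\<bar> \<le> 1)) \<and>
      (\<forall>m\<le>2^n. \<forall>\<omega>\<in>space M. - 1 \<le> (\<Sum>i<m. f i \<omega> * (?Y (T * real (Suc i) / 2 ^ n) \<omega> - ?Y (T * real i / 2 ^ n) \<omega>))) \<longrightarrow>
      measure M {\<omega>\<in>space M. (\<Sum>i<2^n. f i \<omega> * (?Y (T * real (Suc i) / 2 ^ n) \<omega> - ?Y (T * real i / 2 ^ n) \<omega>)) > K} \<le> \<epsilon>"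
    unfolding Cd_def Pm_def G_def .
qed

section \<open>Combining localization with drift control\<close>

lemma ext_stopping_time_min:
  assumes "ext_stopping_time M F T \<sigma>" "ext_stopping_time M F T \<rho>"
  shows "ext_stopping_time M F T (\<lambda>\<omega>. min (\<sigma> \<omega>) (\<rho> \<omega>))"
  unfolding ext_stopping_time_def
proof (intro conjI ballI)
  show "min (\<sigma> \<omega>) (\<rho> \<omega>) \<in> ereal ` {0..T} \<union> {\<infinity>}" if "\<omega> \<in> space M" for \<omega>
    using assms that unfolding ext_stopping_time_def by (auto simp: min_def)
  fix t assume t: "t \<in> {0..T}"
  have "{\<omega> \<in> space M. min (\<sigma> \<omega>) (\<rho> \<omega>) \<le> ereal t} = {\<omega> \<in> space M. \<sigma> \<omega> \<le> ereal t} \<union> {\<omega> \<in> space M. \<rho> \<omega> \<le> ereal t}"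
    by (auto simp: min_le_iff_disj)
  then show "{\<omega> \<in> space M. min (\<sigma> \<omega>) (\<rho> \<omega>) \<le> ereal t} \<in> sets (F t)"
    using assms t unfolding ext_stopping_time_def by auto
qed

lemma ext_real_min:
  assumes "ext_stopping_time M F T \<sigma>" "ext_stopping_time M F T \<rho>" "\<omega> \<in> space M"
  shows "ext_real (\<lambda>\<omega>. min (\<sigma> \<omega>) (\<rho> \<omega>)) \<omega> = min (ext_real \<sigma> \<omega>) (ext_real \<rho> \<omega>)"
  using assms(1,3)
proof (rule ext_real_cases)
  fix s assume s: "s \<in> {0..T}" "\<sigma> \<omega> = ereal s" "ext_real \<sigma> \<omega> = s"
  show ?thesis using assms(2,3) by (rule ext_real_cases) (use s in \<open>auto simp: ext_real_def min_def\<close>)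
next
  assume s: "\<sigma> \<omega> = \<infinity>" "ext_real \<sigma> \<omega> = T"
  show ?thesis using assms(2,3) by (rule ext_real_cases) (use s in \<open>auto simp: ext_real_def min_def\<close>)
qed

text \<open>Half of \<open>\<epsilon>\<close> is spent on the time that bounds \<open>S\<close>,
  half on the time that bounds the drifts. Multiplication by the bound \<open>c\<close> undoes the
  normalisation of \<open>Y\<close>.\<close>

theorem no_free_lunch_decomposition:
  assumes S: "cadlag M T S" "adapted F T S" "locally_bounded M F T S" and nfl: "no_free_lunch_vrli M F T S"
    and e: "0 < \<epsilon>"
  shows "\<exists>\<rho> X P Q. ext_stopping_time M F T \<rho> \<and> 1 - \<epsilon> \<le> measure M {\<omega>\<in>space M. \<rho> \<omega> = \<infinity>} \<and>
    cadlag M T X \<and> martingale M F T X \<and> (AE \<omega> in M.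
     (\<forall>s\<in>{0..T}. \<forall>t\<in>{s..T}. P s \<omega> \<le> P t \<omega> \<and> Q s \<omega> \<le> Q t \<omega>) \<and>
     (\<forall>t\<in>{0..T}. S (min (ext_real \<rho> \<omega>) t) \<omega> = X t \<omega> + P t \<omega> - (Q t \<omega> :: real)))"
proof -
  obtain \<sigma>s where \<sigma>s: "localizing_seq M F T \<sigma>s" "\<And>k. \<exists>C. AE \<omega> in M. \<forall>t\<in>{0..T}. \<bar>stopped S (\<sigma>s k) t \<omega>\<bar> \<le> C"
    using S(3) unfolding locally_bounded_def by blast
  have "(\<lambda>k. measure M {\<omega>\<in>space M. \<sigma>s k \<omega> = \<infinity>}) \<longlonglongrightarrow> 1" using \<sigma>s(1) unfolding localizing_seq_def by blast
  from order_tendstoD(1)[OF this, of "1 - \<epsilon>/2"] obtain k where k: "1 - \<epsilon>/2 < measure M {\<omega>\<in>space M. \<sigma>s k \<omega> = \<infinity>}"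
    using e by (auto simp: eventually_sequentially)
  define \<sigma> where "\<sigma> = \<sigma>s k"
  have \<sigma>: "ext_stopping_time M F T \<sigma>" unfolding \<sigma>_def using \<sigma>s(1) unfolding localizing_seq_def by blast
  obtain C0 where C0: "AE \<omega> in M. \<forall>t\<in>{0..T}. \<bar>stopped S \<sigma> t \<omega>\<bar> \<le> C0" using \<sigma>s(2) unfolding \<sigma>_def by blast
  define c where "c = max 1 C0"
  define s where "s = ext_real \<sigma>"
  have ss: "stopping_time F s" "\<And>\<omega>. \<omega> \<in> space M \<Longrightarrow> s \<omega> \<in> {0..T}"
    unfolding s_def using ext_real_stopping_time[OF \<sigma>] ext_real_range[OF \<sigma>] by auto
  have c1: "1 \<le> c" unfolding c_def by simp
  have cb: "AE \<omega> in M. \<forall>t\<in>{0..T}. \<bar>S (min (s \<omega>) t) \<omega>\<bar> \<le> c"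
    using C0 AE_space
  proof eventually_elim
    case (elim \<omega>)
    show ?case
    proof
      fix t assume t: "t \<in> {0..T}"
      show "\<bar>S (min (s \<omega>) t) \<omega>\<bar> \<le> c" using elim(1)[rule_format, OF t] stopped_eq[OF \<sigma> elim(2) t, of S] unfolding s_def c_def by auto
    qed
  qed
  define Y where "Y = (\<lambda>t \<omega>. if \<forall>u\<in>{0..T}. \<bar>S (min (s \<omega>) u) \<omega>\<bar> \<le> c then S (min (s \<omega>) t) \<omega> / c else 0)"
  interpret B: bounded_nfl M F T Y
    unfolding Y_def by (rule no_free_lunch_bounded_nfl[OF S(1,2) nfl ss c1 cb])
  obtain \<rho>0 C where \<rho>0: "ext_stopping_time M F T \<rho>0" "1 - \<epsilon>/2 \<le> measure M {\<omega>\<in>space M. \<rho>0 \<omega> = \<infinity>}" and C: "0 \<le> C"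
    and pot: "\<forall>k i0 g c. i0 \<le> 2 ^ k \<and> g \<in> borel_measurable (F (B.grid k i0)) \<and> (\<forall>\<omega>\<in>space M. 0 \<le> g \<omega> \<and> g \<omega> \<le> c) \<longrightarrow>
      (\<integral>\<omega>. g \<omega> * (\<Sum>i\<in>{i0..<2^k}. of_bool (ereal (B.grid k i) < \<rho>0 \<omega>) * \<bar>B.drift k i \<omega>\<bar>) \<partial>M) \<le> C * (\<integral>\<omega>. g \<omega> \<partial>M)"
    using B.tight_stopping_time[of "\<epsilon>/2"] e by auto
  interpret D: bounded_stop M F T Y "ext_real \<rho>0" C
  proof unfold_locales
    show "stopping_time F (ext_real \<rho>0)" by (rule ext_real_stopping_time[OF \<rho>0(1)])
    show "ext_real \<rho>0 \<omega> \<in> {0..T}" if "\<omega> \<in> space M" for \<omega> by (rule ext_real_range[OF \<rho>0(1) that])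
    show "0 \<le> C" by (rule C)
    fix k i0 and g :: "'a \<Rightarrow> real" and c :: real assume a: "i0 \<le> 2 ^ k" "g \<in> borel_measurable (F (B.grid k i0))" "\<And>\<omega>. \<omega> \<in> space M \<Longrightarrow> 0 \<le> g \<omega> \<and> g \<omega> \<le> c"
    have "(\<integral>\<omega>. g \<omega> * (\<Sum>i\<in>{i0..<2^k}. of_bool (B.grid k i < ext_real \<rho>0 \<omega>) * \<bar>B.drift k i \<omega>\<bar>) \<partial>M) =
      (\<integral>\<omega>. g \<omega> * (\<Sum>i\<in>{i0..<2^k}. of_bool (ereal (B.grid k i) < \<rho>0 \<omega>) * \<bar>B.drift k i \<omega>\<bar>) \<partial>M)"
    proof (rule Bochner_Integration.integral_cong[OF refl])
      fix \<omega> assume w: "\<omega> \<in> space M"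
      have "B.grid k i < ext_real \<rho>0 \<omega> \<longleftrightarrow> ereal (B.grid k i) < \<rho>0 \<omega>" if "i \<in> {i0..<2^k}" for i
      proof -
        \<comment> \<open>Every grid point in the sum lies strictly before \<open>T\<close>, where
          capping the extended time at \<open>T\<close> cannot change the comparison.\<close>
        have gT: "B.grid k i < T"
        proof -
          have "\<not> B.grid k (2^k) \<le> B.grid k i" unfolding B.grid_le using that by auto
          then show ?thesis unfolding B.grid_T by simp
        qed
        show ?thesis using \<rho>0(1) w by (rule ext_real_cases) (use gT in auto)
      qed
      then show "g \<omega> * (\<Sum>i\<in>{i0..<2^k}. of_bool (B.grid k i < ext_real \<rho>0 \<omega>) * \<bar>B.drift k i \<omega>\<bar>) =
        g \<omega> * (\<Sum>i\<in>{i0..<2^k}. of_bool (ereal (B.grid k i) < \<rho>0 \<omega>) * \<bar>B.drift k i \<omega>\<bar>)"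
        by (intro arg_cong2[where f="(*)"] sum.cong refl) auto
    qed
    also have "\<dots> \<le> C * (\<integral>\<omega>. g \<omega> \<partial>M)" using pot a by blast
    finally show "(\<integral>\<omega>. g \<omega> * (\<Sum>i\<in>{i0..<2^k}. of_bool (B.grid k i < ext_real \<rho>0 \<omega>) * \<bar>B.drift k i \<omega>\<bar>) \<partial>M) \<le> C * (\<integral>\<omega>. g \<omega> \<partial>M)" .
  qed
  obtain X P Q where X: "cadlag M T X" "martingale M F T X" and PQ: "\<And>\<omega>. \<omega> \<in> space M \<Longrightarrow>
     (\<forall>s\<in>{0..T}. \<forall>t\<in>{s..T}. P s \<omega> \<le> P t \<omega> \<and> Q s \<omega> \<le> Q t \<omega>) \<and>
     (\<forall>t\<in>{0..T}. Y (min (ext_real \<rho>0 \<omega>) t) \<omega> = X t \<omega> + P t \<omega> - (Q t \<omega> :: real))"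
    using D.stopped_decomposition by blast
  define \<rho> where "\<rho> \<omega> = min (\<sigma> \<omega>) (\<rho>0 \<omega>)" for \<omega>
  have \<rho>: "ext_stopping_time M F T \<rho>" unfolding \<rho>_def by (rule ext_stopping_time_min[OF \<sigma> \<rho>0(1)])
  have pr: "1 - \<epsilon> \<le> measure M {\<omega>\<in>space M. \<rho> \<omega> = \<infinity>}"
  proof -
    let ?a = "{\<omega>\<in>space M. \<sigma> \<omega> = \<infinity>}" and ?b = "{\<omega>\<in>space M. \<rho>0 \<omega> = \<infinity>}"
    have ms: "?a \<in> sets M" "?b \<in> sets M" using ext_stopping_time_infinity_sets \<sigma> \<rho>0(1) by auto
    have "{\<omega>\<in>space M. \<rho> \<omega> = \<infinity>} = space M - ((space M - ?a) \<union> (space M - ?b))" unfolding \<rho>_def by (auto simp: min_def)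
    then have "measure M {\<omega>\<in>space M. \<rho> \<omega> = \<infinity>} = 1 - measure M ((space M - ?a) \<union> (space M - ?b))" using ms by (simp add: prob_compl)
    moreover have "measure M ((space M - ?a) \<union> (space M - ?b)) \<le> measure M (space M - ?a) + measure M (space M - ?b)"
      by (rule measure_Un_le) (use ms in auto)
    ultimately show ?thesis using prob_compl[OF ms(1)] prob_compl[OF ms(2)] k \<rho>0(2) unfolding \<sigma>_def by linarith
  qed
  have ae: "AE \<omega> in M. (\<forall>s\<in>{0..T}. \<forall>t\<in>{s..T}. c * P s \<omega> \<le> c * P t \<omega> \<and> c * Q s \<omega> \<le> c * Q t \<omega>) \<and>
     (\<forall>t\<in>{0..T}. S (min (ext_real \<rho> \<omega>) t) \<omega> = c * X t \<omega> + c * P t \<omega> - c * Q t \<omega>)"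
    using cb AE_space
  proof eventually_elim
    case (elim \<omega>)
    note pq = PQ[OF elim(2)]
    show ?case
    proof (intro conjI ballI)
      fix u v assume u: "u \<in> {0..T}" "v \<in> {u..T}"
      have "P u \<omega> \<le> P v \<omega>" "Q u \<omega> \<le> Q v \<omega>" using pq u by blast+
      then show "c * P u \<omega> \<le> c * P v \<omega>" "c * Q u \<omega> \<le> c * Q v \<omega>" using c1 by simp_all
    next
      fix t assume t: "t \<in> {0..T}"
      have "ext_real \<rho> \<omega> = min (s \<omega>) (ext_real \<rho>0 \<omega>)" unfolding s_def \<rho>_def by (rule ext_real_min[OF \<sigma> \<rho>0(1) elim(2)])
      then have m: "min (ext_real \<rho> \<omega>) t = min (s \<omega>) (min (ext_real \<rho>0 \<omega>) t)" by (simp add: min.assoc)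
      have "S (min (ext_real \<rho> \<omega>) t) \<omega> = c * Y (min (ext_real \<rho>0 \<omega>) t) \<omega>" unfolding m Y_def using elim(1) c1 by simp
      also have "Y (min (ext_real \<rho>0 \<omega>) t) \<omega> = X t \<omega> + P t \<omega> - Q t \<omega>" using pq t by blast
      finally show "S (min (ext_real \<rho> \<omega>) t) \<omega> = c * X t \<omega> + c * P t \<omega> - c * Q t \<omega>" by (simp add: algebra_simps)
    qed
  qed
  show ?thesis
    by (intro exI[of _ \<rho>] exI[of _ "\<lambda>t \<omega>. c * X t \<omega>"] exI[of _ "\<lambda>t \<omega>. c * P t \<omega>"] exI[of _ "\<lambda>t \<omega>. c * Q t \<omega>"] conjI
      \<rho> pr cadlag_scale[OF X(1)] martingale_scale[OF X(2)] ae)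
qed

section \<open>Pasting local decompositions\<close>

text \<open>An infimum of infinitely many times need not be attained, so the criterion by strict
  sublevel events is applied; for an infimum these events are unions.\<close>

lemma ext_stopping_time_INF:
  assumes \<rho>: "\<And>j. ext_stopping_time M F T (\<rho> j)"
  shows "ext_stopping_time M F T (\<lambda>\<omega>. INF j\<in>{k::nat..}. \<rho> j \<omega>)"
proof (rule ext_stopping_timeI)
  have v: "\<rho> j \<omega> \<in> ereal ` {0..T} \<union> {\<infinity>}" if "\<omega> \<in> space M" for j \<omega> using \<rho>[of j] that unfolding ext_stopping_time_def by auto
  show "(INF j\<in>{k..}. \<rho> j \<omega>) \<in> ereal ` {0..T} \<union> {\<infinity>}" if w: "\<omega> \<in> space M" for \<omega>
  proof (cases "\<exists>j\<ge>k. \<rho> j \<omega> \<noteq> \<infinity>")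
    case True
    then obtain j x where j: "k \<le> j" "x \<in> {0..T}" "\<rho> j \<omega> = ereal x" using v[OF w] by blast
    have u: "(INF j\<in>{k..}. \<rho> j \<omega>) \<le> ereal x" unfolding j(3)[symmetric] by (rule INF_lower) (use j in auto)
    have l: "ereal 0 \<le> (INF j\<in>{k..}. \<rho> j \<omega>)"
    proof (rule INF_greatest)
      fix i show "ereal 0 \<le> \<rho> i \<omega>" using v[OF w, of i] by auto
    qed
    obtain y where y: "(INF j\<in>{k..}. \<rho> j \<omega>) = ereal y" using u l by (cases "INF j\<in>{k..}. \<rho> j \<omega>") auto
    have "y \<in> {0..T}" using u l j(2) unfolding y by auto
    then show ?thesis unfolding y by blast
  next
    case False
    then have "(INF j\<in>{k..}. \<rho> j \<omega>) = (INF j\<in>{k..}. \<infinity>)" by (intro INF_cong) auto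
    then show ?thesis by simp
  qed
  show "{\<omega>\<in>space M. (INF j\<in>{k..}. \<rho> j \<omega>) < ereal t} \<in> sets (F t)" if t: "t \<in> {0<..T}" for t
  proof -
    have "{\<omega>\<in>space M. \<rho> j \<omega> < ereal t} \<in> sets (F t)" for j
    proof -
      have "{\<omega>\<in>space M. ext_real (\<rho> j) \<omega> < t} \<in> sets (F t)"
        using stopping_time_less_const[OF ext_real_stopping_time[OF \<rho>[of j]], of t] by (simp add: pred_def)
      also have "{\<omega>\<in>space M. ext_real (\<rho> j) \<omega> < t} = {\<omega>\<in>space M. \<rho> j \<omega> < ereal t}"
      proof (intro Collect_cong conj_cong refl)
        fix \<omega> assume "\<omega> \<in> space M"
        with \<rho>[of j] show "(ext_real (\<rho> j) \<omega> < t) = (\<rho> j \<omega> < ereal t)" by (rule ext_real_cases) (use t in auto)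
      qed
      finally show ?thesis .
    qed
    then have "(\<Union>j\<in>{k..}. {\<omega>\<in>space M. \<rho> j \<omega> < ereal t}) \<in> sets (F t)" by (intro sets.countable_UN'') auto
    also have "(\<Union>j\<in>{k..}. {\<omega>\<in>space M. \<rho> j \<omega> < ereal t}) = {\<omega>\<in>space M. (INF j\<in>{k..}. \<rho> j \<omega>) < ereal t}" by (auto simp: INF_less_iff)
    finally show ?thesis .
  qed
  have "{\<omega>\<in>space M. \<rho> j \<omega> \<le> ereal T} \<in> sets (F T)" for j using \<rho>[of j] T_pos unfolding ext_stopping_time_def by auto
  then have "(\<Union>j\<in>{k..}. {\<omega>\<in>space M. \<rho> j \<omega> \<le> ereal T}) \<in> sets (F T)" by (intro sets.countable_UN'') auto
  also have "(\<Union>j\<in>{k..}. {\<omega>\<in>space M. \<rho> j \<omega> \<le> ereal T}) = {\<omega>\<in>space M. (INF j\<in>{k..}. \<rho> j \<omega>) \<noteq> \<infinity>}"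
  proof -
    have "(\<exists>j\<in>{k..}. \<rho> j \<omega> \<le> ereal T) \<longleftrightarrow> (INF j\<in>{k..}. \<rho> j \<omega>) < \<infinity>" if w: "\<omega> \<in> space M" for \<omega>
      unfolding INF_less_iff using v[OF w] by (intro bex_cong refl) force
    then show ?thesis by (auto simp: less_top[symmetric] top_ereal_def)
  qed
  finally show "{\<omega>\<in>space M. (INF j\<in>{k..}. \<rho> j \<omega>) \<noteq> \<infinity>} \<in> sets (F T)" .
qed

lemma martingale_diff:
  assumes X: "martingale M F T X" and Z: "martingale M F T Z" shows "martingale M F T (\<lambda>t \<omega>. X t \<omega> - Z t \<omega>)"
proof (rule martingaleI)
  show "adapted F T (\<lambda>t \<omega>. X t \<omega> - Z t \<omega>)" using X Z unfolding martingale_def adapted_def by (blast intro: borel_measurable_diff)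
  have i: "integrable M (X t)" "integrable M (Z t)" if "t \<in> {0..T}" for t using X Z that unfolding martingale_def by auto
  then show "integrable M (\<lambda>\<omega>. X t \<omega> - Z t \<omega>)" if "t \<in> {0..T}" for t using that by auto
  fix s t A assume st: "s \<in> {0..T}" "t \<in> {s..T}" and A: "A \<in> sets (F s)"
  have t': "t \<in> {0..T}" using st by auto
  have AM: "A \<in> sets M" using A F_sub[OF st(1)] by auto
  have g: "(indicator A :: 'a \<Rightarrow> real) \<in> borel_measurable (F s)" "\<bar>indicator A \<omega> :: real\<bar> \<le> 1" for \<omega> using A by (auto simp: indicator_def)
  have ii: "integrable M (\<lambda>\<omega>. indicator A \<omega> * X u \<omega>)" "integrable M (\<lambda>\<omega>. indicator A \<omega> * Z u \<omega>)" if "u \<in> {0..T}" for u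
    using integrable_mult_indicator[OF AM i(1)[OF that]] integrable_mult_indicator[OF AM i(2)[OF that]] by auto
  show "(\<integral>\<omega>. indicator A \<omega> * (X t \<omega> - Z t \<omega>) \<partial>M) = (\<integral>\<omega>. indicator A \<omega> * (X s \<omega> - Z s \<omega>) \<partial>M)"
    using martingale_integral(2)[OF X st g] martingale_integral(2)[OF Z st g] ii[OF t'] ii[OF st(1)] by (simp add: right_diff_distrib)
qed

lemma martingale_sum:
  assumes "\<And>l. l \<in> I \<Longrightarrow> martingale M F T (Z l)"
  shows "martingale M F T (\<lambda>t \<omega>. \<Sum>l\<in>I. Z l t \<omega>)"
proof (rule martingaleI)
  have i: "integrable M (Z l t)" if "t \<in> {0..T}" "l \<in> I" for t l using assms[OF that(2)] that(1) unfolding martingale_def by auto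
  show "adapted F T (\<lambda>t \<omega>. \<Sum>l\<in>I. Z l t \<omega>)" using assms unfolding martingale_def adapted_def by (auto intro: borel_measurable_sum)
  show "integrable M (\<lambda>\<omega>. \<Sum>l\<in>I. Z l t \<omega>)" if "t \<in> {0..T}" for t using i[OF that] by (intro Bochner_Integration.integrable_sum)
  fix s t A assume st: "s \<in> {0..T}" "t \<in> {s..T}" and A: "A \<in> sets (F s)"
  have t': "t \<in> {0..T}" using st by auto
  have AM: "A \<in> sets M" using A F_sub[OF st(1)] by auto
  have g: "(indicator A :: 'a \<Rightarrow> real) \<in> borel_measurable (F s)" "\<bar>indicator A \<omega> :: real\<bar> \<le> 1" for \<omega> using A by (auto simp: indicator_def)
  have ii: "integrable M (\<lambda>\<omega>. indicator A \<omega> * Z l u \<omega>)" if "u \<in> {0..T}" "l \<in> I" for u l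
    using integrable_mult_indicator[OF AM i[OF that]] by auto
  have "(\<integral>\<omega>. (\<Sum>l\<in>I. indicator A \<omega> * Z l t \<omega>) \<partial>M) = (\<Sum>l\<in>I. \<integral>\<omega>. indicator A \<omega> * Z l t \<omega> \<partial>M)"
    by (rule Bochner_Integration.integral_sum) (rule ii[OF t'])
  also have "\<dots> = (\<Sum>l\<in>I. \<integral>\<omega>. indicator A \<omega> * Z l s \<omega> \<partial>M)"
    by (rule sum.cong[OF refl]) (rule martingale_integral(2)[OF assms st g])
  also have "\<dots> = (\<integral>\<omega>. (\<Sum>l\<in>I. indicator A \<omega> * Z l s \<omega>) \<partial>M)"
    by (rule Bochner_Integration.integral_sum[symmetric]) (rule ii[OF st(1)])
  finally show "(\<integral>\<omega>. indicator A \<omega> * (\<Sum>l\<in>I. Z l t \<omega>) \<partial>M) = (\<integral>\<omega>. indicator A \<omega> * (\<Sum>l\<in>I. Z l s \<omega>) \<partial>M)"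
    by (simp add: sum_distrib_left)
qed

lemma martingale_cong_AE:
  assumes X: "martingale M F T X" and a: "adapted F T Z" and e: "\<And>t. t \<in> {0..T} \<Longrightarrow> AE \<omega> in M. X t \<omega> = Z t \<omega>"
  shows "martingale M F T Z"
proof (rule martingaleI[OF a])
  have ZM: "Z t \<in> borel_measurable M" "X t \<in> borel_measurable M" if "t \<in> {0..T}" for t
    using a X that borel_F_M unfolding adapted_def martingale_def by blast+
  show "integrable M (Z t)" if t: "t \<in> {0..T}" for t
    by (rule integrable_cong_AE_imp[OF _ ZM(1)[OF t] e[OF t]]) (use X t in \<open>auto simp: martingale_def\<close>)
  fix s t A assume st: "s \<in> {0..T}" "t \<in> {s..T}" and A: "A \<in> sets (F s)"
  have t': "t \<in> {0..T}" using st by auto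
  have AM[measurable]: "A \<in> sets M" using A F_sub[OF st(1)] by auto
  have c: "(\<integral>\<omega>. indicator A \<omega> * Z u \<omega> \<partial>M) = (\<integral>\<omega>. indicator A \<omega> * X u \<omega> \<partial>M)" if u: "u \<in> {0..T}" for u
  proof (rule integral_cong_AE)
    show "AE \<omega> in M. indicator A \<omega> * Z u \<omega> = indicator A \<omega> * X u \<omega>" using e[OF u] by eventually_elim simp
  qed (use ZM[OF u] in measurable)
  have "(\<integral>\<omega>. indicator A \<omega> * X t \<omega> \<partial>M) = (\<integral>\<omega>. indicator A \<omega> * X s \<omega> \<partial>M)"
    by (rule martingale_integral(2)[OF X st, of _ 1]) (use A in \<open>auto simp: indicator_def\<close>)
  then show "(\<integral>\<omega>. indicator A \<omega> * Z t \<omega> \<partial>M) = (\<integral>\<omega>. indicator A \<omega> * Z s \<omega> \<partial>M)" unfolding c[OF t'] c[OF st(1)] .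
qed

lemma cadlag_diff: "cadlag M T X \<Longrightarrow> cadlag M T Z \<Longrightarrow> cadlag M T (\<lambda>t \<omega>. X t \<omega> - Z t \<omega>)"
  unfolding cadlag_def by (fast intro: tendsto_diff)

lemma cadlag_sum:
  assumes "finite I" "\<And>l. l \<in> I \<Longrightarrow> cadlag M T (Z l)" shows "cadlag M T (\<lambda>t \<omega>. \<Sum>l\<in>I. Z l t \<omega>)"
  using assms
proof (induction I rule: finite_induct)
  case empty
  then show ?case unfolding cadlag_def by auto
next
  case (insert l I)
  have "cadlag M T (\<lambda>t \<omega>. Z l t \<omega> + (\<Sum>l\<in>I. Z l t \<omega>))"
    using insert.IH insert.prems[of l] insert.prems unfolding cadlag_def by (fast intro: tendsto_add)
  then show ?case using insert.hyps by simp
qed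

lemma finite_total_variation_diff_mono:
  assumes e: "\<And>t. t \<in> {0..T} \<Longrightarrow> a t = c + u t - v t"
    and m: "\<And>s t. s \<in> {0..T} \<Longrightarrow> t \<in> {s..T} \<Longrightarrow> u s \<le> u t \<and> v s \<le> (v t :: real)"
  shows "finite_total_variation T a"
  unfolding finite_total_variation_def
proof (intro exI[of _ "(u T - u 0) + (v T - v 0)"] allI impI)
  fix n p assume p: "p 0 = 0 \<and> p n = T \<and> (\<forall>i<n. p i \<le> p (Suc i))"
  have le: "p i \<le> p j" if "i \<le> j" "j \<le> n" for i j
    using that
  proof (induction rule: dec_induct)
    case (step k) then show ?case using p by (metis Suc_le_lessD less_imp_le order_trans)
  qed simp
  have pr: "p i \<in> {0..T}" if "i \<le> n" for i using le[of 0 i] le[of i n] that p by auto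
  have "(\<Sum>i<n. \<bar>a (p (Suc i)) - a (p i)\<bar>) \<le> (\<Sum>i<n. (u (p (Suc i)) - u (p i)) + (v (p (Suc i)) - v (p i)))"
  proof (rule sum_mono)
    fix i assume i: "i \<in> {..<n}"
    have r: "p i \<in> {0..T}" "p (Suc i) \<in> {0..T}" "p (Suc i) \<in> {p i..T}" using pr[of i] pr[of "Suc i"] le[of i "Suc i"] i by auto
    show "\<bar>a (p (Suc i)) - a (p i)\<bar> \<le> (u (p (Suc i)) - u (p i)) + (v (p (Suc i)) - v (p i))"
      unfolding e[OF r(1)] e[OF r(2)] using m[OF r(1,3)] by linarith
  qed
  also have "\<dots> = (u (p n) - u (p 0)) + (v (p n) - v (p 0))"
    unfolding sum.distrib by (simp add: sum_lessThan_telescope[of "\<lambda>i. u (p i)"] sum_lessThan_telescope[of "\<lambda>i. v (p i)"])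
  finally show "(\<Sum>i<n. \<bar>a (p (Suc i)) - a (p i)\<bar>) \<le> (u T - u 0) + (v T - v 0)" using p by simp
qed

text \<open>The times supplied for different \<open>\<epsilon>\<close> are unrelated to each other.
  Their tail infima increase, and summable failure probabilities make almost every path reach a tail
  infimum equal to \<open>\<infinity>\<close>. The martingale \<open>X l\<close> is used only
  between consecutive tail infima, where the \<open>l\<close>-th decomposition is valid, so
  \<open>N\<close> is a finite sum of stopped increments on almost every path.\<close>

theorem paste_semimartingale:
  assumes S: "cadlag M T S" "adapted F T S"
    and loc: "\<And>\<epsilon>. 0 < \<epsilon> \<Longrightarrow> \<exists>\<rho> X P Q. ext_stopping_time M F T \<rho> \<and> 1 - \<epsilon> \<le> measure M {\<omega>\<in>space M. \<rho> \<omega> = \<infinity>} \<and>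
      cadlag M T X \<and> martingale M F T X \<and> (AE \<omega> in M.
       (\<forall>s\<in>{0..T}. \<forall>t\<in>{s..T}. P s \<omega> \<le> P t \<omega> \<and> Q s \<omega> \<le> Q t \<omega>) \<and>
       (\<forall>t\<in>{0..T}. S (min (ext_real \<rho> \<omega>) t) \<omega> = X t \<omega> + P t \<omega> - (Q t \<omega> :: real)))"
  shows "semimartingale M F T S"
proof -
  \<comment> \<open>The sum of these numbers from index \<open>k\<close> on is exactly
    \<open>(1/2) ^ k\<close>.\<close>
  define e where "e k = (1/2::real) ^ Suc k" for k
  have "\<forall>k. \<exists>\<rho> X P Q. ext_stopping_time M F T \<rho> \<and> 1 - e k \<le> measure M {\<omega>\<in>space M. \<rho> \<omega> = \<infinity>} \<and>
      cadlag M T X \<and> martingale M F T X \<and> (AE \<omega> in M.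
       (\<forall>s\<in>{0..T}. \<forall>t\<in>{s..T}. P s \<omega> \<le> P t \<omega> \<and> Q s \<omega> \<le> Q t \<omega>) \<and>
       (\<forall>t\<in>{0..T}. S (min (ext_real \<rho> \<omega>) t) \<omega> = X t \<omega> + P t \<omega> - (Q t \<omega> :: real)))"
    by (intro allI loc) (simp add: e_def)
  then obtain \<rho> X P Q where \<rho>: "\<And>k. ext_stopping_time M F T (\<rho> k)" and \<rho>p: "\<And>k. 1 - e k \<le> measure M {\<omega>\<in>space M. \<rho> k \<omega> = \<infinity>}"
    and X: "\<And>k. cadlag M T (X k)" "\<And>k. martingale M F T (X k)"
    and PQ: "\<And>k. AE \<omega> in M. (\<forall>s\<in>{0..T}. \<forall>t\<in>{s..T}. P k s \<omega> \<le> P k t \<omega> \<and> Q k s \<omega> \<le> Q k t \<omega>) \<and>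
       (\<forall>t\<in>{0..T}. S (min (ext_real (\<rho> k) \<omega>) t) \<omega> = X k t \<omega> + P k t \<omega> - (Q k t \<omega> :: real))"
    unfolding choice_iff by blast
  define \<theta> where "\<theta> k \<omega> = (INF j\<in>{k..}. \<rho> j \<omega>)" for k \<omega>
  have \<theta>: "ext_stopping_time M F T (\<theta> k)" for k unfolding \<theta>_def by (rule ext_stopping_time_INF[OF \<rho>])
  have \<theta>mono: "\<theta> k \<omega> \<le> \<theta> l \<omega>" if "k \<le> l" for k l \<omega> unfolding \<theta>_def using that by (intro INF_superset_mono) auto
  have \<theta>\<rho>: "\<theta> k \<omega> \<le> \<rho> l \<omega>" if "k \<le> l" for k l \<omega> unfolding \<theta>_def using that by (intro INF_lower) auto
  define I where "I k = {\<omega>\<in>space M. \<theta> k \<omega> = \<infinity>}" for k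
  have IM: "I k \<in> sets M" for k unfolding I_def by (rule ext_stopping_time_infinity_sets[OF \<theta>])
  have Ip: "1 - (1/2)^k \<le> measure M (I k)" for k
  proof -
    let ?B = "\<lambda>j. space M - {\<omega>\<in>space M. \<rho> (j + k) \<omega> = \<infinity>}"
    have Bm: "?B j \<in> sets M" for j using ext_stopping_time_infinity_sets[OF \<rho>, of "j + k"] by auto
    have ejk: "e (j + k) = (1/2) ^ k * e j" for j unfolding e_def by (simp add: power_add)
    have Bp: "measure M (?B j) \<le> (1/2) ^ k * e j" for j
      using prob_compl[OF ext_stopping_time_infinity_sets[OF \<rho>, of "j + k"]] \<rho>p[of "j + k"] ejk[of j] by linarith
    have sm: "(\<lambda>j. (1/2) ^ k * e j) sums ((1/2) ^ k * 1)"
      unfolding e_def by (intro sums_mult power_half_series)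
    have sb: "summable (\<lambda>j. measure M (?B j))"
      by (rule summable_comparison_test'[OF sums_summable[OF sm], of 0]) (use Bp in auto)
    have "space M - I k \<subseteq> (\<Union>j. ?B j)"
    proof
      fix \<omega> assume w: "\<omega> \<in> space M - I k"
      then have "\<theta> k \<omega> < \<infinity>" unfolding I_def by (auto simp: less_top[symmetric] top_ereal_def)
      then obtain l where l: "k \<le> l" "\<rho> l \<omega> < \<infinity>" unfolding \<theta>_def INF_less_iff by auto
      have "\<omega> \<in> ?B (l - k)" using w l by auto
      then show "\<omega> \<in> (\<Union>j. ?B j)" by blast
    qed
    then have "measure M (space M - I k) \<le> measure M (\<Union>j. ?B j)" by (rule finite_measure_mono) (rule sets.countable_UN''[OF countableI_type Bm])
    also have "\<dots> \<le> (\<Sum>j. measure M (?B j))"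
    proof (rule measure_subadditive_countably)
      show "(\<Sum>j. emeasure M (?B j)) \<noteq> \<infinity>"
        unfolding emeasure_eq_measure infinity_ennreal_def by (rule ennreal_suminf_neq_top[OF sb measure_nonneg])
    qed (use Bm in auto)
    also have "\<dots> \<le> (\<Sum>j. (1/2) ^ k * e j)" by (rule suminf_le[OF Bp sb sums_summable[OF sm]])
    also have "\<dots> = (1/2) ^ k" using sums_unique[OF sm] by simp
    finally show ?thesis using prob_compl[OF IM[of k]] by linarith
  qed
  have Ilim: "(\<lambda>k. measure M (I k)) \<longlonglongrightarrow> 1"
  proof (rule tendsto_sandwich[OF _ _ _ tendsto_const])
    have "(\<lambda>k. 1 - (1/2::real)^k) \<longlonglongrightarrow> 1 - 0" by (intro tendsto_intros) auto
    then show "(\<lambda>k. 1 - (1/2::real)^k) \<longlonglongrightarrow> 1" by simp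
  qed (use Ip in auto)
  have \<theta>inf: "\<theta> l \<omega> = \<infinity>" if "\<theta> k \<omega> = \<infinity>" "k \<le> l" for k l \<omega> using \<theta>mono[OF that(2), of \<omega>] that(1) by simp
  have Iinc: "incseq I" unfolding incseq_def I_def by (intro allI impI Collect_mono) (metis \<theta>inf)
  define \<Omega> where "\<Omega> = {\<omega>\<in>space M. \<exists>k. \<theta> k \<omega> = \<infinity>}"
  have ae: "AE \<omega> in M. \<exists>k. \<theta> k \<omega> = \<infinity>"
  proof -
    have "(\<lambda>k. measure M (I k)) \<longlonglongrightarrow> measure M (\<Union>k. I k)" using IM Iinc by (intro finite_Lim_measure_incseq) auto
    then have "measure M (\<Union>k. I k) = 1" using Ilim by (rule LIMSEQ_unique)
    then have "AE \<omega> in M. \<omega> \<in> (\<Union>k. I k)" by (rule iffD1[OF prob_eq_1[OF sets.countable_UN''[OF countableI_type IM]]])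
    then show ?thesis by eventually_elim (auto simp: I_def)
  qed
  have \<Omega>F: "\<Omega> \<in> sets (F t)" if "0 \<le> t" for t unfolding \<Omega>_def by (rule AE_set_F[OF ae that])
  \<comment> \<open>The index is shifted by one: piece \<open>l\<close> runs from \<open>R l\<close>
    to \<open>R (Suc l)\<close>, which is the capped \<open>\<theta> l\<close> and hence at most the
    capped \<open>\<rho> l\<close>. Starting from \<open>R 0 = 0\<close> covers the whole
    interval.\<close>
  define R where "R k \<omega> = (case k of 0 \<Rightarrow> 0 | Suc l \<Rightarrow> ext_real (\<theta> l) \<omega>)" for k \<omega>
  have R0: "R 0 \<omega> = 0" for \<omega> unfolding R_def by simp
  have RS: "R (Suc l) \<omega> = ext_real (\<theta> l) \<omega>" for l \<omega> unfolding R_def by simp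
  have Rst: "stopping_time F (R k)" for k
    by (cases k) (auto simp: R_def[abs_def] intro: stopping_time_const ext_real_stopping_time[OF \<theta>])
  have Rr: "R k \<omega> \<in> {0..T}" if "\<omega> \<in> space M" for k \<omega>
    using ext_real_range[OF \<theta> that] T_pos by (cases k) (auto simp: R0 RS)
  have er_mono: "ext_real \<sigma> \<omega> \<le> ext_real \<sigma>' \<omega>" if "ext_stopping_time M F T \<sigma>" "ext_stopping_time M F T \<sigma>'" "\<omega> \<in> space M" "\<sigma> \<omega> \<le> \<sigma>' \<omega>" for \<sigma> \<sigma>' \<omega>
    using that(1,3)
  proof (rule ext_real_cases)
    fix x assume x: "x \<in> {0..T}" "\<sigma> \<omega> = ereal x" "ext_real \<sigma> \<omega> = x"
    show ?thesis using that(2,3) by (rule ext_real_cases) (use x that(4) in auto)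
  next
    assume x: "\<sigma> \<omega> = \<infinity>" "ext_real \<sigma> \<omega> = T"
    then have "\<sigma>' \<omega> = \<infinity>" using that(4) by simp
    then show ?thesis using x unfolding ext_real_def by simp
  qed
  have Rmono: "R k \<omega> \<le> R l \<omega>" if kl: "k \<le> l" and w: "\<omega> \<in> space M" for k l \<omega>
  proof (cases k)
    case 0 then show ?thesis using Rr[OF w, of l] R0 by auto
  next
    case (Suc k')
    then obtain l' where l': "l = Suc l'" "k' \<le> l'" using kl by (cases l) auto
    show ?thesis unfolding Suc l'(1) RS by (rule er_mono[OF \<theta> \<theta> w \<theta>mono[OF l'(2)]])
  qed
  define Z where "Z l t \<omega> = X l (min (R (Suc l) \<omega>) t) \<omega> - X l (min (R l \<omega>) t) \<omega>" for l t \<omega>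
  have Zc: "cadlag M T (Z l)" for l unfolding Z_def by (intro cadlag_diff cadlag_stopped X)
  have Zm: "martingale M F T (Z l)" for l unfolding Z_def by (intro martingale_diff stopped_martingale X Rst Rr)
  \<comment> \<open>Once \<open>\<theta> k \<omega> = \<infinity>\<close>, all later
    \<open>R\<close> equal \<open>T\<close> and the pieces beyond \<open>k\<close> vanish, so every
    larger cut-off gives the same sum. On the exceptional null set \<open>N\<close> is put to
    zero.\<close>
  define N where "N t \<omega> = (if \<omega> \<in> \<Omega> then \<Sum>l\<le>(LEAST k. \<theta> k \<omega> = \<infinity>). Z l t \<omega> else 0)" for t \<omega>
  have Rinf: "R k \<omega> = T" if lk: "l < k" and i: "\<theta> l \<omega> = \<infinity>" for k l \<omega>
  proof -
    obtain k' where k': "k = Suc k'" "l \<le> k'" using lk by (cases k) auto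
    have "\<theta> k' \<omega> = \<infinity>" by (rule \<theta>inf[OF i k'(2)])
    then show ?thesis unfolding k'(1) RS ext_real_def by simp
  qed
  have Zzero: "Z l t \<omega> = 0" if "n < l" "\<theta> n \<omega> = \<infinity>" for n l t \<omega>
    using Rinf[of n l \<omega>] Rinf[of n "Suc l" \<omega>] that unfolding Z_def by simp
  have Nsum: "N t \<omega> = (\<Sum>l\<le>n. Z l t \<omega>)" if w: "\<omega> \<in> space M" and n: "\<theta> n \<omega> = \<infinity>" for n t \<omega>
  proof -
    define k where "k = (LEAST k. \<theta> k \<omega> = \<infinity>)"
    have k: "\<theta> k \<omega> = \<infinity>" "k \<le> n" unfolding k_def using n by (auto intro: LeastI Least_le)
    have "\<omega> \<in> \<Omega>" unfolding \<Omega>_def using w n by auto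
    then have "N t \<omega> = (\<Sum>l\<le>k. Z l t \<omega>)" unfolding N_def k_def by simp
    also have "\<dots> = (\<Sum>l\<le>n. Z l t \<omega>)"
      by (rule sum.mono_neutral_left) (use k Zzero[OF _ k(1)] in \<open>auto simp: not_le\<close>)
    finally show ?thesis .
  qed
  have Nout: "N t \<omega> = 0" if "\<omega> \<notin> \<Omega>" for t \<omega> unfolding N_def using that by simp
  have Nc: "cadlag M T N"
    unfolding cadlag_def
  proof (intro ballI)
    fix \<omega> assume w: "\<omega> \<in> space M"
    show "(\<forall>t\<in>{0..<T}. ((\<lambda>s. N s \<omega>) \<longlongrightarrow> N t \<omega>) (at_right t)) \<and> (\<forall>t\<in>{0<..T}. \<exists>l. ((\<lambda>s. N s \<omega>) \<longlongrightarrow> l) (at_left t))"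
    proof (cases "\<omega> \<in> \<Omega>")
      case True
      then obtain n where n: "\<theta> n \<omega> = \<infinity>" unfolding \<Omega>_def by auto
      have "cadlag M T (\<lambda>t \<omega>. \<Sum>l\<le>n. Z l t \<omega>)" by (intro cadlag_sum Zc) auto
      then show ?thesis using w unfolding cadlag_def Nsum[OF w n] by blast
    next
      case False
      then show ?thesis by (auto simp: Nout)
    qed
  qed
  have Na: "adapted F T N"
    unfolding adapted_def
  proof
    fix t assume t: "t \<in> {0..T}"
    show "N t \<in> borel_measurable (F t)"
    proof (rule borel_measurable_LIMSEQ_metric[where f="\<lambda>n \<omega>. if \<omega> \<in> \<Omega> then \<Sum>l\<le>n. Z l t \<omega> else 0"])
      have "\<Omega> \<inter> space (F t) = \<Omega>" unfolding \<Omega>_def by auto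
      moreover have "Z l t \<in> borel_measurable (F t)" for l using Zm[of l] t unfolding martingale_def adapted_def by blast
      ultimately show "(\<lambda>\<omega>. if \<omega> \<in> \<Omega> then \<Sum>l\<le>n. Z l t \<omega> else 0) \<in> borel_measurable (F t)" for n
        using \<Omega>F[of t] t by (intro measurable_If_set borel_measurable_sum) auto
      fix \<omega> assume "\<omega> \<in> space (F t)"
      then have w: "\<omega> \<in> space M" by simp
      show "(\<lambda>n. if \<omega> \<in> \<Omega> then \<Sum>l\<le>n. Z l t \<omega> else 0) \<longlonglongrightarrow> N t \<omega>"
      proof (cases "\<omega> \<in> \<Omega>")
        case True
        then obtain k where k: "\<theta> k \<omega> = \<infinity>" unfolding \<Omega>_def by auto
        have "N t \<omega> = (\<Sum>l\<le>n. Z l t \<omega>)" if "k \<le> n" for n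
        proof (rule Nsum[OF w])
          show "\<theta> n \<omega> = \<infinity>" by (rule \<theta>inf[OF k that])
        qed
        then have "\<forall>\<^sub>F n in sequentially. (if \<omega> \<in> \<Omega> then \<Sum>l\<le>n. Z l t \<omega> else 0) = N t \<omega>"
          unfolding eventually_sequentially using True by (intro exI[of _ k]) auto
        then show ?thesis by (rule tendsto_eventually)
      qed (simp add: Nout)
    qed
  qed
  \<comment> \<open>Stopping at \<open>R (Suc k)\<close> removes the pieces beyond \<open>k\<close>
    and leaves the others unchanged. The equality holds off the null set on which no
    \<open>\<theta>\<close> becomes infinite.\<close>
  have Nstop: "martingale M F T (stopped N (\<theta> k))" for k
  proof (rule martingale_cong[where X="\<lambda>t \<omega>. N (min (R (Suc k) \<omega>) t) \<omega>"])
    show "N (min (R (Suc k) \<omega>) t) \<omega> = stopped N (\<theta> k) t \<omega>" if "t \<in> {0..T}" "\<omega> \<in> space M" for t \<omega>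
      unfolding RS using stopped_eq[OF \<theta> that(2,1)] by simp
    show "martingale M F T (\<lambda>t \<omega>. N (min (R (Suc k) \<omega>) t) \<omega>)"
    proof (rule martingale_cong_AE[OF martingale_sum[where I="{..k}" and Z=Z, OF Zm]])
      show "adapted F T (\<lambda>t \<omega>. N (min (R (Suc k) \<omega>) t) \<omega>)"
        unfolding adapted_def using stopped_value_measurable[OF Na Nc Rst Rr] by blast
      show "AE \<omega> in M. (\<Sum>l\<le>k. Z l t \<omega>) = N (min (R (Suc k) \<omega>) t) \<omega>" for t
        using ae AE_space
      proof eventually_elim
        case (elim \<omega>)
        then obtain m where m: "\<theta> m \<omega> = \<infinity>" by auto
        define n where "n = max m k"
        have n: "\<theta> n \<omega> = \<infinity>" "k \<le> n" using \<theta>inf[OF m, of n] unfolding n_def by auto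
        have "N (min (R (Suc k) \<omega>) t) \<omega> = (\<Sum>l\<le>n. Z l (min (R (Suc k) \<omega>) t) \<omega>)" by (rule Nsum[OF elim(2) n(1)])
        also have "\<dots> = (\<Sum>l\<le>k. Z l (min (R (Suc k) \<omega>) t) \<omega>)"
        proof (rule sum.mono_neutral_right)
          show "\<forall>l\<in>{..n} - {..k}. Z l (min (R (Suc k) \<omega>) t) \<omega> = 0"
          proof
            fix l assume "l \<in> {..n} - {..k}"
            then have "R (Suc k) \<omega> \<le> R l \<omega>" "R (Suc k) \<omega> \<le> R (Suc l) \<omega>" using Rmono[OF _ elim(2)] by auto
            then have "min (R l \<omega>) (min (R (Suc k) \<omega>) t) = min (R (Suc k) \<omega>) t" "min (R (Suc l) \<omega>) (min (R (Suc k) \<omega>) t) = min (R (Suc k) \<omega>) t" by auto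
            then show "Z l (min (R (Suc k) \<omega>) t) \<omega> = 0" unfolding Z_def by simp
          qed
        qed (use n in auto)
        also have "\<dots> = (\<Sum>l\<le>k. Z l t \<omega>)"
        proof (rule sum.cong[OF refl])
          fix l assume "l \<in> {..k}"
          then have "R l \<omega> \<le> R (Suc k) \<omega>" "R (Suc l) \<omega> \<le> R (Suc k) \<omega>" using Rmono[OF _ elim(2)] by auto
          then have "min (R l \<omega>) (min (R (Suc k) \<omega>) t) = min (R l \<omega>) t" "min (R (Suc l) \<omega>) (min (R (Suc k) \<omega>) t) = min (R (Suc l) \<omega>) t" by auto
          then show "Z l (min (R (Suc k) \<omega>) t) \<omega> = Z l t \<omega>" unfolding Z_def by simp
        qed
        finally show ?case by simp
      qed
    qed
  qed
  have "local_martingale M F T N"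
    unfolding local_martingale_def localizing_seq_def
    using Nc Na \<theta> \<theta>mono Ilim Nstop unfolding I_def by (intro conjI exI[of _ \<theta>]) auto
  moreover define A where "A t \<omega> = S t \<omega> - N t \<omega>" for t \<omega>
  have "finite_variation_process M F T A"
    unfolding finite_variation_process_def
  proof (intro conjI)
    show "cadlag M T A" unfolding A_def by (rule cadlag_diff[OF S(1) Nc])
    show "adapted F T A" using S(2) Na unfolding A_def adapted_def by (blast intro: borel_measurable_diff)
    have "AE \<omega> in M. \<forall>k. (\<forall>s\<in>{0..T}. \<forall>t\<in>{s..T}. P k s \<omega> \<le> P k t \<omega> \<and> Q k s \<omega> \<le> Q k t \<omega>) \<and>
       (\<forall>t\<in>{0..T}. S (min (ext_real (\<rho> k) \<omega>) t) \<omega> = X k t \<omega> + P k t \<omega> - Q k t \<omega>)"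
      unfolding AE_all_countable using PQ by blast
    then show "AE \<omega> in M. finite_total_variation T (\<lambda>t. A t \<omega>)"
      using ae AE_space
    proof eventually_elim
      case (elim \<omega>)
      then obtain n where n: "\<theta> n \<omega> = \<infinity>" by auto
      have w: "\<omega> \<in> space M" by (rule elim)
      have mono: "P k s \<omega> \<le> P k t \<omega>" "Q k s \<omega> \<le> Q k t \<omega>" if "s \<in> {0..T}" "t \<in> {s..T}" for k s t using elim(1) that by blast+
      have dec: "S (min (R m \<omega>) t) \<omega> = X l (min (R m \<omega>) t) \<omega> + P l (min (R m \<omega>) t) \<omega> - Q l (min (R m \<omega>) t) \<omega>"
        if "m \<le> Suc l" "t \<in> {0..T}" for l m t
      proof -
        have "R m \<omega> \<le> R (Suc l) \<omega>" by (rule Rmono[OF that(1) w])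
        also have "\<dots> \<le> ext_real (\<rho> l) \<omega>" unfolding RS by (rule er_mono[OF \<theta> \<rho> w \<theta>\<rho>]) simp
        finally have "min (ext_real (\<rho> l) \<omega>) (min (R m \<omega>) t) = min (R m \<omega>) t" by auto
        moreover have "min (R m \<omega>) t \<in> {0..T}" using Rr[OF w, of m] that(2) by auto
        ultimately show ?thesis using elim(1) by metis
      qed
      \<comment> \<open>Removing the martingale increment from a piece leaves the increments of
        \<open>P l\<close> and \<open>Q l\<close> over it; their four end values are sorted by sign
        into the increasing functions \<open>u\<close> and \<open>v\<close>.\<close>
      define u where "u t = (\<Sum>l\<le>n. P l (min (R (Suc l) \<omega>) t) \<omega> + Q l (min (R l \<omega>) t) \<omega>)" for t
      define v where "v t = (\<Sum>l\<le>n. Q l (min (R (Suc l) \<omega>) t) \<omega> + P l (min (R l \<omega>) t) \<omega>)" for t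
      show ?case
      proof (rule finite_total_variation_diff_mono[where u=u and v=v and c="S 0 \<omega>"])
        fix t assume t: "t \<in> {0..T}"
        have "R (Suc n) \<omega> = T" by (rule Rinf[OF lessI n])
        then have "S t \<omega> - S 0 \<omega> = S (min (R (Suc n) \<omega>) t) \<omega> - S (min (R 0 \<omega>) t) \<omega>" using t by (simp add: R0 min_absorb1 min_absorb2)
        also have "\<dots> = (\<Sum>l<Suc n. S (min (R (Suc l) \<omega>) t) \<omega> - S (min (R l \<omega>) t) \<omega>)"
          by (rule sum_lessThan_telescope[of "\<lambda>l. S (min (R l \<omega>) t) \<omega>", symmetric])
        also have "\<dots> = (\<Sum>l\<le>n. S (min (R (Suc l) \<omega>) t) \<omega> - S (min (R l \<omega>) t) \<omega>)" by (simp only: lessThan_Suc_atMost)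
        also have "\<dots> = (\<Sum>l\<le>n. Z l t \<omega> + (P l (min (R (Suc l) \<omega>) t) \<omega> + Q l (min (R l \<omega>) t) \<omega>) - (Q l (min (R (Suc l) \<omega>) t) \<omega> + P l (min (R l \<omega>) t) \<omega>))"
        proof (rule sum.cong[OF refl])
          fix l
          show "S (min (R (Suc l) \<omega>) t) \<omega> - S (min (R l \<omega>) t) \<omega> =
            Z l t \<omega> + (P l (min (R (Suc l) \<omega>) t) \<omega> + Q l (min (R l \<omega>) t) \<omega>) - (Q l (min (R (Suc l) \<omega>) t) \<omega> + P l (min (R l \<omega>) t) \<omega>)"
            using dec[of "Suc l" l t] dec[of l l t] t unfolding Z_def by simp
        qed
        also have "\<dots> = N t \<omega> + u t - v t" unfolding Nsum[OF w n] u_def v_def by (simp only: sum.distrib sum_subtractf)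
        finally show "A t \<omega> = S 0 \<omega> + u t - v t" unfolding A_def by simp
      next
        fix s t assume s: "s \<in> {0..T}" and t: "t \<in> {s..T}"
        have m: "min (R m \<omega>) s \<in> {0..T}" "min (R m \<omega>) t \<in> {min (R m \<omega>) s..T}" for m using Rr[OF w, of m] s t by auto
        show "u s \<le> u t \<and> v s \<le> v t"
          unfolding u_def v_def by (intro conjI sum_mono add_mono mono m)
      qed
    qed
  qed
  ultimately show ?thesis unfolding semimartingale_def A_def by (intro exI[of _ N] exI[of _ "\<lambda>t \<omega>. S t \<omega> - N t \<omega>"]) auto
qed

end

theorem theorem1p6:
  fixes M :: "'a measure" and F :: "real \<Rightarrow> 'a measure" and T :: real
    and S :: "real \<Rightarrow> 'a \<Rightarrow> real"
  assumes "usual_filtered_prob_space M F T"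
    and "cadlag M T S"
    and "adapted F T S"
    and "locally_bounded M F T S"
  shows "no_free_lunch_vrli M F T S \<longleftrightarrow> semimartingale M F T S"
proof -
  interpret usual_filtered_prob_space M F T by (rule assms(1))
  show ?thesis
  proof
    assume "no_free_lunch_vrli M F T S"
    then show "semimartingale M F T S"
      by (intro paste_semimartingale no_free_lunch_decomposition assms)
  next
    assume "semimartingale M F T S"
    then show "no_free_lunch_vrli M F T S" by (rule semimartingale_no_free_lunch[OF assms(2-4)])
  qed
qed

end
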